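(* Let $c\in\mathbb K$ and let $A^r_q(n|m;c)$ be the universal associative unital superalgebra generated by elements $x_i$ ($i\in I$), homogeneous of degree $\eta_i$, subject to the relations $$x_i^2=0\quad\text{for } \eta_i=\bar 1,$$ $$x_ix_j=\sigma_{i,j}\,q\,x_jx_i\quad\text{for } i<j,\ i\ne -j,$$ $$q^{-\sigma_{j-1}}x_{-j+1}x_{j-1}-\sigma_{j-1}\,q\,x_{j-1}x_{-j+1}=\sigma_{j-1}\sigma_j\,x_{-j}x_j-\sigma_{j-1}\,q\,q^{-\sigma_j}\,x_jx_{-j}\quad\text{for } 2\le j\le r,$$ $$x_{-1}x_1-q^2x_1x_{-1}=q^{2d}c-(q-q^{-1})\sum_{i=2}^{n+m}((C^q)^{-1})_{i,-i}\,x_ix_{-i}.$$ Then there is a unique homomorphism of superalgebras $\delta:A^r_q(n|m;c)\to A^r_q(n|m;c)\,\overline{\otimes}\,\mathrm{SPO}_q(2n|2m)$ such that $$\delta(x_i)=\sum_{j\in I}\sigma(\eta_i,\eta_j-\eta_i)\,x_j\otimes t_{j,i}\qquad\text{for all } i\in I,$$ and $\delta$ converts $A^r_q(n|m;c)$ into a graded right $\mathrm{SPO}_q(2n|2m)$-comodule superalgebra.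
   Context: Setting. $\mathbb K$ is a field of characteristic zero, $q\in\mathbb K$ is nonzero and not a root of unity, $n,m\ge 1$ are integers, $r=n+m$, $d=n-m$, and $I=\{-r,\dots,-1,1,\dots,r\}$. Gradations are over $\mathbb Z_2$, with $\sigma(\alpha,\beta)=(-1)^{\alpha\beta}$. Degrees: $\eta_i=\bar 0$ for $1\le|i|\le n$ and $\eta_i=\bar 1$ for $n+1\le|i|\le r$; $\sigma_{i,j}=\sigma(\eta_i,\eta_j)$, $\sigma_i=\sigma_{i,i}$. $V$ is the $\mathbb Z_2$-graded vector space with basis $(e_i)_{i\in I}$, $e_i$ of degree $\eta_i$; $E_{i,j}(e_k)=\delta_{jk}e_i$. Graded tensor product of linear maps: $(g\,\overline{\otimes}\,g')(x\otimes y)=\sigma(\gamma',\xi)g(x)\otimes g'(y)$ with $\gamma'=\deg g'$, $\xi=\deg x$. The graded tensor product $A\,\overline{\otimes}\,B$ of superalgebras carries the product $(a\otimes b)(a'\otimes b')=\sigma(\deg b,\deg a')\,aa'\otimes bb'$; bi-superalgebras and Hopf superalgebras are meant with respect to this product, with structure maps of degree zero. The matrix $C^q=(C^q_{i,j})_{i,j\in I}$ has $C^q_{i,j}=0$ for $j\neq -i$, and for $1\le j\le r$ $$C^q_{j,-j}=q^{\sum_{k=1}^{j}\sigma_k},\qquad C^q_{-j,j}=-\sigma_j\,q^{-1-\sum_{k=1}^{j-1}\sigma_k}.$$ The operator $R=\sum R_{ij,k\ell}E_{i,k}\,\overline{\otimes}\,E_{j,\ell}$ in $V\otimes V$ is $$R=\sum_i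 q^{\sigma_i}E_{i,i}\overline{\otimes}E_{i,i}+\sum_i q^{-\sigma_i}E_{i,i}\overline{\otimes}E_{-i,-i}+\sum_{i\ne j,-j}E_{i,i}\overline{\otimes}E_{j,j}+(q-q^{-1})\sum_{i<j}\sigma_iE_{j,i}\overline{\otimes}E_{i,j}-(q-q^{-1})\sum_{i<j}\sigma_i\sigma_j\sigma_{i,j}((C^q)^{-1})_{-j,j}C^q_{i,-i}\,E_{j,i}\overline{\otimes}E_{-j,-i}.$$ $A(R)$ is the bi-superalgebra given as the universal associative unital superalgebra generated by elements $t_{i,j}$ ($i,j\in I$) of degree $\eta_j-\eta_i$ with relations $$\sum_{a,b\in I}\sigma(\eta_j-\eta_\ell,\eta_a-\eta_k)R_{ij,ab}\,t_{a,k}t_{b,\ell}=\sum_{a,b\in I}\sigma(\eta_j-\eta_b,\eta_a-\eta_k)\,t_{j,b}t_{i,a}R_{ab,k\ell}\qquad(i,j,k,\ell\in I)$$ and with $\Delta(t_{i,j})=\sum_{k}\sigma(\eta_k-\eta_i,\eta_k-\eta_j)\,t_{i,k}\otimes t_{k,j}$, $\varepsilon(t_{i,j})=\delta_{i,j}$. The element $Q=(C^q_{k,-k})^{-1}\sum_{a,b\in I}\sigma_{a,k}\sigma_{b,a}C^q_{a,b}\,t_{a,k}t_{b,-k}\in A(R)$ does not depend on $k\in I$; it is of degree zero, group-like and central. $\mathrm{SPO}_q(2n|2m)=A(R)/J(Q)$, where $J(Q)$ is the two-sided ideal generated by $Q-1$ (a graded biideal); it is a Hopf superalgebra, and the images of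 the generators are again denoted $t_{i,j}$. A graded right $H$-comodule superalgebra over a bi-superalgebra $H$ is a superalgebra $B$ with a right $H$-comodule structure map $\delta:B\to B\,\overline{\otimes}\,H$ (coassociative and counital) that is homogeneous of degree zero and a homomorphism of unital superalgebras. For $c\neq0$ the algebra $A^r_q(n|m;c)$ is called the $\mathrm{SPO}_q(2n|2m)$-covariant quantum Weyl superalgebra. *)

theory Defs
  imports Complex_Main
    "HOL-Algebra.QuotRing"
    "HOL-Algebra.Module"
    "HOL-Library.Poly_Mapping"
    "HOL-Library.Z2"
begin

section \<open>Superalgebras over a field\<close>

text \<open>
  The scalars are the elements of a type of class \<^class>\<open>field\<close>; degrees are elements
  of \<^typ>\<open>bit\<close>. The constant \<open>ground\<close> is both the coefficient ring of the modules below
  and the superalgebra \<open>K\<close> itself, concentrated in degree zero.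
\<close>

record ('k, 'a) superalgebra = "('k, 'a) module" +
  homog :: "bit \<Rightarrow> 'a set"

definition ground :: "('k::field, 'k) superalgebra" where
  "ground = \<lparr>carrier = UNIV, mult = (*), one = 1, zero = 0, add = (+), smult = (*),
     homog = (\<lambda>\<gamma>. if \<gamma> = 0 then UNIV else {0})\<rparr>"

definition sgnf :: "bit \<Rightarrow> bit \<Rightarrow> int" where
  "sgnf \<alpha> \<beta> = (if \<alpha> * \<beta> = 1 then - 1 else 1)"

locale superalgebra = module ground A + ring A
  for A :: "('k::field, 'a, 'm) superalgebra_scheme" (structure) +
  assumes smult_mult_left:
      "\<lbrakk>x \<in> carrier A; y \<in> carrier A\<rbrakk> \<Longrightarrow> (c \<odot> x) \<otimes> y = c \<odot> (x \<otimes> y)"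
    and smult_mult_right:
      "\<lbrakk>x \<in> carrier A; y \<in> carrier A\<rbrakk> \<Longrightarrow> x \<otimes> (c \<odot> y) = c \<odot> (x \<otimes> y)"
    and homog_submodule: "submodule (homog A \<gamma>) ground A"
    and homog_decomp: "x \<in> carrier A \<Longrightarrow> \<exists>y\<in>homog A 0. \<exists>z\<in>homog A 1. x = y \<oplus> z"
    and homog_disjoint: "homog A 0 \<inter> homog A 1 = {\<zero>}"
    and homog_mult: "\<lbrakk>x \<in> homog A \<alpha>; y \<in> homog A \<beta>\<rbrakk> \<Longrightarrow> x \<otimes> y \<in> homog A (\<alpha> + \<beta>)"
    and homog_one: "\<one> \<in> homog A 0"

text \<open>Homomorphisms are unital, since \<^const>\<open>ring_hom\<close> preserves \<open>\<one>\<close>.\<close>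

definition superalgebra_hom ::
  "('k, 'a, 'm) superalgebra_scheme \<Rightarrow> ('k, 'b, 'p) superalgebra_scheme \<Rightarrow> ('a \<Rightarrow> 'b) set" where
  "superalgebra_hom A B = {f \<in> ring_hom A B.
     (\<forall>c. \<forall>x\<in>carrier A. f (c \<odot>\<^bsub>A\<^esub> x) = c \<odot>\<^bsub>B\<^esub> f x) \<and>
     (\<forall>\<gamma>. f ` homog A \<gamma> \<subseteq> homog B \<gamma>)}"

definition hcomp :: "('k, 'a, 'm) superalgebra_scheme \<Rightarrow> bit \<Rightarrow> 'a \<Rightarrow> 'a" where
  "hcomp A \<gamma> x = (THE y. y \<in> homog A \<gamma> \<and> (\<exists>z\<in>homog A (\<gamma> + 1). x = y \<oplus>\<^bsub>A\<^esub> z))"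

text \<open>Quotient by a two-sided ideal (meant for graded ideals).\<close>

definition quot_superalgebra ::
  "('k, 'a, 'm) superalgebra_scheme \<Rightarrow> 'a set \<Rightarrow> ('k, 'a set) superalgebra" where
  "quot_superalgebra A I = \<lparr>carrier = carrier (A Quot I), mult = mult (A Quot I),
     one = one (A Quot I), zero = zero (A Quot I), add = add (A Quot I),
     smult = (\<lambda>c X. \<Union>x\<in>X. I +>\<^bsub>A\<^esub> (c \<odot>\<^bsub>A\<^esub> x)),
     homog = (\<lambda>\<gamma>. (\<lambda>x. I +>\<^bsub>A\<^esub> x) ` homog A \<gamma>)\<rparr>"


section \<open>Superalgebras given by generators and relations\<close>

text \<open>The free monoid, so that \<open>'x fmon \<Rightarrow>\<^sub>0 'k\<close> with its library ring structure is the free algebra.\<close>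

datatype 'x fmon = Fmon (letters: "'x list")

instantiation fmon :: (type) monoid_add
begin

definition zero_fmon :: "'a fmon" where "0 = Fmon []"

definition plus_fmon :: "'a fmon \<Rightarrow> 'a fmon \<Rightarrow> 'a fmon" where
  "v + w = Fmon (letters v @ letters w)"

instance
  by standard (simp_all add: zero_fmon_def plus_fmon_def)

end

definition const :: "'k::field \<Rightarrow> ('x fmon \<Rightarrow>\<^sub>0 'k)" where
  "const c = Poly_Mapping.single 0 c"

definition var :: "'x \<Rightarrow> ('x fmon \<Rightarrow>\<^sub>0 'k::field)" where
  "var x = Poly_Mapping.single (Fmon [x]) 1"

definition free_superalgebra ::
  "'x set \<Rightarrow> ('x \<Rightarrow> bit) \<Rightarrow> ('k::field, 'x fmon \<Rightarrow>\<^sub>0 'k) superalgebra" where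
  "free_superalgebra X d = \<lparr>carrier = {f. \<forall>w\<in>Poly_Mapping.keys f. set (letters w) \<subseteq> X},
     mult = (*), one = 1, zero = 0, add = (+), smult = (\<lambda>c f. const c * f),
     homog = (\<lambda>\<gamma>. {f. \<forall>w\<in>Poly_Mapping.keys f.
        set (letters w) \<subseteq> X \<and> sum_list (map d (letters w)) = \<gamma>})\<rparr>"

definition presented_superalgebra ::
  "'x set \<Rightarrow> ('x \<Rightarrow> bit) \<Rightarrow> ('x fmon \<Rightarrow>\<^sub>0 'k::field) set \<Rightarrow> ('k, ('x fmon \<Rightarrow>\<^sub>0 'k) set) superalgebra"
  where "presented_superalgebra X d S =
    quot_superalgebra (free_superalgebra X d) (Idl\<^bsub>free_superalgebra X d\<^esub> S)"

definition presented_gen ::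
  "'x set \<Rightarrow> ('x \<Rightarrow> bit) \<Rightarrow> ('x fmon \<Rightarrow>\<^sub>0 'k::field) set \<Rightarrow> 'x \<Rightarrow> ('x fmon \<Rightarrow>\<^sub>0 'k) set"
  where "presented_gen X d S x =
    (Idl\<^bsub>free_superalgebra X d\<^esub> S) +>\<^bsub>free_superalgebra X d\<^esub> var x"


section \<open>Graded tensor products\<close>

text \<open>
  The tensor product of \<open>A\<close> and \<open>B\<close> is the vector space with basis
  \<open>carrier A \<times> carrier B\<close> modulo the subspace spanned by the bilinearity relations;
  its elements are the cosets \<open>tensor_class A B u\<close>.
\<close>

definition pscale :: "'k::field \<Rightarrow> ('a \<Rightarrow>\<^sub>0 'k) \<Rightarrow> ('a \<Rightarrow>\<^sub>0 'k)" where
  "pscale c u = Poly_Mapping.map ((*) c) u"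

lemma lookup_pscale [simp]: "Poly_Mapping.lookup (pscale c u) p = c * Poly_Mapping.lookup u p"
  by (simp add: pscale_def Poly_Mapping.map.rep_eq when_def)

interpretation pscale: vector_space pscale
  by standard (auto intro!: poly_mapping_eqI simp: lookup_add algebra_simps)

abbreviation pair1 :: "'a \<Rightarrow> 'b \<Rightarrow> ('a \<times> 'b \<Rightarrow>\<^sub>0 'k::field)" where
  "pair1 x y \<equiv> Poly_Mapping.single (x, y) 1"

definition tensor_rels ::
  "('k::field, 'a, 'm) superalgebra_scheme \<Rightarrow> ('k, 'b, 'p) superalgebra_scheme \<Rightarrow> ('a \<times> 'b \<Rightarrow>\<^sub>0 'k) set"
  where "tensor_rels A B =
    {pair1 (x \<oplus>\<^bsub>A\<^esub> x') y - pair1 x y - pair1 x' y | x x' y.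
       x \<in> carrier A \<and> x' \<in> carrier A \<and> y \<in> carrier B} \<union>
    {pair1 x (y \<oplus>\<^bsub>B\<^esub> y') - pair1 x y - pair1 x y' | x y y'.
       x \<in> carrier A \<and> y \<in> carrier B \<and> y' \<in> carrier B} \<union>
    {pair1 (c \<odot>\<^bsub>A\<^esub> x) y - pscale c (pair1 x y) | c x y. x \<in> carrier A \<and> y \<in> carrier B} \<union>
    {pair1 x (c \<odot>\<^bsub>B\<^esub> y) - pscale c (pair1 x y) | c x y. x \<in> carrier A \<and> y \<in> carrier B}"

definition tensor_null ::
  "('k::field, 'a, 'm) superalgebra_scheme \<Rightarrow> ('k, 'b, 'p) superalgebra_scheme \<Rightarrow> ('a \<times> 'b \<Rightarrow>\<^sub>0 'k) set"
  where "tensor_null A B = pscale.span (tensor_rels A B)"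

definition tensor_class ::
  "('k::field, 'a, 'm) superalgebra_scheme \<Rightarrow> ('k, 'b, 'p) superalgebra_scheme \<Rightarrow>
   ('a \<times> 'b \<Rightarrow>\<^sub>0 'k) \<Rightarrow> ('a \<times> 'b \<Rightarrow>\<^sub>0 'k) set"
  where "tensor_class A B u = (\<lambda>v. u + v) ` tensor_null A B"

text \<open>
  The product on representatives: the bilinear extension of
  \<open>(a \<otimes> b)(a' \<otimes> b') = \<sigma>(deg b, deg a') aa' \<otimes> bb'\<close>,
  where \<open>b\<close> and \<open>a'\<close> are decomposed into their homogeneous components.
\<close>

definition tensor_times ::
  "('k::field, 'a, 'm) superalgebra_scheme \<Rightarrow> ('k, 'b, 'p) superalgebra_scheme \<Rightarrow>
   ('a \<times> 'b \<Rightarrow>\<^sub>0 'k) \<Rightarrow> ('a \<times> 'b \<Rightarrow>\<^sub>0 'k) \<Rightarrow> ('a \<times> 'b \<Rightarrow>\<^sub>0 'k)"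
  where "tensor_times A B u v =
    (\<Sum>(a, b)\<in>Poly_Mapping.keys u. \<Sum>(a', b')\<in>Poly_Mapping.keys v. \<Sum>\<beta>\<in>{0, 1}. \<Sum>\<alpha>\<in>{0, 1}.
       Poly_Mapping.single (a \<otimes>\<^bsub>A\<^esub> hcomp A \<alpha> a', hcomp B \<beta> b \<otimes>\<^bsub>B\<^esub> b')
         (of_int (sgnf \<beta> \<alpha>) * Poly_Mapping.lookup u (a, b) * Poly_Mapping.lookup v (a', b')))"

definition tensor ::
  "('k::field, 'a, 'm) superalgebra_scheme \<Rightarrow> ('k, 'b, 'p) superalgebra_scheme \<Rightarrow>
   ('k, ('a \<times> 'b \<Rightarrow>\<^sub>0 'k) set) superalgebra"  (infixr \<open>\<otimes>\<^sub>s\<close> 70)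
  where "tensor A B = \<lparr>
    carrier = tensor_class A B ` {u. Poly_Mapping.keys u \<subseteq> carrier A \<times> carrier B},
    mult = (\<lambda>X Y. \<Union>u\<in>X. \<Union>v\<in>Y. tensor_class A B (tensor_times A B u v)),
    one = tensor_class A B (pair1 \<one>\<^bsub>A\<^esub> \<one>\<^bsub>B\<^esub>),
    zero = tensor_null A B,
    add = (\<lambda>X Y. \<Union>u\<in>X. \<Union>v\<in>Y. {u + v}),
    smult = (\<lambda>c X. \<Union>u\<in>X. tensor_class A B (pscale c u)),
    homog = (\<lambda>\<gamma>. tensor_class A B `
      {u. Poly_Mapping.keys u \<subseteq> (\<Union>\<alpha>. homog A \<alpha> \<times> homog B (\<gamma> - \<alpha>))})\<rparr>"

definition pure_tensor ::
  "('k::field, 'a, 'm) superalgebra_scheme \<Rightarrow> ('k, 'b, 'p) superalgebra_scheme \<Rightarrow>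
   'a \<Rightarrow> 'b \<Rightarrow> ('a \<times> 'b \<Rightarrow>\<^sub>0 'k) set"
  where "pure_tensor A B x y = tensor_class A B (pair1 x y)"

text \<open>The linear map on \<open>A \<otimes>\<^sub>s B\<close> induced by a bilinear map \<open>f\<close> into \<open>M\<close>.\<close>

definition tensor_lift ::
  "('k::field, 'a, 'm) superalgebra_scheme \<Rightarrow> ('k, 'b, 'p) superalgebra_scheme \<Rightarrow>
   ('k, 'c, 'r) superalgebra_scheme \<Rightarrow> ('a \<Rightarrow> 'b \<Rightarrow> 'c) \<Rightarrow> ('a \<times> 'b \<Rightarrow>\<^sub>0 'k) set \<Rightarrow> 'c"
  where "tensor_lift A B M f = (\<lambda>X\<in>carrier (A \<otimes>\<^sub>s B). THE z. \<forall>u\<in>X.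
     z = (\<Oplus>\<^bsub>M\<^esub>p\<in>Poly_Mapping.keys u. Poly_Mapping.lookup u p \<odot>\<^bsub>M\<^esub> f (fst p) (snd p)))"

text \<open>
  \<open>f \<otimes> g\<close> without signs; this is the graded tensor product when \<open>g\<close> has degree zero,
  the only case in which it is used.
\<close>

definition tensor_map ::
  "('k::field, 'a, 'm) superalgebra_scheme \<Rightarrow> ('k, 'b, 'p) superalgebra_scheme \<Rightarrow>
   ('k, 'c, 'r) superalgebra_scheme \<Rightarrow> ('k, 'd, 's) superalgebra_scheme \<Rightarrow>
   ('a \<Rightarrow> 'c) \<Rightarrow> ('b \<Rightarrow> 'd) \<Rightarrow> ('a \<times> 'b \<Rightarrow>\<^sub>0 'k) set \<Rightarrow> ('c \<times> 'd \<Rightarrow>\<^sub>0 'k) set"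
  where "tensor_map A B C D f g =
    tensor_lift A B (C \<otimes>\<^sub>s D) (\<lambda>x y. pure_tensor C D (f x) (g y))"

text \<open>The canonical isomorphism from \<open>(A \<otimes>\<^sub>s B) \<otimes>\<^sub>s C\<close> to \<open>A \<otimes>\<^sub>s (B \<otimes>\<^sub>s C)\<close>.\<close>

definition tensor_assoc ::
  "('k::field, 'a, 'm) superalgebra_scheme \<Rightarrow> ('k, 'b, 'p) superalgebra_scheme \<Rightarrow>
   ('k, 'c, 'r) superalgebra_scheme \<Rightarrow>
   (('a \<times> 'b \<Rightarrow>\<^sub>0 'k) set \<times> 'c \<Rightarrow>\<^sub>0 'k) set \<Rightarrow> ('a \<times> ('b \<times> 'c \<Rightarrow>\<^sub>0 'k) set \<Rightarrow>\<^sub>0 'k) set"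
  where "tensor_assoc A B C =
    tensor_lift (A \<otimes>\<^sub>s B) C (A \<otimes>\<^sub>s (B \<otimes>\<^sub>s C)) (\<lambda>X z.
      tensor_lift A B (A \<otimes>\<^sub>s (B \<otimes>\<^sub>s C)) (\<lambda>x y.
        pure_tensor A (B \<otimes>\<^sub>s C) x (pure_tensor B C y z)) X)"


section \<open>Bi-superalgebras and comodule superalgebras\<close>

locale bisuperalgebra = superalgebra H
  for H :: "('k::field, 'a, 'm) superalgebra_scheme" (structure)
    and \<Delta> :: "'a \<Rightarrow> ('a \<times> 'a \<Rightarrow>\<^sub>0 'k) set"
    and \<epsilon> :: "'a \<Rightarrow> 'k" +
  assumes comult_hom: "\<Delta> \<in> superalgebra_hom H (H \<otimes>\<^sub>s H)"
    and counit_hom: "\<epsilon> \<in> superalgebra_hom H ground"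
    and coassoc: "h \<in> carrier H \<Longrightarrow>
      tensor_assoc H H H (tensor_map H H (H \<otimes>\<^sub>s H) H \<Delta> id (\<Delta> h)) =
      tensor_map H H H (H \<otimes>\<^sub>s H) id \<Delta> (\<Delta> h)"
    and counit_left: "h \<in> carrier H \<Longrightarrow> tensor_lift H H H (\<lambda>x y. \<epsilon> x \<odot> y) (\<Delta> h) = h"
    and counit_right: "h \<in> carrier H \<Longrightarrow> tensor_lift H H H (\<lambda>x y. \<epsilon> y \<odot> x) (\<Delta> h) = h"

locale comodule_superalgebra = H: bisuperalgebra H \<Delta> \<epsilon> + B: superalgebra B
  for H :: "('k::field, 'a, 'm) superalgebra_scheme"
    and \<Delta> :: "'a \<Rightarrow> ('a \<times> 'a \<Rightarrow>\<^sub>0 'k) set"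
    and \<epsilon> :: "'a \<Rightarrow> 'k"
    and B :: "('k, 'b, 'p) superalgebra_scheme"
    and \<delta> :: "'b \<Rightarrow> ('b \<times> 'a \<Rightarrow>\<^sub>0 'k) set" +
  assumes coaction_hom: "\<delta> \<in> superalgebra_hom B (B \<otimes>\<^sub>s H)"
    and coaction_coassoc: "b \<in> carrier B \<Longrightarrow>
      tensor_assoc B H H (tensor_map B H (B \<otimes>\<^sub>s H) H \<delta> id (\<delta> b)) =
      tensor_map B H B (H \<otimes>\<^sub>s H) id \<Delta> (\<delta> b)"
    and coaction_counit: "b \<in> carrier B \<Longrightarrow>
      tensor_lift B H B (\<lambda>x h. \<epsilon> h \<odot>\<^bsub>B\<^esub> x) (\<delta> b) = b"


section \<open>The quantum supergroup \<open>SPO\<^sub>q(2n|2m)\<close>\<close>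

definition idx :: "nat \<Rightarrow> nat \<Rightarrow> int set" where
  "idx n m = {- int (n + m)..int (n + m)} - {0}"

definition eta :: "nat \<Rightarrow> int \<Rightarrow> bit" where
  "eta n i = (if \<bar>i\<bar> \<le> int n then 0 else 1)"

definition sig2 :: "nat \<Rightarrow> int \<Rightarrow> int \<Rightarrow> int" where
  "sig2 n i j = sgnf (eta n i) (eta n j)"

definition sig :: "nat \<Rightarrow> int \<Rightarrow> int" where
  "sig n i = sig2 n i i"

definition Cq :: "nat \<Rightarrow> 'k::field \<Rightarrow> int \<Rightarrow> int \<Rightarrow> 'k" where
  "Cq n q i j =
    (if j \<noteq> - i then 0
     else if 0 < i then q powi (\<Sum>k=1..i. sig n k)
     else - of_int (sig n j) * q powi (- 1 - (\<Sum>k=1..j - 1. sig n k)))"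

definition Cq_inv :: "nat \<Rightarrow> 'k::field \<Rightarrow> int \<Rightarrow> int \<Rightarrow> 'k" where
  "Cq_inv n q i j = (if j = - i then inverse (Cq n q j i) else 0)"

lemma Cq_nonzero: "q \<noteq> 0 \<Longrightarrow> Cq n q i (- i) \<noteq> 0"
  by (simp add: Cq_def sig_def sig2_def sgnf_def)

lemma Cq_eq_0: "j \<noteq> - i \<Longrightarrow> Cq n q i j = 0"
  by (simp add: Cq_def)

lemma Cq_mult_Cq_inv:
  assumes "q \<noteq> 0" "i \<in> idx n m" "j \<in> idx n m"
  shows "(\<Sum>k\<in>idx n m. Cq n q i k * Cq_inv n q k j) = of_bool (i = j)"
    and "(\<Sum>k\<in>idx n m. Cq_inv n q i k * Cq n q k j) = of_bool (i = j)"
proof -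
  have fin: "finite (idx n m)" and neg: "- i \<in> idx n m"
    using assms(2) by (auto simp: idx_def)
  have "(\<Sum>k\<in>idx n m. Cq n q i k * Cq_inv n q k j) = Cq n q i (- i) * Cq_inv n q (- i) j"
    using sum.mono_neutral_right[OF fin, of "{- i}" "\<lambda>k. Cq n q i k * Cq_inv n q k j"] neg
    by (simp add: Cq_eq_0)
  then show "(\<Sum>k\<in>idx n m. Cq n q i k * Cq_inv n q k j) = of_bool (i = j)"
    using Cq_nonzero[OF assms(1), of n i] by (simp add: Cq_inv_def)
  have "(\<Sum>k\<in>idx n m. Cq_inv n q i k * Cq n q k j) = Cq_inv n q i (- i) * Cq n q (- i) j"
    using sum.mono_neutral_right[OF fin, of "{- i}" "\<lambda>k. Cq_inv n q i k * Cq n q k j"] neg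
    by (simp add: Cq_inv_def)
  then show "(\<Sum>k\<in>idx n m. Cq_inv n q i k * Cq n q k j) = of_bool (i = j)"
    using Cq_nonzero[OF assms(1), of n "- i"] by (cases "i = j") (auto simp: Cq_inv_def Cq_eq_0)
qed

text \<open>
  \<open>EE i k j l\<close> is \<open>E\<^sub>i\<^sub>,\<^sub>k \<otimes> E\<^sub>j\<^sub>,\<^sub>l\<close> as its family of coefficients \<open>X\<^sub>a\<^sub>b\<^sub>,\<^sub>c\<^sub>d\<close> with respect to
  \<open>E\<^sub>a\<^sub>,\<^sub>c \<otimes> E\<^sub>b\<^sub>,\<^sub>d\<close>, and \<open>Rq n m q a b c d\<close> is \<open>R\<^sub>a\<^sub>b\<^sub>,\<^sub>c\<^sub>d\<close>. The two
  functions thus take their indices in different orders.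
\<close>

definition EE :: "int \<Rightarrow> int \<Rightarrow> int \<Rightarrow> int \<Rightarrow> int \<Rightarrow> int \<Rightarrow> int \<Rightarrow> int \<Rightarrow> 'k::field" where
  "EE i k j l a b c d = of_bool (a = i \<and> c = k \<and> b = j \<and> d = l)"

definition Rq :: "nat \<Rightarrow> nat \<Rightarrow> 'k::field \<Rightarrow> int \<Rightarrow> int \<Rightarrow> int \<Rightarrow> int \<Rightarrow> 'k" where
  "Rq n m q a b c d =
     (\<Sum>i\<in>idx n m. q powi sig n i * EE i i i i a b c d)
   + (\<Sum>i\<in>idx n m. q powi (- sig n i) * EE i i (- i) (- i) a b c d)
   + (\<Sum>(i, j)\<in>{(i, j) \<in> idx n m \<times> idx n m. i \<noteq> j \<and> i \<noteq> - j}. EE i i j j a b c d)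
   + (q - inverse q) *
     (\<Sum>(i, j)\<in>{(i, j) \<in> idx n m \<times> idx n m. i < j}. of_int (sig n i) * EE j i i j a b c d)
   - (q - inverse q) *
     (\<Sum>(i, j)\<in>{(i, j) \<in> idx n m \<times> idx n m. i < j}.
        of_int (sig n i * sig n j * sig2 n i j) * Cq_inv n q (- j) j * Cq n q i (- i)
          * EE j i (- j) (- i) a b c d)"

definition tdeg :: "nat \<Rightarrow> int \<times> int \<Rightarrow> bit" where
  "tdeg n = (\<lambda>(i, j). eta n j - eta n i)"

definition AR_rels :: "nat \<Rightarrow> nat \<Rightarrow> 'k::field \<Rightarrow> ((int \<times> int) fmon \<Rightarrow>\<^sub>0 'k) set" where
  "AR_rels n m q =
    {(\<Sum>a\<in>idx n m. \<Sum>b\<in>idx n m.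
        const (of_int (sgnf (eta n j - eta n l) (eta n a - eta n k)) * Rq n m q i j a b)
          * var (a, k) * var (b, l))
     - (\<Sum>a\<in>idx n m. \<Sum>b\<in>idx n m.
        const (of_int (sgnf (eta n j - eta n b) (eta n a - eta n k)) * Rq n m q a b k l)
          * var (j, b) * var (i, a))
     | i j k l. i \<in> idx n m \<and> j \<in> idx n m \<and> k \<in> idx n m \<and> l \<in> idx n m}"

definition AR :: "nat \<Rightarrow> nat \<Rightarrow> 'k::field \<Rightarrow> ('k, ((int \<times> int) fmon \<Rightarrow>\<^sub>0 'k) set) superalgebra" where
  "AR n m q = presented_superalgebra (idx n m \<times> idx n m) (tdeg n) (AR_rels n m q)"

definition AR_gen :: "nat \<Rightarrow> nat \<Rightarrow> 'k::field \<Rightarrow> int \<Rightarrow> int \<Rightarrow> ((int \<times> int) fmon \<Rightarrow>\<^sub>0 'k) set" where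
  "AR_gen n m q i j = presented_gen (idx n m \<times> idx n m) (tdeg n) (AR_rels n m q) (i, j)"

definition Qelt :: "nat \<Rightarrow> nat \<Rightarrow> 'k::field \<Rightarrow> int \<Rightarrow> ((int \<times> int) fmon \<Rightarrow>\<^sub>0 'k) set" where
  "Qelt n m q k = inverse (Cq n q k (- k)) \<odot>\<^bsub>AR n m q\<^esub>
    (\<Oplus>\<^bsub>AR n m q\<^esub>a\<in>idx n m. \<Oplus>\<^bsub>AR n m q\<^esub>b\<in>idx n m.
       (of_int (sig2 n a k * sig2 n b a) * Cq n q a b) \<odot>\<^bsub>AR n m q\<^esub>
         (AR_gen n m q a k \<otimes>\<^bsub>AR n m q\<^esub> AR_gen n m q b (- k)))"

text \<open>\<open>Qelt n m q k\<close> does not depend on \<open>k \<in> idx n m\<close>; the ideal is formed with \<open>k = 1\<close>.\<close>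

definition JQ :: "nat \<Rightarrow> nat \<Rightarrow> 'k::field \<Rightarrow> ((int \<times> int) fmon \<Rightarrow>\<^sub>0 'k) set set" where
  "JQ n m q = Idl\<^bsub>AR n m q\<^esub> {Qelt n m q 1 \<ominus>\<^bsub>AR n m q\<^esub> \<one>\<^bsub>AR n m q\<^esub>}"

definition SPO ::
  "nat \<Rightarrow> nat \<Rightarrow> 'k::field \<Rightarrow> ('k, ((int \<times> int) fmon \<Rightarrow>\<^sub>0 'k) set set) superalgebra" where
  "SPO n m q = quot_superalgebra (AR n m q) (JQ n m q)"

definition SPO_gen ::
  "nat \<Rightarrow> nat \<Rightarrow> 'k::field \<Rightarrow> int \<Rightarrow> int \<Rightarrow> ((int \<times> int) fmon \<Rightarrow>\<^sub>0 'k) set set" where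
  "SPO_gen n m q i j = JQ n m q +>\<^bsub>AR n m q\<^esub> AR_gen n m q i j"

text \<open>
  The structure maps of \<open>SPO\<^sub>q(2n|2m)\<close> are the superalgebra homomorphisms with the prescribed
  values on the generators.
\<close>

definition SPO_comult :: "nat \<Rightarrow> nat \<Rightarrow> 'k::field \<Rightarrow> ((int \<times> int) fmon \<Rightarrow>\<^sub>0 'k) set set \<Rightarrow>
    (((int \<times> int) fmon \<Rightarrow>\<^sub>0 'k) set set \<times> ((int \<times> int) fmon \<Rightarrow>\<^sub>0 'k) set set \<Rightarrow>\<^sub>0 'k) set" where
  "SPO_comult n m q = (THE \<Delta>.
     \<Delta> \<in> extensional (carrier (SPO n m q)) \<and>
     \<Delta> \<in> superalgebra_hom (SPO n m q) (SPO n m q \<otimes>\<^sub>s SPO n m q) \<and>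
     (\<forall>i\<in>idx n m. \<forall>j\<in>idx n m. \<Delta> (SPO_gen n m q i j) =
        (\<Oplus>\<^bsub>SPO n m q \<otimes>\<^sub>s SPO n m q\<^esub>k\<in>idx n m.
           of_int (sgnf (eta n k - eta n i) (eta n k - eta n j)) \<odot>\<^bsub>SPO n m q \<otimes>\<^sub>s SPO n m q\<^esub>
             pure_tensor (SPO n m q) (SPO n m q) (SPO_gen n m q i k) (SPO_gen n m q k j))))"

definition SPO_counit ::
  "nat \<Rightarrow> nat \<Rightarrow> 'k::field \<Rightarrow> ((int \<times> int) fmon \<Rightarrow>\<^sub>0 'k) set set \<Rightarrow> 'k" where
  "SPO_counit n m q = (THE \<epsilon>.
     \<epsilon> \<in> extensional (carrier (SPO n m q)) \<and>
     \<epsilon> \<in> superalgebra_hom (SPO n m q) ground \<and>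
     (\<forall>i\<in>idx n m. \<forall>j\<in>idx n m. \<epsilon> (SPO_gen n m q i j) = of_bool (i = j)))"


section \<open>The algebra \<open>A\<^sup>r\<^sub>q(n|m;c)\<close>\<close>

definition weyl_rels :: "nat \<Rightarrow> nat \<Rightarrow> 'k::field \<Rightarrow> 'k \<Rightarrow> (int fmon \<Rightarrow>\<^sub>0 'k) set" where
  "weyl_rels n m q c =
    {var i * var i | i. i \<in> idx n m \<and> eta n i = 1} \<union>
    {var i * var j - const (of_int (sig2 n i j) * q) * var j * var i | i j.
       i \<in> idx n m \<and> j \<in> idx n m \<and> i < j \<and> i \<noteq> - j} \<union>
    {(const (q powi (- sig n (j - 1))) * var (- j + 1) * var (j - 1)
        - const (of_int (sig n (j - 1)) * q) * var (j - 1) * var (- j + 1))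
     - (const (of_int (sig n (j - 1) * sig n j)) * var (- j) * var j
        - const (of_int (sig n (j - 1)) * q * q powi (- sig n j)) * var j * var (- j))
     | j. 2 \<le> j \<and> j \<le> int (n + m)} \<union>
    {(var (- 1) * var 1 - const (q ^ 2) * var 1 * var (- 1))
     - (const (q powi (2 * (int n - int m)) * c)
        - (\<Sum>i=2..int (n + m).
             const ((q - inverse q) * Cq_inv n q i (- i)) * var i * var (- i)))}"

definition weyl :: "nat \<Rightarrow> nat \<Rightarrow> 'k::field \<Rightarrow> 'k \<Rightarrow> ('k, (int fmon \<Rightarrow>\<^sub>0 'k) set) superalgebra" where
  "weyl n m q c = presented_superalgebra (idx n m) (eta n) (weyl_rels n m q c)"

definition weyl_gen :: "nat \<Rightarrow> nat \<Rightarrow> 'k::field \<Rightarrow> 'k \<Rightarrow> int \<Rightarrow> (int fmon \<Rightarrow>\<^sub>0 'k) set" where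
  "weyl_gen n m q c i = presented_gen (idx n m) (eta n) (weyl_rels n m q c) i"

text \<open>
  Homomorphisms \<open>\<delta>\<close> with the prescribed values on the generators; they are normalised to be
  undefined outside the carrier, so that uniqueness can be stated for HOL functions.
\<close>

definition weyl_coaction :: "nat \<Rightarrow> nat \<Rightarrow> 'k::field \<Rightarrow> 'k \<Rightarrow>
    ((int fmon \<Rightarrow>\<^sub>0 'k) set \<Rightarrow>
     ((int fmon \<Rightarrow>\<^sub>0 'k) set \<times> ((int \<times> int) fmon \<Rightarrow>\<^sub>0 'k) set set \<Rightarrow>\<^sub>0 'k) set) \<Rightarrow> bool" where
  "weyl_coaction n m q c \<delta> \<longleftrightarrow>
     \<delta> \<in> extensional (carrier (weyl n m q c)) \<and>
     \<delta> \<in> superalgebra_hom (weyl n m q c) (weyl n m q c \<otimes>\<^sub>s SPO n m q) \<and>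
     (\<forall>i\<in>idx n m. \<delta> (weyl_gen n m q c i) =
        (\<Oplus>\<^bsub>weyl n m q c \<otimes>\<^sub>s SPO n m q\<^esub>j\<in>idx n m.
           of_int (sgnf (eta n i) (eta n j - eta n i)) \<odot>\<^bsub>weyl n m q c \<otimes>\<^sub>s SPO n m q\<^esub>
             pure_tensor (weyl n m q c) (SPO n m q) (weyl_gen n m q c j) (SPO_gen n m q j i)))"

end

theory Submission imports Defs begin

text \<open>
  After absorbing signs into the generators, the relations of \<open>A(R)\<close> say that the matrix \<open>S\<close> of
  products of pairs of generators commutes with the braid form \<open>Rh\<close> of the R-matrix, and \<open>\<Delta>\<close> and the
  coaction lose their signs. As \<open>Rh\<^sup>2\<close> is a combination of \<open>1\<close>, \<open>Rh\<close> and the rank one matrix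
  with entries \<open>(C\<^sup>-\<^sup>1)\<^sub>i\<^sub>j C\<^sub>k\<^sub>l\<close>, commuting with \<open>Rh\<close> forces \<open>C S = Q C\<close>, so \<open>C S = C\<close> over \<open>SPO\<^sub>q(2n|2m)\<close>.
  The relations of the Weyl superalgebra are equivalent to \<open>X (Rh - q) = c C\<close> for the row \<open>X\<close> of the
  products \<open>x\<^sub>a x\<^sub>b\<close>; since \<open>Rh S = S Rh\<close> and \<open>C S = C\<close>,
  this form is preserved by \<open>X \<mapsto> X \<otimes> S\<close>, which gives the coaction.
  Coassociativity and counitality need only be checked on the generators.
\<close>

section \<open>Linear combinations in modules over the ground field\<close>

text \<open>If the rank one matrix \<open>D C\<close> commutes with \<open>S\<close>, then
  \<open>D_p (C S)_r = (S D)_p C_r\<close> for all \<open>p\<close> and \<open>r\<close>, so fixing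
  one \<open>p\<close> exhibits the element \<open>Q\<close>, the same in every column. A single
  column of \<open>C S = C\<close> therefore suffices, and that is what the relation
  \<open>Q = 1\<close> provides. The argument needs the coefficient of \<open>D C\<close> in the
  square of \<open>Rh\<close> to be nonzero; it is
  \<open>(q - inverse q) * q powi (- 1 - 2 * d)\<close>, found by summing the products of
  corresponding entries of \<open>C\<close> and its inverse, which telescopes.

  Covariance is hidden in the presentation of the Weyl superalgebra: for the pairs
  \<open>(k, - k)\<close> it lists \<open>r\<close> relations, where the covariant form has
  \<open>2 r\<close>. An interpolating family carries the inhomogeneous relation along the others to
  a multiple of the covariant relation at \<open>(r, - r)\<close>; the constant
  \<open>q powi (2 * d)\<close> is the square of the entry of \<open>C\<close> there.

  That \<open>q\<close> is not a root of unity is used as \<open>q^2 \<noteq> 1\<close>, for the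
  coefficient above, and as \<open>q^2 \<noteq> - 1\<close>, so that covariance makes the squares of
  odd generators vanish.\<close>

lemma ground_simps [simp]:
  "carrier ground = UNIV" "mult ground = (*)" "one ground = 1" "zero ground = 0" "add ground = (+)"
  "smult ground = (*)" "homog ground \<gamma> = (if \<gamma> = 0 then UNIV else {0})"
  by (simp_all add: ground_def)

lemma cring_ground: "cring (ground :: ('k::field, 'k) superalgebra)"
  by (rule cringI, rule abelian_groupI, auto simp: comm_monoid_def comm_monoid_axioms_def monoid_def
      algebra_simps intro: exI[of _ "- _"])

text \<open>Coefficients and vectors are separate arguments: a matrix identity over the field then
  acts on the coefficients alone, through ordinary sums, while the vectors stay untouched.\<close>

definition lincomb ::
  "('k::field, 'a, 'm) module_scheme \<Rightarrow> 'i set \<Rightarrow> ('i \<Rightarrow> 'k) \<Rightarrow> ('i \<Rightarrow> 'a) \<Rightarrow> 'a" where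
  "lincomb M I c x = (\<Oplus>\<^bsub>M\<^esub>i\<in>I. c i \<odot>\<^bsub>M\<^esub> x i)"

locale ground_module = module ground M
  for M :: "('k::field, 'a, 'm) module_scheme" (structure)
begin

lemma smult_in_carrier [simp, intro]: "x \<in> carrier M \<Longrightarrow> c \<odot> x \<in> carrier M"
  by (rule smult_closed) auto

lemma smult_add_left: "x \<in> carrier M \<Longrightarrow> (c + d) \<odot> x = c \<odot> x \<oplus> d \<odot> x"
  using smult_l_distr[of c d x] by simp

lemma smult_add_right: "x \<in> carrier M \<Longrightarrow> y \<in> carrier M \<Longrightarrow> c \<odot> (x \<oplus> y) = c \<odot> x \<oplus> c \<odot> y"
  using smult_r_distr[of c x y] by simp

lemma smult_smult [simp]: "x \<in> carrier M \<Longrightarrow> c \<odot> (d \<odot> x) = (c * d) \<odot> x"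
  using smult_assoc1[of c d x] by simp

lemma one_smult [simp]: "x \<in> carrier M \<Longrightarrow> 1 \<odot> x = x"
  using smult_one[of x] by simp

lemma zero_smult [simp]: "x \<in> carrier M \<Longrightarrow> 0 \<odot> x = \<zero>\<^bsub>M\<^esub>"
  using smult_l_null[of x] by simp

lemma smult_zero [simp]: "c \<odot> \<zero>\<^bsub>M\<^esub> = \<zero>\<^bsub>M\<^esub>"
  using smult_r_null[of c] by simp

lemma minus_eq_smult: "x \<in> carrier M \<Longrightarrow> \<ominus>\<^bsub>M\<^esub> x = (- 1) \<odot> x"
  using smult_add_left[of x 1 "- 1"]
  by (metis M.minus_equality add.right_inverse one_smult M.a_comm smult_in_carrier zero_smult)

lemma smult_cancel:
  assumes "c \<noteq> 0" "x \<in> carrier M" "y \<in> carrier M" "c \<odot> x = c \<odot> y" shows "x = y"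
proof -
  have "inverse c \<odot> (c \<odot> x) = inverse c \<odot> (c \<odot> y)" using assms(4) by simp
  then show ?thesis using assms(1-3) by simp
qed

lemma lincomb_closed [simp, intro]:
  "(\<And>i. i \<in> I \<Longrightarrow> x i \<in> carrier M) \<Longrightarrow> lincomb M I c x \<in> carrier M"
  unfolding lincomb_def by (rule M.finsum_closed) auto

lemma lincomb_empty [simp]: "lincomb M {} c x = \<zero>\<^bsub>M\<^esub>"
  by (simp add: lincomb_def)

lemma lincomb_insert:
  "finite I \<Longrightarrow> i \<notin> I \<Longrightarrow> x i \<in> carrier M \<Longrightarrow> (\<And>j. j \<in> I \<Longrightarrow> x j \<in> carrier M) \<Longrightarrow>
    lincomb M (insert i I) c x = c i \<odot> x i \<oplus> lincomb M I c x"
  unfolding lincomb_def by (rule M.finsum_insert) auto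

lemma lincomb_cong:
  assumes "I = J" "\<And>i. i \<in> J \<Longrightarrow> c i \<odot> x i = d i \<odot> y i" "\<And>i. i \<in> J \<Longrightarrow> y i \<in> carrier M"
  shows "lincomb M I c x = lincomb M J d y"
  unfolding lincomb_def by (rule M.finsum_cong') (use assms in auto)

lemma lincomb_zero:
  assumes "\<And>i. i \<in> I \<Longrightarrow> c i \<odot> x i = \<zero>\<^bsub>M\<^esub>"
  shows "lincomb M I c x = \<zero>\<^bsub>M\<^esub>"
  unfolding lincomb_def by (rule M.add.finprod_one_eqI) (use assms in auto)

lemma lincomb_singleton: "x i \<in> carrier M \<Longrightarrow> lincomb M {i} c x = c i \<odot> x i"
  using lincomb_insert[of "{}" i x c] by simp

lemma lincomb_mono_neutral:
  assumes "finite J" "I \<subseteq> J" "\<And>i. i \<in> J - I \<Longrightarrow> c i = 0" "\<And>i. i \<in> J \<Longrightarrow> x i \<in> carrier M"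
  shows "lincomb M I c x = lincomb M J c x"
  unfolding lincomb_def
  by (rule M.add.finprod_mono_neutral_cong_left) (use assms in auto)

lemma lincomb_single:
  assumes "finite I" "i \<in> I" "\<And>j. j \<in> I \<Longrightarrow> j \<noteq> i \<Longrightarrow> c j = 0" "\<And>j. j \<in> I \<Longrightarrow> x j \<in> carrier M"
  shows "lincomb M I c x = c i \<odot> x i"
  using lincomb_mono_neutral[of I "{i}" c x] assms by (auto simp: lincomb_singleton)

lemma lincomb_add_coeff:
  "(\<And>i. i \<in> I \<Longrightarrow> x i \<in> carrier M) \<Longrightarrow>
    lincomb M I (\<lambda>i. c i + d i) x = lincomb M I c x \<oplus> lincomb M I d x"
  unfolding lincomb_def
  by (rule trans[OF M.finsum_cong'[OF refl] M.finsum_addf]) (auto simp: smult_add_left)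

lemma lincomb_add:
  "(\<And>i. i \<in> I \<Longrightarrow> x i \<in> carrier M) \<Longrightarrow> (\<And>i. i \<in> I \<Longrightarrow> y i \<in> carrier M) \<Longrightarrow>
    lincomb M I c (\<lambda>i. x i \<oplus> y i) = lincomb M I c x \<oplus> lincomb M I c y"
  unfolding lincomb_def
  by (rule trans[OF M.finsum_cong'[OF refl] M.finsum_addf]) (auto simp: smult_add_right)

lemma smult_lincomb:
  assumes "finite I" "\<And>i. i \<in> I \<Longrightarrow> x i \<in> carrier M"
  shows "a \<odot> lincomb M I c x = lincomb M I (\<lambda>i. a * c i) x"
  using assms by (induction I rule: finite_induct) (auto simp: lincomb_insert smult_add_right)

lemma lincomb_smult:
  assumes "\<And>i. i \<in> I \<Longrightarrow> x i \<in> carrier M"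
  shows "lincomb M I c (\<lambda>i. d i \<odot> x i) = lincomb M I (\<lambda>i. c i * d i) x"
  by (rule lincomb_cong) (use assms in auto)

lemma lincomb_swap:
  assumes "finite I" "finite J" "\<And>i j. i \<in> I \<Longrightarrow> j \<in> J \<Longrightarrow> x i j \<in> carrier M"
  shows "lincomb M I c (\<lambda>i. lincomb M J d (x i)) = lincomb M J d (\<lambda>j. lincomb M I c (\<lambda>i. x i j))"
  using assms(1,3)
proof (induction I rule: finite_induct)
  case empty
  then show ?case by (auto intro!: lincomb_zero[symmetric])
next
  case (insert i I)
  have "lincomb M (insert i I) c (\<lambda>i. lincomb M J d (x i)) =
      lincomb M J d (\<lambda>j. c i \<odot> x i j) \<oplus> lincomb M J d (\<lambda>j. lincomb M I c (\<lambda>i. x i j))"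
    using insert assms(2)
    by (auto simp: lincomb_insert smult_lincomb lincomb_smult mult.commute intro!: lincomb_closed)
  also have "\<dots> = lincomb M J d (\<lambda>j. lincomb M (insert i I) c (\<lambda>i. x i j))"
    using insert by (subst lincomb_add[symmetric]) (auto intro!: lincomb_cong simp: lincomb_insert)
  finally show ?case .
qed

text \<open>This is where a product of coefficient matrices appears, in particular the square of
  \<open>Rh\<close>.\<close>

lemma lincomb_lincomb:
  assumes "finite I" "finite J" "\<And>j. j \<in> J \<Longrightarrow> x j \<in> carrier M"
  shows "lincomb M I c (\<lambda>i. lincomb M J (d i) x) = lincomb M J (\<lambda>j. \<Sum>i\<in>I. c i * d i j) x"
  using assms(1)
proof (induction I rule: finite_induct)
  case empty
  then show ?case using assms by (auto intro!: lincomb_zero[symmetric])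
next
  case (insert i I)
  then show ?case using assms by (simp add: lincomb_insert smult_lincomb lincomb_add_coeff)
qed

lemma lincomb_Un:
  assumes "finite I" "finite J" "I \<inter> J = {}" "\<And>i. i \<in> I \<union> J \<Longrightarrow> x i \<in> carrier M"
  shows "lincomb M (I \<union> J) c x = lincomb M I c x \<oplus> lincomb M J c x"
  unfolding lincomb_def by (rule M.finsum_Un_disjoint) (use assms in auto)

lemma lincomb_reindex:
  assumes "inj_on h I" "\<And>i. i \<in> I \<Longrightarrow> x (h i) \<in> carrier M"
  shows "lincomb M (h ` I) c x = lincomb M I (\<lambda>i. c (h i)) (\<lambda>i. x (h i))"
  unfolding lincomb_def by (rule M.finsum_reindex) (use assms in auto)

lemma lincomb_product:
  assumes "finite I" "finite J" "\<And>i j. i \<in> I \<Longrightarrow> j \<in> J \<Longrightarrow> x i j \<in> carrier M"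
  shows "lincomb M I c (\<lambda>i. lincomb M J (d i) (x i)) =
    lincomb M (I \<times> J) (\<lambda>(i, j). c i * d i j) (\<lambda>(i, j). x i j)"
  using assms(1,3)
proof (induction I rule: finite_induct)
  case empty
  then show ?case by simp
next
  case (insert i I)
  have "insert i I \<times> J = (Pair i ` J) \<union> (I \<times> J)" by auto
  moreover have "lincomb M ((Pair i ` J) \<union> (I \<times> J)) (\<lambda>(i, j). c i * d i j) (\<lambda>(i, j). x i j) =
     lincomb M (Pair i ` J) (\<lambda>(i, j). c i * d i j) (\<lambda>(i, j). x i j) \<oplus>
     lincomb M (I \<times> J) (\<lambda>(i, j). c i * d i j) (\<lambda>(i, j). x i j)"
    using insert assms(2) by (intro lincomb_Un) auto
  moreover have "lincomb M (Pair i ` J) (\<lambda>(i, j). c i * d i j) (\<lambda>(i, j). x i j) =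
     lincomb M J (\<lambda>j. c i * d i j) (x i)"
    using insert by (subst lincomb_reindex) (auto intro: inj_onI)
  ultimately show ?case using insert assms(2) by (simp add: lincomb_insert smult_lincomb)
qed

end

text \<open>Used with two bases: words, for maps out of a free superalgebra, and pairs of elements,
  for maps out of a tensor product.\<close>

definition linext :: "('k::field, 'a, 'm) module_scheme \<Rightarrow> ('p \<Rightarrow> 'a) \<Rightarrow> ('p \<Rightarrow>\<^sub>0 'k) \<Rightarrow> 'a" where
  "linext M g u = lincomb M (Poly_Mapping.keys u) (Poly_Mapping.lookup u) g"

lemma keys_pscale: "Poly_Mapping.keys (pscale c u) \<subseteq> Poly_Mapping.keys u"
  by (auto simp: in_keys_iff)

lemma pscale_single [simp]: "pscale c (Poly_Mapping.single p d) = Poly_Mapping.single p (c * d)"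
  by (rule poly_mapping_eqI) (auto simp: lookup_single when_def)

context ground_module
begin

lemma linext_superset:
  assumes "finite I" "Poly_Mapping.keys u \<subseteq> I" "\<And>p. p \<in> I \<Longrightarrow> g p \<in> carrier M"
  shows "linext M g u = lincomb M I (Poly_Mapping.lookup u) g"
  unfolding linext_def by (rule lincomb_mono_neutral) (use assms in \<open>auto simp: in_keys_iff\<close>)

lemma linext_closed [simp, intro]:
  "(\<And>p. p \<in> Poly_Mapping.keys u \<Longrightarrow> g p \<in> carrier M) \<Longrightarrow> linext M g u \<in> carrier M"
  unfolding linext_def by blast

lemma linext_add:
  assumes "\<And>p. p \<in> Poly_Mapping.keys u \<union> Poly_Mapping.keys v \<Longrightarrow> g p \<in> carrier M"
  shows "linext M g (u + v) = linext M g u \<oplus> linext M g v"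
proof -
  let ?I = "Poly_Mapping.keys u \<union> Poly_Mapping.keys v"
  have "linext M g (u + v) = lincomb M ?I (\<lambda>p. Poly_Mapping.lookup u p + Poly_Mapping.lookup v p) g"
    using linext_superset[of ?I "u + v" g] keys_add[of u v] assms
    by (auto simp: lookup_add[abs_def] plus_poly_mapping.rep_eq)
  also have "\<dots> = linext M g u \<oplus> linext M g v"
    using linext_superset[of ?I u g] linext_superset[of ?I v g] assms
    by (subst lincomb_add_coeff) auto
  finally show ?thesis .
qed

lemma linext_zero [simp]: "linext M g 0 = \<zero>\<^bsub>M\<^esub>"
  by (simp add: linext_def)

lemma linext_single [simp]: "g p \<in> carrier M \<Longrightarrow> linext M g (Poly_Mapping.single p c) = c \<odot> g p"
  using linext_superset[of "{p}" "Poly_Mapping.single p c" g]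
  by (simp add: lincomb_singleton)

lemma linext_pscale:
  assumes "\<And>p. p \<in> Poly_Mapping.keys u \<Longrightarrow> g p \<in> carrier M"
  shows "linext M g (pscale c u) = c \<odot> linext M g u"
  using linext_superset[of "Poly_Mapping.keys u" "pscale c u" g] keys_pscale[of c u] assms
  by (simp add: smult_lincomb linext_def pscale_def[symmetric] lookup_pscale[abs_def])

lemma linext_minus:
  assumes "\<And>p. p \<in> Poly_Mapping.keys u \<union> Poly_Mapping.keys v \<Longrightarrow> g p \<in> carrier M"
  shows "linext M g (u - v) = linext M g u \<ominus> linext M g v"
proof -
  have v: "u - v = u + pscale (- 1) v" by (rule poly_mapping_eqI) (simp add: lookup_add lookup_minus)
  have "linext M g (u + pscale (- 1) v) = linext M g u \<oplus> linext M g (pscale (- 1) v)"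
    using assms keys_pscale[of "-1" v] by (intro linext_add) auto
  moreover have "linext M g (pscale (- 1) v) = (- 1) \<odot> linext M g v"
    using assms by (intro linext_pscale) auto
  ultimately show ?thesis unfolding v using assms by (auto simp: a_minus_def minus_eq_smult)
qed

lemma linext_cong:
  assumes "\<And>p. p \<in> Poly_Mapping.keys u \<Longrightarrow> g p = h p" "\<And>p. p \<in> Poly_Mapping.keys u \<Longrightarrow> h p \<in> carrier M"
  shows "linext M g u = linext M h u"
  unfolding linext_def by (rule lincomb_cong) (use assms in auto)

end

sublocale superalgebra \<subseteq> ground_module A
  by unfold_locales

section \<open>Homogeneous components and homomorphisms\<close>

lemma bit_cases: fixes \<gamma> :: bit shows "\<gamma> = 0 \<or> \<gamma> = 1" by (cases \<gamma>) auto

lemma bit_add_self [simp]: "(\<gamma>::bit) + \<gamma> = 0" by (cases \<gamma>) auto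
lemma bit_add_self2 [simp]: "(\<gamma>::bit) + (\<gamma> + \<delta>) = \<delta>" by (cases \<gamma>; cases \<delta>) auto
text \<open>Degrees of generators are given as differences; as sums they are open to associativity,
  commutativity and the biadditivity of \<open>sgnf\<close>.\<close>

lemma bit_diff_add [simp]: "(\<gamma>::bit) - \<delta> = \<gamma> + \<delta>" by (cases \<gamma>; cases \<delta>) auto

context superalgebra
begin

lemma homog_carrier [simp, intro]: "x \<in> homog A \<gamma> \<Longrightarrow> x \<in> carrier A"
  using submoduleE(1)[OF homog_submodule[of \<gamma>]] by auto

lemma homog_smult [simp, intro]: "x \<in> homog A \<gamma> \<Longrightarrow> c \<odot> x \<in> homog A \<gamma>"
  using submoduleE(4)[OF homog_submodule[of \<gamma>], of c x] by auto

lemma homog_plus [simp, intro]: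
  "x \<in> homog A \<gamma> \<Longrightarrow> y \<in> homog A \<gamma> \<Longrightarrow> x \<oplus> y \<in> homog A \<gamma>"
  using submoduleE(5)[OF homog_submodule[of \<gamma>], of x y] by auto

lemma homog_minus [simp, intro]: "x \<in> homog A \<gamma> \<Longrightarrow> \<ominus> x \<in> homog A \<gamma>"
  using submoduleE(3)[OF homog_submodule[of \<gamma>], of x] by auto

lemma homog_zero [simp, intro]: "\<zero> \<in> homog A \<gamma>"
  using homog_smult[of _ \<gamma> 0] submoduleE(2)[OF homog_submodule[of \<gamma>]] by fastforce

lemma homog_lincomb:
  "finite I \<Longrightarrow> (\<And>i. i \<in> I \<Longrightarrow> x i \<in> homog A \<gamma>) \<Longrightarrow> lincomb A I c x \<in> homog A \<gamma>"
proof (induction I rule: finite_induct)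
  case (insert i I)
  then show ?case by (subst lincomb_insert) auto
qed simp

lemma homog_Int:
  assumes "x \<in> homog A \<alpha>" "x \<in> homog A \<beta>" "\<alpha> \<noteq> \<beta>" shows "x = \<zero>"
  using assms homog_disjoint by (cases \<alpha>; cases \<beta>) auto

text \<open>\<open>hcomp\<close> is a definite description, so uniqueness is the point: the
  difference of two candidates lies in both homogeneous parts, which meet in zero.\<close>

lemma hcomp_eq:
  assumes "y \<in> homog A \<gamma>" "z \<in> homog A (\<gamma> + 1)"
  shows "hcomp A \<gamma> (y \<oplus> z) = y"
  unfolding hcomp_def
proof (rule the_equality)
  show "y \<in> homog A \<gamma> \<and> (\<exists>z'\<in>homog A (\<gamma> + 1). y \<oplus> z = y \<oplus> z')" using assms by blast
next
  fix y' assume y': "y' \<in> homog A \<gamma> \<and> (\<exists>z'\<in>homog A (\<gamma> + 1). y \<oplus> z = y' \<oplus> z')"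
  then obtain z' where z': "z' \<in> homog A (\<gamma> + 1)" "y \<oplus> z = y' \<oplus> z'" by blast
  have c: "y \<in> carrier A" "y' \<in> carrier A" "z \<in> carrier A" "z' \<in> carrier A"
    using assms y' z' homog_carrier by blast+
  have e: "y' \<oplus> \<ominus> y = z \<oplus> \<ominus> z'"
  proof -
    have "y' = (y' \<oplus> z') \<oplus> \<ominus> z'" using c by (simp add: a_assoc r_neg)
    also have "\<dots> = (y \<oplus> z) \<oplus> \<ominus> z'" using z' by simp
    finally have "y' = y \<oplus> (z \<oplus> \<ominus> z')" using c by (simp add: a_assoc)
    then have "y' \<oplus> \<ominus> y = (z \<oplus> \<ominus> z') \<oplus> (y \<oplus> \<ominus> y)" using c by (simp add: a_ac)
    then show ?thesis using c by (simp add: r_neg)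
  qed
  have "y' \<oplus> \<ominus> y = \<zero>"
  proof (rule homog_Int[of _ \<gamma> "\<gamma> + 1"])
    show "y' \<oplus> \<ominus> y \<in> homog A \<gamma>" using assms y' by auto
    show "y' \<oplus> \<ominus> y \<in> homog A (\<gamma> + 1)" unfolding e using assms z' by auto
  qed (cases \<gamma>; simp)
  then show "y' = y" using c by (metis minus_equality minus_minus a_inv_closed)
qed

lemma hcomp_ex:
  assumes "x \<in> carrier A"
  obtains y z where "y \<in> homog A \<gamma>" "z \<in> homog A (\<gamma> + 1)" "x = y \<oplus> z"
proof -
  from homog_decomp[OF assms] obtain y z where yz: "y \<in> homog A 0" "z \<in> homog A 1" "x = y \<oplus> z"
    by blast
  show ?thesis
  proof (cases "\<gamma> = 0")
    case True
    then show ?thesis using yz that by simp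
  next
    case False
    then have 1: "\<gamma> = 1" by (cases \<gamma>) auto
    have "x = z \<oplus> y" using yz homog_carrier by (metis a_comm)
    then show ?thesis using yz that 1 by simp
  qed
qed

lemma hcomp_homog [simp, intro]: "x \<in> carrier A \<Longrightarrow> hcomp A \<gamma> x \<in> homog A \<gamma>"
  by (metis hcomp_ex hcomp_eq)

lemma hcomp_closed [simp, intro]: "x \<in> carrier A \<Longrightarrow> hcomp A \<gamma> x \<in> carrier A"
  by blast

lemma hcomp_decomp: "x \<in> carrier A \<Longrightarrow> hcomp A 0 x \<oplus> hcomp A 1 x = x"
proof -
  assume x: "x \<in> carrier A"
  then obtain y z where yz: "y \<in> homog A 0" "z \<in> homog A (0 + 1)" "x = y \<oplus> z" by (rule hcomp_ex)
  have "hcomp A 0 x = y" using yz hcomp_eq by blast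
  moreover have "x = z \<oplus> y" using yz homog_carrier by (metis a_comm)
  then have "hcomp A 1 x = z" using yz hcomp_eq[of z 1 y] by simp
  ultimately show ?thesis using yz by simp
qed

lemma hcomp_of_homog: "x \<in> homog A \<alpha> \<Longrightarrow> hcomp A \<gamma> x = (if \<gamma> = \<alpha> then x else \<zero>)"
proof (cases "\<gamma> = \<alpha>")
  case True
  assume x: "x \<in> homog A \<alpha>"
  show ?thesis using hcomp_eq[of x \<alpha> \<zero>] x True by auto
next
  case False
  assume x: "x \<in> homog A \<alpha>"
  have "\<alpha> = \<gamma> + 1" using False by (cases \<alpha>; cases \<gamma>) auto
  then show ?thesis using hcomp_eq[of \<zero> \<gamma> x] x False by auto
qed

lemma hcomp_add:
  assumes "x \<in> carrier A" "y \<in> carrier A"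
  shows "hcomp A \<gamma> (x \<oplus> y) = hcomp A \<gamma> x \<oplus> hcomp A \<gamma> y"
proof -
  obtain x0 x1 where x: "x0 \<in> homog A \<gamma>" "x1 \<in> homog A (\<gamma> + 1)" "x = x0 \<oplus> x1"
    using assms(1) by (rule hcomp_ex)
  obtain y0 y1 where y: "y0 \<in> homog A \<gamma>" "y1 \<in> homog A (\<gamma> + 1)" "y = y0 \<oplus> y1"
    using assms(2) by (rule hcomp_ex)
  have "x \<oplus> y = (x0 \<oplus> y0) \<oplus> (x1 \<oplus> y1)"
    using x y homog_carrier[of x0] homog_carrier[of x1] homog_carrier[of y0] homog_carrier[of y1]
    by (simp add: a_ac)
  then have "hcomp A \<gamma> (x \<oplus> y) = x0 \<oplus> y0" using hcomp_eq[of "x0 \<oplus> y0" \<gamma> "x1 \<oplus> y1"] x y by auto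
  then show ?thesis using x y hcomp_eq by simp
qed

lemma hcomp_smult:
  assumes "x \<in> carrier A"
  shows "hcomp A \<gamma> (c \<odot> x) = c \<odot> hcomp A \<gamma> x"
proof -
  obtain x0 x1 where x: "x0 \<in> homog A \<gamma>" "x1 \<in> homog A (\<gamma> + 1)" "x = x0 \<oplus> x1"
    using assms(1) by (rule hcomp_ex)
  then show ?thesis using hcomp_eq[of x0 \<gamma> x1] hcomp_eq[of "c \<odot> x0" \<gamma> "c \<odot> x1"]
      homog_carrier[of x0] homog_carrier[of x1]
    by (auto simp: smult_add_right)
qed

lemma mult_lincomb:
  assumes "finite I" "\<And>i. i \<in> I \<Longrightarrow> x i \<in> carrier A" "y \<in> carrier A"
  shows "y \<otimes> lincomb A I c x = lincomb A I c (\<lambda>i. y \<otimes> x i)"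
  using assms by (induction I rule: finite_induct) (auto simp: lincomb_insert r_distr smult_mult_right)

lemma lincomb_mult:
  assumes "finite I" "\<And>i. i \<in> I \<Longrightarrow> x i \<in> carrier A" "y \<in> carrier A"
  shows "lincomb A I c x \<otimes> y = lincomb A I c (\<lambda>i. x i \<otimes> y)"
  using assms by (induction I rule: finite_induct) (auto simp: lincomb_insert l_distr smult_mult_left)

lemma lincomb_mult_lincomb:
  assumes "finite I" "finite J" "\<And>i. i \<in> I \<Longrightarrow> x i \<in> carrier A" "\<And>j. j \<in> J \<Longrightarrow> y j \<in> carrier A"
  shows "lincomb A I c x \<otimes> lincomb A J d y =
    lincomb A (I \<times> J) (\<lambda>(i, j). c i * d j) (\<lambda>(i, j). x i \<otimes> y j)"
proof -
  have "lincomb A I c x \<otimes> lincomb A J d y = lincomb A I c (\<lambda>i. x i \<otimes> lincomb A J d y)"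
    by (rule lincomb_mult) (use assms in auto)
  also have "\<dots> = lincomb A I c (\<lambda>i. lincomb A J d (\<lambda>j. x i \<otimes> y j))"
    by (rule lincomb_cong) (use assms in \<open>auto simp: mult_lincomb\<close>)
  also have "\<dots> = lincomb A (I \<times> J) (\<lambda>(i, j). c i * d j) (\<lambda>(i, j). x i \<otimes> y j)"
    by (rule lincomb_product) (use assms in auto)
  finally show ?thesis .
qed

end

section \<open>Linear maps and homomorphisms of superalgebras\<close>

definition linear_maps ::
  "('k, 'a, 'm) module_scheme \<Rightarrow> ('k, 'b, 'p) module_scheme \<Rightarrow> ('a \<Rightarrow> 'b) set" where
  "linear_maps M N = {f. (\<forall>x\<in>carrier M. f x \<in> carrier N) \<and>
     (\<forall>x\<in>carrier M. \<forall>y\<in>carrier M. f (x \<oplus>\<^bsub>M\<^esub> y) = f x \<oplus>\<^bsub>N\<^esub> f y) \<and>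
     (\<forall>c. \<forall>x\<in>carrier M. f (c \<odot>\<^bsub>M\<^esub> x) = c \<odot>\<^bsub>N\<^esub> f x)}"

lemma linear_maps_zero:
  assumes "ground_module M" "ground_module N" "f \<in> linear_maps M N"
  shows "f \<zero>\<^bsub>M\<^esub> = \<zero>\<^bsub>N\<^esub>"
proof -
  interpret M: ground_module M by fact
  interpret N: ground_module N by fact
  have "f (0 \<odot>\<^bsub>M\<^esub> \<zero>\<^bsub>M\<^esub>) = 0 \<odot>\<^bsub>N\<^esub> f \<zero>\<^bsub>M\<^esub>" "f \<zero>\<^bsub>M\<^esub> \<in> carrier N"
    using assms(3) M.M.zero_closed unfolding linear_maps_def by blast+
  then show ?thesis by (metis N.zero_smult M.smult_zero)
qed

lemma linear_maps_lincomb: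
  assumes "ground_module M" "ground_module N" "f \<in> linear_maps M N"
    and "finite I" "\<And>i. i \<in> I \<Longrightarrow> x i \<in> carrier M"
  shows "f (lincomb M I c x) = lincomb N I c (\<lambda>i. f (x i))"
proof -
  interpret M: ground_module M by fact
  interpret N: ground_module N by fact
  show ?thesis using assms(4,5)
  proof (induction I rule: finite_induct)
    case empty
    then show ?case using linear_maps_zero[OF assms(1-3)] by simp
  next
    case (insert i I)
    show ?case using insert assms(3) unfolding linear_maps_def
      by (simp add: M.lincomb_insert N.lincomb_insert)
  qed
qed

context
  fixes A :: "('k, 'a, 'm) superalgebra_scheme" and B :: "('k, 'b, 'p) superalgebra_scheme"
    and f :: "'a \<Rightarrow> 'b"
  assumes f: "f \<in> superalgebra_hom A B"
begin

lemma hom_closed [simp, intro]: "x \<in> carrier A \<Longrightarrow> f x \<in> carrier B"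
  using f by (auto simp: superalgebra_hom_def dest: ring_hom_closed)

lemma hom_mult: "x \<in> carrier A \<Longrightarrow> y \<in> carrier A \<Longrightarrow> f (x \<otimes>\<^bsub>A\<^esub> y) = f x \<otimes>\<^bsub>B\<^esub> f y"
  using f by (auto simp: superalgebra_hom_def dest: ring_hom_mult)

lemma hom_add: "x \<in> carrier A \<Longrightarrow> y \<in> carrier A \<Longrightarrow> f (x \<oplus>\<^bsub>A\<^esub> y) = f x \<oplus>\<^bsub>B\<^esub> f y"
  using f by (auto simp: superalgebra_hom_def dest: ring_hom_add)

lemma hom_one: "f \<one>\<^bsub>A\<^esub> = \<one>\<^bsub>B\<^esub>"
  using f by (auto simp: superalgebra_hom_def dest: ring_hom_one)

lemma hom_smult: "x \<in> carrier A \<Longrightarrow> f (c \<odot>\<^bsub>A\<^esub> x) = c \<odot>\<^bsub>B\<^esub> f x"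
  using f by (auto simp: superalgebra_hom_def)

lemma hom_homog: "x \<in> homog A \<gamma> \<Longrightarrow> f x \<in> homog B \<gamma>"
  using f unfolding superalgebra_hom_def by blast

lemma hom_linear: "f \<in> linear_maps A B"
  by (auto simp: linear_maps_def hom_add hom_smult)

end

lemma superalgebra_homI:
  assumes "\<And>x. x \<in> carrier A \<Longrightarrow> f x \<in> carrier B"
    "\<And>x y. x \<in> carrier A \<Longrightarrow> y \<in> carrier A \<Longrightarrow> f (x \<otimes>\<^bsub>A\<^esub> y) = f x \<otimes>\<^bsub>B\<^esub> f y"
    "\<And>x y. x \<in> carrier A \<Longrightarrow> y \<in> carrier A \<Longrightarrow> f (x \<oplus>\<^bsub>A\<^esub> y) = f x \<oplus>\<^bsub>B\<^esub> f y"
    "f \<one>\<^bsub>A\<^esub> = \<one>\<^bsub>B\<^esub>"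
    "\<And>c x. x \<in> carrier A \<Longrightarrow> f (c \<odot>\<^bsub>A\<^esub> x) = c \<odot>\<^bsub>B\<^esub> f x"
    "\<And>\<gamma> x. x \<in> homog A \<gamma> \<Longrightarrow> f x \<in> homog B \<gamma>"
  shows "f \<in> superalgebra_hom A B"
  using assms by (auto simp: superalgebra_hom_def intro!: ring_hom_memI)

lemma hom_lincomb:
  assumes "superalgebra A" "superalgebra B" "f \<in> superalgebra_hom A B"
    and "finite I" "\<And>i. i \<in> I \<Longrightarrow> x i \<in> carrier A"
  shows "f (lincomb A I c x) = lincomb B I c (\<lambda>i. f (x i))"
proof -
  interpret A: superalgebra A by fact
  interpret B: superalgebra B by fact
  show ?thesis
    by (rule linear_maps_lincomb) (use A.ground_module_axioms B.ground_module_axioms hom_linear assms in auto)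
qed

lemma hom_zero:
  assumes "superalgebra A" "superalgebra B" "f \<in> superalgebra_hom A B"
  shows "f \<zero>\<^bsub>A\<^esub> = \<zero>\<^bsub>B\<^esub>"
proof -
  interpret A: superalgebra A by fact
  interpret B: superalgebra B by fact
  show ?thesis
    by (rule linear_maps_zero) (use A.ground_module_axioms B.ground_module_axioms hom_linear assms in auto)
qed

lemma hom_id: "id \<in> superalgebra_hom A A"
  by (rule superalgebra_homI) auto

lemma hom_compose:
  assumes "f \<in> superalgebra_hom A B" "g \<in> superalgebra_hom B C"
  shows "g \<circ> f \<in> superalgebra_hom A C"
  by (rule superalgebra_homI)
    (simp_all add: hom_closed[OF assms(1)] hom_mult[OF assms(1)] hom_add[OF assms(1)] hom_one[OF assms(1)]
      hom_smult[OF assms(1)] hom_homog[OF assms(1)] hom_closed[OF assms(2)] hom_mult[OF assms(2)]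
      hom_add[OF assms(2)] hom_one[OF assms(2)] hom_smult[OF assms(2)] hom_homog[OF assms(2)])

lemma hom_cong:
  assumes "superalgebra A" "f \<in> superalgebra_hom A B" "\<And>x. x \<in> carrier A \<Longrightarrow> g x = f x"
  shows "g \<in> superalgebra_hom A B"
proof -
  interpret A: superalgebra A by fact
  show ?thesis
    by (rule superalgebra_homI)
      (simp_all add: assms(3) hom_closed[OF assms(2)] hom_mult[OF assms(2)] hom_add[OF assms(2)]
        hom_one[OF assms(2)] hom_smult[OF assms(2)] hom_homog[OF assms(2)])
qed

lemma superalgebra_ground: "superalgebra (ground :: ('k::field, 'k) superalgebra)"
proof -
  interpret cring "ground :: ('k, 'k) superalgebra" by (rule cring_ground)
  interpret module "ground :: ('k, 'k) superalgebra" ground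
    by (rule moduleI) (auto simp: algebra_simps intro: cring_ground is_abelian_group)
  show ?thesis
  proof (intro superalgebra.intro superalgebra_axioms.intro)
    fix \<gamma> :: bit
    have "\<ominus>\<^bsub>ground\<^esub> a = - a" for a :: 'k by (rule minus_equality) auto
    then show "submodule (homog ground \<gamma>) (ground :: ('k, 'k) superalgebra) (ground :: ('k, 'k) superalgebra)"
      by (intro submoduleI) (auto split: if_splits)
  next
    fix x y :: 'k and \<alpha> \<beta> assume "x \<in> homog ground \<alpha>" "y \<in> homog ground \<beta>"
    then show "x \<otimes>\<^bsub>ground\<^esub> y \<in> homog ground (\<alpha> + \<beta>)" by (cases \<alpha>; cases \<beta>) auto
  qed (auto intro: module_axioms ring_axioms)
qed

text \<open>Composed with a counit, this turns a scalar-valued homomorphism into one with values in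
  \<open>A\<close>.\<close>

lemma (in superalgebra) unit_hom: "(\<lambda>c. c \<odot> \<one>) \<in> superalgebra_hom ground A"
proof (rule superalgebra_homI)
  fix \<gamma> and x :: 'k assume "x \<in> homog ground \<gamma>"
  then show "x \<odot> \<one> \<in> homog A \<gamma>" using homog_one by (cases \<gamma>) auto
qed (auto simp: smult_add_left smult_mult_left)

section \<open>Quotients\<close>

text \<open>\<open>quot_superalgebra\<close> takes the images of the homogeneous parts for any
  ideal; closure under components is what makes these images meet only in zero.\<close>

locale graded_ideal = superalgebra A + ideal I A
  for A :: "('k::field, 'a, 'm) superalgebra_scheme" (structure) and I :: "'a set" +
  assumes hcomp_mem: "x \<in> I \<Longrightarrow> hcomp A \<gamma> x \<in> I"
begin

text \<open>An ideal is only known to absorb ring elements; scalars are absorbed because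
  \<open>c \<odot> x\<close> is the product of \<open>c \<odot> \<one>\<close> with
  \<open>x\<close>.\<close>

lemma smult_mem: "x \<in> I \<Longrightarrow> c \<odot> x \<in> I"
  using I_l_closed[of x "c \<odot> \<one>"] Icarr[of x] by (simp add: smult_mult_left)

abbreviation "proj x \<equiv> I +> x"
abbreviation "Q \<equiv> quot_superalgebra A I"

lemma proj_eq_iff: "x \<in> carrier A \<Longrightarrow> y \<in> carrier A \<Longrightarrow> proj x = proj y \<longleftrightarrow> x \<ominus> y \<in> I"
  using quotient_eq_iff_same_a_r_cos[OF ideal_axioms] by blast

lemma proj_eq_zero_iff: "x \<in> carrier A \<Longrightarrow> proj x = proj \<zero> \<longleftrightarrow> x \<in> I"
  using proj_eq_iff[of x \<zero>] by (simp add: a_minus_def)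

lemma quot_carrier: "carrier Q = proj ` carrier A"
  by (auto simp: quot_superalgebra_def FactRing_simps)

lemma quot_mult: "x \<in> carrier A \<Longrightarrow> y \<in> carrier A \<Longrightarrow> proj x \<otimes>\<^bsub>Q\<^esub> proj y = proj (x \<otimes> y)"
  using ring_hom_mult[OF rcos_ring_hom] by (simp add: quot_superalgebra_def)

lemma quot_add: "x \<in> carrier A \<Longrightarrow> y \<in> carrier A \<Longrightarrow> proj x \<oplus>\<^bsub>Q\<^esub> proj y = proj (x \<oplus> y)"
  using ring_hom_add[OF rcos_ring_hom] by (simp add: quot_superalgebra_def)

lemma quot_one: "\<one>\<^bsub>Q\<^esub> = proj \<one>"
  using ring_hom_one[OF rcos_ring_hom] by (simp add: quot_superalgebra_def)

lemma quot_zero: "\<zero>\<^bsub>Q\<^esub> = proj \<zero>"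
proof -
  have "\<zero>\<^bsub>Q\<^esub> = I" by (simp add: quot_superalgebra_def FactRing_def)
  then show ?thesis by (metis a_rcos_zero ideal_axioms zero_closed)
qed

text \<open>The quotient defines scalar multiples as unions over all representatives, so every
  representative must give the same coset. Two of them differ by an element of \<open>I\<close>, and
  \<open>I\<close> absorbs scalars.\<close>

lemma quot_smult: "x \<in> carrier A \<Longrightarrow> c \<odot>\<^bsub>Q\<^esub> proj x = proj (c \<odot> x)"
proof -
  assume x: "x \<in> carrier A"
  have "proj (c \<odot> y) = proj (c \<odot> x)" if y: "y \<in> proj x" for y
  proof -
    have yc: "y \<in> carrier A" using y x a_r_coset_subset_G[OF a_subset] by blast
    have "y \<ominus> x \<in> I" using a_rcos_module_rev[OF x] y yc x a_rcos_module_imp is_additive_subgroup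
      by (metis a_minus_def abelian_subgroup.a_rcos_module abelian_subgroupI3 abelian_group_axioms)
    then have "c \<odot> (y \<ominus> x) \<in> I" by (rule smult_mem)
    moreover have "c \<odot> (y \<ominus> x) = c \<odot> y \<ominus> c \<odot> x"
      using x yc by (simp add: a_minus_def smult_add_right minus_eq_smult)
    ultimately show ?thesis using x yc by (subst proj_eq_iff) auto
  qed
  then have "(\<Union>y\<in>proj x. proj (c \<odot> y)) = (\<Union>y\<in>proj x. proj (c \<odot> x))" by (rule SUP_cong[OF refl])
  moreover have "x \<in> proj x" using x by (rule a_rcos_self)
  ultimately show ?thesis by (simp add: quot_superalgebra_def) blast
qed

lemma quot_homog: "homog Q \<gamma> = proj ` homog A \<gamma>"
  by (simp add: quot_superalgebra_def)

lemmas quot_simps = quot_carrier quot_mult quot_add quot_one quot_zero quot_smult quot_homog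

lemma superalgebra_quot: "superalgebra Q"
proof -
  have ab: "abelian_group Q"
  proof (rule abelian_groupI)
    fix X assume "X \<in> carrier Q"
    then obtain x where "x \<in> carrier A" "X = proj x" by (auto simp: quot_simps)
    then show "\<exists>Y\<in>carrier Q. Y \<oplus>\<^bsub>Q\<^esub> X = \<zero>\<^bsub>Q\<^esub>"
      by (intro bexI[of _ "proj (\<ominus> x)"]) (auto simp: quot_simps l_neg)
  qed (auto simp: quot_simps a_ac)
  interpret Q: ring Q
    by (rule ringI) (use ab in \<open>auto simp: quot_simps m_assoc l_distr r_distr intro!: monoidI\<close>)
  interpret Q: module ground Q
    by (rule moduleI) (use ab cring_ground in \<open>auto simp: quot_simps smult_add_left smult_add_right\<close>)
  have disj: "X = \<zero>\<^bsub>Q\<^esub>" if X: "X \<in> homog Q 0" "X \<in> homog Q 1" for X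
  proof -
    from X obtain x y where xy: "x \<in> homog A 0" "y \<in> homog A 1" "X = proj x" "X = proj y"
      by (auto simp: quot_homog)
    then have "x \<oplus> \<ominus> y \<in> I" using proj_eq_iff[of x y] by (auto simp: a_minus_def)
    \<comment> \<open>The degree zero component of the difference is \<open>x\<close> itself, so
      \<open>x\<close> lies in the ideal.\<close>
    then have "hcomp A 0 (x \<oplus> \<ominus> y) \<in> I" by (rule hcomp_mem)
    moreover have "hcomp A 0 (x \<oplus> \<ominus> y) = x" using xy by (intro hcomp_eq) auto
    ultimately show ?thesis using proj_eq_zero_iff[of x] xy by (auto simp: quot_zero)
  qed
  show ?thesis
  proof (intro superalgebra.intro superalgebra_axioms.intro)
    fix \<gamma>
    show "submodule (homog Q \<gamma>) ground Q"
    proof (rule Q.submoduleI)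
      fix X assume "X \<in> homog Q \<gamma>"
      then obtain x where x: "x \<in> homog A \<gamma>" "X = proj x" by (auto simp: quot_simps)
      have "\<ominus>\<^bsub>Q\<^esub> X = proj (\<ominus> x)"
      proof (rule Q.minus_equality)
        show "proj (\<ominus> x) \<oplus>\<^bsub>Q\<^esub> X = \<zero>\<^bsub>Q\<^esub>" using x by (auto simp: quot_simps l_neg)
      qed (use x in \<open>auto simp: quot_simps\<close>)
      then show "\<ominus>\<^bsub>Q\<^esub> X \<in> homog Q \<gamma>" using x by (auto simp: quot_simps)
    qed (auto simp: quot_simps)
  next
    fix X assume "X \<in> carrier Q"
    then obtain x where x: "x \<in> carrier A" "X = proj x" by (auto simp: quot_simps)
    have "X = proj (hcomp A 0 x) \<oplus>\<^bsub>Q\<^esub> proj (hcomp A 1 x)"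
      using x by (simp add: quot_add hcomp_decomp)
    then show "\<exists>Y\<in>homog Q 0. \<exists>Z\<in>homog Q 1. X = Y \<oplus>\<^bsub>Q\<^esub> Z" using x by (auto simp: quot_homog)
  next
    show "homog Q 0 \<inter> homog Q 1 = {\<zero>\<^bsub>Q\<^esub>}"
      using disj by (auto simp: quot_homog quot_zero)
  next
    fix X Y \<alpha> \<beta> assume "X \<in> homog Q \<alpha>" "Y \<in> homog Q \<beta>"
    then obtain x y where xy: "x \<in> homog A \<alpha>" "y \<in> homog A \<beta>" "X = proj x" "Y = proj y"
      by (auto simp: quot_homog)
    then have "X \<otimes>\<^bsub>Q\<^esub> Y = proj (x \<otimes> y)" by (auto simp: quot_mult)
    then show "X \<otimes>\<^bsub>Q\<^esub> Y \<in> homog Q (\<alpha> + \<beta>)" using xy homog_mult by (auto simp: quot_homog)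
  qed (auto simp: quot_simps smult_mult_left smult_mult_right homog_one intro: Q.module_axioms Q.ring_axioms)
qed

lemma proj_hom: "proj \<in> superalgebra_hom A Q"
  by (rule superalgebra_homI) (auto simp: quot_simps)

lemma quot_lift:
  assumes B: "superalgebra B" and f: "f \<in> superalgebra_hom A B"
    and van: "\<And>x. x \<in> I \<Longrightarrow> f x = \<zero>\<^bsub>B\<^esub>"
  shows "\<exists>g\<in>superalgebra_hom Q B. \<forall>x\<in>carrier A. g (proj x) = f x"
proof -
  interpret B: superalgebra B by fact
  have wd: "f x = f y" if "x \<in> carrier A" "y \<in> carrier A" "proj x = proj y" for x y
  proof -
    have "x \<oplus> \<ominus> y \<in> I" using that proj_eq_iff by (auto simp: a_minus_def)
    then have "f (x \<oplus> \<ominus> y) = \<zero>\<^bsub>B\<^esub>" by (rule van)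
    then have "f x \<oplus>\<^bsub>B\<^esub> (- 1) \<odot>\<^bsub>B\<^esub> f y = \<zero>\<^bsub>B\<^esub>"
      using that by (simp add: hom_add[OF f] hom_smult[OF f] minus_eq_smult)
    then show ?thesis using that hom_closed[OF f]
      by (metis B.minus_eq_smult B.minus_minus B.minus_equality B.a_inv_closed)
  qed
  define g where "g X = f (SOME x. x \<in> carrier A \<and> proj x = X)" for X
  have g: "g (proj x) = f x" if "x \<in> carrier A" for x
  proof -
    have "(SOME y. y \<in> carrier A \<and> proj y = proj x) \<in> carrier A \<and> 
      proj (SOME y. y \<in> carrier A \<and> proj y = proj x) = proj x"
      by (rule someI[of _ x]) (use that in simp)
    then show ?thesis unfolding g_def using wd that by blast
  qed
  have "g \<in> superalgebra_hom Q B"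
  proof (rule superalgebra_homI)
    fix \<gamma> X assume "X \<in> homog Q \<gamma>"
    then obtain x where "x \<in> homog A \<gamma>" "X = proj x" by (auto simp: quot_homog)
    then show "g X \<in> homog B \<gamma>" using g hom_homog[OF f] by auto
  qed (auto simp: quot_simps g hom_closed[OF f] hom_mult[OF f] hom_add[OF f] hom_one[OF f] hom_smult[OF f])
  then show ?thesis using g by blast
qed

lemma quot_hom_eqI:
  assumes "\<And>x. x \<in> carrier A \<Longrightarrow> f (proj x) = g (proj x)" "X \<in> carrier Q"
  shows "f X = g X"
  using assms by (auto simp: quot_carrier)

end

context superalgebra
begin

text \<open>The elements all of whose components lie in \<open>Idl S\<close> form an ideal that
  contains \<open>S\<close>, hence all of \<open>Idl S\<close>. Closure under products reduces to
  homogeneous factors, where multiplication merely shifts components.\<close>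

lemma graded_ideal_genideal:
  assumes S: "S \<subseteq> (\<Union>\<gamma>. homog A \<gamma>)"
  shows "graded_ideal A (Idl S)"
proof -
  have Sc: "S \<subseteq> carrier A" using S by auto
  interpret I: ideal "Idl S" A by (rule genideal_ideal[OF Sc])
  define J where "J = {x \<in> carrier A. \<forall>\<gamma>. hcomp A \<gamma> x \<in> Idl S}"
  have smem: "c \<odot> x \<in> Idl S" if "x \<in> Idl S" for c x
    using I.I_l_closed[of x "c \<odot> \<one>"] I.Icarr[of x] that by (simp add: smult_mult_left)
  have l: "hcomp A \<gamma> (x \<otimes> a) \<in> Idl S" if a: "\<And>\<gamma>. hcomp A \<gamma> a \<in> Idl S" "a \<in> carrier A"
    and x: "x \<in> homog A \<xi>" for x a \<xi> \<gamma>
  proof -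
    have "x \<otimes> a = x \<otimes> hcomp A 0 a \<oplus> x \<otimes> hcomp A 1 a"
      using a x by (metis homog_carrier hcomp_closed hcomp_decomp r_distr)
    then have "hcomp A \<gamma> (x \<otimes> a) = hcomp A \<gamma> (x \<otimes> hcomp A 0 a) \<oplus> hcomp A \<gamma> (x \<otimes> hcomp A 1 a)"
      using a x by (simp add: hcomp_add homog_carrier[OF x])
    moreover have "hcomp A \<gamma> (x \<otimes> hcomp A \<beta> a) \<in> Idl S" for \<beta>
      using hcomp_of_homog[OF homog_mult[OF x hcomp_homog[OF a(2)]], of \<gamma> \<beta>]
        I.I_l_closed[OF a(1)[of \<beta>] homog_carrier[OF x]] by auto
    ultimately show ?thesis by simp
  qed
  have r: "hcomp A \<gamma> (a \<otimes> x) \<in> Idl S" if a: "\<And>\<gamma>. hcomp A \<gamma> a \<in> Idl S" "a \<in> carrier A"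
    and x: "x \<in> homog A \<xi>" for x a \<xi> \<gamma>
  proof -
    have "a \<otimes> x = hcomp A 0 a \<otimes> x \<oplus> hcomp A 1 a \<otimes> x"
      using a x by (metis homog_carrier hcomp_closed hcomp_decomp l_distr)
    then have "hcomp A \<gamma> (a \<otimes> x) = hcomp A \<gamma> (hcomp A 0 a \<otimes> x) \<oplus> hcomp A \<gamma> (hcomp A 1 a \<otimes> x)"
      using a x by (simp add: hcomp_add homog_carrier[OF x])
    moreover have "hcomp A \<gamma> (hcomp A \<beta> a \<otimes> x) \<in> Idl S" for \<beta>
      using hcomp_of_homog[OF homog_mult[OF hcomp_homog[OF a(2)] x], of \<gamma> \<beta>]
        I.I_r_closed[OF a(1)[of \<beta>] homog_carrier[OF x]] by auto
    ultimately show ?thesis by simp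
  qed
  have "ideal J A"
  proof (rule idealI[OF ring_axioms])
    show "subgroup J (add_monoid A)"
    proof (rule add.subgroupI)
      show "J \<subseteq> carrier A" by (auto simp: J_def)
      have "\<zero> \<in> J" using hcomp_of_homog[OF homog_zero] by (auto simp: J_def)
      then show "J \<noteq> {}" by blast
    next
      fix a assume "a \<in> J"
      then show "\<ominus> a \<in> J" using smem by (auto simp: J_def minus_eq_smult hcomp_smult)
    next
      fix a b assume "a \<in> J" "b \<in> J"
      then show "a \<oplus> b \<in> J" by (auto simp: J_def hcomp_add)
    qed
  next
    fix a x assume a: "a \<in> J" and x: "x \<in> carrier A"
    have x': "x = hcomp A 0 x \<oplus> hcomp A 1 x" using x hcomp_decomp by simp
    have ac: "a \<in> carrier A" "\<And>\<gamma>. hcomp A \<gamma> a \<in> Idl S" using a by (auto simp: J_def)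
    have "x \<otimes> a = hcomp A 0 x \<otimes> a \<oplus> hcomp A 1 x \<otimes> a"
      using x ac by (metis x' hcomp_closed l_distr)
    then have "hcomp A \<gamma> (x \<otimes> a) \<in> Idl S" for \<gamma>
      using x ac l[OF ac(2,1) hcomp_homog[OF x], of \<gamma> 0] l[OF ac(2,1) hcomp_homog[OF x], of \<gamma> 1]
      by (simp add: hcomp_add)
    then show "x \<otimes> a \<in> J" using x ac by (simp add: J_def)
    have "a \<otimes> x = a \<otimes> hcomp A 0 x \<oplus> a \<otimes> hcomp A 1 x"
      using x ac by (metis x' hcomp_closed r_distr)
    then have "hcomp A \<gamma> (a \<otimes> x) \<in> Idl S" for \<gamma>
      using x ac r[OF ac(2,1) hcomp_homog[OF x], of \<gamma> 0] r[OF ac(2,1) hcomp_homog[OF x], of \<gamma> 1]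
      by (simp add: hcomp_add)
    then show "a \<otimes> x \<in> J" using x ac by (simp add: J_def)
  qed
  moreover have "S \<subseteq> J"
  proof
    fix s assume s: "s \<in> S"
    then obtain \<gamma> where "s \<in> homog A \<gamma>" using S by auto
    moreover have "s \<in> Idl S" using genideal_self[OF Sc] s by blast
    ultimately show "s \<in> J" by (auto simp: J_def hcomp_of_homog)
  qed
  ultimately have "Idl S \<subseteq> J" by (rule genideal_minimal)
  then show ?thesis
    by (intro graded_ideal.intro graded_ideal_axioms.intro superalgebra_axioms I.ideal_axioms)
      (auto simp: J_def)
qed

text \<open>The kernel of \<open>f\<close> is an ideal containing \<open>S\<close>.\<close>

lemma hom_vanishes_genideal:
  assumes B: "superalgebra B" and f: "f \<in> superalgebra_hom A B"
    and S: "S \<subseteq> carrier A" "\<And>s. s \<in> S \<Longrightarrow> f s = \<zero>\<^bsub>B\<^esub>" and x: "x \<in> Idl S"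
  shows "f x = \<zero>\<^bsub>B\<^esub>"
proof -
  interpret B: superalgebra B by fact
  interpret h: ring_hom_ring A B f
    by (rule ring_hom_ringI2[OF ring_axioms B.ring_axioms]) (use f in \<open>simp add: superalgebra_hom_def\<close>)
  have "S \<subseteq> a_kernel A B f" using S unfolding a_kernel_def' by blast
  then have "Idl S \<subseteq> a_kernel A B f"
    by (rule genideal_minimal[OF h.kernel_is_ideal])
  then show ?thesis using x unfolding a_kernel_def' by blast
qed

end

section \<open>Free superalgebras and presentations\<close>

text \<open>The support stays inside \<open>S\<close> throughout the induction, so facts that hold
  only for words in given letters, or for pairs from given carriers, can be used at each
  step.\<close>

lemma poly_mapping_keys_induct [consumes 1, case_names zero single add]:
  assumes "Poly_Mapping.keys p \<subseteq> S" "P 0"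
    and "\<And>w c. w \<in> S \<Longrightarrow> P (Poly_Mapping.single w c)"
    and "\<And>p q. Poly_Mapping.keys p \<subseteq> S \<Longrightarrow> Poly_Mapping.keys q \<subseteq> S \<Longrightarrow> P p \<Longrightarrow> P q \<Longrightarrow> P (p + q)"
  shows "P (p :: 'a \<Rightarrow>\<^sub>0 'b::comm_monoid_add)"
proof -
  \<comment> \<open>The bound on the support is proved along with \<open>P\<close>, since the
    addition step demands it of the partial sum.\<close>
  have *: "P (\<Sum>w\<in>T. Poly_Mapping.single w (c w)) \<and> Poly_Mapping.keys (\<Sum>w\<in>T. Poly_Mapping.single w (c w)) \<subseteq> S"
    if "finite T" "T \<subseteq> S" for T and c :: "'a \<Rightarrow> 'b"
    using that
  proof (induction T rule: finite_induct)
    case (insert w T)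
    then have "P (Poly_Mapping.single w (c w) + (\<Sum>w\<in>T. Poly_Mapping.single w (c w)))"
      using assms(3)[of w "c w"] by (intro assms(4)) auto
    moreover have "Poly_Mapping.keys (Poly_Mapping.single w (c w) + (\<Sum>w\<in>T. Poly_Mapping.single w (c w))) \<subseteq> S"
      using insert by (intro order_trans[OF keys_add]) auto
    ultimately show ?case using insert.hyps by simp
  qed (simp add: assms(2))
  have "p = (\<Sum>w\<in>Poly_Mapping.keys p. Poly_Mapping.single w (Poly_Mapping.lookup p w))"
    by (rule poly_mapping_eqI) (simp add: lookup_sum lookup_single when_def in_keys_iff)
  then show ?thesis using *[of "Poly_Mapping.keys p" "Poly_Mapping.lookup p"] assms(1) by simp
qed

lemma const_mult: "const c * p = pscale c p"
proof -
  have "Poly_Mapping.keys p \<subseteq> UNIV" by simp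
  then show ?thesis
  proof (induction p rule: poly_mapping_keys_induct)
    case (add p q)
    then show ?case by (simp add: distrib_left pscale.scale_right_distrib)
  qed (auto simp: const_def mult_single)
qed

lemma mult_const: "p * const c = pscale c p"
proof -
  have "Poly_Mapping.keys p \<subseteq> UNIV" by simp
  then show ?thesis
  proof (induction p rule: poly_mapping_keys_induct)
    case (add p q)
    then show ?case by (simp add: distrib_right pscale.scale_right_distrib)
  qed (auto simp: const_def mult_single mult.commute)
qed

lemma letters_plus [simp]: "letters (v + w) = letters v @ letters w"
  by (simp add: plus_fmon_def)

lemma letters_zero [simp]: "letters 0 = []"
  by (simp add: zero_fmon_def)

lemma free_carrier:
  "carrier (free_superalgebra X d) = {f. Poly_Mapping.keys f \<subseteq> {w. set (letters w) \<subseteq> X}}"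
  by (auto simp: free_superalgebra_def)

lemma free_simps [simp]:
  "mult (free_superalgebra X d) = (*)" "one (free_superalgebra X d) = 1"
  "zero (free_superalgebra X d) = 0" "add (free_superalgebra X d) = (+)"
  "smult (free_superalgebra X d) = pscale"
  by (auto simp: free_superalgebra_def const_mult fun_eq_iff)

lemma homog_free:
  "homog (free_superalgebra X d) \<gamma> = {f. Poly_Mapping.keys f \<subseteq>
     {w. set (letters w) \<subseteq> X \<and> sum_list (map d (letters w)) = \<gamma>}}"
  by (auto simp: free_superalgebra_def)

lemma superalgebra_free: "superalgebra (free_superalgebra X d :: ('k::field, 'x fmon \<Rightarrow>\<^sub>0 'k) superalgebra)"
proof -
  let ?F = "free_superalgebra X d :: ('k, 'x fmon \<Rightarrow>\<^sub>0 'k) superalgebra"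
  have add: "p + q \<in> carrier ?F" if "p \<in> carrier ?F" "q \<in> carrier ?F" for p q
    using that keys_add[of p q] unfolding free_carrier by blast
  have neg: "- p \<in> carrier ?F" if "p \<in> carrier ?F" for p
    using that by (simp add: free_carrier)
  have zero: "0 \<in> carrier ?F" and one: "1 \<in> carrier ?F"
    by (simp_all add: free_carrier)
  have ab: "abelian_group ?F"
  proof (rule abelian_groupI)
    fix p assume "p \<in> carrier ?F"
    then show "\<exists>q\<in>carrier ?F. q \<oplus>\<^bsub>?F\<^esub> p = \<zero>\<^bsub>?F\<^esub>" by (intro bexI[of _ "- p"]) (auto simp: neg)
  qed (simp_all add: add zero algebra_simps)
  have mult: "p * q \<in> carrier ?F" if "p \<in> carrier ?F" "q \<in> carrier ?F" for p q
    using that keys_mult[of p q] unfolding free_carrier by fastforce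
  interpret F: ring ?F
    by (rule ringI, rule ab, rule monoidI) (simp_all add: mult one algebra_simps)
  have sc: "pscale c p \<in> carrier ?F" if "p \<in> carrier ?F" for c p
    using that keys_pscale[of c p] unfolding free_carrier by blast
  interpret FM: module ground ?F
    by (rule moduleI, rule cring_ground, rule ab)
      (simp_all add: sc pscale.scale_left_distrib pscale.scale_right_distrib)
  have sl: "pscale c p * q = pscale c (p * q)" for c and p q :: "'x fmon \<Rightarrow>\<^sub>0 'k"
    by (metis const_mult mult.assoc)
  have sr: "p * pscale c q = pscale c (p * q)" for c and p q :: "'x fmon \<Rightarrow>\<^sub>0 'k"
    by (metis mult_const mult.assoc)
  show ?thesis
  proof (intro superalgebra.intro superalgebra_axioms.intro)
    fix \<gamma>
    show "submodule (homog ?F \<gamma>) ground ?F"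
    proof (rule FM.submoduleI)
      fix p assume p: "p \<in> homog ?F \<gamma>"
      have "\<ominus>\<^bsub>?F\<^esub> p = - p"
        by (rule F.minus_equality) (use p in \<open>auto simp: homog_free free_carrier\<close>)
      then show "\<ominus>\<^bsub>?F\<^esub> p \<in> homog ?F \<gamma>" using p by (auto simp: homog_free)
    next
      fix p q assume "p \<in> homog ?F \<gamma>" "q \<in> homog ?F \<gamma>"
      then show "p \<oplus>\<^bsub>?F\<^esub> q \<in> homog ?F \<gamma>" using keys_add[of p q] by (simp add: homog_free) blast
    next
      fix c p assume "p \<in> homog ?F \<gamma>"
      then show "c \<odot>\<^bsub>?F\<^esub> p \<in> homog ?F \<gamma>" using keys_pscale[of c p] by (force simp: homog_free)
    qed (auto simp: homog_free free_carrier)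
  next
    fix p assume "p \<in> carrier ?F"
    then have "Poly_Mapping.keys p \<subseteq> {w. set (letters w) \<subseteq> X}" by (auto simp: free_carrier)
    then show "\<exists>y\<in>homog ?F 0. \<exists>z\<in>homog ?F 1. p = y \<oplus>\<^bsub>?F\<^esub> z"
    proof (induction p rule: poly_mapping_keys_induct)
      case zero
      show ?case by (intro bexI[of _ 0]) (auto simp: homog_free)
    next
      case (single w c)
      show ?case
      proof (cases "sum_list (map d (letters w)) = 0")
        case True
        then show ?thesis using single
          by (intro bexI[of _ "Poly_Mapping.single w c"] bexI[of _ 0]) (auto simp: homog_free)
      next
        case False
        then have "sum_list (map d (letters w)) = 1" using bit_cases by blast
        then show ?thesis using single
          by (intro bexI[of _ "Poly_Mapping.single w c"] bexI[of _ 0]) (auto simp: homog_free)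
      qed
    next
      case (add p q)
      then obtain y z y' z' where "y \<in> homog ?F 0" "z \<in> homog ?F 1" "p = y + z"
        "y' \<in> homog ?F 0" "z' \<in> homog ?F 1" "q = y' + z'" by auto
      then have "y + y' \<in> homog ?F 0" "z + z' \<in> homog ?F 1" "p + q = (y + y') \<oplus>\<^bsub>?F\<^esub> (z + z')"
        using keys_add[of y y'] keys_add[of z z'] by (simp_all add: homog_free) blast+
      then show ?case by blast
    qed
  next
    have "p = 0" if "p \<in> homog ?F 0" "p \<in> homog ?F 1" for p :: "_ \<Rightarrow>\<^sub>0 'k"
    proof -
      have "w \<notin> Poly_Mapping.keys p" for w
      proof
        assume "w \<in> Poly_Mapping.keys p"
        then have "sum_list (map d (letters w)) = 0" "sum_list (map d (letters w)) = 1"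
          using that by (auto simp: homog_free)
        then show False by simp
      qed
      then show ?thesis by (metis all_not_in_conv keys_eq_empty)
    qed
    then show "homog ?F 0 \<inter> homog ?F 1 = {\<zero>\<^bsub>?F\<^esub>}" by (auto simp: homog_free)
  next
    fix p q \<alpha> \<beta> assume pq: "p \<in> homog ?F \<alpha>" "q \<in> homog ?F \<beta>"
    have "set (letters w) \<subseteq> X \<and> sum_list (map d (letters w)) = \<alpha> + \<beta>"
      if "w \<in> Poly_Mapping.keys (p * q)" for w
    proof -
      obtain u v where "u \<in> Poly_Mapping.keys p" "v \<in> Poly_Mapping.keys q" "w = u + v"
        using keys_mult[of p q] \<open>w \<in> Poly_Mapping.keys (p * q)\<close> by blast
      then show ?thesis using pq by (auto simp: homog_free simp del: add_bit_eq_xor)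
    qed
    then show "p \<otimes>\<^bsub>?F\<^esub> q \<in> homog ?F (\<alpha> + \<beta>)" by (auto simp: homog_free simp del: add_bit_eq_xor)
  qed (simp_all add: sl sr homog_free FM.module_axioms F.ring_axioms)
qed

section \<open>Evaluation of words and the universal property of the free superalgebra\<close>

definition word_eval :: "('k, 'b, 'p) superalgebra_scheme \<Rightarrow> ('x \<Rightarrow> 'b) \<Rightarrow> 'x fmon \<Rightarrow> 'b" where
  "word_eval B b w = foldr (\<lambda>x y. b x \<otimes>\<^bsub>B\<^esub> y) (letters w) \<one>\<^bsub>B\<^esub>"

lemma var_in_free: "x \<in> X \<Longrightarrow> var x \<in> homog (free_superalgebra X d) (d x)"
  by (simp add: homog_free var_def)

context superalgebra
begin

lemma word_eval_homog:
  assumes "\<And>x. x \<in> X \<Longrightarrow> b x \<in> homog A (d x)" "set (letters w) \<subseteq> X"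
  shows "word_eval A b w \<in> homog A (sum_list (map d (letters w)))"
proof -
  have "foldr (\<lambda>x y. b x \<otimes> y) xs \<one> \<in> homog A (sum_list (map d xs))" if "set xs \<subseteq> X" for xs
    using that assms(1) by (induction xs) (auto simp: homog_one simp del: add_bit_eq_xor intro: homog_mult)
  then show ?thesis using assms(2) by (simp add: word_eval_def)
qed

lemma word_eval_plus:
  assumes "\<And>x. x \<in> X \<Longrightarrow> b x \<in> homog A (d x)" "set (letters v) \<subseteq> X" "set (letters w) \<subseteq> X"
  shows "word_eval A b (v + w) = word_eval A b v \<otimes> word_eval A b w"
proof -
  have bc: "b x \<in> carrier A" if "x \<in> X" for x using assms(1) that by blast
  have c: "foldr (\<lambda>x y. b x \<otimes> y) xs \<one> \<in> carrier A" if "set xs \<subseteq> X" for xs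
    using that bc by (induction xs) auto
  have "foldr (\<lambda>x y. b x \<otimes> y) (xs @ ys) \<one> = foldr (\<lambda>x y. b x \<otimes> y) xs \<one> \<otimes> foldr (\<lambda>x y. b x \<otimes> y) ys \<one>"
    if "set xs \<subseteq> X" "set ys \<subseteq> X" for xs ys
    using that bc c by (induction xs) (auto simp: m_assoc)
  then show ?thesis using assms(2,3) by (simp add: word_eval_def)
qed

lemma free_lift:
  assumes b: "\<And>x. x \<in> X \<Longrightarrow> b x \<in> homog A (d x)"
  shows "\<exists>f\<in>superalgebra_hom (free_superalgebra X d) A. \<forall>x\<in>X. f (var x) = b x"
proof -
  let ?F = "free_superalgebra X d :: ('k, _) superalgebra"
  let ?f = "linext A (word_eval A b)"
  define S where "S = {w. set (letters w) \<subseteq> X}"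
  have wc: "word_eval A b w \<in> carrier A" if "w \<in> S" for w
    using word_eval_homog[of X b d w, OF b] that by (auto simp: S_def)
  have fc: "?f p \<in> carrier A" if "Poly_Mapping.keys p \<subseteq> S" for p
    by (rule linext_closed) (use that wc in blast)
  have fadd: "?f (p + q) = ?f p \<oplus> ?f q" if "Poly_Mapping.keys p \<subseteq> S" "Poly_Mapping.keys q \<subseteq> S" for p q
    by (rule linext_add) (use that wc in blast)
  have ks: "Poly_Mapping.keys (Poly_Mapping.single w c * p) \<subseteq> S"
    if "w \<in> S" "Poly_Mapping.keys p \<subseteq> S" for w and c :: 'k and p
    using keys_mult[of "Poly_Mapping.single w c" p] that unfolding S_def by (fastforce split: if_splits)
  have kp: "Poly_Mapping.keys (p * q) \<subseteq> S" if "Poly_Mapping.keys p \<subseteq> S" "Poly_Mapping.keys q \<subseteq> S" for p q :: "_ \<Rightarrow>\<^sub>0 'k"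
    using keys_mult[of p q] that unfolding S_def by fastforce
  \<comment> \<open>Both sides are additive in each factor, so multiplicativity is proved first for
    a single word on the left and then for sums of words.\<close>
  have fm1: "?f (Poly_Mapping.single w c * q) = ?f (Poly_Mapping.single w c) \<otimes> ?f q"
    if w: "w \<in> S" and "Poly_Mapping.keys q \<subseteq> S" for w c q
    using that(2)
  proof (induction q rule: poly_mapping_keys_induct)
    case zero
    then show ?case using w wc by simp
  next
    case (single v e)
    have "w + v \<in> S" using w single by (simp add: S_def)
    then have "?f (Poly_Mapping.single (w + v) (c * e)) = (c * e) \<odot> word_eval A b (w + v)"
      using wc by (intro linext_single)
    moreover have "word_eval A b (w + v) = word_eval A b w \<otimes> word_eval A b v"
      using word_eval_plus[of X b d w v, OF b] w single by (simp add: S_def)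
    ultimately show ?case using w single wc by (simp add: mult_single smult_mult_left smult_mult_right mult.commute)
  next
    case (add p q)
    then show ?case using w ks fadd fc wc by (simp add: distrib_left r_distr)
  qed
  have fm: "?f (p * q) = ?f p \<otimes> ?f q" if "Poly_Mapping.keys p \<subseteq> S" and q: "Poly_Mapping.keys q \<subseteq> S" for p q
    using that(1)
  proof (induction p rule: poly_mapping_keys_induct)
    case zero
    then show ?case using fc[OF q] by simp
  next
    case (single w c)
    then show ?case using fm1 q by blast
  next
    case (add p p')
    then show ?case using q kp fadd fc by (simp add: distrib_right l_distr)
  qed
  have "?f \<in> superalgebra_hom ?F A"
  proof (rule superalgebra_homI)
    show "?f \<one>\<^bsub>?F\<^esub> = \<one>"
      using linext_single[of "word_eval A b" 0 1] by (simp add: word_eval_def flip: single_one)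
  next
    fix c p assume "p \<in> carrier ?F"
    then show "?f (c \<odot>\<^bsub>?F\<^esub> p) = c \<odot> ?f p"
      using wc by (auto simp: free_carrier S_def intro!: linext_pscale)
  next
    fix \<gamma> p assume p: "p \<in> homog ?F \<gamma>"
    show "?f p \<in> homog A \<gamma>"
      unfolding linext_def
    proof (rule homog_lincomb)
      fix w assume "w \<in> Poly_Mapping.keys p"
      then have w: "set (letters w) \<subseteq> X" "sum_list (map d (letters w)) = \<gamma>"
        using p by (auto simp: homog_free)
      show "word_eval A b w \<in> homog A \<gamma>"
        using word_eval_homog[of X b d w, OF b w(1)] w(2) by simp
    qed simp
  qed (simp_all add: free_carrier fc fadd fm flip: S_def)
  moreover have "?f (var x) = b x" if "x \<in> X" for x
    using linext_single[of "word_eval A b" "Fmon [x]" 1] b[OF that] wc[of "Fmon [x]"] that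
    by (auto simp: var_def word_eval_def S_def)
  ultimately show ?thesis by blast
qed

lemma free_hom_eq:
  assumes f: "f \<in> superalgebra_hom (free_superalgebra X d) A"
    and g: "g \<in> superalgebra_hom (free_superalgebra X d) A"
    and e: "\<And>x. x \<in> X \<Longrightarrow> f (var x) = g (var x)" and p: "p \<in> carrier (free_superalgebra X d)"
  shows "f p = g p"
proof -
  let ?F = "free_superalgebra X d :: ('k, _) superalgebra"
  interpret F: superalgebra ?F by (rule superalgebra_free)
  have w: "f (Poly_Mapping.single (Fmon xs) 1) = g (Poly_Mapping.single (Fmon xs) 1)" if "set xs \<subseteq> X" for xs
    using that
  proof (induction xs)
    case Nil
    then show ?case using hom_one[OF f] hom_one[OF g] by (simp flip: zero_fmon_def)
  next
    case (Cons x xs)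
    have "Poly_Mapping.single (Fmon (x # xs)) 1 = var x \<otimes>\<^bsub>?F\<^esub> Poly_Mapping.single (Fmon xs) 1"
      by (simp add: var_def mult_single plus_fmon_def)
    moreover have "var x \<in> carrier ?F" "Poly_Mapping.single (Fmon xs) 1 \<in> carrier ?F"
      using Cons by (auto simp: var_def free_carrier)
    ultimately show ?case using Cons e by (simp only: hom_mult[OF f] hom_mult[OF g]) auto
  qed
  have "Poly_Mapping.keys p \<subseteq> {w. set (letters w) \<subseteq> X}" using p by (simp add: free_carrier)
  then show ?thesis
  proof (induction p rule: poly_mapping_keys_induct)
    case zero
    show ?case using hom_zero[OF superalgebra_free superalgebra_axioms f]
        hom_zero[OF superalgebra_free superalgebra_axioms g] by simp
  next
    case (single v c)
    have "Poly_Mapping.single v c = c \<odot>\<^bsub>?F\<^esub> Poly_Mapping.single v 1" by simp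
    moreover have "Poly_Mapping.single v 1 \<in> carrier ?F" using single by (auto simp: free_carrier)
    ultimately show ?case using w[of "letters v"] single by (simp only: hom_smult[OF f] hom_smult[OF g]) auto
  next
    case (add p q)
    then have "p \<in> carrier ?F" "q \<in> carrier ?F" by (auto simp: free_carrier)
    then show ?case using hom_add[OF f, of p q] hom_add[OF g, of p q] add by simp
  qed
qed

end

text \<open>Degrees are added as elements of a group; rewriting their sums to exclusive or would
  hide this from the additive laws used below.\<close>

declare add_bit_eq_xor [simp del] mult_bit_eq_and [simp del]

lemma sgnf_simps [simp]: "sgnf 0 \<beta> = 1" "sgnf \<alpha> 0 = 1" "sgnf 1 1 = - 1"
  by (simp_all add: sgnf_def)

lemma sgnf_add_left: "sgnf (\<alpha> + \<beta>) \<gamma> = sgnf \<alpha> \<gamma> * sgnf \<beta> \<gamma>"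
  by (cases \<alpha>; cases \<beta>; cases \<gamma>) simp_all

lemma sgnf_add_right: "sgnf \<gamma> (\<alpha> + \<beta>) = sgnf \<gamma> \<alpha> * sgnf \<gamma> \<beta>"
  by (cases \<alpha>; cases \<beta>; cases \<gamma>) simp_all

lemma sgnf_square [simp]: "sgnf \<alpha> \<beta> * sgnf \<alpha> \<beta> = 1"
  by (cases \<alpha>; cases \<beta>) simp_all

text \<open>Homogeneous relations generate a graded ideal; for other relations the quotient need not
  be a superalgebra.\<close>

locale presentation =
  fixes X :: "'x set" and d :: "'x \<Rightarrow> bit" and S :: "('x fmon \<Rightarrow>\<^sub>0 'k::field) set"
  assumes rels_homog: "S \<subseteq> (\<Union>\<gamma>. homog (free_superalgebra X d) \<gamma>)"
begin

abbreviation "FX \<equiv> free_superalgebra X d :: ('k, 'x fmon \<Rightarrow>\<^sub>0 'k) superalgebra"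
abbreviation "PX \<equiv> presented_superalgebra X d S"
abbreviation "gen \<equiv> presented_gen X d S"

sublocale F: superalgebra FX by (rule superalgebra_free)
sublocale Id: graded_ideal FX "Idl\<^bsub>FX\<^esub> S" by (rule F.graded_ideal_genideal[OF rels_homog])

lemma superalgebra_presented: "superalgebra PX"
  unfolding presented_superalgebra_def by (rule Id.superalgebra_quot)

lemma proj_hom: "Id.proj \<in> superalgebra_hom FX PX"
  unfolding presented_superalgebra_def by (rule Id.proj_hom)

lemma gen_homog: "x \<in> X \<Longrightarrow> gen x \<in> homog PX (d x)"
  unfolding presented_gen_def by (rule hom_homog[OF proj_hom]) (rule var_in_free)

lemma rels_carrier: "S \<subseteq> carrier FX"
  using rels_homog F.homog_carrier by blast

lemma proj_rels: "s \<in> S \<Longrightarrow> Id.proj s = \<zero>\<^bsub>PX\<^esub>"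
  using Id.proj_eq_zero_iff[of s] F.genideal_self[OF rels_carrier] rels_carrier
  unfolding presented_superalgebra_def Id.quot_zero by blast

text \<open>The hypothesis on the relations quantifies over every homomorphism with the prescribed
  values, since the one in question is only obtained inside the proof.\<close>

lemma presented_lift:
  assumes B: "superalgebra B" and b: "\<And>x. x \<in> X \<Longrightarrow> b x \<in> homog B (d x)"
    and r: "\<And>f s. f \<in> superalgebra_hom FX B \<Longrightarrow> (\<And>x. x \<in> X \<Longrightarrow> f (var x) = b x) \<Longrightarrow> s \<in> S \<Longrightarrow> f s = \<zero>\<^bsub>B\<^esub>"
  shows "\<exists>g\<in>superalgebra_hom PX B. \<forall>x\<in>X. g (gen x) = b x"
proof -
  interpret B: superalgebra B by fact
  obtain f where f: "f \<in> superalgebra_hom FX B" "\<forall>x\<in>X. f (var x) = b x"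
    using B.free_lift[of X b d, OF b] by blast
  have "f x = \<zero>\<^bsub>B\<^esub>" if "x \<in> Idl\<^bsub>FX\<^esub> S" for x
    by (rule F.hom_vanishes_genideal[OF B f(1) rels_carrier _ that]) (rule r[OF f(1)], use f in auto)
  from Id.quot_lift[OF B f(1) this] obtain g where
    g: "g \<in> superalgebra_hom PX B" "\<forall>x\<in>carrier FX. g (Id.proj x) = f x"
    unfolding presented_superalgebra_def by blast
  have "g (gen x) = b x" if "x \<in> X" for x
    using g f that F.homog_carrier[OF var_in_free[OF that]] by (simp add: presented_gen_def)
  then show ?thesis using g by blast
qed

lemma presented_hom_eq:
  assumes B: "superalgebra B" and f: "f \<in> superalgebra_hom PX B" and g: "g \<in> superalgebra_hom PX B"
    and e: "\<And>x. x \<in> X \<Longrightarrow> f (gen x) = g (gen x)" and p: "p \<in> carrier PX"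
  shows "f p = g p"
proof -
  interpret B: superalgebra B by fact
  have "(f \<circ> Id.proj) x = (g \<circ> Id.proj) x" if "x \<in> carrier FX" for x
    by (rule B.free_hom_eq[OF hom_compose[OF proj_hom f] hom_compose[OF proj_hom g] _ that])
      (use e in \<open>simp add: presented_gen_def\<close>)
  then show ?thesis using Id.quot_hom_eqI[of f g p] p
    unfolding presented_superalgebra_def by simp
qed

end

section \<open>Tensor products\<close>

definition bilinear_maps ::
  "('k, 'a, 'm) module_scheme \<Rightarrow> ('k, 'b, 'p) module_scheme \<Rightarrow> ('k, 'c, 'r) module_scheme \<Rightarrow>
   ('a \<Rightarrow> 'b \<Rightarrow> 'c) set" where
  "bilinear_maps A B M = {f. (\<forall>x\<in>carrier A. f x \<in> linear_maps B M) \<and>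
     (\<forall>y\<in>carrier B. (\<lambda>x. f x y) \<in> linear_maps A M)}"

lemma bilinear_mapsD:
  assumes "f \<in> bilinear_maps A B M"
  shows "x \<in> carrier A \<Longrightarrow> y \<in> carrier B \<Longrightarrow> f x y \<in> carrier M"
    "x \<in> carrier A \<Longrightarrow> x' \<in> carrier A \<Longrightarrow> y \<in> carrier B \<Longrightarrow> f (x \<oplus>\<^bsub>A\<^esub> x') y = f x y \<oplus>\<^bsub>M\<^esub> f x' y"
    "x \<in> carrier A \<Longrightarrow> y \<in> carrier B \<Longrightarrow> y' \<in> carrier B \<Longrightarrow> f x (y \<oplus>\<^bsub>B\<^esub> y') = f x y \<oplus>\<^bsub>M\<^esub> f x y'"
    "x \<in> carrier A \<Longrightarrow> y \<in> carrier B \<Longrightarrow> f (c \<odot>\<^bsub>A\<^esub> x) y = c \<odot>\<^bsub>M\<^esub> f x y"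
    "x \<in> carrier A \<Longrightarrow> y \<in> carrier B \<Longrightarrow> f x (c \<odot>\<^bsub>B\<^esub> y) = c \<odot>\<^bsub>M\<^esub> f x y"
  using assms unfolding bilinear_maps_def linear_maps_def by blast+

lemma bilinear_mapsI:
  assumes
    "\<And>x y. x \<in> carrier A \<Longrightarrow> y \<in> carrier B \<Longrightarrow> f x y \<in> carrier M"
    "\<And>x x' y. x \<in> carrier A \<Longrightarrow> x' \<in> carrier A \<Longrightarrow> y \<in> carrier B \<Longrightarrow> f (x \<oplus>\<^bsub>A\<^esub> x') y = f x y \<oplus>\<^bsub>M\<^esub> f x' y"
    "\<And>x y y'. x \<in> carrier A \<Longrightarrow> y \<in> carrier B \<Longrightarrow> y' \<in> carrier B \<Longrightarrow> f x (y \<oplus>\<^bsub>B\<^esub> y') = f x y \<oplus>\<^bsub>M\<^esub> f x y'"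
    "\<And>c x y. x \<in> carrier A \<Longrightarrow> y \<in> carrier B \<Longrightarrow> f (c \<odot>\<^bsub>A\<^esub> x) y = c \<odot>\<^bsub>M\<^esub> f x y"
    "\<And>c x y. x \<in> carrier A \<Longrightarrow> y \<in> carrier B \<Longrightarrow> f x (c \<odot>\<^bsub>B\<^esub> y) = c \<odot>\<^bsub>M\<^esub> f x y"
  shows "f \<in> bilinear_maps A B M"
  using assms unfolding bilinear_maps_def linear_maps_def by blast

text \<open>The product of two pairs, left multiplication and the projection onto a degree are all
  finite linear combinations of simpler bilinear maps, and their bilinearity is checked term by
  term.\<close>

lemma (in ground_module) bilinear_maps_lincomb:
  assumes "finite I" "\<And>i. i \<in> I \<Longrightarrow> f i \<in> bilinear_maps A B M"
  shows "(\<lambda>x y. lincomb M I c (\<lambda>i. f i x y)) \<in> bilinear_maps A B M"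
proof -
  note D = bilinear_mapsD[OF assms(2)]
  show ?thesis
  proof (rule bilinear_mapsI)
  fix x x' y assume h: "x \<in> carrier A" "x' \<in> carrier A" "y \<in> carrier B"
  have "lincomb M I c (\<lambda>i. f i (x \<oplus>\<^bsub>A\<^esub> x') y) = lincomb M I c (\<lambda>i. f i x y \<oplus> f i x' y)"
    by (rule lincomb_cong) (use h in \<open>simp_all add: D\<close>)
  also have "\<dots> = lincomb M I c (\<lambda>i. f i x y) \<oplus> lincomb M I c (\<lambda>i. f i x' y)"
    by (rule lincomb_add) (use h in \<open>simp_all add: D\<close>)
  finally show "lincomb M I c (\<lambda>i. f i (x \<oplus>\<^bsub>A\<^esub> x') y) =
    lincomb M I c (\<lambda>i. f i x y) \<oplus> lincomb M I c (\<lambda>i. f i x' y)" .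
next
  fix x y y' assume h: "x \<in> carrier A" "y \<in> carrier B" "y' \<in> carrier B"
  have "lincomb M I c (\<lambda>i. f i x (y \<oplus>\<^bsub>B\<^esub> y')) = lincomb M I c (\<lambda>i. f i x y \<oplus> f i x y')"
    by (rule lincomb_cong) (use h in \<open>simp_all add: D\<close>)
  also have "\<dots> = lincomb M I c (\<lambda>i. f i x y) \<oplus> lincomb M I c (\<lambda>i. f i x y')"
    by (rule lincomb_add) (use h in \<open>simp_all add: D\<close>)
  finally show "lincomb M I c (\<lambda>i. f i x (y \<oplus>\<^bsub>B\<^esub> y')) =
    lincomb M I c (\<lambda>i. f i x y) \<oplus> lincomb M I c (\<lambda>i. f i x y')" .
next
  fix e x y assume h: "x \<in> carrier A" "y \<in> carrier B"
  have s: "e \<odot> lincomb M I c (\<lambda>i. f i x y) = lincomb M I (\<lambda>i. e * c i) (\<lambda>i. f i x y)"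
    by (rule smult_lincomb) (use h assms(1) in \<open>simp_all add: D\<close>)
  show "lincomb M I c (\<lambda>i. f i (e \<odot>\<^bsub>A\<^esub> x) y) = e \<odot> lincomb M I c (\<lambda>i. f i x y)"
    unfolding s by (rule lincomb_cong) (use h in \<open>simp_all add: D mult.commute\<close>)
  show "lincomb M I c (\<lambda>i. f i x (e \<odot>\<^bsub>B\<^esub> y)) = e \<odot> lincomb M I c (\<lambda>i. f i x y)"
    unfolding s by (rule lincomb_cong) (use h in \<open>simp_all add: D mult.commute\<close>)
qed (auto simp: D)
qed

section \<open>The tensor product as formal sums modulo the bilinearity relations\<close>

locale tensor_pair = A: superalgebra A + B: superalgebra B
  for A :: "('k::field, 'a, 'm) superalgebra_scheme" and B :: "('k, 'b, 'p) superalgebra_scheme"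
begin

abbreviation "T \<equiv> A \<otimes>\<^sub>s B"
abbreviation "cls \<equiv> tensor_class A B"
abbreviation "P \<equiv> pure_tensor A B"
text \<open>The type also contains formal sums of pairs outside the carriers; bilinearity of a map
  says nothing about those.\<close>

definition "U = {u :: 'a \<times> 'b \<Rightarrow>\<^sub>0 'k. Poly_Mapping.keys u \<subseteq> carrier A \<times> carrier B}"

lemma U_add [simp]: "u \<in> U \<Longrightarrow> v \<in> U \<Longrightarrow> u + v \<in> U"
  using keys_add[of u v] by (auto simp: U_def)

lemma U_diff [simp]: "u \<in> U \<Longrightarrow> v \<in> U \<Longrightarrow> u - v \<in> U"
  using keys_diff[of u v] by (auto simp: U_def)

lemma U_pscale [simp]: "u \<in> U \<Longrightarrow> pscale c u \<in> U"
  using keys_pscale[of c u] by (auto simp: U_def)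

lemma U_single [simp]: "x \<in> carrier A \<Longrightarrow> y \<in> carrier B \<Longrightarrow> Poly_Mapping.single (x, y) c \<in> U"
  by (auto simp: U_def)

lemma U_zero [simp]: "0 \<in> U"
  by (simp add: U_def)

lemma U_sum: "(\<And>i. i \<in> I \<Longrightarrow> f i \<in> U) \<Longrightarrow> (\<Sum>i\<in>I. f i) \<in> U"
  by (induction I rule: infinite_finite_induct) auto

lemma subspace_U: "pscale.subspace U"
  by (rule pscale.subspaceI) simp_all

abbreviation "N \<equiv> tensor_null A B"

lemma rels_U: "tensor_rels A B \<subseteq> U"
  unfolding tensor_rels_def by (auto intro!: U_diff U_pscale U_single simp del: pscale_single)

lemma N_U: "u \<in> N \<Longrightarrow> u \<in> U"
  unfolding tensor_null_def using pscale.span_minimal[OF rels_U subspace_U] by blast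

lemma N_zero [simp]: "0 \<in> N"
  unfolding tensor_null_def by (rule pscale.span_zero)

lemma N_add: "u \<in> N \<Longrightarrow> v \<in> N \<Longrightarrow> u + v \<in> N"
  unfolding tensor_null_def by (rule pscale.span_add)

lemma N_diff: "u \<in> N \<Longrightarrow> v \<in> N \<Longrightarrow> u - v \<in> N"
  unfolding tensor_null_def by (rule pscale.span_diff)

lemma N_scale: "u \<in> N \<Longrightarrow> pscale c u \<in> N"
  unfolding tensor_null_def by (rule pscale.span_scale)

lemma N_rel: "u \<in> tensor_rels A B \<Longrightarrow> u \<in> N"
  unfolding tensor_null_def by (rule pscale.span_base)

lemma cls_mem: "v \<in> cls u \<longleftrightarrow> v - u \<in> N"
proof
  assume "v - u \<in> N"
  then show "v \<in> cls u" unfolding tensor_class_def by (rule rev_image_eqI) simp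
qed (auto simp: tensor_class_def)

lemma cls_self: "u \<in> cls u"
  by (simp add: cls_mem)

lemma cls_eq_iff: "cls u = cls v \<longleftrightarrow> u - v \<in> N"
proof
  assume "u - v \<in> N"
  then have "w - u \<in> N \<longleftrightarrow> w - v \<in> N" for w
    using N_add[of "w - u" "u - v"] N_diff[of "w - v" "u - v"] by auto
  then show "cls u = cls v" by (auto simp: cls_mem)
qed (use cls_self cls_mem in blast)

lemma cls_U: "u \<in> U \<Longrightarrow> v \<in> cls u \<Longrightarrow> v \<in> U"
  using N_U[of "v - u"] U_add[of "v - u" u] by (simp add: cls_mem)

lemma T_carrier: "carrier T = cls ` U"
  by (simp add: tensor_def U_def)

lemma T_zero: "\<zero>\<^bsub>T\<^esub> = cls 0"
  by (simp add: tensor_def tensor_class_def)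

lemma T_one: "\<one>\<^bsub>T\<^esub> = P \<one>\<^bsub>A\<^esub> \<one>\<^bsub>B\<^esub>"
  by (simp add: tensor_def pure_tensor_def)

lemma T_add: "cls u \<oplus>\<^bsub>T\<^esub> cls v = cls (u + v)"
proof -
  have "cls u \<oplus>\<^bsub>T\<^esub> cls v = (\<Union>u'\<in>cls u. \<Union>v'\<in>cls v. {u' + v'})" by (simp add: tensor_def)
  also have "\<dots> = cls (u + v)"
  proof (intro equalityI subsetI)
    fix w assume "w \<in> (\<Union>u'\<in>cls u. \<Union>v'\<in>cls v. {u' + v'})"
    then obtain u' v' where "u' - u \<in> N" "v' - v \<in> N" "w = u' + v'" by (auto simp: cls_mem)
    then show "w \<in> cls (u + v)" using N_add[of "u' - u" "v' - v"] by (simp add: cls_mem algebra_simps)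
  next
    fix w assume "w \<in> cls (u + v)"
    then have "w - v \<in> cls u" by (simp add: cls_mem algebra_simps)
    then show "w \<in> (\<Union>u'\<in>cls u. \<Union>v'\<in>cls v. {u' + v'})"
      using cls_self[of v] by (intro UN_I[of "w - v"] UN_I[of v]) auto
  qed
  finally show ?thesis .
qed

lemma T_smult: "c \<odot>\<^bsub>T\<^esub> cls u = cls (pscale c u)"
proof -
  have "cls (pscale c u') = cls (pscale c u)" if "u' \<in> cls u" for u'
    using that N_scale[of "u' - u" c] by (simp add: cls_eq_iff cls_mem pscale.scale_right_diff_distrib)
  then have "(\<Union>u'\<in>cls u. cls (pscale c u')) = (\<Union>u'\<in>cls u. cls (pscale c u))"
    by (rule SUP_cong[OF refl])
  then show ?thesis using cls_self[of u] by (simp add: tensor_def) blast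
qed

lemma ground_module_T: "ground_module T"
proof -
  have ab: "abelian_group T"
  proof (rule abelian_groupI)
    fix X assume "X \<in> carrier T"
    then obtain u where "u \<in> U" "X = cls u" by (auto simp: T_carrier)
    then show "\<exists>Y\<in>carrier T. Y \<oplus>\<^bsub>T\<^esub> X = \<zero>\<^bsub>T\<^esub>"
      using U_diff[of 0 u] by (intro bexI[of _ "cls (- u)"]) (auto simp: T_carrier T_add T_zero)
  qed (auto simp: T_carrier T_add T_zero algebra_simps)
  show ?thesis
    by (rule ground_module.intro, rule moduleI, rule cring_ground, rule ab)
      (auto simp: T_carrier T_add T_smult pscale.scale_left_distrib pscale.scale_right_distrib)
qed

sublocale T: ground_module T
  by (rule ground_module_T)

lemma P_closed [simp, intro]: "x \<in> carrier A \<Longrightarrow> y \<in> carrier B \<Longrightarrow> P x y \<in> carrier T"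
  by (auto simp: T_carrier pure_tensor_def)

lemma cls_single: "cls (Poly_Mapping.single (x, y) c) = c \<odot>\<^bsub>T\<^esub> P x y"
  by (simp add: pure_tensor_def T_smult)

lemma P_bilinear: "P \<in> bilinear_maps A B T"
proof (rule bilinear_mapsI)
  fix x x' y assume "x \<in> carrier A" "x' \<in> carrier A" "y \<in> carrier B"
  then have "pair1 (x \<oplus>\<^bsub>A\<^esub> x') y - pair1 x y - pair1 x' y \<in> tensor_rels A B"
    unfolding tensor_rels_def by blast
  from N_rel[OF this] show "P (x \<oplus>\<^bsub>A\<^esub> x') y = P x y \<oplus>\<^bsub>T\<^esub> P x' y"
    by (simp add: pure_tensor_def T_add cls_eq_iff diff_diff_eq)
next
  fix x y y' assume "x \<in> carrier A" "y \<in> carrier B" "y' \<in> carrier B"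
  then have "pair1 x (y \<oplus>\<^bsub>B\<^esub> y') - pair1 x y - pair1 x y' \<in> tensor_rels A B"
    unfolding tensor_rels_def by blast
  from N_rel[OF this] show "P x (y \<oplus>\<^bsub>B\<^esub> y') = P x y \<oplus>\<^bsub>T\<^esub> P x y'"
    by (simp add: pure_tensor_def T_add cls_eq_iff diff_diff_eq)
next
  fix c x y assume "x \<in> carrier A" "y \<in> carrier B"
  then have "pair1 (c \<odot>\<^bsub>A\<^esub> x) y - pscale c (pair1 x y) \<in> tensor_rels A B"
    "pair1 x (c \<odot>\<^bsub>B\<^esub> y) - pscale c (pair1 x y) \<in> tensor_rels A B"
    unfolding tensor_rels_def by blast+
  from this[THEN N_rel] show "P (c \<odot>\<^bsub>A\<^esub> x) y = c \<odot>\<^bsub>T\<^esub> P x y" "P x (c \<odot>\<^bsub>B\<^esub> y) = c \<odot>\<^bsub>T\<^esub> P x y"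
    by (simp_all add: pure_tensor_def T_smult cls_eq_iff)
qed auto

lemmas P_simps = bilinear_mapsD(2-5)[OF P_bilinear]

lemma P_zero [simp]: "y \<in> carrier B \<Longrightarrow> P \<zero>\<^bsub>A\<^esub> y = \<zero>\<^bsub>T\<^esub>" "x \<in> carrier A \<Longrightarrow> P x \<zero>\<^bsub>B\<^esub> = \<zero>\<^bsub>T\<^esub>"
  using P_simps(3)[of "\<zero>\<^bsub>A\<^esub>" y 0] P_simps(4)[of x "\<zero>\<^bsub>B\<^esub>" 0] by simp_all

lemma P_lincomb_left:
  assumes "finite I" "\<And>i. i \<in> I \<Longrightarrow> x i \<in> carrier A" "y \<in> carrier B"
  shows "P (lincomb A I c x) y = lincomb T I c (\<lambda>i. P (x i) y)"
proof -
  have "(\<lambda>x. P x y) \<in> linear_maps A T" using P_bilinear assms(3) by (simp add: bilinear_maps_def)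
  from linear_maps_lincomb[OF A.ground_module_axioms T.ground_module_axioms this assms(1,2)]
  show ?thesis by simp
qed

lemma P_lincomb_right:
  assumes "finite I" "\<And>i. i \<in> I \<Longrightarrow> y i \<in> carrier B" "x \<in> carrier A"
  shows "P x (lincomb B I c y) = lincomb T I c (\<lambda>i. P x (y i))"
proof -
  have "P x \<in> linear_maps B T" using P_bilinear assms(3) by (simp add: bilinear_maps_def)
  from linear_maps_lincomb[OF B.ground_module_axioms T.ground_module_axioms this assms(1,2)]
  show ?thesis by simp
qed

text \<open>Scalars move into the left factor and both factors split into components, so homogeneous
  pure tensors generate the carrier additively; on these every sign is explicit.\<close>

lemma T_induct [consumes 1, case_names zero pure add]:
  assumes "X \<in> carrier T" "Q \<zero>\<^bsub>T\<^esub>"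
    and "\<And>x y \<alpha> \<beta>. x \<in> homog A \<alpha> \<Longrightarrow> y \<in> homog B \<beta> \<Longrightarrow> Q (P x y)"
    and "\<And>Y Z. Y \<in> carrier T \<Longrightarrow> Z \<in> carrier T \<Longrightarrow> Q Y \<Longrightarrow> Q Z \<Longrightarrow> Q (Y \<oplus>\<^bsub>T\<^esub> Z)"
  shows "Q X"
proof -
  obtain u where u: "u \<in> U" "X = cls u" using assms(1) by (auto simp: T_carrier)
  have "Poly_Mapping.keys u \<subseteq> carrier A \<times> carrier B" using u by (simp add: U_def)
  then have "Q (cls u)"
  proof (induction u rule: poly_mapping_keys_induct)
    case zero
    then show ?case using assms(2) by (simp add: T_zero)
  next
    case (single p c)
    obtain x y where p: "p = (x, y)" "x \<in> carrier A" "y \<in> carrier B" using single by auto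
    let ?x = "\<lambda>\<alpha>. hcomp A \<alpha> (c \<odot>\<^bsub>A\<^esub> x)" and ?y = "\<lambda>\<beta>. hcomp B \<beta> y"
    have "cls (Poly_Mapping.single p c) = P (c \<odot>\<^bsub>A\<^esub> x) y"
      using p by (simp add: cls_single P_simps)
    also have "\<dots> = P (?x 0 \<oplus>\<^bsub>A\<^esub> ?x 1) (?y 0 \<oplus>\<^bsub>B\<^esub> ?y 1)"
      using p by (simp add: A.hcomp_decomp B.hcomp_decomp)
    also have "\<dots> = (P (?x 0) (?y 0) \<oplus>\<^bsub>T\<^esub> P (?x 0) (?y 1)) \<oplus>\<^bsub>T\<^esub> (P (?x 1) (?y 0) \<oplus>\<^bsub>T\<^esub> P (?x 1) (?y 1))"
      using p by (simp add: P_simps T.M.a_ac)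
    finally show ?case using p assms(3)[OF A.hcomp_homog B.hcomp_homog]
      by (auto intro!: assms(4))
  next
    case (add u v)
    then show ?case using assms(4)[of "cls u" "cls v"] by (auto simp: T_add T_carrier U_def)
  qed
  then show ?thesis using u by simp
qed

context
  fixes M :: "('k, 'c, 'r) superalgebra_scheme" and f
  assumes M: "ground_module M" and f: "f \<in> bilinear_maps A B M"
begin

interpretation M: ground_module M by (rule M)

lemma linext_bilinear_closed: "u \<in> U \<Longrightarrow> linext M (\<lambda>p. f (fst p) (snd p)) u \<in> carrier M"
  using bilinear_mapsD(1)[OF f] by (intro M.linext_closed) (auto simp: U_def)

lemma linext_bilinear_add: "u \<in> U \<Longrightarrow> v \<in> U \<Longrightarrow>
    linext M (\<lambda>p. f (fst p) (snd p)) (u + v) =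
    linext M (\<lambda>p. f (fst p) (snd p)) u \<oplus>\<^bsub>M\<^esub> linext M (\<lambda>p. f (fst p) (snd p)) v"
  using bilinear_mapsD(1)[OF f] by (intro M.linext_add) (auto simp: U_def)

lemma linext_bilinear_minus: "u \<in> U \<Longrightarrow> v \<in> U \<Longrightarrow>
    linext M (\<lambda>p. f (fst p) (snd p)) (u - v) =
    linext M (\<lambda>p. f (fst p) (snd p)) u \<ominus>\<^bsub>M\<^esub> linext M (\<lambda>p. f (fst p) (snd p)) v"
  using bilinear_mapsD(1)[OF f] by (intro M.linext_minus) (auto simp: U_def)

lemma linext_bilinear_pscale: "u \<in> U \<Longrightarrow>
    linext M (\<lambda>p. f (fst p) (snd p)) (pscale c u) = c \<odot>\<^bsub>M\<^esub> linext M (\<lambda>p. f (fst p) (snd p)) u"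
  using bilinear_mapsD(1)[OF f] by (intro M.linext_pscale) (auto simp: U_def)

text \<open>Within \<open>U\<close> the kernel of the linear extension is a subspace containing each
  bilinearity relation, hence their span. This is why a bilinear map descends to the tensor
  product.\<close>

lemma linext_null:
  assumes "u \<in> N" shows "linext M (\<lambda>p. f (fst p) (snd p)) u = \<zero>\<^bsub>M\<^esub>"
proof -
  let ?L = "linext M (\<lambda>p. f (fst p) (snd p))"
  have s: "?L (Poly_Mapping.single (x, y) c) = c \<odot>\<^bsub>M\<^esub> f x y" if "x \<in> carrier A" "y \<in> carrier B" for x y c
    using M.linext_single[of "\<lambda>p. f (fst p) (snd p)" "(x, y)" c] bilinear_mapsD(1)[OF f] that by simp
  have c2: "x \<ominus>\<^bsub>M\<^esub> x = \<zero>\<^bsub>M\<^esub>" if "x \<in> carrier M" for x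
    using that by (simp add: a_minus_def M.M.r_neg)
  have c3: "x \<oplus>\<^bsub>M\<^esub> y \<ominus>\<^bsub>M\<^esub> x \<ominus>\<^bsub>M\<^esub> y = \<zero>\<^bsub>M\<^esub>" if "x \<in> carrier M" "y \<in> carrier M" for x y
  proof -
    have "x \<oplus>\<^bsub>M\<^esub> y \<ominus>\<^bsub>M\<^esub> x = y \<oplus>\<^bsub>M\<^esub> (x \<oplus>\<^bsub>M\<^esub> \<ominus>\<^bsub>M\<^esub> x)" using that by (simp add: a_minus_def M.M.a_ac)
    then show ?thesis using that by (simp add: M.M.r_neg c2)
  qed
  let ?K = "{u \<in> U. ?L u = \<zero>\<^bsub>M\<^esub>}"
  have "pscale.subspace ?K"
    by (rule pscale.subspaceI) (auto simp: linext_bilinear_add linext_bilinear_pscale)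
  moreover have "tensor_rels A B \<subseteq> ?K"
  proof
    fix r assume r: "r \<in> tensor_rels A B"
    have "?L r = \<zero>\<^bsub>M\<^esub>"
      using r bilinear_mapsD[OF f] unfolding tensor_rels_def
      by (elim UnE) (auto simp: linext_bilinear_minus s c2 c3)
    then show "r \<in> ?K" using r rels_U by auto
  qed
  ultimately show ?thesis using assms pscale.span_minimal unfolding tensor_null_def by blast
qed

lemma tensor_lift_cls:
  assumes "u \<in> U" shows "tensor_lift A B M f (cls u) = linext M (\<lambda>p. f (fst p) (snd p)) u"
proof -
  let ?L = "linext M (\<lambda>p. f (fst p) (snd p))"
  have "?L v = ?L u" if "v \<in> cls u" for v
  proof -
    have n: "v - u \<in> N" using that by (simp add: cls_mem)
    then have "?L ((v - u) + u) = ?L u"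
      using assms N_U[OF n] linext_null[OF n] linext_bilinear_closed[OF assms]
      by (subst linext_bilinear_add) auto
    then show ?thesis by simp
  qed
  then have "\<forall>v\<in>cls u. ?L u = ?L v" by metis
  then have "(THE z. \<forall>v\<in>cls u. z = ?L v) = ?L u"
    by (rule the_equality) (use cls_self in blast)
  moreover have "cls u \<in> carrier T" using assms by (simp add: T_carrier)
  ultimately show ?thesis by (simp add: tensor_lift_def linext_def lincomb_def)
qed

lemma tensor_lift_pure:
  "x \<in> carrier A \<Longrightarrow> y \<in> carrier B \<Longrightarrow> tensor_lift A B M f (P x y) = f x y"
  using M.linext_single[of "\<lambda>p. f (fst p) (snd p)" "(x, y)" 1] bilinear_mapsD(1)[OF f]
  by (simp add: pure_tensor_def tensor_lift_cls)

lemma tensor_lift_linear: "tensor_lift A B M f \<in> linear_maps T M"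
  unfolding linear_maps_def
  by (auto simp: T_carrier T_add T_smult tensor_lift_cls linext_bilinear_closed linext_bilinear_add
      linext_bilinear_pscale)

end

end

section \<open>The graded product on the tensor product\<close>

lemma (in ground_module) lincomb_one_term:
  assumes "finite I" "i \<in> I" "\<And>j. j \<in> I \<Longrightarrow> j \<noteq> i \<Longrightarrow> c j \<odot> x j = \<zero>\<^bsub>M\<^esub>" "\<And>j. j \<in> I \<Longrightarrow> x j \<in> carrier M"
  shows "lincomb M I c x = c i \<odot> x i"
proof -
  have "lincomb M I c x = lincomb M I (\<lambda>j. if j = i then c i else 0) x"
    by (rule lincomb_cong) (use assms in auto)
  then show ?thesis using lincomb_single[OF assms(1,2), of "\<lambda>j. if j = i then c i else 0" x] assms(4) by simp
qed

definition bit_pairs :: "(bit \<times> bit) set" where "bit_pairs = {0, 1} \<times> {0, 1}"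

lemma finite_bit_pairs [simp]: "finite bit_pairs" and mem_bit_pairs [simp]: "i \<in> bit_pairs"
  using bit_cases by (auto simp: bit_pairs_def prod_eq_iff mem_Times_iff)

context tensor_pair
begin

text \<open>The first bit is the degree of the component of the second entry of \<open>p\<close>,
  the second bit that of the first entry of \<open>p'\<close>. The four terms together are the
  signed product of two pure tensors, still as a formal sum.\<close>

definition pmult :: "'a \<times> 'b \<Rightarrow> 'a \<times> 'b \<Rightarrow> ('a \<times> 'b \<Rightarrow>\<^sub>0 'k)" where
  "pmult p p' = (\<Sum>i\<in>bit_pairs. pscale (of_int (sgnf (fst i) (snd i)))
     (pair1 (fst p \<otimes>\<^bsub>A\<^esub> hcomp A (snd i) (fst p')) (hcomp B (fst i) (snd p) \<otimes>\<^bsub>B\<^esub> snd p')))"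

definition mu :: "'a \<Rightarrow> 'b \<Rightarrow> 'a \<Rightarrow> 'b \<Rightarrow> ('a \<times> 'b \<Rightarrow>\<^sub>0 'k) set" where
  "mu a b a' b' = cls (pmult (a, b) (a', b'))"

lemma tensor_times_eq:
  "tensor_times A B u v = (\<Sum>p\<in>Poly_Mapping.keys u. pscale (Poly_Mapping.lookup u p)
     (\<Sum>p'\<in>Poly_Mapping.keys v. pscale (Poly_Mapping.lookup v p') (pmult p p')))"
  unfolding tensor_times_def pmult_def bit_pairs_def pscale.scale_sum_right sum.cartesian_product split_beta
  by (simp add: sum.cartesian_product[symmetric] split_beta ac_simps)

lemma pmult_U: "a \<in> carrier A \<Longrightarrow> b \<in> carrier B \<Longrightarrow> a' \<in> carrier A \<Longrightarrow> b' \<in> carrier B \<Longrightarrow>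
    pmult (a, b) (a', b') \<in> U"
  unfolding pmult_def by (intro U_sum U_pscale) simp

lemma cls_sum:
  "finite I \<Longrightarrow> (\<And>i. i \<in> I \<Longrightarrow> w i \<in> U) \<Longrightarrow>
    cls (\<Sum>i\<in>I. pscale (c i) (w i)) = lincomb T I c (\<lambda>i. cls (w i))"
proof (induction I rule: finite_induct)
  case empty
  then show ?case by (simp add: T_zero)
next
  case (insert i I)
  then show ?case by (simp add: T.lincomb_insert T_carrier T_smult T_add flip: T_add)
qed

lemma cls_tensor_times:
  assumes "u \<in> U" "v \<in> U"
  shows "cls (tensor_times A B u v) =
    linext T (\<lambda>p. linext T (\<lambda>p'. mu (fst p) (snd p) (fst p') (snd p')) v) u"
proof -
  have U: "pmult p p' \<in> U" if "p \<in> Poly_Mapping.keys u" "p' \<in> Poly_Mapping.keys v" for p p'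
  proof -
    have "p \<in> carrier A \<times> carrier B" "p' \<in> carrier A \<times> carrier B" using that assms by (auto simp: U_def)
    then show ?thesis using pmult_U[of "fst p" "snd p" "fst p'" "snd p'"] by (simp add: mem_Times_iff)
  qed
  have "cls (tensor_times A B u v) = lincomb T (Poly_Mapping.keys u) (Poly_Mapping.lookup u)
     (\<lambda>p. cls (\<Sum>p'\<in>Poly_Mapping.keys v. pscale (Poly_Mapping.lookup v p') (pmult p p')))"
    unfolding tensor_times_eq by (rule cls_sum) (auto intro!: U_sum simp: U)
  also have "\<dots> = lincomb T (Poly_Mapping.keys u) (Poly_Mapping.lookup u)
     (\<lambda>p. lincomb T (Poly_Mapping.keys v) (Poly_Mapping.lookup v) (\<lambda>p'. cls (pmult p p')))"
  proof (rule T.lincomb_cong[OF refl])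
    fix p assume p: "p \<in> Poly_Mapping.keys u"
    have e: "cls (\<Sum>p'\<in>Poly_Mapping.keys v. pscale (Poly_Mapping.lookup v p') (pmult p p')) =
       lincomb T (Poly_Mapping.keys v) (Poly_Mapping.lookup v) (\<lambda>p'. cls (pmult p p'))"
      by (rule cls_sum) (use U p in auto)
    show "Poly_Mapping.lookup u p \<odot>\<^bsub>T\<^esub> cls (\<Sum>p'\<in>Poly_Mapping.keys v. pscale (Poly_Mapping.lookup v p') (pmult p p')) =
       Poly_Mapping.lookup u p \<odot>\<^bsub>T\<^esub> lincomb T (Poly_Mapping.keys v) (Poly_Mapping.lookup v) (\<lambda>p'. cls (pmult p p'))"
      unfolding e ..
    show "lincomb T (Poly_Mapping.keys v) (Poly_Mapping.lookup v) (\<lambda>p'. cls (pmult p p')) \<in> carrier T"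
      by (rule T.lincomb_closed) (use U p in \<open>auto simp: T_carrier\<close>)
  qed
  finally show ?thesis by (simp add: linext_def mu_def)
qed

lemma mu_eq:
  assumes "a \<in> carrier A" "b \<in> carrier B" "a' \<in> carrier A" "b' \<in> carrier B"
  shows "mu a b a' b' = lincomb T bit_pairs (\<lambda>i. of_int (sgnf (fst i) (snd i)))
    (\<lambda>i. P (a \<otimes>\<^bsub>A\<^esub> hcomp A (snd i) a') (hcomp B (fst i) b \<otimes>\<^bsub>B\<^esub> b'))"
  using cls_sum[of bit_pairs "\<lambda>i. pair1 (a \<otimes>\<^bsub>A\<^esub> hcomp A (snd i) a') (hcomp B (fst i) b \<otimes>\<^bsub>B\<^esub> b')"] assms
  by (simp add: mu_def pmult_def pure_tensor_def)

lemma mu_bilinear_left: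
  assumes "a' \<in> carrier A" "b' \<in> carrier B"
  shows "(\<lambda>a b. mu a b a' b') \<in> bilinear_maps A B T"
proof -
  let ?f = "\<lambda>i a b. P (a \<otimes>\<^bsub>A\<^esub> hcomp A (snd i) a') (hcomp B (fst i) b \<otimes>\<^bsub>B\<^esub> b')"
  have "(\<lambda>a b. lincomb T bit_pairs (\<lambda>i. of_int (sgnf (fst i) (snd i))) (\<lambda>i. ?f i a b)) \<in> bilinear_maps A B T"
    by (rule T.bilinear_maps_lincomb)
      (use assms in \<open>auto intro!: bilinear_mapsI simp: A.l_distr B.l_distr B.hcomp_add B.hcomp_smult
        A.smult_mult_left B.smult_mult_left P_simps\<close>)
  note D = bilinear_mapsD[OF this]
  show ?thesis
    by (rule bilinear_mapsI) (use assms D in \<open>simp_all add: mu_eq\<close>)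
qed

lemma mu_bilinear_right:
  assumes "a \<in> carrier A" "b \<in> carrier B"
  shows "mu a b \<in> bilinear_maps A B T"
proof -
  let ?f = "\<lambda>i a' b'. P (a \<otimes>\<^bsub>A\<^esub> hcomp A (snd i) a') (hcomp B (fst i) b \<otimes>\<^bsub>B\<^esub> b')"
  have "(\<lambda>a' b'. lincomb T bit_pairs (\<lambda>i. of_int (sgnf (fst i) (snd i))) (\<lambda>i. ?f i a' b')) \<in> bilinear_maps A B T"
    by (rule T.bilinear_maps_lincomb)
      (use assms in \<open>auto intro!: bilinear_mapsI simp: A.r_distr B.r_distr A.hcomp_add A.hcomp_smult
        A.smult_mult_right B.smult_mult_right P_simps\<close>)
  note D = bilinear_mapsD[OF this]
  show ?thesis
    by (rule bilinear_mapsI) (use assms D in \<open>simp_all add: mu_eq\<close>)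
qed

text \<open>For homogeneous inner factors one of the four terms survives, and the usual sign rule
  appears.\<close>

lemma mu_homog:
  assumes "a \<in> carrier A" "b \<in> homog B \<beta>" "a' \<in> homog A \<alpha>" "b' \<in> carrier B"
  shows "mu a b a' b' = of_int (sgnf \<beta> \<alpha>) \<odot>\<^bsub>T\<^esub> P (a \<otimes>\<^bsub>A\<^esub> a') (b \<otimes>\<^bsub>B\<^esub> b')"
proof -
  have c: "b \<in> carrier B" "a' \<in> carrier A" using assms by auto
  let ?c = "\<lambda>i. of_int (sgnf (fst i) (snd i))"
    and ?x = "\<lambda>i. P (a \<otimes>\<^bsub>A\<^esub> hcomp A (snd i) a') (hcomp B (fst i) b \<otimes>\<^bsub>B\<^esub> b')"
  have "mu a b a' b' = ?c (\<beta>, \<alpha>) \<odot>\<^bsub>T\<^esub> ?x (\<beta>, \<alpha>)"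
    using assms c unfolding mu_eq[OF assms(1) c assms(4)]
    by (intro T.lincomb_one_term[of bit_pairs "(\<beta>, \<alpha>)" ?c ?x]) (auto simp: A.hcomp_of_homog B.hcomp_of_homog split: if_splits)
  then show ?thesis using assms by (simp add: A.hcomp_of_homog B.hcomp_of_homog)
qed

text \<open>The product is built from two nested lifts, one for each factor, so that independence of
  representatives follows from the bilinearity of \<open>mu\<close> in one factor at a time.\<close>

definition lmult :: "('a \<times> 'b \<Rightarrow>\<^sub>0 'k) set \<Rightarrow> 'a \<Rightarrow> 'b \<Rightarrow> ('a \<times> 'b \<Rightarrow>\<^sub>0 'k) set" where
  "lmult Y a b = tensor_lift A B T (mu a b) Y"

lemma lmult_bilinear:
  assumes "Y \<in> carrier T" shows "lmult Y \<in> bilinear_maps A B T"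
proof -
  obtain v where v: "v \<in> U" "Y = cls v" using assms by (auto simp: T_carrier)
  have e: "lmult Y a b = linext T (\<lambda>p'. mu a b (fst p') (snd p')) v" if "a \<in> carrier A" "b \<in> carrier B" for a b
    unfolding lmult_def v(2) by (rule tensor_lift_cls[OF ground_module_T mu_bilinear_right[OF that] v(1)])
  have "(\<lambda>a b. lincomb T (Poly_Mapping.keys v) (Poly_Mapping.lookup v) (\<lambda>p'. mu a b (fst p') (snd p')))
      \<in> bilinear_maps A B T"
    by (rule T.bilinear_maps_lincomb) (use v in \<open>auto simp: U_def intro!: mu_bilinear_left\<close>)
  note D = bilinear_mapsD[OF this]
  show ?thesis by (rule bilinear_mapsI) (use D in \<open>simp_all add: e linext_def\<close>)
qed

lemma T_mult:
  assumes "X \<in> carrier T" "Y \<in> carrier T"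
  shows "X \<otimes>\<^bsub>T\<^esub> Y = tensor_lift A B T (lmult Y) X"
proof -
  obtain u where u: "u \<in> U" "X = cls u" using assms by (auto simp: T_carrier)
  obtain v where v: "v \<in> U" "Y = cls v" using assms by (auto simp: T_carrier)
  \<comment> \<open>\<open>tensor\<close> forms the union over all pairs of representatives; each
    pair is shown to contribute the same class.\<close>
  have "cls (tensor_times A B u' v') = tensor_lift A B T (lmult Y) X" if u': "u' \<in> X" and v': "v' \<in> Y" for u' v'
  proof -
    have U: "u' \<in> U" "v' \<in> U" using cls_U u v u' v' by auto
    have X: "X = cls u'" "Y = cls v'" using u v u' v' by (auto simp: cls_eq_iff cls_mem dest: N_diff[OF N_zero])
    have "tensor_lift A B T (lmult Y) X = linext T (\<lambda>p. lmult Y (fst p) (snd p)) u'"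
      unfolding X(1) by (rule tensor_lift_cls[OF ground_module_T lmult_bilinear[OF assms(2)] U(1)])
    also have "\<dots> = linext T (\<lambda>p. linext T (\<lambda>p'. mu (fst p) (snd p) (fst p') (snd p')) v') u'"
    proof (rule T.linext_cong)
      fix p assume "p \<in> Poly_Mapping.keys u'"
      then have p: "fst p \<in> carrier A" "snd p \<in> carrier B" using U by (auto simp: U_def)
      show e: "lmult Y (fst p) (snd p) = linext T (\<lambda>p'. mu (fst p) (snd p) (fst p') (snd p')) v'"
        unfolding lmult_def X(2) by (rule tensor_lift_cls[OF ground_module_T mu_bilinear_right[OF p] U(2)])
      show "linext T (\<lambda>p'. mu (fst p) (snd p) (fst p') (snd p')) v' \<in> carrier T"
        unfolding e[symmetric] by (rule bilinear_mapsD(1)[OF lmult_bilinear[OF assms(2)] p])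
    qed
    finally show ?thesis using cls_tensor_times[OF U] by simp
  qed
  then have "(\<Union>u'\<in>X. \<Union>v'\<in>Y. cls (tensor_times A B u' v')) = (\<Union>u'\<in>X. \<Union>v'\<in>Y. tensor_lift A B T (lmult Y) X)"
    by (intro SUP_cong refl)
  also have "\<dots> = tensor_lift A B T (lmult Y) X"
    using cls_self[of u] cls_self[of v] u(2) v(2) by auto
  finally show ?thesis by (simp add: tensor_def)
qed

lemma T_mult_closed [simp]: "X \<in> carrier T \<Longrightarrow> Y \<in> carrier T \<Longrightarrow> X \<otimes>\<^bsub>T\<^esub> Y \<in> carrier T"
  using tensor_lift_linear[OF ground_module_T lmult_bilinear, of Y] by (simp add: T_mult linear_maps_def)

lemma T_mult_left_linear:
  assumes Y: "Y \<in> carrier T"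
  shows "X \<in> carrier T \<Longrightarrow> X' \<in> carrier T \<Longrightarrow> (X \<oplus>\<^bsub>T\<^esub> X') \<otimes>\<^bsub>T\<^esub> Y = X \<otimes>\<^bsub>T\<^esub> Y \<oplus>\<^bsub>T\<^esub> X' \<otimes>\<^bsub>T\<^esub> Y"
    and "X \<in> carrier T \<Longrightarrow> (c \<odot>\<^bsub>T\<^esub> X) \<otimes>\<^bsub>T\<^esub> Y = c \<odot>\<^bsub>T\<^esub> (X \<otimes>\<^bsub>T\<^esub> Y)"
  using tensor_lift_linear[OF ground_module_T lmult_bilinear[OF Y]] Y by (simp_all add: T_mult linear_maps_def)

lemma P_mult_eq:
  assumes "a \<in> carrier A" "b \<in> carrier B" "Y \<in> carrier T"
  shows "P a b \<otimes>\<^bsub>T\<^esub> Y = tensor_lift A B T (mu a b) Y"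
  using assms tensor_lift_pure[OF ground_module_T lmult_bilinear, of Y a b] by (simp add: T_mult lmult_def)

lemma P_mult_P:
  assumes "a \<in> carrier A" "b \<in> homog B \<beta>" "a' \<in> homog A \<alpha>" "b' \<in> carrier B"
  shows "P a b \<otimes>\<^bsub>T\<^esub> P a' b' = of_int (sgnf \<beta> \<alpha>) \<odot>\<^bsub>T\<^esub> P (a \<otimes>\<^bsub>A\<^esub> a') (b \<otimes>\<^bsub>B\<^esub> b')"
proof -
  have c: "b \<in> carrier B" "a' \<in> carrier A" using assms by auto
  show ?thesis using assms c tensor_lift_pure[OF ground_module_T mu_bilinear_right[OF assms(1) c(1)] c(2) assms(4)]
    by (simp add: P_mult_eq mu_homog)
qed

lemma T_mult_right_linear:
  assumes "X \<in> carrier T" "Y \<in> carrier T"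
  shows "Y' \<in> carrier T \<Longrightarrow> X \<otimes>\<^bsub>T\<^esub> (Y \<oplus>\<^bsub>T\<^esub> Y') = X \<otimes>\<^bsub>T\<^esub> Y \<oplus>\<^bsub>T\<^esub> X \<otimes>\<^bsub>T\<^esub> Y'"
    and "X \<otimes>\<^bsub>T\<^esub> (c \<odot>\<^bsub>T\<^esub> Y) = c \<odot>\<^bsub>T\<^esub> (X \<otimes>\<^bsub>T\<^esub> Y)"
proof -
  have z: "\<zero>\<^bsub>T\<^esub> \<otimes>\<^bsub>T\<^esub> Z = \<zero>\<^bsub>T\<^esub>" if "Z \<in> carrier T" for Z
    using T_mult_left_linear(2)[OF that, of "\<zero>\<^bsub>T\<^esub>" 0] that by simp
  show "X \<otimes>\<^bsub>T\<^esub> (Y \<oplus>\<^bsub>T\<^esub> Y') = X \<otimes>\<^bsub>T\<^esub> Y \<oplus>\<^bsub>T\<^esub> X \<otimes>\<^bsub>T\<^esub> Y'" if Y': "Y' \<in> carrier T"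
    using assms(1)
  proof (induction X rule: T_induct)
    case zero
    then show ?case using z assms Y' by simp
  next
    case (pure a b)
    then have "a \<in> carrier A" "b \<in> carrier B" by auto
    then show ?case using tensor_lift_linear[OF ground_module_T mu_bilinear_right, of a b] assms Y'
      by (simp add: P_mult_eq linear_maps_def)
  next
    case (add X X')
    then show ?case using assms Y' by (simp add: T_mult_left_linear T.M.a_ac)
  qed
  show "X \<otimes>\<^bsub>T\<^esub> (c \<odot>\<^bsub>T\<^esub> Y) = c \<odot>\<^bsub>T\<^esub> (X \<otimes>\<^bsub>T\<^esub> Y)"
    using assms(1)
  proof (induction X rule: T_induct)
    case zero
    then show ?case using z assms by simp
  next
    case (pure a b)
    then have "a \<in> carrier A" "b \<in> carrier B" by auto
    then show ?case using tensor_lift_linear[OF ground_module_T mu_bilinear_right, of a b] assms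
      by (simp add: P_mult_eq linear_maps_def)
  next
    case (add X X')
    then show ?case using assms by (simp add: T_mult_left_linear T.smult_add_right)
  qed
qed

lemma T_mult_zero [simp]:
  "X \<in> carrier T \<Longrightarrow> \<zero>\<^bsub>T\<^esub> \<otimes>\<^bsub>T\<^esub> X = \<zero>\<^bsub>T\<^esub>" "X \<in> carrier T \<Longrightarrow> X \<otimes>\<^bsub>T\<^esub> \<zero>\<^bsub>T\<^esub> = \<zero>\<^bsub>T\<^esub>"
  using T_mult_left_linear(2)[of X "\<zero>\<^bsub>T\<^esub>" 0] T_mult_right_linear(2)[of X "\<zero>\<^bsub>T\<^esub>" 0] by simp_all

lemmas T_mult_linear = T_mult_left_linear T_mult_right_linear

text \<open>On homogeneous pure tensors both bracketings produce the same three signs, one for each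
  passage of a right entry past a later left entry.\<close>

lemma T_assoc:
  assumes X: "X \<in> carrier T" and Y: "Y \<in> carrier T" and Z: "Z \<in> carrier T"
  shows "X \<otimes>\<^bsub>T\<^esub> Y \<otimes>\<^bsub>T\<^esub> Z = X \<otimes>\<^bsub>T\<^esub> (Y \<otimes>\<^bsub>T\<^esub> Z)"
  using X
proof (induction X rule: T_induct)
  case (pure a b \<alpha> \<beta>)
  from Y show ?case
  proof (induction Y rule: T_induct)
    case (pure a' b' \<alpha>' \<beta>')
    from Z show ?case
    proof (induction Z rule: T_induct)
      case (pure a'' b'' \<alpha>'' \<beta>'')
      note h = \<open>a \<in> homog A \<alpha>\<close> \<open>b \<in> homog B \<beta>\<close> \<open>a' \<in> homog A \<alpha>'\<close> \<open>b' \<in> homog B \<beta>'\<close> pure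
      have "P (a \<otimes>\<^bsub>A\<^esub> a') (b \<otimes>\<^bsub>B\<^esub> b') \<otimes>\<^bsub>T\<^esub> P a'' b'' =
          of_int (sgnf (\<beta> + \<beta>') \<alpha>'') \<odot>\<^bsub>T\<^esub> P (a \<otimes>\<^bsub>A\<^esub> a' \<otimes>\<^bsub>A\<^esub> a'') (b \<otimes>\<^bsub>B\<^esub> b' \<otimes>\<^bsub>B\<^esub> b'')"
        by (rule P_mult_P) (use h B.homog_mult in auto)
      moreover have "P a b \<otimes>\<^bsub>T\<^esub> P (a' \<otimes>\<^bsub>A\<^esub> a'') (b' \<otimes>\<^bsub>B\<^esub> b'') =
          of_int (sgnf \<beta> (\<alpha>' + \<alpha>'')) \<odot>\<^bsub>T\<^esub> P (a \<otimes>\<^bsub>A\<^esub> (a' \<otimes>\<^bsub>A\<^esub> a'')) (b \<otimes>\<^bsub>B\<^esub> (b' \<otimes>\<^bsub>B\<^esub> b''))"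
        by (rule P_mult_P) (use h A.homog_mult in auto)
      moreover have "P a b \<otimes>\<^bsub>T\<^esub> P a' b' = of_int (sgnf \<beta> \<alpha>') \<odot>\<^bsub>T\<^esub> P (a \<otimes>\<^bsub>A\<^esub> a') (b \<otimes>\<^bsub>B\<^esub> b')"
        by (rule P_mult_P) (use h in auto)
      moreover have "P a' b' \<otimes>\<^bsub>T\<^esub> P a'' b'' = of_int (sgnf \<beta>' \<alpha>'') \<odot>\<^bsub>T\<^esub> P (a' \<otimes>\<^bsub>A\<^esub> a'') (b' \<otimes>\<^bsub>B\<^esub> b'')"
        by (rule P_mult_P) (use h in auto)
      ultimately show ?case using h
        by (simp add: T_mult_linear A.homog_carrier[OF h(1)] A.homog_carrier[OF h(3)] A.homog_carrier[OF h(5)]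
            B.homog_carrier[OF h(2)] B.homog_carrier[OF h(4)] B.homog_carrier[OF h(6)]
            A.m_assoc B.m_assoc sgnf_add_left sgnf_add_right ac_simps)
    qed (use pure \<open>a \<in> homog A \<alpha>\<close> \<open>b \<in> homog B \<beta>\<close> in
        \<open>simp_all add: T_mult_linear A.homog_carrier[of a] A.homog_carrier[of a'] B.homog_carrier[of b] B.homog_carrier[of b']\<close>)
  qed (use Z pure in \<open>simp_all add: T_mult_linear A.homog_carrier[of a] B.homog_carrier[of b]\<close>)
qed (use Y Z in \<open>simp_all add: T_mult_linear\<close>)

lemma T_one_mult: "X \<in> carrier T \<Longrightarrow> \<one>\<^bsub>T\<^esub> \<otimes>\<^bsub>T\<^esub> X = X \<and> X \<otimes>\<^bsub>T\<^esub> \<one>\<^bsub>T\<^esub> = X"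
proof (induction X rule: T_induct)
  case zero
  then show ?case by (simp add: T_one)
next
  case (pure a b \<alpha> \<beta>)
  then show ?case
    using P_mult_P[OF A.one_closed B.homog_one pure(1), of b] P_mult_P[OF _ pure(2) A.homog_one, of a "\<one>\<^bsub>B\<^esub>"]
      A.homog_carrier[OF pure(1)] B.homog_carrier[OF pure(2)]
    by (simp add: T_one)
next
  case (add X Y)
  then show ?case by (simp add: T_mult_linear T_one)
qed

section \<open>The grading of the tensor product\<close>

lemma T_homog: "homog T \<gamma> = cls ` {u. Poly_Mapping.keys u \<subseteq> (\<Union>\<alpha>. homog A \<alpha> \<times> homog B (\<gamma> + \<alpha>))}"
  by (simp add: tensor_def)

lemma P_homog: "a \<in> homog A \<alpha> \<Longrightarrow> b \<in> homog B \<beta> \<Longrightarrow> P a b \<in> homog T (\<alpha> + \<beta>)"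
  unfolding T_homog pure_tensor_def
  by (rule imageI) (auto intro!: exI[of _ \<alpha>] simp: add.commute[of \<alpha>] add.assoc)

lemma T_homog_add: "X \<in> homog T \<gamma> \<Longrightarrow> Y \<in> homog T \<gamma> \<Longrightarrow> X \<oplus>\<^bsub>T\<^esub> Y \<in> homog T \<gamma>"
proof -
  assume "X \<in> homog T \<gamma>" "Y \<in> homog T \<gamma>"
  then obtain u v where uv: "Poly_Mapping.keys u \<subseteq> (\<Union>\<alpha>. homog A \<alpha> \<times> homog B (\<gamma> + \<alpha>))" "X = cls u"
    "Poly_Mapping.keys v \<subseteq> (\<Union>\<alpha>. homog A \<alpha> \<times> homog B (\<gamma> + \<alpha>))" "Y = cls v"
    by (auto simp: T_homog)
  then have "Poly_Mapping.keys (u + v) \<subseteq> (\<Union>\<alpha>. homog A \<alpha> \<times> homog B (\<gamma> + \<alpha>))"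
    using keys_add[of u v] by blast
  then show ?thesis using uv by (auto simp: T_homog T_add)
qed

lemma T_homog_smult: "X \<in> homog T \<gamma> \<Longrightarrow> c \<odot>\<^bsub>T\<^esub> X \<in> homog T \<gamma>"
proof -
  assume "X \<in> homog T \<gamma>"
  then obtain u where u: "Poly_Mapping.keys u \<subseteq> (\<Union>\<alpha>. homog A \<alpha> \<times> homog B (\<gamma> + \<alpha>))" "X = cls u"
    by (auto simp: T_homog)
  then have "Poly_Mapping.keys (pscale c u) \<subseteq> (\<Union>\<alpha>. homog A \<alpha> \<times> homog B (\<gamma> + \<alpha>))"
    using keys_pscale[of c u] by blast
  then show ?thesis using u by (auto simp: T_homog T_smult)
qed

lemma T_homog_zero: "\<zero>\<^bsub>T\<^esub> \<in> homog T \<gamma>"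
  unfolding T_homog T_zero by (rule imageI) simp

lemma T_homog_carrier: "X \<in> homog T \<gamma> \<Longrightarrow> X \<in> carrier T"
  unfolding T_homog T_carrier U_def by auto

lemma T_homog_induct [consumes 1, case_names zero pure add]:
  assumes "X \<in> homog T \<gamma>" "Q \<zero>\<^bsub>T\<^esub>"
    and "\<And>x y \<alpha> \<beta>. x \<in> homog A \<alpha> \<Longrightarrow> y \<in> homog B \<beta> \<Longrightarrow> \<alpha> + \<beta> = \<gamma> \<Longrightarrow> Q (P x y)"
    and "\<And>Y Z. Y \<in> homog T \<gamma> \<Longrightarrow> Z \<in> homog T \<gamma> \<Longrightarrow> Q Y \<Longrightarrow> Q Z \<Longrightarrow> Q (Y \<oplus>\<^bsub>T\<^esub> Z)"
  shows "Q X"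
proof -
  obtain u where u: "Poly_Mapping.keys u \<subseteq> (\<Union>\<alpha>. homog A \<alpha> \<times> homog B (\<gamma> + \<alpha>))" "X = cls u"
    using assms(1) by (auto simp: T_homog)
  have "Q (cls u)"
    using u(1)
  proof (induction u rule: poly_mapping_keys_induct)
    case zero
    then show ?case using assms(2) by (simp add: T_zero)
  next
    case (single p c)
    then obtain x y \<alpha> where p: "p = (x, y)" "x \<in> homog A \<alpha>" "y \<in> homog B (\<gamma> + \<alpha>)" by auto
    have "cls (Poly_Mapping.single p c) = P (c \<odot>\<^bsub>A\<^esub> x) y"
      using p A.homog_carrier[OF p(2)] B.homog_carrier[OF p(3)] by (simp add: cls_single P_simps)
    moreover have "\<alpha> + (\<gamma> + \<alpha>) = \<gamma>" by (cases \<alpha>; cases \<gamma>) simp_all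
    ultimately show ?case using assms(3)[of "c \<odot>\<^bsub>A\<^esub> x" \<alpha> y "\<gamma> + \<alpha>"] p by auto
  next
    case (add u v)
    then show ?case using assms(4)[of "cls u" "cls v"] by (auto simp: T_add T_homog)
  qed
  then show ?thesis using u by simp
qed

lemma ring_T: "ring T"
  by (rule ringI, rule T.M.abelian_group_axioms, rule monoidI)
    (simp_all add: T_one_mult T_assoc T_mult_linear, simp add: T_one)

text \<open>Homogeneous elements are classes of homogeneous representatives, so it is not apparent
  from representatives that the two parts meet only in zero. The lift of this bilinear map is the
  projection onto degree \<gamma>: it fixes one part and kills the other.\<close>

definition grproj :: "bit \<Rightarrow> 'a \<Rightarrow> 'b \<Rightarrow> ('a \<times> 'b \<Rightarrow>\<^sub>0 'k) set" where
  "grproj \<gamma> x y = lincomb T {0, 1} (\<lambda>_. 1) (\<lambda>\<alpha>. P (hcomp A \<alpha> x) (hcomp B (\<gamma> + \<alpha>) y))"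

lemma grproj_bilinear: "grproj \<gamma> \<in> bilinear_maps A B T"
  unfolding grproj_def
  by (rule T.bilinear_maps_lincomb)
    (auto intro!: bilinear_mapsI simp: P_simps A.hcomp_add B.hcomp_add A.hcomp_smult B.hcomp_smult)

lemma grproj_homog:
  assumes "x \<in> homog A \<alpha>" "y \<in> homog B \<beta>"
  shows "grproj \<gamma> x y = (if \<alpha> + \<beta> = \<gamma> then P x y else \<zero>\<^bsub>T\<^esub>)"
proof -
  have "grproj \<gamma> x y = 1 \<odot>\<^bsub>T\<^esub> P (hcomp A \<alpha> x) (hcomp B (\<gamma> + \<alpha>) y)"
    unfolding grproj_def using A.homog_carrier[OF assms(1)] B.homog_carrier[OF assms(2)] assms bit_cases[of \<alpha>]
    by (intro T.lincomb_one_term) (auto simp: A.hcomp_of_homog)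
  then show ?thesis using A.homog_carrier[OF assms(1)] B.homog_carrier[OF assms(2)] assms
    by (cases \<alpha>; cases \<beta>; cases \<gamma>) (auto simp: A.hcomp_of_homog B.hcomp_of_homog)
qed

lemma tensor_lift_grproj:
  assumes "X \<in> homog T \<delta>"
  shows "tensor_lift A B T (grproj \<gamma>) X = (if \<gamma> = \<delta> then X else \<zero>\<^bsub>T\<^esub>)"
  using assms
proof (induction X rule: T_homog_induct)
  case zero
  then show ?case
    using linear_maps_zero[OF ground_module_T ground_module_T tensor_lift_linear[OF ground_module_T grproj_bilinear]]
    by simp
next
  case (pure x y \<alpha> \<beta>)
  then show ?case
    using tensor_lift_pure[OF ground_module_T grproj_bilinear] A.homog_carrier[OF pure(1)] B.homog_carrier[OF pure(2)]
    by (simp add: grproj_homog)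
next
  case (add X Y)
  then show ?case
    using tensor_lift_linear[OF ground_module_T grproj_bilinear] T_homog_carrier by (auto simp: linear_maps_def)
qed

lemma superalgebra_T: "superalgebra T"
proof -
  interpret R: ring T by (rule ring_T)
  show ?thesis
  proof (intro superalgebra.intro superalgebra_axioms.intro)
    fix \<gamma>
    show "submodule (homog T \<gamma>) ground T"
      by (rule T.submoduleI)
        (auto simp: T_homog_carrier T_homog_zero T_homog_add T_homog_smult T.minus_eq_smult)
  next
    fix X assume "X \<in> carrier T"
    then show "\<exists>y\<in>homog T 0. \<exists>z\<in>homog T 1. X = y \<oplus>\<^bsub>T\<^esub> z"
    proof (induction X rule: T_induct)
      case zero
      then show ?case by (intro bexI[of _ "\<zero>\<^bsub>T\<^esub>"] T_homog_zero) simp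
    next
      case (pure x y \<alpha> \<beta>)
      have c: "P x y \<in> carrier T" using pure by auto
      show ?case
      proof (cases "\<alpha> + \<beta> = 0")
        case True
        then show ?thesis using P_homog[OF pure] c
          by (intro bexI[of _ "P x y"] bexI[of _ "\<zero>\<^bsub>T\<^esub>"]) (auto simp: T_homog_zero)
      next
        case False
        then have "\<alpha> + \<beta> = 1" using bit_cases by blast
        then have "P x y \<in> homog T 1" "P x y = \<zero>\<^bsub>T\<^esub> \<oplus>\<^bsub>T\<^esub> P x y" using P_homog[OF pure] c by auto
        then show ?thesis using T_homog_zero by blast
      qed
    next
      case (add X Y)
      then obtain y z y' z' where h: "y \<in> homog T 0" "z \<in> homog T 1" "X = y \<oplus>\<^bsub>T\<^esub> z"
        "y' \<in> homog T 0" "z' \<in> homog T 1" "Y = y' \<oplus>\<^bsub>T\<^esub> z'" by blast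
      have "X \<oplus>\<^bsub>T\<^esub> Y = (y \<oplus>\<^bsub>T\<^esub> y') \<oplus>\<^bsub>T\<^esub> (z \<oplus>\<^bsub>T\<^esub> z')"
        using h(3,6) h(1,2,4,5)[THEN T_homog_carrier] by (simp add: T.M.a_ac)
      then show ?case using T_homog_add h by blast
    qed
  next
    have "X = \<zero>\<^bsub>T\<^esub>" if "X \<in> homog T 0" "X \<in> homog T 1" for X
      using tensor_lift_grproj[OF that(1), of 0] tensor_lift_grproj[OF that(2), of 0] by simp
    then show "homog T 0 \<inter> homog T 1 = {\<zero>\<^bsub>T\<^esub>}" using T_homog_zero by blast
  next
    fix X Y \<alpha> \<beta> assume X: "X \<in> homog T \<alpha>" and Y: "Y \<in> homog T \<beta>"
    from X show "X \<otimes>\<^bsub>T\<^esub> Y \<in> homog T (\<alpha> + \<beta>)"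
    proof (induction X rule: T_homog_induct)
      case (pure x y \<alpha>1 \<alpha>2)
      from Y show ?case
      proof (induction Y rule: T_homog_induct)
        case (pure x' y' \<beta>1 \<beta>2)
        note h = \<open>x \<in> homog A \<alpha>1\<close> \<open>y \<in> homog B \<alpha>2\<close> \<open>\<alpha>1 + \<alpha>2 = \<alpha>\<close> pure
        have "P x y \<otimes>\<^bsub>T\<^esub> P x' y' = of_int (sgnf \<alpha>2 \<beta>1) \<odot>\<^bsub>T\<^esub> P (x \<otimes>\<^bsub>A\<^esub> x') (y \<otimes>\<^bsub>B\<^esub> y')"
          by (rule P_mult_P) (use h in auto)
        moreover have "P (x \<otimes>\<^bsub>A\<^esub> x') (y \<otimes>\<^bsub>B\<^esub> y') \<in> homog T ((\<alpha>1 + \<beta>1) + (\<alpha>2 + \<beta>2))"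
          by (rule P_homog) (use h A.homog_mult B.homog_mult in auto)
        moreover have "(\<alpha>1 + \<beta>1) + (\<alpha>2 + \<beta>2) = \<alpha> + \<beta>" using h by (simp add: ac_simps)
        ultimately show ?case by (simp add: T_homog_smult)
      qed (use pure in \<open>auto simp: T_mult_linear T_homog_carrier T_homog_zero T_homog_add\<close>)
    qed (use Y in \<open>auto simp: T_mult_linear T_homog_carrier T_homog_zero T_homog_add\<close>)
  next
    show "\<one>\<^bsub>T\<^esub> \<in> homog T 0" using P_homog[OF A.homog_one B.homog_one] by (simp add: T_one)
  qed (simp_all add: T_mult_linear T.module_axioms R.ring_axioms)
qed

sublocale TS: superalgebra T
  by (rule superalgebra_T)

section \<open>Universal property, functoriality and associativity of the graded tensor
  product\<close>

lemma tensor_lift_cong: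
  assumes M: "ground_module M" and f: "f \<in> bilinear_maps A B M"
    and e: "\<And>x y. x \<in> carrier A \<Longrightarrow> y \<in> carrier B \<Longrightarrow> g x y = f x y" and X: "X \<in> carrier T"
  shows "tensor_lift A B M g X = tensor_lift A B M f X"
proof -
  interpret M: ground_module M by (rule M)
  have g: "g \<in> bilinear_maps A B M"
    by (rule bilinear_mapsI) (simp_all add: e bilinear_mapsD[OF f])
  obtain u where u: "u \<in> U" "X = cls u" using X by (auto simp: T_carrier)
  have c: "fst p \<in> carrier A" "snd p \<in> carrier B" if "p \<in> Poly_Mapping.keys u" for p
    using u that by (auto simp: U_def)
  show ?thesis
    unfolding u(2) tensor_lift_cls[OF M f u(1)] tensor_lift_cls[OF M g u(1)]
    by (rule M.linext_cong) (simp_all add: e c bilinear_mapsD[OF f])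
qed

lemma hom_product_bilinear:
  assumes M: "superalgebra M" and f: "f \<in> superalgebra_hom A M" and g: "g \<in> superalgebra_hom B M"
  shows "(\<lambda>x y. f x \<otimes>\<^bsub>M\<^esub> g y) \<in> bilinear_maps A B M"
proof -
  interpret M: superalgebra M by (rule M)
  show ?thesis
    by (rule bilinear_mapsI)
      (simp_all add: hom_closed[OF f] hom_closed[OF g] hom_add[OF f] hom_add[OF g] hom_smult[OF f] hom_smult[OF g]
        M.l_distr M.r_distr M.smult_mult_left M.smult_mult_right)
qed

text \<open>In a product of two images the one rearrangement is to move the \<open>f\<close>-image
  of the second factor past the \<open>g\<close>-image of the first, and \<open>comm\<close>
  supplies its sign. Tensor products of maps, the associator and evaluation at a counit are all
  shown to be homomorphisms through this universal property.\<close>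

lemma tensor_lift_hom:
  assumes M: "superalgebra M" and f: "f \<in> superalgebra_hom A M" and g: "g \<in> superalgebra_hom B M"
    and comm: "\<And>\<alpha> \<beta> a b. a \<in> homog A \<alpha> \<Longrightarrow> b \<in> homog B \<beta> \<Longrightarrow>
      g b \<otimes>\<^bsub>M\<^esub> f a = of_int (sgnf \<beta> \<alpha>) \<odot>\<^bsub>M\<^esub> (f a \<otimes>\<^bsub>M\<^esub> g b)"
  shows "tensor_lift A B M (\<lambda>x y. f x \<otimes>\<^bsub>M\<^esub> g y) \<in> superalgebra_hom T M"
proof -
  interpret M: superalgebra M by (rule M)
  let ?L = "tensor_lift A B M (\<lambda>x y. f x \<otimes>\<^bsub>M\<^esub> g y)"
  note bil = hom_product_bilinear[OF M f g]
  have L1: "?L X \<in> carrier M" "?L (c \<odot>\<^bsub>T\<^esub> X) = c \<odot>\<^bsub>M\<^esub> ?L X" if "X \<in> carrier T" for X c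
    using tensor_lift_linear[OF M.ground_module_axioms bil] that by (auto simp: linear_maps_def)
  have L2: "?L (X \<oplus>\<^bsub>T\<^esub> Y) = ?L X \<oplus>\<^bsub>M\<^esub> ?L Y" if "X \<in> carrier T" "Y \<in> carrier T" for X Y
    using tensor_lift_linear[OF M.ground_module_axioms bil] that by (auto simp: linear_maps_def)
  note L = L1 L2
  have L0: "?L \<zero>\<^bsub>T\<^esub> = \<zero>\<^bsub>M\<^esub>"
    by (rule linear_maps_zero[OF ground_module_T M.ground_module_axioms tensor_lift_linear[OF M.ground_module_axioms bil]])
  have LP: "?L (P x y) = f x \<otimes>\<^bsub>M\<^esub> g y" if "x \<in> carrier A" "y \<in> carrier B" for x y
    by (rule tensor_lift_pure[OF M.ground_module_axioms bil that])
  show ?thesis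
  proof (rule superalgebra_homI)
    fix X Y assume X: "X \<in> carrier T" and Y: "Y \<in> carrier T"
    from X show "?L (X \<otimes>\<^bsub>T\<^esub> Y) = ?L X \<otimes>\<^bsub>M\<^esub> ?L Y"
    proof (induction X rule: T_induct)
      case (pure a b \<alpha> \<beta>)
      from Y show ?case
      proof (induction Y rule: T_induct)
        case (pure a' b' \<alpha>' \<beta>')
        note h = \<open>a \<in> homog A \<alpha>\<close> \<open>b \<in> homog B \<beta>\<close> pure
        note hc = A.homog_carrier[OF h(1)] B.homog_carrier[OF h(2)] A.homog_carrier[OF h(3)] B.homog_carrier[OF h(4)]
        note fc = hom_closed[OF f hc(1)] hom_closed[OF g hc(2)] hom_closed[OF f hc(3)] hom_closed[OF g hc(4)]
        have "?L (P a b \<otimes>\<^bsub>T\<^esub> P a' b') = of_int (sgnf \<beta> \<alpha>') \<odot>\<^bsub>M\<^esub> (f (a \<otimes>\<^bsub>A\<^esub> a') \<otimes>\<^bsub>M\<^esub> g (b \<otimes>\<^bsub>B\<^esub> b'))"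
          unfolding P_mult_P[OF hc(1) h(2,3) hc(4)] using hc by (simp add: L LP)
        also have "\<dots> = f a \<otimes>\<^bsub>M\<^esub> (of_int (sgnf \<beta> \<alpha>') \<odot>\<^bsub>M\<^esub> (f a' \<otimes>\<^bsub>M\<^esub> g b)) \<otimes>\<^bsub>M\<^esub> g b'"
          using hc fc by (simp add: hom_mult[OF f] hom_mult[OF g] M.m_assoc M.smult_mult_left M.smult_mult_right)
        also have "\<dots> = (f a \<otimes>\<^bsub>M\<^esub> g b) \<otimes>\<^bsub>M\<^esub> (f a' \<otimes>\<^bsub>M\<^esub> g b')"
          unfolding comm[OF h(3) h(2), symmetric] using fc by (simp add: M.m_assoc)
        finally show ?case using hc by (simp add: LP)
      qed (use pure L L0 in \<open>simp_all add: T_mult_linear M.r_distr A.homog_carrier[of a] B.homog_carrier[of b]\<close>)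
    qed (use Y L L0 in \<open>simp_all add: T_mult_linear M.l_distr\<close>)
  next
    show "?L \<one>\<^bsub>T\<^esub> = \<one>\<^bsub>M\<^esub>" by (simp add: T_one LP hom_one[OF f] hom_one[OF g])
  next
    fix \<gamma> X assume "X \<in> homog T \<gamma>"
    then show "?L X \<in> homog M \<gamma>"
    proof (induction X rule: T_homog_induct)
      case (pure a b \<alpha> \<beta>)
      then show ?case
        using M.homog_mult[OF hom_homog[OF f pure(1)] hom_homog[OF g pure(2)]]
          A.homog_carrier[OF pure(1)] B.homog_carrier[OF pure(2)] by (simp add: LP)
    qed (use L L0 T_homog_carrier in auto)
  qed (use L in auto)
qed

lemma inl_hom: "(\<lambda>x. P x \<one>\<^bsub>B\<^esub>) \<in> superalgebra_hom A T"
proof (rule superalgebra_homI)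
  fix x y assume "x \<in> carrier A" "y \<in> carrier A"
  \<comment> \<open>\<open>P_mult_P\<close> requires the left entry of the second factor to be
    homogeneous.\<close>
  then obtain y0 y1 where y: "y0 \<in> homog A 0" "y1 \<in> homog A 1" "y = y0 \<oplus>\<^bsub>A\<^esub> y1" and x: "x \<in> carrier A"
    using A.homog_decomp by blast
  have "P x \<one>\<^bsub>B\<^esub> \<otimes>\<^bsub>T\<^esub> P z \<one>\<^bsub>B\<^esub> = P (x \<otimes>\<^bsub>A\<^esub> z) \<one>\<^bsub>B\<^esub>" if "z \<in> homog A \<zeta>" for z \<zeta>
    using P_mult_P[OF x B.homog_one that B.one_closed] that x by auto
  from this[OF y(1)] this[OF y(2)] show "P (x \<otimes>\<^bsub>A\<^esub> y) \<one>\<^bsub>B\<^esub> = P x \<one>\<^bsub>B\<^esub> \<otimes>\<^bsub>T\<^esub> P y \<one>\<^bsub>B\<^esub>"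
    using x y A.homog_carrier[OF y(1)] A.homog_carrier[OF y(2)] by (simp add: P_simps T_mult_linear A.r_distr)
qed (use P_homog[OF _ B.homog_one] in \<open>auto simp: P_simps T_one\<close>)

lemma inr_hom: "P \<one>\<^bsub>A\<^esub> \<in> superalgebra_hom B T"
proof (rule superalgebra_homI)
  fix x y assume "x \<in> carrier B" and y: "y \<in> carrier B"
  then obtain x0 x1 where x: "x0 \<in> homog B 0" "x1 \<in> homog B 1" "x = x0 \<oplus>\<^bsub>B\<^esub> x1"
    using B.homog_decomp by blast
  have "P \<one>\<^bsub>A\<^esub> z \<otimes>\<^bsub>T\<^esub> P \<one>\<^bsub>A\<^esub> y = P \<one>\<^bsub>A\<^esub> (z \<otimes>\<^bsub>B\<^esub> y)" if "z \<in> homog B \<zeta>" for z \<zeta>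
    using P_mult_P[OF A.one_closed that A.homog_one y] that y by auto
  from this[OF x(1)] this[OF x(2)] show "P \<one>\<^bsub>A\<^esub> (x \<otimes>\<^bsub>B\<^esub> y) = P \<one>\<^bsub>A\<^esub> x \<otimes>\<^bsub>T\<^esub> P \<one>\<^bsub>A\<^esub> y"
    using x y B.homog_carrier[OF x(1)] B.homog_carrier[OF x(2)] by (simp add: P_simps T_mult_linear B.l_distr)
qed (use P_homog[OF A.homog_one] in \<open>auto simp: P_simps T_one\<close>)

lemma inl_inr: "x \<in> carrier A \<Longrightarrow> y \<in> carrier B \<Longrightarrow> P x \<one>\<^bsub>B\<^esub> \<otimes>\<^bsub>T\<^esub> P \<one>\<^bsub>A\<^esub> y = P x y"
  using P_mult_P[OF _ B.homog_one A.homog_one, of x y] by simp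

lemma inr_inl: "x \<in> homog A \<alpha> \<Longrightarrow> y \<in> homog B \<beta> \<Longrightarrow>
    P \<one>\<^bsub>A\<^esub> y \<otimes>\<^bsub>T\<^esub> P x \<one>\<^bsub>B\<^esub> = of_int (sgnf \<beta> \<alpha>) \<odot>\<^bsub>T\<^esub> P x y"
  using P_mult_P[OF A.one_closed, of y \<beta> x \<alpha> "\<one>\<^bsub>B\<^esub>"] A.homog_carrier[of x] B.homog_carrier[of y] by simp

end

text \<open>The map is rewritten as the product of \<open>f\<close> followed by the left embedding
  and \<open>g\<close> followed by the right one, so that the universal property applies.\<close>

lemma tensor_map_hom:
  assumes A: "superalgebra A" and B: "superalgebra B" and C: "superalgebra C" and D: "superalgebra D"
    and f: "f \<in> superalgebra_hom A C" and g: "g \<in> superalgebra_hom B D"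
  shows "tensor_map A B C D f g \<in> superalgebra_hom (A \<otimes>\<^sub>s B) (C \<otimes>\<^sub>s D)"
    and "x \<in> carrier A \<Longrightarrow> y \<in> carrier B \<Longrightarrow>
      tensor_map A B C D f g (pure_tensor A B x y) = pure_tensor C D (f x) (g y)"
proof -
  interpret AB: tensor_pair A B by (rule tensor_pair.intro[OF A B])
  interpret CD: tensor_pair C D by (rule tensor_pair.intro[OF C D])
  note F = hom_compose[OF f CD.inl_hom] and G = hom_compose[OF g CD.inr_hom]
  let ?h = "\<lambda>x y. ((\<lambda>x. pure_tensor C D x \<one>\<^bsub>D\<^esub>) \<circ> f) x \<otimes>\<^bsub>C \<otimes>\<^sub>s D\<^esub> (pure_tensor C D \<one>\<^bsub>C\<^esub> \<circ> g) y"
  note bil = AB.hom_product_bilinear[OF CD.superalgebra_T F G]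
  have e: "pure_tensor C D (f x) (g y) = ?h x y" if "x \<in> carrier A" "y \<in> carrier B" for x y
    using that by (simp add: CD.inl_inr hom_closed[OF f] hom_closed[OF g])
  have hom: "tensor_lift A B (C \<otimes>\<^sub>s D) ?h \<in> superalgebra_hom (A \<otimes>\<^sub>s B) (C \<otimes>\<^sub>s D)"
  proof (rule AB.tensor_lift_hom[OF CD.superalgebra_T F G])
    fix \<alpha> \<beta> a b assume ab: "a \<in> homog A \<alpha>" "b \<in> homog B \<beta>"
    then show "(pure_tensor C D \<one>\<^bsub>C\<^esub> \<circ> g) b \<otimes>\<^bsub>C \<otimes>\<^sub>s D\<^esub> ((\<lambda>x. pure_tensor C D x \<one>\<^bsub>D\<^esub>) \<circ> f) a =
       of_int (sgnf \<beta> \<alpha>) \<odot>\<^bsub>C \<otimes>\<^sub>s D\<^esub> ?h a b"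
      using CD.inr_inl[OF hom_homog[OF f ab(1)] hom_homog[OF g ab(2)]]
      by (simp add: CD.inl_inr hom_closed[OF f] hom_closed[OF g] AB.A.homog_carrier[of a] AB.B.homog_carrier[of b])
  qed
  have eq: "tensor_map A B C D f g X = tensor_lift A B (C \<otimes>\<^sub>s D) ?h X" if "X \<in> carrier (A \<otimes>\<^sub>s B)" for X
    unfolding tensor_map_def by (rule AB.tensor_lift_cong[OF CD.ground_module_T bil e that])
  show "tensor_map A B C D f g \<in> superalgebra_hom (A \<otimes>\<^sub>s B) (C \<otimes>\<^sub>s D)"
    by (rule hom_cong[OF AB.superalgebra_T hom eq])
  show "tensor_map A B C D f g (pure_tensor A B x y) = pure_tensor C D (f x) (g y)"
    if "x \<in> carrier A" "y \<in> carrier B"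
    using that AB.tensor_lift_pure[OF CD.ground_module_T bil that] by (simp add: eq e)
qed

text \<open>The nested lifts are rewritten as a product of two homomorphisms, one on the tensor
  product of \<open>A\<close> and \<open>B\<close> and one on \<open>C\<close>. It then remains to
  check that their images commute up to sign.\<close>

lemma tensor_assoc_hom:
  assumes A: "superalgebra A" and B: "superalgebra B" and C: "superalgebra C"
  shows "tensor_assoc A B C \<in> superalgebra_hom ((A \<otimes>\<^sub>s B) \<otimes>\<^sub>s C) (A \<otimes>\<^sub>s (B \<otimes>\<^sub>s C))"
    and "x \<in> carrier A \<Longrightarrow> y \<in> carrier B \<Longrightarrow> z \<in> carrier C \<Longrightarrow>
      tensor_assoc A B C (pure_tensor (A \<otimes>\<^sub>s B) C (pure_tensor A B x y) z) =
      pure_tensor A (B \<otimes>\<^sub>s C) x (pure_tensor B C y z)"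
proof -
  interpret AB: tensor_pair A B by (rule tensor_pair.intro[OF A B])
  interpret BC: tensor_pair B C by (rule tensor_pair.intro[OF B C])
  interpret L: tensor_pair "A \<otimes>\<^sub>s B" C by (rule tensor_pair.intro[OF AB.superalgebra_T C])
  interpret R: tensor_pair A "B \<otimes>\<^sub>s C" by (rule tensor_pair.intro[OF A BC.superalgebra_T])
  define \<phi> where "\<phi> = tensor_map A B A (B \<otimes>\<^sub>s C) id (\<lambda>y. BC.P y \<one>\<^bsub>C\<^esub>)"
  let ?\<psi> = "R.P \<one>\<^bsub>A\<^esub> \<circ> BC.P \<one>\<^bsub>B\<^esub>"
  have \<phi>_hom: "\<phi> \<in> superalgebra_hom AB.T R.T"
    unfolding \<phi>_def by (rule tensor_map_hom(1)[OF A B A BC.superalgebra_T hom_id BC.inl_hom])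
  have \<phi>P: "\<phi> (AB.P x y) = R.P x (BC.P y \<one>\<^bsub>C\<^esub>)" if "x \<in> carrier A" "y \<in> carrier B" for x y
    using tensor_map_hom(2)[OF A B A BC.superalgebra_T hom_id BC.inl_hom that] by (simp add: \<phi>_def)
  have \<psi>: "?\<psi> \<in> superalgebra_hom C R.T"
    by (rule hom_compose[OF BC.inr_hom R.inr_hom])
  note bil = L.hom_product_bilinear[OF R.superalgebra_T \<phi>_hom \<psi>]
  have inner_bil: "(\<lambda>x y. R.P x (BC.P y z)) \<in> bilinear_maps A B R.T" if "z \<in> carrier C" for z
    by (rule bilinear_mapsI) (use that in \<open>simp_all add: R.P_simps BC.P_simps\<close>)
  \<comment> \<open>For fixed \<open>z\<close> the inner lift is the embedding \<phi> followed by
    right multiplication with the image of \<open>z\<close>.\<close>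
  have inner: "tensor_lift A B R.T (\<lambda>x y. R.P x (BC.P y z)) X = \<phi> X \<otimes>\<^bsub>R.T\<^esub> ?\<psi> z"
    if X: "X \<in> carrier AB.T" and z: "z \<in> carrier C" for X z
  proof -
    let ?L = "tensor_lift A B R.T (\<lambda>x y. R.P x (BC.P y z))"
    note lin = AB.tensor_lift_linear[OF R.ground_module_T inner_bil[OF z]]
    have pz: "?\<psi> z \<in> carrier R.T" using z by simp
    show ?thesis using X
    proof (induction X rule: AB.T_induct)
      case zero
      have "?L \<zero>\<^bsub>AB.T\<^esub> = \<zero>\<^bsub>R.T\<^esub>" by (rule linear_maps_zero[OF AB.ground_module_T R.ground_module_T lin])
      moreover have "\<phi> \<zero>\<^bsub>AB.T\<^esub> = \<zero>\<^bsub>R.T\<^esub>" by (rule hom_zero[OF AB.superalgebra_T R.superalgebra_T \<phi>_hom])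
      ultimately show ?case using pz by simp
    next
      case (pure x y \<alpha> \<beta>)
      have c: "x \<in> carrier A" "y \<in> carrier B" using pure by auto
      have "R.P x (BC.P y \<one>\<^bsub>C\<^esub>) \<otimes>\<^bsub>R.T\<^esub> R.P \<one>\<^bsub>A\<^esub> (BC.P \<one>\<^bsub>B\<^esub> z) = R.P x (BC.P y z)"
        using R.P_mult_P[OF c(1) BC.P_homog[OF pure(2) BC.B.homog_one] AB.A.homog_one, of "BC.P \<one>\<^bsub>B\<^esub> z"] c z
        by (simp add: BC.inl_inr)
      then show ?case using c z by (simp add: \<phi>P AB.tensor_lift_pure[OF R.ground_module_T inner_bil[OF z]])
    next
      case (add X Y)
      then show ?case using lin pz by (simp add: linear_maps_def hom_add[OF \<phi>_hom] hom_closed[OF \<phi>_hom] R.T_mult_linear)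
    qed
  qed
  have hom: "tensor_lift AB.T C R.T (\<lambda>X z. \<phi> X \<otimes>\<^bsub>R.T\<^esub> ?\<psi> z) \<in> superalgebra_hom L.T R.T"
  proof (rule L.tensor_lift_hom[OF R.superalgebra_T \<phi>_hom \<psi>])
    fix \<alpha> \<beta> X z assume X: "X \<in> homog AB.T \<alpha>" and z: "z \<in> homog C \<beta>"
    have zc: "z \<in> carrier C" using z by auto
    then have pz: "?\<psi> z \<in> carrier R.T" by simp
    from X show "?\<psi> z \<otimes>\<^bsub>R.T\<^esub> \<phi> X = of_int (sgnf \<beta> \<alpha>) \<odot>\<^bsub>R.T\<^esub> (\<phi> X \<otimes>\<^bsub>R.T\<^esub> ?\<psi> z)"
    proof (induction X rule: AB.T_homog_induct)
      case zero
      have "\<phi> \<zero>\<^bsub>AB.T\<^esub> = \<zero>\<^bsub>R.T\<^esub>" by (rule hom_zero[OF AB.superalgebra_T R.superalgebra_T \<phi>_hom])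
      then show ?case using pz by simp
    next
      case (pure x y \<xi> \<eta>)
      have c: "x \<in> carrier A" "y \<in> carrier B" using pure by auto
      have h1: "BC.P \<one>\<^bsub>B\<^esub> z \<in> homog BC.T \<beta>" using BC.P_homog[OF AB.B.homog_one z] by simp
      have h2: "BC.P y \<one>\<^bsub>C\<^esub> \<in> homog BC.T \<eta>" using BC.P_homog[OF pure(2) BC.B.homog_one] by simp
      have "?\<psi> z \<otimes>\<^bsub>R.T\<^esub> \<phi> (AB.P x y) = of_int (sgnf \<beta> \<xi>) \<odot>\<^bsub>R.T\<^esub> R.P x (BC.P \<one>\<^bsub>B\<^esub> z \<otimes>\<^bsub>BC.T\<^esub> BC.P y \<one>\<^bsub>C\<^esub>)"
        using R.P_mult_P[OF AB.A.one_closed h1 pure(1), of "BC.P y \<one>\<^bsub>C\<^esub>"] c by (simp add: \<phi>P)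
      also have "\<dots> = (of_int (sgnf \<beta> \<xi>) * of_int (sgnf \<beta> \<eta>)) \<odot>\<^bsub>R.T\<^esub> R.P x (BC.P y z)"
        using c zc by (simp add: BC.inr_inl[OF pure(2) z] R.P_simps)
      also have "\<dots> = of_int (sgnf \<beta> \<alpha>) \<odot>\<^bsub>R.T\<^esub> R.P x (BC.P y z)"
        using pure(3) by (simp add: sgnf_add_right[of \<beta> \<xi> \<eta>, symmetric] flip: of_int_mult)
      also have "R.P x (BC.P y z) = \<phi> (AB.P x y) \<otimes>\<^bsub>R.T\<^esub> ?\<psi> z"
        using R.P_mult_P[OF c(1) h2 AB.A.homog_one, of "BC.P \<one>\<^bsub>B\<^esub> z"] c zc by (simp add: \<phi>P BC.inl_inr)
      finally show ?case .
    next
      case (add X Y)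
      then show ?case using pz AB.T_homog_carrier[OF add(1)] AB.T_homog_carrier[OF add(2)]
        by (simp add: hom_add[OF \<phi>_hom] hom_closed[OF \<phi>_hom] R.T_mult_linear R.T.smult_add_right)
    qed
  qed
  have eq: "tensor_assoc A B C X = tensor_lift AB.T C R.T (\<lambda>X z. \<phi> X \<otimes>\<^bsub>R.T\<^esub> ?\<psi> z) X" if "X \<in> carrier L.T" for X
    unfolding tensor_assoc_def by (rule L.tensor_lift_cong[OF R.ground_module_T bil inner that])
  show "tensor_assoc A B C \<in> superalgebra_hom ((A \<otimes>\<^sub>s B) \<otimes>\<^sub>s C) (A \<otimes>\<^sub>s (B \<otimes>\<^sub>s C))"
    by (rule hom_cong[OF L.superalgebra_T hom eq])
  assume c: "x \<in> carrier A" "y \<in> carrier B" "z \<in> carrier C"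
  have "tensor_assoc A B C (L.P (AB.P x y) z) = \<phi> (AB.P x y) \<otimes>\<^bsub>R.T\<^esub> ?\<psi> z"
    using c L.tensor_lift_pure[OF R.ground_module_T bil, of "AB.P x y" z] by (simp add: eq)
  also have "\<dots> = R.P x (BC.P y z)"
    using inner[of "AB.P x y" z] AB.tensor_lift_pure[OF R.ground_module_T inner_bil[OF c(3)] c(1,2)] c by simp
  finally show "tensor_assoc A B C (L.P (AB.P x y) z) = R.P x (BC.P y z)" .
qed

section \<open>The R-matrix\<close>

text \<open>
  \<open>Rh\<close> is the braid form of \<open>R\<close>, that is, \<open>R\<close> followed by the graded flip of \<open>V \<otimes> V\<close>;
  on the span of the \<open>e\<^sub>k \<otimes> e\<^sub>-\<^sub>k\<close> it is the matrix \<open>Mh\<close>.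
\<close>

locale quantum_parameters =
  fixes n m :: nat and q :: "'k::field"
  assumes q0: "q \<noteq> 0" and n1: "n \<ge> 1"
begin

abbreviation "I \<equiv> idx n m"
definition J :: "(int \<times> int) set" where "J = I \<times> I"
abbreviation "\<eta> \<equiv> eta n"
abbreviation "\<kappa> \<equiv> q - inverse q"

definition sg :: "int \<Rightarrow> 'k" where "sg i = of_int (sig n i)"
text \<open>The inverse of \<open>sg i * q powi sig n i\<close>, which is one of the two roots
  \<open>q\<close> and \<open>- inverse q\<close> of \<open>t^2 = 1 + \<kappa> * t\<close>.\<close>

definition av :: "int \<Rightarrow> 'k" where "av i = sg i * q powi (- sig n i)"
definition Cv :: "int \<Rightarrow> 'k" where "Cv i = Cq n q i (- i)"
definition Dv :: "int \<Rightarrow> 'k" where "Dv i = Cq_inv n q i (- i)"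

definition Mh :: "int \<Rightarrow> int \<Rightarrow> 'k" where
  "Mh j k = av k * of_bool (j = - k) + \<kappa> * of_bool (k < 0 \<and> j = k) - \<kappa> * of_bool (j < - k) * Dv j * Cv k"

definition Rh :: "int \<times> int \<Rightarrow> int \<times> int \<Rightarrow> 'k" where
  "Rh p r = (case p of (i, j) \<Rightarrow> case r of (k, l) \<Rightarrow>
     if l = - k then of_bool (j = - i) * Mh i k
     else if k = l then of_bool (i = k \<and> j = k) * (sg k * q powi sig n k)
     else of_bool (i = l \<and> j = k) * of_int (sig2 n k l) + of_bool (i = k \<and> j = l \<and> k < l) * \<kappa>)"

lemma finite_I [simp]: "finite I"
  by (simp add: idx_def)

lemma I_uminus [simp]: "- i \<in> I \<longleftrightarrow> i \<in> I"
  by (auto simp: idx_def)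

lemma I_nonzero: "i \<in> I \<Longrightarrow> i \<noteq> 0"
  by (auto simp: idx_def)

lemma eta_uminus [simp]: "eta n (- i) = eta n i"
  by (simp add: eta_def)

lemma sig_uminus [simp]: "sig n (- i) = sig n i" "sg (- i) = sg i" "av (- i) = av i"
  by (simp_all add: sig_def sig2_def sg_def av_def)

lemma sig_cases: "sig n i = 1 \<or> sig n i = - 1"
  by (simp add: sig_def sig2_def sgnf_def)

lemma sg_cases: "(sig n i = 1 \<and> sg i = 1) \<or> (sig n i = - 1 \<and> sg i = - 1)"
  using sig_cases[of i] by (auto simp: sg_def)

lemma sg_square [simp]: "sg i * sg i = 1" "sg i * (sg i * x) = x"
  using sg_cases[of i] by auto

lemma sig_1 [simp]: "sig n 1 = 1"
  using n1 by (simp add: sig_def sig2_def eta_def)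

lemma av_inv: "av i * (av i + \<kappa>) = 1"
  using sg_cases[of i] q0 by (auto simp: av_def power_int_minus field_simps)

lemma av_nonzero: "av i \<noteq> 0"
  using av_inv[of i] by auto

lemma kappa_eq: "\<kappa> = inverse (av i) - av i"
proof -
  have "av i * \<kappa> = 1 - av i * av i" using av_inv[of i] by (simp add: algebra_simps)
  then have "inverse (av i) * (av i * \<kappa>) = inverse (av i) * (1 - av i * av i)" by simp
  then show ?thesis using av_nonzero[of i] by (simp add: algebra_simps mult.assoc[symmetric])
qed

lemma av_powi: "av i * q powi sig n i = sg i"
  using sg_cases[of i] q0 by (auto simp: av_def power_int_minus)

lemma Cv_nonzero: "Cv i \<noteq> 0"
  unfolding Cv_def by (rule Cq_nonzero[OF q0])

lemma Dv_eq: "Dv i = inverse (Cv (- i))"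
  by (simp add: Dv_def Cv_def Cq_inv_def)

lemma Dv_nonzero: "Dv i \<noteq> 0"
  by (simp add: Dv_eq Cv_nonzero)

lemma Cv_pos: "0 < i \<Longrightarrow> Cv i = q powi (\<Sum>k=1..i. sig n k)"
  by (simp add: Cv_def Cq_def)

lemma sum_sig_rec: "0 < i \<Longrightarrow> (\<Sum>k=1..i. sig n k) = sig n i + (\<Sum>k=1..i - 1. sig n k)"
proof -
  assume i: "0 < i"
  have "{1..i} = insert i {1..i - 1}" using i by auto
  then show ?thesis by simp
qed

lemma Cv_rec: "0 < i \<Longrightarrow> Cv (i + 1) = q powi sig n (i + 1) * Cv i"
  using sum_sig_rec[of "i + 1"] q0 by (simp add: Cv_pos power_int_add)

lemma Cv_1: "Cv 1 = q"
  by (simp add: Cv_pos)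

text \<open>In the exponents of \<open>Cv i\<close> and \<open>Cv (- i)\<close> the sums of signs
  cancel up to the term at \<open>i\<close>; the resulting identity is symmetric under
  \<open>i\<close> to \<open>- i\<close>, so positive \<open>i\<close> suffices. It makes each
  product \<open>Cv x * Dv x\<close> a multiple of a square, which is what allows these products to
  be summed in closed form.\<close>

lemma Dv_av:
  assumes "i \<noteq> 0" shows "Dv i = - q * av i * Cv i"
proof -
  have *: "Cv (- i) * (- q * av i * Cv i) = 1" if i: "0 < i" for i
  proof -
    have "Cv (- i) = - sg i * q powi (- 1 - (\<Sum>k=1..i - 1. sig n k))"
      using i by (simp add: Cv_def Cq_def sg_def)
    also have "- 1 - (\<Sum>k=1..i - 1. sig n k) = - 1 + sig n i - (\<Sum>k=1..i. sig n k)"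
      using sum_sig_rec[OF i] by simp
    finally have "Cv (- i) * (- q * av i * Cv i) = q powi (- 1 + sig n i - (\<Sum>k=1..i. sig n k)) * q powi 1
        * q powi (- sig n i) * q powi (\<Sum>k=1..i. sig n k)"
      using i by (simp add: Cv_pos av_def)
    also have "\<dots> = q powi ((- 1 + sig n i - (\<Sum>k=1..i. sig n k)) + 1 + - sig n i + (\<Sum>k=1..i. sig n k))"
      by (simp only: power_int_add[OF disjI1[OF q0]])
    also have "\<dots> = 1" by simp
    finally show ?thesis .
  qed
  show ?thesis
  proof (cases "0 < i")
    case True
    then show ?thesis using *[of i] Cv_nonzero[of "- i"] unfolding Dv_eq by (simp add: field_simps)
  next
    case False
    then have "Cv i * (- q * av i * Cv (- i)) = 1" using *[of "- i"] assms by simp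
    then show ?thesis using Cv_nonzero[of "- i"] unfolding Dv_eq by (simp add: field_simps)
  qed
qed

lemma Cv_uminus: "i \<noteq> 0 \<Longrightarrow> Cv (- i) = - inverse (q * av i * Cv i)"
proof -
  assume "i \<noteq> 0"
  have "Cv (- i) = inverse (Dv i)" by (simp add: Dv_eq)
  then show ?thesis using \<open>i \<noteq> 0\<close> by (simp add: Dv_av)
qed

lemma Dv_Suc: "0 < i \<Longrightarrow> Dv (i + 1) = - q * sg (i + 1) * Cv i"
  using Dv_av[of "i + 1"] av_powi[of "i + 1"] by (simp add: Cv_rec mult.assoc[symmetric])

text \<open>Chosen so that the partial sums \<open>gv\<close> vanish at the least index. Its value
  is \<open>q powi (- 1 - 2 * (int n - int m))\<close>, and \<open>\<kappa> * mu0\<close> is the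
  coefficient of the rank one matrix in the square of \<open>Rh\<close>.\<close>

definition mu0 :: 'k where "mu0 = inverse q * (Dv (- int (n + m)))\<^sup>2"

text \<open>Partial sums of the (geometric) diagonal of the rank one matrix \<open>Dv j * Cv k\<close>.\<close>

definition gv :: "int \<Rightarrow> 'k" where
  "gv y = (let z = (if y = 0 then 1 else y) in mu0 + \<kappa> * of_bool (z > 0) - inverse q * (Dv z)\<^sup>2)"

text \<open>Consecutive values of \<open>Cv\<close> differ by a power of \<open>q\<close>, so away
  from zero each diagonal entry is a difference of multiples of two squares of \<open>Dv\<close>.
  The step from \<open>- 1\<close> leads to \<open>1\<close>, as \<open>0\<close> is no index, and
  the extra \<kappa> at positive arguments accounts for the change of formula there.\<close>

lemma gv_step:
  assumes "y \<noteq> 0" shows "gv (y + 1) - gv y = \<kappa> * Cv y * Dv y"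
proof -
  consider "y > 0" | "y = - 1" | "y < - 1" using assms by linarith
  then show ?thesis
  proof cases
    case 1
    then have "gv (y + 1) - gv y = inverse q * ((Dv y)\<^sup>2 - (Dv (y + 1))\<^sup>2)"
      by (simp add: gv_def Let_def algebra_simps)
    also have "\<dots> = q * (Cv y)\<^sup>2 * ((av y)\<^sup>2 - 1)"
      using q0 unfolding Dv_Suc[OF 1] Dv_av[OF assms] by (simp add: power2_eq_square field_simps)
    also have "(av y)\<^sup>2 - 1 = - (\<kappa> * av y)"
      using av_inv[of y] by (simp add: power2_eq_square algebra_simps)
    finally show ?thesis using 1 by (simp add: Dv_av power2_eq_square algebra_simps)
  next
    case 2
    have D1: "Dv 1 = - q" using Dv_av[of 1] q0 by (simp add: Cv_1 av_def sg_def power_int_minus)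
    have D2: "Dv (- 1) = inverse q" by (simp add: Dv_eq Cv_1)
    have "Cv (- 1) = inverse (Dv 1)" by (simp add: Dv_eq)
    then have C1: "Cv (- 1) = - inverse q" by (simp add: D1)
    show ?thesis using 2 q0 by (simp add: gv_def Let_def D1 D2 C1) (simp add: field_simps power2_eq_square)
  next
    case 3
    define i where "i = - y - 1"
    have i: "0 < i" "y = - (i + 1)" "y + 1 = - i" using 3 by (auto simp: i_def)
    have C: "Cv (- (i + 1)) = - inverse (q * av (i + 1) * Cv (i + 1))"
      using i by (intro Cv_uminus) simp
    have "gv (y + 1) - gv y = inverse q * ((Dv (- (i + 1)))\<^sup>2 - (Dv (- i))\<^sup>2)"
      unfolding i(3) unfolding i(2) using i(1) by (simp add: gv_def Let_def algebra_simps)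
    also have "\<dots> = inverse q * (inverse (Cv (i + 1)))\<^sup>2 * (1 - (q powi sig n (i + 1))\<^sup>2)"
    proof -
      have "inverse (Cv i) = q powi sig n (i + 1) * inverse (Cv (i + 1))"
        unfolding Cv_rec[OF i(1)] using q0 by simp
      then show ?thesis unfolding Dv_eq by (simp add: power_mult_distrib algebra_simps)
    qed
    also have "1 - (q powi sig n (i + 1))\<^sup>2 = - \<kappa> * inverse (av (i + 1))"
    proof -
      have "q powi sig n (i + 1) = sg (i + 1) * inverse (av (i + 1))"
        using av_powi[of "i + 1"] av_nonzero[of "i + 1"] by (simp add: field_simps)
      then have "(q powi sig n (i + 1))\<^sup>2 = inverse (av (i + 1)) * inverse (av (i + 1))"
        using sg_square(1)[of "i + 1"] by (simp add: power2_eq_square algebra_simps)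
      then show ?thesis using av_nonzero[of "i + 1"]
        unfolding kappa_eq[of "i + 1"] by (simp add: algebra_simps)
    qed
    finally show ?thesis unfolding i(2) C using q0 av_nonzero[of "i + 1"] Cv_nonzero[of "i + 1"]
      by (simp add: Dv_eq power2_eq_square field_simps)
  qed
qed

lemma sum_Cv_Dv:
  assumes "- int (n + m) \<le> y" "y \<le> int (n + m)"
  shows "\<kappa> * (\<Sum>x | x \<in> I \<and> x < y. Cv x * Dv x) = gv y"
  using assms
proof (induction y rule: int_ge_induct)
  case base
  have e: "{x \<in> I. x < - int (n + m)} = {}" by (auto simp: idx_def)
  show ?case unfolding e using n1 by (simp add: gv_def Let_def mu0_def)
next
  case (step y)
  \<comment> \<open>Passing over the missing index \<open>0\<close> changes neither the sum nor
    \<open>gv\<close>.\<close>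
  show ?case
  proof (cases "y = 0")
    case True
    have "{x \<in> I. x < y + 1} = {x \<in> I. x < y}" using True by (auto simp: idx_def)
    moreover have "gv (y + 1) = gv y" using True by (simp add: gv_def)
    ultimately show ?thesis using step by simp
  next
    case False
    have "{x \<in> I. x < y + 1} = insert y {x \<in> I. x < y}" using False step.hyps step.prems by (auto simp: idx_def)
    moreover have "gv (y + 1) = gv y + \<kappa> * (Cv y * Dv y)"
      using gv_step[OF False] by (simp add: diff_eq_eq mult.assoc add.commute)
    ultimately show ?thesis using step by (simp add: distrib_left add.commute)
  qed
qed

section \<open>The quadratic relation for the braid matrix\<close>

lemma sum_Mh_right:
  assumes "k \<in> I"
  shows "(\<Sum>x\<in>I. f x * Mh x k) = f (- k) * av k + \<kappa> * of_bool (k < 0) * f k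
    - \<kappa> * Cv k * (\<Sum>x | x \<in> I \<and> x < - k. f x * Dv x)"
proof -
  have "(\<Sum>x\<in>I. f x * Mh x k) = (\<Sum>x\<in>I. if x = - k then f x * av k else 0)
      + (\<Sum>x\<in>I. if x = k then \<kappa> * of_bool (k < 0) * f x else 0)
      - (\<Sum>x\<in>I. if x < - k then \<kappa> * Cv k * (f x * Dv x) else 0)"
    unfolding sum.distrib[symmetric] sum_subtractf[symmetric]
    by (rule sum.cong) (auto simp: Mh_def algebra_simps)
  also have "(\<Sum>x\<in>I. if x < - k then \<kappa> * Cv k * (f x * Dv x) else 0) =
      \<kappa> * Cv k * (\<Sum>x | x \<in> I \<and> x < - k. f x * Dv x)"
    by (simp add: sum.inter_filter[symmetric] sum_distrib_left)
  finally show ?thesis using assms by simp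
qed

text \<open>Two cut-offs meet, \<open>x < - k\<close> from the sum and \<open>x < - i\<close> from
  the rank one part of \<open>Mh\<close>; this is why the partial sum ends at their minimum.\<close>

lemma sum_Mh_Dv:
  assumes "i \<in> I" "k \<in> I"
  shows "(\<Sum>x | x \<in> I \<and> x < - k. Mh i x * Dv x) =
    of_bool (k < i) * av i * Dv (- i) + \<kappa> * of_bool (i < 0 \<and> i < - k) * Dv i - Dv i * gv (min (- k) (- i))"
proof -
  let ?L = "{x \<in> I. x < - k}"
  have b: "- int (n + m) \<le> min (- k) (- i)" "min (- k) (- i) \<le> int (n + m)" using assms by (auto simp: idx_def)
  have "(\<Sum>x\<in>?L. Mh i x * Dv x) = (\<Sum>x\<in>?L. if x = - i then av x * Dv x else 0)
      + (\<Sum>x\<in>?L. if x = i then \<kappa> * of_bool (i < 0) * Dv x else 0)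
      - (\<Sum>x\<in>?L. if x < - i then \<kappa> * Dv i * (Cv x * Dv x) else 0)"
    unfolding sum.distrib[symmetric] sum_subtractf[symmetric]
    by (rule sum.cong) (auto simp: Mh_def algebra_simps)
  also have "(\<Sum>x\<in>?L. if x < - i then \<kappa> * Dv i * (Cv x * Dv x) else 0) =
      \<kappa> * Dv i * (\<Sum>x\<in>{x \<in> ?L. x < - i}. Cv x * Dv x)"
    by (simp add: sum.inter_filter[symmetric] sum_distrib_left)
  also have "{x \<in> ?L. x < - i} = {x \<in> I. x < min (- k) (- i)}" by auto
  also have "\<kappa> * Dv i * (\<Sum>x\<in>{x \<in> I. x < min (- k) (- i)}. Cv x * Dv x) = Dv i * gv (min (- k) (- i))"
    unfolding sum_Cv_Dv[OF b, symmetric] by (simp add: ac_simps)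
  finally show ?thesis using assms by (simp add: ac_simps)
qed

text \<open>Multiplying the two cut-off rank one parts produces a partial sum of the diagonal
  \<open>Cv x * Dv x\<close>. The constant \<open>mu0\<close> in its closed form gives the full rank
  one matrix, without cut-off; the remainder combines with the other products to the identity and
  \<kappa> times \<open>Mh\<close>.\<close>

lemma Mh_square:
  assumes i: "i \<in> I" and k: "k \<in> I"
  shows "(\<Sum>x\<in>I. Mh i x * Mh x k) = of_bool (i = k) + \<kappa> * (Mh i k + mu0 * Dv i * Cv k)"
proof -
  have nz: "i \<noteq> 0" "k \<noteq> 0" using i k I_nonzero by auto
  have D: "Dv x = - q * av x * Cv x" if "x \<noteq> 0" for x using Dv_av that .
  have Di: "Dv (- k) = inverse (Cv k)" "Dv (- i) = inverse (Cv i)" by (simp_all add: Dv_eq)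
  have Ck: "Cv (- k) = - inverse (q * av k * Cv k)" using nz by (intro Cv_uminus) simp
  define K where "K = \<kappa>"
  note nzs = q0 av_nonzero[of i] av_nonzero[of k] Cv_nonzero[of i] Cv_nonzero[of k]
  have e: "(\<Sum>x\<in>I. Mh i x * Mh x k) = Mh i (- k) * av k + K * of_bool (k < 0) * Mh i k
    - K * Cv k * (of_bool (k < i) * av i * Dv (- i) + K * of_bool (i < 0 \<and> i < - k) * Dv i
      - Dv i * gv (min (- k) (- i)))"
    unfolding sum_Mh_right[OF k] sum_Mh_Dv[OF i k] K_def by simp
  have M: "Mh j k = av k * of_bool (j = - k) + K * of_bool (k < 0 \<and> j = k) - K * of_bool (j < - k) * Dv j * Cv k" for j k
    by (simp add: Mh_def K_def)
  have g: "gv z = mu0 + K * of_bool (z > 0) - inverse q * (Dv z)\<^sup>2" if "z \<noteq> 0" for z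
    using that by (simp add: gv_def K_def)
  have Kk: "av k * K = 1 - av k * av k" and Ki: "av i * K = 1 - av i * av i"
    using av_inv[of k] av_inv[of i] by (simp_all add: K_def algebra_simps)
  have Kk': "K = inverse (av k) - av k" and Ki': "K = inverse (av i) - av i"
    using Kk Ki nzs by (simp_all add: field_simps)
  have "(\<Sum>x\<in>I. Mh i x * Mh x k) = of_bool (i = k) + K * (Mh i k + mu0 * Dv i * Cv k)"
  proof -
    \<comment> \<open>The order of \<open>i\<close> and \<open>k\<close> decides which cut-off ends
      the partial sum.\<close>
    consider "i < k" | "i = k" | "k < i" by linarith
    then show ?thesis
    proof cases
      case 1
      have combine: "z = w + y" if "x + y = 0" "x + z = w" for x y z w :: 'k
        using that by (metis add.assoc add.commute add.right_neutral)
      from 1 have m: "min (- k) (- i) = - k" by simp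
      have "K * Dv i * Cv (- k) * av k = - K * Dv i * inverse (q * Cv k)"
        using nzs by (simp add: Ck field_simps)
      then have "Mh i (- k) * av k = K * of_bool (k > 0 \<and> i = - k) * av k + K * Dv i * inverse (q * Cv k)"
        using 1 by (simp add: M algebra_simps)
      moreover have "Cv k * gv (- k) = Cv k * mu0 + Cv k * K * of_bool (k < 0) - inverse (q * Cv k)"
        using nz nzs by (simp add: g Di power2_eq_square field_simps)
      then have "K * Dv i * (Cv k * gv (- k)) =
          K * Dv i * (Cv k * mu0 + Cv k * K * of_bool (k < 0) - inverse (q * Cv k))" by simp
      moreover have "i = - k \<Longrightarrow> Dv i * Cv k = 1" using Di nzs by simp
      ultimately show ?thesis
        unfolding e m using 1 nz Kk
        by (cases "i = - k"; cases "k < 0"; cases "i < - k") (auto simp: M algebra_simps intro: combine)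
    next
      case 2
      have combine2: "a + z = 1 + w" if "1 + x = a" "x + z = w" for a x z w :: 'k
        using that by (metis add.assoc)
      from 2 have m: "min (- k) (- i) = - k" by simp
      have "Cv k * gv (- k) = Cv k * mu0 + Cv k * K * of_bool (k < 0) - inverse (q * Cv k)"
        using nz nzs by (simp add: g Di power2_eq_square field_simps)
      then have "K * Dv i * (Cv k * gv (- k)) =
          K * Dv i * (Cv k * mu0 + Cv k * K * of_bool (k < 0) - inverse (q * Cv k))" by simp
      moreover have "K * Dv k * inverse (q * Cv k) = - (1 - av k * av k)"
        using nz nzs Kk by (simp add: D field_simps)
      ultimately show ?thesis
        unfolding e m using 2 nz Kk
        by (cases "k < 0") (auto simp: M algebra_simps intro: combine2)
    next
      case 3
      then have m: "min (- k) (- i) = - i" by simp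
      have "Dv i * gv (- i) = Dv i * mu0 + Dv i * K * of_bool (i < 0) + av i * inverse (Cv i)"
        using nz nzs by (simp add: g Di D power2_eq_square field_simps)
      moreover have "i = - k \<Longrightarrow> Dv i * Cv k = 1" using Di nzs by simp
      ultimately show ?thesis
        unfolding e m using 3 nz nzs Di
        by (cases "i = - k"; cases "k < 0"; cases "i < - k") (auto simp: M algebra_simps)
    qed
  qed
  then show ?thesis by (simp add: K_def)
qed

lemma sum_J_antidiagonal:
  assumes "\<And>i j. i \<in> I \<Longrightarrow> j \<in> I \<Longrightarrow> j \<noteq> - i \<Longrightarrow> f (i, j) = 0"
  shows "(\<Sum>s\<in>J. f s) = (\<Sum>x\<in>I. f (x, - x))"
proof -
  have "(\<Sum>s\<in>J. f s) = (\<Sum>s\<in>(\<lambda>x. (x, - x)) ` I. f s)"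
    by (rule sum.mono_neutral_right) (use assms in \<open>auto simp: J_def\<close>)
  also have "\<dots> = (\<Sum>x\<in>I. f (x, - x))" by (subst sum.reindex) (auto intro: inj_onI)
  finally show ?thesis .
qed

text \<open>\<open>q\<close> and \<open>- inverse q\<close> are the only possible values, and they
  are the two roots of \<open>t^2 = 1 + \<kappa> * t\<close>.\<close>

lemma sg_powi_quadratic: "(sg k * q powi sig n k) * (sg k * q powi sig n k) = 1 + \<kappa> * (sg k * q powi sig n k)"
  using sg_cases[of k] q0 by (auto simp: power_int_minus field_simps)

text \<open>The quadratic relation of Birman--Murakami--Wenzl type.\<close>

lemma Rh_square:
  assumes "p \<in> J" "r \<in> J"
  shows "(\<Sum>s\<in>J. Rh p s * Rh s r) = of_bool (p = r) + \<kappa> * (Rh p r + mu0 *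
    (of_bool (snd p = - fst p) * Dv (fst p) * Cq n q (fst r) (snd r)))"
proof -
  obtain i j k l where pr: "p = (i, j)" "r = (k, l)" by (cases p; cases r)
  have mem: "i \<in> I" "j \<in> I" "k \<in> I" "l \<in> I" using assms pr by (auto simp: J_def)
  \<comment> \<open>\<open>Rh\<close> is block diagonal: one block on all pairs
    \<open>(k, - k)\<close>, blocks of size one on \<open>(k, k)\<close>, and blocks of size two on
    \<open>(k, l)\<close> and \<open>(l, k)\<close>.\<close>
  consider "l = - k" | "l \<noteq> - k" "l = k" | "l \<noteq> - k" "l \<noteq> k" by blast
  then show ?thesis
  proof cases
    case 1
    have "(\<Sum>s\<in>J. Rh p s * Rh s r) = (\<Sum>x\<in>I. Rh p (x, - x) * Rh (x, - x) r)"
      by (rule sum_J_antidiagonal) (auto simp: pr 1 Rh_def)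
    also have "\<dots> = of_bool (j = - i) * (\<Sum>x\<in>I. Mh i x * Mh x k)"
      unfolding sum_distrib_left by (rule sum.cong) (auto simp: pr 1 Rh_def)
    finally show ?thesis using Mh_square[OF mem(1,3)]
      by (auto simp: pr 1 Rh_def Cv_def mult.assoc)
  next
    case 2
    have z: "Cq n q k k = 0" using I_nonzero[OF mem(3)] by (intro Cq_eq_0) auto
    have "(\<Sum>s\<in>J. Rh p s * Rh s r) = (\<Sum>s\<in>{(k, k)}. Rh p s * Rh s r)"
      by (rule sum.mono_neutral_right) (use mem 2 in \<open>auto simp: pr Rh_def J_def\<close>)
    also have "\<dots> = of_bool (i = k \<and> j = k) * ((sg k * q powi sig n k) * (sg k * q powi sig n k))"
      using 2 by (simp add: pr Rh_def)
    finally show ?thesis using 2 z unfolding sg_powi_quadratic by (simp add: pr Rh_def)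
  next
    case 3
    have z: "Cq n q k l = 0" using 3 by (intro Cq_eq_0) auto
    have kl: "- l \<noteq> k" using 3 by auto
    have s: "of_int (sig2 n k l) * of_int (sig2 n l k) = (1::'k)" "sig2 n l k = sig2 n k l"
      by (simp_all add: sig2_def sgnf_def mult.commute)
    have "(\<Sum>s\<in>J. Rh p s * Rh s r) = (\<Sum>s\<in>{(l, k), (k, l)}. Rh p s * Rh s r)"
      by (rule sum.mono_neutral_right) (use mem 3 in \<open>auto simp: pr Rh_def J_def\<close>)
    also have "\<dots> = Rh p (l, k) * Rh (l, k) r + Rh p (k, l) * Rh (k, l) r" using 3 by simp
    also have "\<dots> = (of_bool (i = k \<and> j = l) * of_int (sig2 n k l) + of_bool (i = l \<and> j = k \<and> l < k) * \<kappa>) *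
        of_int (sig2 n k l) + Rh p r * (of_bool (k < l) * \<kappa>)"
      using 3 kl by (simp add: pr Rh_def s(2))
    also have "\<dots> = of_bool (i = k \<and> j = l) + \<kappa> * Rh p r"
    proof -
      consider "k < l" | "l < k" using 3 by linarith
      then show ?thesis
        using 3 s(1)[unfolded s(2)] by cases (auto simp: pr Rh_def algebra_simps)
    qed
    finally show ?thesis using z by (simp add: pr)
  qed
qed

end

lemma (in ground_module) sum_left_cancel:
  assumes "x \<in> carrier M" "y \<in> carrier M" "z \<in> carrier M" "x \<oplus> y = x \<oplus> z"
  shows "y = z"
proof -
  have "\<ominus> x \<oplus> (x \<oplus> y) = \<ominus> x \<oplus> (x \<oplus> z)" using assms(4) by simp
  then show ?thesis using assms(1-3) by (simp add: M.a_assoc[symmetric] M.l_neg)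
qed

section \<open>Entries of \<open>R\<close> and the comparison with its braid form\<close>

context quantum_parameters
begin

lemma sum_of_bool_eq:
  assumes "finite S"
  shows "(\<Sum>x\<in>S. f x * of_bool (x = x0 \<and> Q)) = of_bool (x0 \<in> S \<and> Q) * (f x0 :: 'k)"
proof -
  have "(\<Sum>x\<in>S. f x * of_bool (x = x0 \<and> Q)) = (\<Sum>x\<in>S. if x = x0 then of_bool Q * f x0 else 0)"
    by (rule sum.cong) auto
  then show ?thesis using assms by (auto simp: sum.delta)
qed

text \<open>In each sum over matrix units the four given indices select at most one term; in the
  last two sums it is the one at \<open>(a, i)\<close>.\<close>

lemma Rq_eq:
  assumes "i \<in> I" "j \<in> I" "a \<in> I" "b \<in> I"
  shows "Rq n m q i j a b = of_bool (i = j \<and> a = i \<and> b = i) * q powi sig n i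
    + of_bool (j = - i \<and> a = i \<and> b = j) * q powi (- sig n i)
    + of_bool (a = i \<and> b = j \<and> i \<noteq> j \<and> i \<noteq> - j)
    + \<kappa> * (of_bool (j = a \<and> b = i \<and> a < i) * of_int (sig n a))
    - \<kappa> * (of_bool (j = - i \<and> b = - a \<and> a < i) *
        (of_int (sig n a * sig n i * sig2 n a i) * Cq_inv n q (- i) i * Cq n q a (- a)))"
proof -
  have f2: "finite {(i, j) \<in> I \<times> I. R i j}" for R
    by (rule finite_subset[of _ "I \<times> I"]) auto
  have 1: "(\<Sum>x\<in>I. q powi sig n x * EE x x x x i j a b) = of_bool (i = j \<and> a = i \<and> b = i) * q powi sig n i"
  proof -
    have "(\<Sum>x\<in>I. q powi sig n x * EE x x x x i j a b) =
        (\<Sum>x\<in>I. q powi sig n x * of_bool (x = i \<and> (i = j \<and> a = i \<and> b = i)))"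
      by (rule sum.cong) (auto simp: EE_def)
    then show ?thesis using assms by (simp only: sum_of_bool_eq[OF finite_I]) simp
  qed
  have 2: "(\<Sum>x\<in>I. q powi (- sig n x) * EE x x (- x) (- x) i j a b) = of_bool (j = - i \<and> a = i \<and> b = j) * q powi (- sig n i)"
  proof -
    have "(\<Sum>x\<in>I. q powi (- sig n x) * EE x x (- x) (- x) i j a b) =
        (\<Sum>x\<in>I. q powi (- sig n x) * of_bool (x = i \<and> (j = - i \<and> a = i \<and> b = j)))"
      by (rule sum.cong) (auto simp: EE_def)
    then show ?thesis using assms by (simp only: sum_of_bool_eq[OF finite_I]) simp
  qed
  have 3: "(\<Sum>(x, y)\<in>{(x, y) \<in> I \<times> I. x \<noteq> y \<and> x \<noteq> - y}. EE x x y y i j a b) =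
      (of_bool (a = i \<and> b = j \<and> i \<noteq> j \<and> i \<noteq> - j) :: 'k)"
  proof -
    have "(\<Sum>(x, y)\<in>{(x, y) \<in> I \<times> I. x \<noteq> y \<and> x \<noteq> - y}. EE x x y y i j a b) =
       (\<Sum>p\<in>{(x, y) \<in> I \<times> I. x \<noteq> y \<and> x \<noteq> - y}. 1 * of_bool (p = (i, j) \<and> (a = i \<and> b = j)) :: 'k)"
      by (rule sum.cong) (auto simp: EE_def)
    also have "\<dots> = of_bool ((i, j) \<in> {(x, y) \<in> I \<times> I. x \<noteq> y \<and> x \<noteq> - y} \<and> (a = i \<and> b = j)) * 1"
      by (rule sum_of_bool_eq[OF f2])
    finally show ?thesis using assms by (simp add: conj_ac)
  qed
  have 4: "(\<Sum>(x, y)\<in>{(x, y) \<in> I \<times> I. x < y}. of_int (sig n x) * EE y x x y i j a b) =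
      (of_bool (j = a \<and> b = i \<and> a < i) * of_int (sig n a) :: 'k)"
  proof -
    have "(\<Sum>(x, y)\<in>{(x, y) \<in> I \<times> I. x < y}. of_int (sig n x) * EE y x x y i j a b) =
       (\<Sum>p\<in>{(x, y) \<in> I \<times> I. x < y}. (\<lambda>p. of_int (sig n (fst p))) p * of_bool (p = (a, i) \<and> (j = a \<and> b = i)) :: 'k)"
      by (rule sum.cong) (auto simp: EE_def)
    also have "\<dots> = of_bool ((a, i) \<in> {(x, y) \<in> I \<times> I. x < y} \<and> (j = a \<and> b = i)) * of_int (sig n (fst (a, i)))"
      by (rule sum_of_bool_eq[OF f2])
    finally show ?thesis using assms by (simp add: conj_ac)
  qed
  have 5: "(\<Sum>(x, y)\<in>{(x, y) \<in> I \<times> I. x < y}. of_int (sig n x * sig n y * sig2 n x y) * Cq_inv n q (- y) y *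
        Cq n q x (- x) * EE y x (- y) (- x) i j a b) =
      (of_bool (j = - i \<and> b = - a \<and> a < i) *
        (of_int (sig n a * sig n i * sig2 n a i) * Cq_inv n q (- i) i * Cq n q a (- a)) :: 'k)"
    (is "?l = _")
  proof -
    let ?f = "\<lambda>p. of_int (sig n (fst p) * sig n (snd p) * sig2 n (fst p) (snd p)) * Cq_inv n q (- snd p) (snd p) *
       Cq n q (fst p) (- fst p)"
    have "?l = (\<Sum>p\<in>{(x, y) \<in> I \<times> I. x < y}. ?f p * of_bool (p = (a, i) \<and> (j = - i \<and> b = - a)))"
      by (rule sum.cong) (auto simp: EE_def)
    also have "\<dots> = of_bool ((a, i) \<in> {(x, y) \<in> I \<times> I. x < y} \<and> (j = - i \<and> b = - a)) * ?f (a, i)"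
      by (rule sum_of_bool_eq[OF f2])
    finally show ?thesis using assms by (simp add: conj_ac)
  qed
  show ?thesis unfolding Rq_def 1 2 3 4 5 ..
qed

text \<open>The nonzero entries of \<open>R\<close> keep two indices, exchange them, or replace one
  antipodal pair by another, and degrees depend on absolute values only. This makes the relations of
  \<open>A(R)\<close> homogeneous and lets their signs be sorted out.\<close>

lemma Rq_parity:
  assumes "i \<in> I" "j \<in> I" "a \<in> I" "b \<in> I" "Rq n m q i j a b \<noteq> 0"
  shows "\<eta> i + \<eta> j = \<eta> a + \<eta> b"
proof (rule ccontr)
  assume ne: "\<eta> i + \<eta> j \<noteq> \<eta> a + \<eta> b"
  have "\<not> (i = j \<and> a = i \<and> b = i)" "\<not> (j = - i \<and> a = i \<and> b = j)" "\<not> (a = i \<and> b = j)"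
    "\<not> (j = a \<and> b = i)" "\<not> (j = - i \<and> b = - a)"
    using ne by (auto simp: add.commute)
  then have "Rq n m q i j a b = 0" unfolding Rq_eq[OF assms(1-4)] by auto
  then show False using assms(5) by simp
qed

text \<open>The sign has two sources. The graded tensor product of \<open>E i a\<close> and
  \<open>E j b\<close>, applied to the basis vector of \<open>(a, b)\<close>, gives
  \<open>sgnf (\<eta> j + \<eta> b) (\<eta> a)\<close>; the graded flip that follows gives
  \<open>sig2 n i j\<close> and exchanges the row indices.\<close>

lemma Rh_Rq:
  assumes "i \<in> I" "j \<in> I" "a \<in> I" "b \<in> I"
  shows "Rh (j, i) (a, b) = of_int (sig2 n i j * sgnf (\<eta> j + \<eta> b) (\<eta> a)) * Rq n m q i j a b"
proof -
  have nz: "i \<noteq> 0" "j \<noteq> 0" "a \<noteq> 0" "b \<noteq> 0" using assms I_nonzero by auto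
  \<comment> \<open>On antipodal pairs the signs in the last sum of \<open>R\<close> cancel against
    those of the braid form, leaving the bare product of entries of \<open>C\<close> and its
    inverse.\<close>
  have s1: "of_int (sig2 n i i * sgnf (\<eta> i + \<eta> a) (\<eta> a)) * (of_int (sig n a * sig n i * sig2 n a i) * (x::'k)) = x" for x i a
    unfolding sig_def sig2_def by (cases "\<eta> i"; cases "\<eta> a") simp_all
  consider "b = - a" | "b \<noteq> - a" "b = a" | "b \<noteq> - a" "b \<noteq> a" by blast
  then show ?thesis
  proof cases
    case 1
    show ?thesis
    proof (cases "i = - j")
      case True
      have e: "sig2 n i j = sig n a * sig n a * sig n j" "\<eta> b = \<eta> a" "sig n i = sig n j"
        using 1 True sig_cases[of a] by (auto simp: sig_def sig2_def)
      let ?s = "of_int (sig2 n i j * sgnf (\<eta> j + \<eta> b) (\<eta> a)) :: 'k"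
      have s3: "?s * (of_int (sig n a * sig n i * sig2 n a i) * x * y) = x * y" for x y :: 'k
        using s1[of i a "x * y"] 1 True by (simp add: sig2_def mult.assoc)
      have i: "j = - i" using True by auto
      have R: "Rh (j, i) (a, b) = Mh j a" using 1 True by (simp add: Rh_def)
      define X where "X = of_int (sig n a * sig n i * sig2 n a i) * Cq_inv n q (- i) i * Cq n q a (- a)"
      have X: "?s * X = Cq_inv n q (- i) i * Cq n q a (- a)" unfolding X_def using s3 .
      \<comment> \<open>For \<open>a = i\<close> the diagonal of \<open>R\<close> becomes the
        \<open>av\<close> entry of \<open>Mh\<close>; for \<open>a = j\<close> both \<kappa> terms
        can occur; elsewhere only the cut-off rank one part is left.\<close>
      consider "a = i" | "a = j" | "a \<noteq> i" "a \<noteq> j" by blast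
      then show ?thesis
      proof cases
        case a: 1
        have "?s = sg i" using a 1 i by (simp add: sg_def sig_def sig2_def)
        then show ?thesis unfolding Rq_eq[OF assms] R using a 1 nz i by (simp add: Mh_def av_def)
      next
        case a: 2
        have 1: "?s * of_int (sig n a) = 1" using a 1 i sg_square(1)[of a] by (simp add: sg_def sig_def sig2_def)
        have "Rq n m q i j a b = \<kappa> * of_bool (a < i) * of_int (sig n a) - \<kappa> * of_bool (a < i) * X"
          unfolding Rq_eq[OF assms] X_def using a \<open>b = - a\<close> nz i by auto
        then have "?s * Rq n m q i j a b = \<kappa> * of_bool (a < i) * (?s * of_int (sig n a)) - \<kappa> * of_bool (a < i) * (?s * X)"
          by (simp only: right_diff_distrib mult.left_commute mult.assoc)
        then show ?thesis unfolding R 1 X using a nz i by (simp add: Mh_def Dv_def Cv_def)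
      next
        case a: 3
        have "Rq n m q i j a b = - (\<kappa> * of_bool (a < i) * X)"
          unfolding Rq_eq[OF assms] X_def using a 1 nz i by auto
        then have "?s * Rq n m q i j a b = - (\<kappa> * of_bool (a < i) * (?s * X))"
          by (simp only: mult_minus_right mult.left_commute mult.assoc)
        then show ?thesis unfolding R X using a nz i by (simp add: Mh_def Dv_def Cv_def)
      qed
    next
      case False
      then show ?thesis unfolding Rq_eq[OF assms] using 1 nz by (auto simp: Rh_def)
    qed
  next
    case 2
    have "sgnf (\<eta> a + \<eta> a) (\<eta> a) = 1" by simp
    then show ?thesis unfolding Rq_eq[OF assms] using 2 nz by (auto simp: Rh_def sg_def sig_def)
  next
    case 3
    let ?s = "of_int (sig2 n i j * sgnf (\<eta> j + \<eta> b) (\<eta> a)) :: 'k"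
    consider "i = b" "j = a" | "i = a" "j = b" | "\<not> (i = b \<and> j = a)" "\<not> (i = a \<and> j = b)" by blast
    then show ?thesis
    proof cases
      case ij: 1
      have "sig2 n b a * sgnf (\<eta> a + \<eta> b) (\<eta> a) * sig n a = 1"
        unfolding sig_def sig2_def by (cases "\<eta> a"; cases "\<eta> b"; simp)
      then have s: "?s * of_int (sig n a) = 1" using ij by (simp flip: of_int_mult)
      have "Rq n m q i j a b = \<kappa> * of_bool (a < b) * of_int (sig n a)"
        unfolding Rq_eq[OF assms] using 3 ij nz by auto
      then have "?s * Rq n m q i j a b = \<kappa> * of_bool (a < b) * (?s * of_int (sig n a))"
        by (simp only: mult.left_commute mult.assoc)
      then show ?thesis unfolding s using 3 ij by (simp add: Rh_def)
    next
      case ij: 2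
      have "Rq n m q i j a b = 1" unfolding Rq_eq[OF assms] using 3 ij nz by auto
      then show ?thesis using 3 ij by (simp add: Rh_def sig2_def)
    next
      case ij: 3
      have "Rq n m q i j a b = 0" unfolding Rq_eq[OF assms] using 3 ij nz by auto
      then show ?thesis using 3 ij by (auto simp: Rh_def)
    qed
  qed
qed

section \<open>Multiplicative matrices\<close>

text \<open>
  \<open>x i\<close> of degree \<open>\<eta> i\<close> tensored with a multiplicative matrix \<open>s\<close> gives
  \<open>x' k = \<Sum>\<^sub>a x a \<otimes> s a k\<close>; \<open>tt B s\<close> is the matrix with
  \<open>x' k x' l = \<Sum>\<^sub>(\<^sub>a\<^sub>,\<^sub>b\<^sub>) x a x b \<otimes> tt B s (a, b) (k, l)\<close>. In terms of it the defining relations of \<open>A(R)\<close>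
  say that it commutes with \<open>Rh\<close>, and no signs remain. The generator \<open>t\<^sub>i\<^sub>j\<close> is \<open>tsign i j\<close> times \<open>s i j\<close>.
\<close>

definition tt :: "('k, 'b, 'p) superalgebra_scheme \<Rightarrow> (int \<Rightarrow> int \<Rightarrow> 'b) \<Rightarrow> int \<times> int \<Rightarrow> int \<times> int \<Rightarrow> 'b" where
  "tt B s p r = of_int (sgnf (\<eta> (fst p) + \<eta> (fst r)) (\<eta> (snd p))) \<odot>\<^bsub>B\<^esub>
     (s (fst p) (fst r) \<otimes>\<^bsub>B\<^esub> s (snd p) (snd r))"

definition tsign :: "int \<Rightarrow> int \<Rightarrow> 'k" where
  "tsign i j = of_int (sgnf (\<eta> j) (\<eta> i + \<eta> j))"

definition rtt :: "('k, 'b, 'p) superalgebra_scheme \<Rightarrow> (int \<Rightarrow> int \<Rightarrow> 'b) \<Rightarrow> bool" where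
  "rtt B s \<longleftrightarrow> (\<forall>i\<in>I. \<forall>j\<in>I. s i j \<in> homog B (\<eta> i + \<eta> j)) \<and>
     (\<forall>p\<in>J. \<forall>r\<in>J. lincomb B J (Rh p) (\<lambda>u. tt B s u r) = lincomb B J (\<lambda>u. Rh u r) (tt B s p))"

definition Crow :: "int \<times> int \<Rightarrow> 'k" where
  "Crow p = Cq n q (fst p) (snd p)"

text \<open>A property of matrices over an arbitrary superalgebra, because it is applied to the
  generators, to the matrix of their coproducts and to the identity matrix over the field.\<close>

definition spo :: "('k, 'b, 'p) superalgebra_scheme \<Rightarrow> (int \<Rightarrow> int \<Rightarrow> 'b) \<Rightarrow> bool" where
  "spo B s \<longleftrightarrow> rtt B s \<and>
     (\<forall>r\<in>J. lincomb B J Crow (\<lambda>u. tt B s u r) = Crow r \<odot>\<^bsub>B\<^esub> \<one>\<^bsub>B\<^esub>)"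

lemma tsign_square [simp]: "tsign i j * tsign i j = 1"
  by (simp add: tsign_def flip: of_int_mult)

lemma finite_J [simp]: "finite J"
  by (simp add: J_def)

lemma tt_closed:
  assumes "superalgebra B" "\<forall>i\<in>I. \<forall>j\<in>I. s i j \<in> homog B (\<eta> i + \<eta> j)" "p \<in> J" "r \<in> J"
  shows "tt B s p r \<in> carrier B"
proof -
  interpret superalgebra B by fact
  have "s (fst p) (fst r) \<in> homog B (\<eta> (fst p) + \<eta> (fst r))" "s (snd p) (snd r) \<in> homog B (\<eta> (snd p) + \<eta> (snd r))"
    using assms by (auto simp: J_def)
  from this[THEN homog_carrier] show ?thesis unfolding tt_def by auto
qed

lemma tt_hom:
  assumes "superalgebra A" "f \<in> superalgebra_hom A B" "\<forall>i\<in>I. \<forall>j\<in>I. s i j \<in> homog A (\<eta> i + \<eta> j)" "p \<in> J" "r \<in> J"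
  shows "tt B (\<lambda>i j. f (s i j)) p r = f (tt A s p r)"
proof -
  interpret superalgebra A by fact
  have "s (fst p) (fst r) \<in> homog A (\<eta> (fst p) + \<eta> (fst r))" "s (snd p) (snd r) \<in> homog A (\<eta> (snd p) + \<eta> (snd r))"
    using assms(3-5) by (auto simp: J_def)
  from this[THEN homog_carrier] show ?thesis by (simp add: tt_def hom_mult[OF assms(2)] hom_smult[OF assms(2)])
qed

lemma rtt_hom:
  assumes A: "superalgebra A" and B: "superalgebra B" and f: "f \<in> superalgebra_hom A B" and s: "rtt A s"
  shows "rtt B (\<lambda>i j. f (s i j))"
proof -
  interpret A: superalgebra A by fact
  interpret B: superalgebra B by fact
  have h: "\<forall>i\<in>I. \<forall>j\<in>I. s i j \<in> homog A (\<eta> i + \<eta> j)" using s by (simp add: rtt_def)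
  note cl = tt_closed[OF A h] and th = tt_hom[OF A f h]
  have "lincomb B J (Rh p) (\<lambda>u. tt B (\<lambda>i j. f (s i j)) u r) = lincomb B J (\<lambda>u. Rh u r) (tt B (\<lambda>i j. f (s i j)) p)"
    if pr: "p \<in> J" "r \<in> J" for p r
  proof -
    have "lincomb B J (Rh p) (\<lambda>u. tt B (\<lambda>i j. f (s i j)) u r) = f (lincomb A J (Rh p) (\<lambda>u. tt A s u r))"
    proof -
      have "f (lincomb A J (Rh p) (\<lambda>u. tt A s u r)) = lincomb B J (Rh p) (\<lambda>u. f (tt A s u r))"
        by (rule hom_lincomb[OF A B f finite_J]) (use cl pr in auto)
      moreover have "lincomb B J (Rh p) (\<lambda>u. tt B (\<lambda>i j. f (s i j)) u r) = lincomb B J (Rh p) (\<lambda>u. f (tt A s u r))"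
        by (rule B.lincomb_cong) (use th cl pr hom_closed[OF f] in auto)
      ultimately show ?thesis by simp
    qed
    also have "\<dots> = f (lincomb A J (\<lambda>u. Rh u r) (tt A s p))" using s pr by (simp add: rtt_def)
    also have "\<dots> = lincomb B J (\<lambda>u. Rh u r) (tt B (\<lambda>i j. f (s i j)) p)"
    proof -
      have "f (lincomb A J (\<lambda>u. Rh u r) (tt A s p)) = lincomb B J (\<lambda>u. Rh u r) (\<lambda>u. f (tt A s p u))"
        by (rule hom_lincomb[OF A B f finite_J]) (use cl pr in auto)
      moreover have "lincomb B J (\<lambda>u. Rh u r) (tt B (\<lambda>i j. f (s i j)) p) = lincomb B J (\<lambda>u. Rh u r) (\<lambda>u. f (tt A s p u))"
        by (rule B.lincomb_cong) (use th cl pr hom_closed[OF f] in auto)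
      ultimately show ?thesis by simp
    qed
    finally show ?thesis .
  qed
  then show ?thesis using h hom_homog[OF f] by (simp add: rtt_def)
qed

text \<open>
  Since \<open>Rh\<close> commutes with \<open>tt B s\<close>, so does the rank one matrix of \<open>Rh_square\<close>;
  hence \<open>Crow\<close> is an eigenvector, with the element \<open>Q\<close> as its eigenvalue.
\<close>

lemma rtt_Crow:
  assumes B: "superalgebra B" and s: "rtt B s" and \<kappa>: "\<kappa> \<noteq> 0"
  shows "\<exists>Q\<in>carrier B. \<forall>r\<in>J. lincomb B J Crow (\<lambda>u. tt B s u r) = Crow r \<odot>\<^bsub>B\<^esub> Q"
proof -
  interpret superalgebra B by fact
  have h: "\<forall>i\<in>I. \<forall>j\<in>I. s i j \<in> homog B (\<eta> i + \<eta> j)" using s by (simp add: rtt_def)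
  note cl = tt_closed[OF B h]
  have R: "lincomb B J (Rh p) (\<lambda>u. tt B s u r) = lincomb B J (\<lambda>u. Rh u r) (tt B s p)" if "p \<in> J" "r \<in> J" for p r
    using s that by (simp add: rtt_def)
  \<comment> \<open>The column factor of the rank one matrix whose row factor is
    \<open>Crow\<close>.\<close>
  define Dc where "Dc p = of_bool (snd p = - fst p) * Dv (fst p)" for p :: "int \<times> int"
  have mu0: "mu0 \<noteq> 0" using q0 Dv_nonzero by (simp add: mu0_def)
  have sq1: "(\<Sum>v\<in>J. Rh p v * Rh v u) = of_bool (u = p) + \<kappa> * Rh p u + \<kappa> * mu0 * Dc p * Crow u"
    and sq2: "(\<Sum>v\<in>J. Rh p v * Rh v u) = of_bool (p = u) + \<kappa> * Rh p u + \<kappa> * mu0 * Crow u * Dc p"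
    if "p \<in> J" "u \<in> J" for p u
    unfolding Rh_square[OF that] by (auto simp: Dc_def Crow_def algebra_simps)
  \<comment> \<open>Both orders of the product of \<open>Rh\<close> squared with the matrix
    \<open>tt B s\<close> agree; the parts coming from the identity and from \<open>Rh\<close>
    cancel, which leaves the rank one parts.\<close>
  have main: "(\<kappa> * mu0 * Dc p) \<odot>\<^bsub>B\<^esub> lincomb B J Crow (\<lambda>u. tt B s u r) =
      (\<kappa> * mu0 * Crow r) \<odot>\<^bsub>B\<^esub> lincomb B J Dc (tt B s p)" if pr: "p \<in> J" "r \<in> J" for p r
  proof -
    let ?X = "lincomb B J (Rh p) (\<lambda>u. tt B s u r)"
    let ?L = "lincomb B J Crow (\<lambda>u. tt B s u r)" and ?D = "lincomb B J Dc (tt B s p)"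
    have c: "?X \<in> carrier B" "?L \<in> carrier B" "?D \<in> carrier B" "tt B s p r \<in> carrier B"
      using cl pr by (auto intro!: lincomb_closed)
    have "lincomb B J (\<lambda>u. \<Sum>v\<in>J. Rh p v * Rh v u) (\<lambda>u. tt B s u r) =
        lincomb B J (Rh p) (\<lambda>v. lincomb B J (Rh v) (\<lambda>u. tt B s u r))"
      by (rule lincomb_lincomb[symmetric]) (use cl pr in auto)
    also have "\<dots> = lincomb B J (Rh p) (\<lambda>v. lincomb B J (\<lambda>u. Rh u r) (tt B s v))"
      by (rule lincomb_cong) (use R cl pr in auto)
    also have "\<dots> = lincomb B J (\<lambda>u. Rh u r) (\<lambda>u. lincomb B J (Rh p) (\<lambda>v. tt B s v u))"
      by (rule lincomb_swap) (use cl in auto)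
    also have "\<dots> = lincomb B J (\<lambda>u. Rh u r) (\<lambda>u. lincomb B J (\<lambda>v. Rh v u) (tt B s p))"
      by (rule lincomb_cong) (use R cl pr in auto)
    also have "\<dots> = lincomb B J (\<lambda>v. \<Sum>u\<in>J. Rh u r * Rh v u) (tt B s p)"
      by (rule lincomb_lincomb) (use cl pr in auto)
    finally have e: "lincomb B J (\<lambda>u. \<Sum>v\<in>J. Rh p v * Rh v u) (\<lambda>u. tt B s u r) =
        lincomb B J (\<lambda>v. \<Sum>u\<in>J. Rh v u * Rh u r) (tt B s p)" by (simp add: mult.commute)
    have l: "lincomb B J (\<lambda>u. \<Sum>v\<in>J. Rh p v * Rh v u) (\<lambda>u. tt B s u r) =
        tt B s p r \<oplus>\<^bsub>B\<^esub> \<kappa> \<odot>\<^bsub>B\<^esub> ?X \<oplus>\<^bsub>B\<^esub> (\<kappa> * mu0 * Dc p) \<odot>\<^bsub>B\<^esub> ?L"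
    proof -
      have "lincomb B J (\<lambda>u. \<Sum>v\<in>J. Rh p v * Rh v u) (\<lambda>u. tt B s u r) =
         lincomb B J (\<lambda>u. of_bool (u = p) + \<kappa> * Rh p u + \<kappa> * mu0 * Dc p * Crow u) (\<lambda>u. tt B s u r)"
        by (rule lincomb_cong) (use pr cl in \<open>auto simp: sq1\<close>)
      moreover have "lincomb B J (\<lambda>u. of_bool (u = p)) (\<lambda>u. tt B s u r) = of_bool (p = p) \<odot>\<^bsub>B\<^esub> tt B s p r"
        by (rule lincomb_single) (use pr cl in auto)
      ultimately show ?thesis using pr cl c
        by (simp add: lincomb_add_coeff smult_lincomb)
    qed
    have r: "lincomb B J (\<lambda>v. \<Sum>u\<in>J. Rh v u * Rh u r) (tt B s p) =
        tt B s p r \<oplus>\<^bsub>B\<^esub> \<kappa> \<odot>\<^bsub>B\<^esub> ?X \<oplus>\<^bsub>B\<^esub> (\<kappa> * mu0 * Crow r) \<odot>\<^bsub>B\<^esub> ?D"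
    proof -
      have "lincomb B J (\<lambda>v. \<Sum>u\<in>J. Rh v u * Rh u r) (tt B s p) =
         lincomb B J (\<lambda>v. of_bool (v = r) + \<kappa> * Rh v r + \<kappa> * mu0 * Crow r * Dc v) (tt B s p)"
        by (rule lincomb_cong) (use pr cl in \<open>auto simp: sq2\<close>)
      moreover have "lincomb B J (\<lambda>u. of_bool (u = r)) (tt B s p) = of_bool (r = r) \<odot>\<^bsub>B\<^esub> tt B s p r"
        by (rule lincomb_single) (use pr cl in auto)
      ultimately show ?thesis using pr cl c R[OF pr]
        by (simp add: lincomb_add_coeff smult_lincomb)
    qed
    show ?thesis by (rule sum_left_cancel[OF _ _ _ e[unfolded l r]]) (use c in auto)
  qed
  \<comment> \<open>Any pair at which \<open>Dc\<close> is nonzero serves to solve for the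
    eigenvalue; this one is available since \<open>n \<ge> 1\<close>.\<close>
  let ?p = "(1, - 1) :: int \<times> int"
  have p: "?p \<in> J" using n1 by (auto simp: idx_def J_def)
  have Dp: "Dc ?p \<noteq> 0" using Dv_nonzero[of 1] by (simp add: Dc_def)
  let ?Q = "inverse (Dc ?p) \<odot>\<^bsub>B\<^esub> lincomb B J Dc (tt B s ?p)"
  have cD: "lincomb B J Dc (tt B s ?p) \<in> carrier B" by (rule lincomb_closed) (use cl p in blast)
  have "lincomb B J Crow (\<lambda>u. tt B s u r) = Crow r \<odot>\<^bsub>B\<^esub> ?Q" if r: "r \<in> J" for r
  proof (rule smult_cancel[of "\<kappa> * mu0 * Dc ?p"])
    have "lincomb B J Crow (\<lambda>u. tt B s u r) \<in> carrier B" by (rule lincomb_closed) (use cl r in blast)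
    then show "lincomb B J Crow (\<lambda>u. tt B s u r) \<in> carrier B" .
    show "(\<kappa> * mu0 * Dc ?p) \<odot>\<^bsub>B\<^esub> lincomb B J Crow (\<lambda>u. tt B s u r) = (\<kappa> * mu0 * Dc ?p) \<odot>\<^bsub>B\<^esub> (Crow r \<odot>\<^bsub>B\<^esub> ?Q)"
      unfolding main[OF p r] using cD Dp by (simp add: algebra_simps)
  qed (use \<kappa> mu0 Dp cD in auto)
  then show ?thesis using cD by (intro bexI[of _ ?Q]) auto
qed

text \<open>One eigenvalue serves all columns, so it can be read off at \<open>(1, - 1)\<close>,
  where \<open>C\<close> does not vanish. The relation \<open>Q = 1\<close> supplies just this
  column.\<close>

lemma spoI:
  assumes B: "superalgebra B" and s: "rtt B s" and \<kappa>: "\<kappa> \<noteq> 0"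
    and one: "lincomb B J Crow (\<lambda>u. tt B s u (1, - 1)) = Crow (1, - 1) \<odot>\<^bsub>B\<^esub> \<one>\<^bsub>B\<^esub>"
  shows "spo B s"
proof -
  interpret superalgebra B by fact
  obtain Q where Q: "Q \<in> carrier B" "\<forall>r\<in>J. lincomb B J Crow (\<lambda>u. tt B s u r) = Crow r \<odot>\<^bsub>B\<^esub> Q"
    using rtt_Crow[OF B s \<kappa>] by blast
  have p: "(1, - 1) \<in> J" using n1 by (auto simp: idx_def J_def)
  have "Q = \<one>\<^bsub>B\<^esub>"
    by (rule smult_cancel[of "Crow (1, - 1)"]) (use Q p one Cv_nonzero[of 1] in \<open>auto simp: Crow_def Cv_def\<close>)
  then show ?thesis using s Q by (simp add: spo_def)
qed

end

section \<open>Images of quadratic expressions under homomorphisms from a free superalgebra\<close>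

lemma var_carrier: "x \<in> X \<Longrightarrow> var x \<in> carrier (free_superalgebra X d :: ('k::field, _) superalgebra)"
  by (simp add: free_carrier var_def)

lemma free_lincomb:
  assumes "finite I" "\<And>i. i \<in> I \<Longrightarrow> x i \<in> carrier (free_superalgebra X d)"
  shows "lincomb (free_superalgebra X d) I c x = (\<Sum>i\<in>I. const (c i) * x i)"
proof -
  interpret F: superalgebra "free_superalgebra X d" by (rule superalgebra_free)
  show ?thesis using assms
    by (induction I rule: finite_induct) (simp_all add: F.lincomb_insert const_mult)
qed

context
  fixes X :: "'x set" and d :: "'x \<Rightarrow> bit" and B :: "('k::field, 'b, 'p) superalgebra_scheme" and f
  assumes B: "superalgebra B" and f: "f \<in> superalgebra_hom (free_superalgebra X d) B"
begin

lemma hom_free_minus: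
  assumes "x \<in> carrier (free_superalgebra X d)" "y \<in> carrier (free_superalgebra X d)"
  shows "f (x - y) = f x \<ominus>\<^bsub>B\<^esub> f y"
proof -
  interpret B: superalgebra B by (rule B)
  interpret F: superalgebra "free_superalgebra X d :: ('k, _) superalgebra" by (rule superalgebra_free)
  have "x - y = x \<oplus>\<^bsub>free_superalgebra X d\<^esub> ((- 1) \<odot>\<^bsub>free_superalgebra X d\<^esub> y)" by simp
  moreover have "(- 1) \<odot>\<^bsub>free_superalgebra X d\<^esub> y \<in> carrier (free_superalgebra X d)" using assms by (rule_tac F.smult_in_carrier)
  ultimately have "f (x - y) = f x \<oplus>\<^bsub>B\<^esub> ((- 1) \<odot>\<^bsub>B\<^esub> f y)"
    using assms by (simp only: hom_add[OF f] hom_smult[OF f])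
  then show ?thesis using assms hom_closed[OF f] by (simp add: a_minus_def B.minus_eq_smult)
qed

lemma quadratic_carrier:
  assumes "\<And>i. i \<in> I \<Longrightarrow> u i \<in> X \<and> v i \<in> X"
  shows "i \<in> I \<Longrightarrow> var (u i) * var (v i) \<in> carrier (free_superalgebra X d :: ('k, _) superalgebra)"
proof -
  interpret F: superalgebra "free_superalgebra X d :: ('k, _) superalgebra" by (rule superalgebra_free)
  assume "i \<in> I"
  then have "var (u i) \<in> carrier (free_superalgebra X d :: ('k, _) superalgebra)" "var (v i) \<in> carrier (free_superalgebra X d :: ('k, _) superalgebra)"
    using assms by (simp_all add: var_carrier)
  from F.m_closed[OF this] show "var (u i) * var (v i) \<in> carrier (free_superalgebra X d :: ('k, _) superalgebra)" by simp
qed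

text \<open>Serves both sides of the relations of \<open>A(R)\<close> as well as the sum in the last
  Weyl relation.\<close>

lemma hom_quadratic:
  assumes "finite I" "\<And>i. i \<in> I \<Longrightarrow> u i \<in> X \<and> v i \<in> X"
  shows "f (\<Sum>i\<in>I. const (c i) * var (u i) * var (v i)) =
    lincomb B I c (\<lambda>i. f (var (u i)) \<otimes>\<^bsub>B\<^esub> f (var (v i)))"
    and "(\<Sum>i\<in>I. const (c i) * var (u i) * var (v i)) \<in> carrier (free_superalgebra X d)"
proof -
  interpret B: superalgebra B by (rule B)
  interpret F: superalgebra "free_superalgebra X d :: ('k, _) superalgebra" by (rule superalgebra_free)
  have q: "var (u i) * var (v i) \<in> carrier (free_superalgebra X d :: ('k, _) superalgebra)" if "i \<in> I" for i
    using quadratic_carrier[of I u v, OF assms(2) that] by simp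
  have v: "var (u i) \<in> carrier (free_superalgebra X d :: ('k, _) superalgebra)"
    "var (v i) \<in> carrier (free_superalgebra X d :: ('k, _) superalgebra)" if "i \<in> I" for i
    using assms(2)[OF that] by (simp_all add: var_carrier)
  have e: "(\<Sum>i\<in>I. const (c i) * var (u i) * var (v i)) = lincomb (free_superalgebra X d) I c (\<lambda>i. var (u i) * var (v i))"
    using free_lincomb[OF assms(1), of "\<lambda>i. var (u i) * var (v i)", OF q] by (simp add: mult.assoc)
  show "(\<Sum>i\<in>I. const (c i) * var (u i) * var (v i)) \<in> carrier (free_superalgebra X d)"
    unfolding e by (rule F.lincomb_closed) (rule q)
  have "f (\<Sum>i\<in>I. const (c i) * var (u i) * var (v i)) = lincomb B I c (\<lambda>i. f (var (u i) * var (v i)))"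
    unfolding e by (rule hom_lincomb[OF superalgebra_free B f assms(1)]) (rule q)
  also have "\<dots> = lincomb B I c (\<lambda>i. f (var (u i)) \<otimes>\<^bsub>B\<^esub> f (var (v i)))"
  proof (rule B.lincomb_cong[OF refl])
    fix i assume i: "i \<in> I"
    show "c i \<odot>\<^bsub>B\<^esub> f (var (u i) * var (v i)) = c i \<odot>\<^bsub>B\<^esub> (f (var (u i)) \<otimes>\<^bsub>B\<^esub> f (var (v i)))"
      using hom_mult[OF f v[OF i]] by simp
    show "f (var (u i)) \<otimes>\<^bsub>B\<^esub> f (var (v i)) \<in> carrier B" using v[OF i] hom_closed[OF f] by simp
  qed
  finally show "f (\<Sum>i\<in>I. const (c i) * var (u i) * var (v i)) =
    lincomb B I c (\<lambda>i. f (var (u i)) \<otimes>\<^bsub>B\<^esub> f (var (v i)))" .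
qed

end

text \<open>Homogeneity is asked only where the coefficient is nonzero, because parity is conserved
  only at the nonzero entries of \<open>R\<close>.\<close>

lemma (in superalgebra) homog_lincomb_support:
  assumes "finite I" "\<And>i. i \<in> I \<Longrightarrow> x i \<in> carrier A" "\<And>i. i \<in> I \<Longrightarrow> c i \<noteq> 0 \<Longrightarrow> x i \<in> homog A \<gamma>"
  shows "lincomb A I c x \<in> homog A \<gamma>"
proof -
  have "lincomb A I c x = lincomb A I (\<lambda>_. 1) (\<lambda>i. c i \<odot> x i)"
    by (rule lincomb_cong) (use assms in auto)
  also have "\<dots> \<in> homog A \<gamma>"
  proof (rule homog_lincomb[OF assms(1)])
    fix i assume i: "i \<in> I"
    show "c i \<odot> x i \<in> homog A \<gamma>" using assms(2,3)[OF i] by (cases "c i = 0") auto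
  qed
  finally show ?thesis .
qed

lemma (in ground_module) finsum_finsum_smult:
  assumes "finite I" "finite I'" "\<And>i j. i \<in> I \<Longrightarrow> j \<in> I' \<Longrightarrow> x i j \<in> carrier M"
  shows "(\<Oplus>\<^bsub>M\<^esub>i\<in>I. \<Oplus>\<^bsub>M\<^esub>j\<in>I'. c i j \<odot> x i j) = lincomb M (I \<times> I') (\<lambda>p. c (fst p) (snd p)) (\<lambda>p. x (fst p) (snd p))"
proof -
  have "(\<Oplus>\<^bsub>M\<^esub>i\<in>I. \<Oplus>\<^bsub>M\<^esub>j\<in>I'. c i j \<odot> x i j) = lincomb M I (\<lambda>_. 1) (\<lambda>i. lincomb M I' (c i) (x i))"
    unfolding lincomb_def by (rule M.finsum_cong') (use assms in \<open>auto intro!: M.finsum_closed\<close>)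
  also have "\<dots> = lincomb M (I \<times> I') (\<lambda>(i, j). 1 * c i j) (\<lambda>(i, j). x i j)"
    by (rule lincomb_product) (use assms in auto)
  finally show ?thesis by (simp add: case_prod_unfold)
qed

lemma (in ground_module) sub_eq_zero_iff:
  assumes "x \<in> carrier M" "y \<in> carrier M" shows "x \<ominus>\<^bsub>M\<^esub> y = \<zero>\<^bsub>M\<^esub> \<longleftrightarrow> x = y"
proof
  assume "x \<ominus>\<^bsub>M\<^esub> y = \<zero>\<^bsub>M\<^esub>"
  then have "\<ominus>\<^bsub>M\<^esub> y \<oplus> x = \<ominus>\<^bsub>M\<^esub> y \<oplus> y" using assms by (simp add: a_minus_def M.a_comm M.r_neg)
  then show "x = y" using assms by (intro sum_left_cancel[of "\<ominus>\<^bsub>M\<^esub> y" x y]) auto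
qed (use assms in \<open>simp add: a_minus_def M.r_neg\<close>)

section \<open>The universal properties of \<open>A(R)\<close> and \<open>SPO\<^sub>q(2n|2m)\<close>\<close>

text \<open>The sign between a defining relation of \<open>A(R)\<close> and its sign-free form. It
  involves the four free indices but no summation index, so it factors out of both sides and
  cancels.\<close>

definition rel_sign :: "bit \<Rightarrow> bit \<Rightarrow> bit \<Rightarrow> bit \<Rightarrow> int" where
  "rel_sign i j k l = sgnf i j * sgnf k k * sgnf l l * sgnf j k * sgnf l k * sgnf (k + l) (i + j)"

text \<open>On one side stand the sign of the relation and those of two generators, on the other the
  common sign together with those contained in \<open>Rh_Rq\<close> and \<open>tt\<close>.
  Conservation of parity by \<open>R\<close> makes the dependence on \<open>a\<close> and
  \<open>b\<close> agree.\<close>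

lemma rel_sign_left:
  assumes "i + j = a + b"
  shows "sgnf (j + l) (a + k) * (sgnf k (a + k) * sgnf l (b + l)) =
    rel_sign i j k l * (sgnf i j * sgnf (j + b) a) * sgnf (a + k) b"
  using assms unfolding rel_sign_def
  by (cases i; cases j; cases k; cases l; cases a; cases b) simp_all

lemma rel_sign_right:
  assumes "a + b = k + l"
  shows "sgnf (j + b) (a + k) * (sgnf b (j + b) * sgnf a (i + a)) =
    rel_sign i j k l * (sgnf a b * sgnf (b + l) k) * sgnf (j + b) i"
  using assms unfolding rel_sign_def
  by (cases i; cases j; cases k; cases l; cases a; cases b) simp_all

context quantum_parameters
begin

definition rel_left :: "int \<Rightarrow> int \<Rightarrow> int \<Rightarrow> int \<Rightarrow> ((int \<times> int) fmon \<Rightarrow>\<^sub>0 'k)" where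
  "rel_left i j k l = (\<Sum>p\<in>J. const (of_int (sgnf (\<eta> j + \<eta> l) (\<eta> (fst p) + \<eta> k)) * Rq n m q i j (fst p) (snd p))
     * var (fst p, k) * var (snd p, l))"

definition rel_right :: "int \<Rightarrow> int \<Rightarrow> int \<Rightarrow> int \<Rightarrow> ((int \<times> int) fmon \<Rightarrow>\<^sub>0 'k)" where
  "rel_right i j k l = (\<Sum>p\<in>J. const (of_int (sgnf (\<eta> j + \<eta> (snd p)) (\<eta> (fst p) + \<eta> k)) * Rq n m q (fst p) (snd p) k l)
     * var (j, snd p) * var (i, fst p))"

lemma AR_rels_eq: "AR_rels n m q = {rel_left i j k l - rel_right i j k l | i j k l. i \<in> I \<and> j \<in> I \<and> k \<in> I \<and> l \<in> I}"
  unfolding AR_rels_def rel_left_def rel_right_def J_def by (simp add: sum.cartesian_product split_beta)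

abbreviation "FT \<equiv> free_superalgebra (I \<times> I) (tdeg n) :: ('k, (int \<times> int) fmon \<Rightarrow>\<^sub>0 'k) superalgebra"

lemma var_pair: "i \<in> I \<Longrightarrow> j \<in> I \<Longrightarrow> var (i, j) \<in> homog FT (\<eta> i + \<eta> j)"
  using var_in_free[of "(i, j)" "I \<times> I" "tdeg n"] by (simp add: tdeg_def add.commute)

context
  fixes B :: "('k, 'b, 'p) superalgebra_scheme" and s f
  assumes B: "superalgebra B" and s: "\<forall>i\<in>I. \<forall>j\<in>I. s i j \<in> homog B (\<eta> i + \<eta> j)"
    and f: "f \<in> superalgebra_hom FT B" and fs: "\<And>i j. i \<in> I \<Longrightarrow> j \<in> I \<Longrightarrow> f (var (i, j)) = tsign i j \<odot>\<^bsub>B\<^esub> s i j"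
begin

lemma hom_rel_left:
  assumes "i \<in> I" "j \<in> I" "k \<in> I" "l \<in> I"
  shows "f (rel_left i j k l) = of_int (rel_sign (\<eta> i) (\<eta> j) (\<eta> k) (\<eta> l)) \<odot>\<^bsub>B\<^esub> lincomb B J (Rh (j, i)) (\<lambda>u. tt B s u (k, l))"
    and "rel_left i j k l \<in> carrier FT"
proof -
  interpret B: superalgebra B by (rule B)
  note cl = tt_closed[OF B s]
  note q = hom_quadratic[OF B f finite_J, of "\<lambda>p. (fst p, k)" "\<lambda>p. (snd p, l)"]
  have m: "(fst p, k) \<in> I \<times> I \<and> (snd p, l) \<in> I \<times> I" if "p \<in> J" for p using that assms by (auto simp: J_def)
  show "rel_left i j k l \<in> carrier FT" unfolding rel_left_def by (rule q(2)) (rule m)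
  have sc: "s x y \<in> carrier B" if "x \<in> I" "y \<in> I" for x y using s that B.homog_carrier by blast
  have kl: "(k, l) \<in> J" using assms by (simp add: J_def)
  have "f (rel_left i j k l) = lincomb B J
      (\<lambda>p. of_int (sgnf (\<eta> j + \<eta> l) (\<eta> (fst p) + \<eta> k)) * Rq n m q i j (fst p) (snd p))
      (\<lambda>p. f (var (fst p, k)) \<otimes>\<^bsub>B\<^esub> f (var (snd p, l)))"
    unfolding rel_left_def by (rule q(1)) (rule m)
  also have "\<dots> = lincomb B J (\<lambda>p. of_int (rel_sign (\<eta> i) (\<eta> j) (\<eta> k) (\<eta> l)) * Rh (j, i) p) (\<lambda>u. tt B s u (k, l))"
  proof (rule B.lincomb_cong[OF refl])
    fix p assume p: "p \<in> J"
    show "tt B s p (k, l) \<in> carrier B" using cl p kl by blast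
    obtain a b where ab: "p = (a, b)" "a \<in> I" "b \<in> I" using p by (auto simp: J_def)
    let ?c = "of_int (sgnf (\<eta> j + \<eta> l) (\<eta> a + \<eta> k)) * Rq n m q i j a b"
    have "?c \<odot>\<^bsub>B\<^esub> (f (var (a, k)) \<otimes>\<^bsub>B\<^esub> f (var (b, l))) = (?c * (tsign a k * tsign b l)) \<odot>\<^bsub>B\<^esub> (s a k \<otimes>\<^bsub>B\<^esub> s b l)"
      using ab assms sc by (simp add: fs B.smult_mult_left B.smult_mult_right ac_simps)
    \<comment> \<open>Where the entry of \<open>R\<close> vanishes so does that of
      \<open>Rh\<close>; elsewhere parity is conserved and the sign identity applies.\<close>
    also have "?c * (tsign a k * tsign b l) = of_int (rel_sign (\<eta> i) (\<eta> j) (\<eta> k) (\<eta> l)) * Rh (j, i) (a, b) *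
        of_int (sgnf (\<eta> a + \<eta> k) (\<eta> b))"
    proof (cases "Rq n m q i j a b = 0")
      case True
      then show ?thesis using ab assms by (simp add: Rh_Rq)
    next
      case False
      then have "\<eta> i + \<eta> j = \<eta> a + \<eta> b" using Rq_parity ab assms by blast
      from rel_sign_left[OF this, of "\<eta> l" "\<eta> k"]
      have "of_int (sgnf (\<eta> j + \<eta> l) (\<eta> a + \<eta> k)) * (tsign a k * tsign b l) =
          (of_int (rel_sign (\<eta> i) (\<eta> j) (\<eta> k) (\<eta> l)) * of_int (sig2 n i j * sgnf (\<eta> j + \<eta> b) (\<eta> a)) *
          of_int (sgnf (\<eta> a + \<eta> k) (\<eta> b)) :: 'k)"
        unfolding tsign_def sig2_def of_int_mult[symmetric] by simp
      then have "Rq n m q i j a b * (of_int (sgnf (\<eta> j + \<eta> l) (\<eta> a + \<eta> k)) * (tsign a k * tsign b l)) =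
          Rq n m q i j a b * (of_int (rel_sign (\<eta> i) (\<eta> j) (\<eta> k) (\<eta> l)) * of_int (sig2 n i j * sgnf (\<eta> j + \<eta> b) (\<eta> a)) *
          of_int (sgnf (\<eta> a + \<eta> k) (\<eta> b)))" by simp
      then show ?thesis using ab assms by (simp only: Rh_Rq mult.assoc mult.left_commute mult.commute)
    qed
    finally show "(of_int (sgnf (\<eta> j + \<eta> l) (\<eta> (fst p) + \<eta> k)) * Rq n m q i j (fst p) (snd p)) \<odot>\<^bsub>B\<^esub>
        (f (var (fst p, k)) \<otimes>\<^bsub>B\<^esub> f (var (snd p, l))) =
        (of_int (rel_sign (\<eta> i) (\<eta> j) (\<eta> k) (\<eta> l)) * Rh (j, i) p) \<odot>\<^bsub>B\<^esub> tt B s p (k, l)"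
      using ab assms sc by (simp add: tt_def)
  qed
  finally show "f (rel_left i j k l) = of_int (rel_sign (\<eta> i) (\<eta> j) (\<eta> k) (\<eta> l)) \<odot>\<^bsub>B\<^esub> lincomb B J (Rh (j, i)) (\<lambda>u. tt B s u (k, l))"
    using cl kl by (subst B.smult_lincomb) auto
qed

lemma hom_rel_right:
  assumes "i \<in> I" "j \<in> I" "k \<in> I" "l \<in> I"
  shows "f (rel_right i j k l) = of_int (rel_sign (\<eta> i) (\<eta> j) (\<eta> k) (\<eta> l)) \<odot>\<^bsub>B\<^esub> lincomb B J (\<lambda>u. Rh u (k, l)) (tt B s (j, i))"
    and "rel_right i j k l \<in> carrier FT"
proof -
  interpret B: superalgebra B by (rule B)
  note cl = tt_closed[OF B s]
  note q = hom_quadratic[OF B f finite_J, of "\<lambda>p. (j, snd p)" "\<lambda>p. (i, fst p)"]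
  have m: "(j, snd p) \<in> I \<times> I \<and> (i, fst p) \<in> I \<times> I" if "p \<in> J" for p using that assms by (auto simp: J_def)
  show "rel_right i j k l \<in> carrier FT" unfolding rel_right_def by (rule q(2)) (rule m)
  have sc: "s x y \<in> carrier B" if "x \<in> I" "y \<in> I" for x y using s that B.homog_carrier by blast
  have ji: "(j, i) \<in> J" using assms by (simp add: J_def)
  have sw: "prod.swap ` J = J" by (force simp: J_def)
  have sm: "(b, a) \<in> J" if "(a, b) \<in> J" for a b using that by (auto simp: J_def)
  have "f (rel_right i j k l) = lincomb B J
      (\<lambda>p. of_int (sgnf (\<eta> j + \<eta> (snd p)) (\<eta> (fst p) + \<eta> k)) * Rq n m q (fst p) (snd p) k l)
      (\<lambda>p. f (var (j, snd p)) \<otimes>\<^bsub>B\<^esub> f (var (i, fst p)))"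
    unfolding rel_right_def by (rule q(1)) (rule m)
  \<comment> \<open>The factors carry the summation indices in the order \<open>(b, a)\<close>, so
    the index pair is swapped to obtain a matrix product.\<close>
  also have "\<dots> = lincomb B J (\<lambda>p. of_int (rel_sign (\<eta> i) (\<eta> j) (\<eta> k) (\<eta> l)) * Rh (prod.swap p) (k, l)) (\<lambda>p. tt B s (j, i) (prod.swap p))"
  proof (rule B.lincomb_cong[OF refl])
    fix p assume p: "p \<in> J"
    then show "tt B s (j, i) (prod.swap p) \<in> carrier B" using cl ji sw by blast
    obtain a b where ab: "p = (a, b)" "a \<in> I" "b \<in> I" using p by (auto simp: J_def)
    let ?c = "of_int (sgnf (\<eta> j + \<eta> b) (\<eta> a + \<eta> k)) * Rq n m q a b k l"
    have "?c \<odot>\<^bsub>B\<^esub> (f (var (j, b)) \<otimes>\<^bsub>B\<^esub> f (var (i, a))) = (?c * (tsign j b * tsign i a)) \<odot>\<^bsub>B\<^esub> (s j b \<otimes>\<^bsub>B\<^esub> s i a)"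
      using ab assms sc by (simp add: fs B.smult_mult_left B.smult_mult_right ac_simps)
    also have "?c * (tsign j b * tsign i a) = of_int (rel_sign (\<eta> i) (\<eta> j) (\<eta> k) (\<eta> l)) * Rh (b, a) (k, l) *
        of_int (sgnf (\<eta> j + \<eta> b) (\<eta> i))"
    proof (cases "Rq n m q a b k l = 0")
      case True
      then show ?thesis using ab assms by (simp add: Rh_Rq)
    next
      case False
      then have "\<eta> a + \<eta> b = \<eta> k + \<eta> l" using Rq_parity ab assms by blast
      from rel_sign_right[OF this, of "\<eta> j" "\<eta> i"]
      have "of_int (sgnf (\<eta> j + \<eta> b) (\<eta> a + \<eta> k)) * (tsign j b * tsign i a) =
          (of_int (rel_sign (\<eta> i) (\<eta> j) (\<eta> k) (\<eta> l)) * of_int (sig2 n a b * sgnf (\<eta> b + \<eta> l) (\<eta> k)) *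
          of_int (sgnf (\<eta> j + \<eta> b) (\<eta> i)) :: 'k)"
        unfolding tsign_def sig2_def of_int_mult[symmetric] by simp
      then have "Rq n m q a b k l * (of_int (sgnf (\<eta> j + \<eta> b) (\<eta> a + \<eta> k)) * (tsign j b * tsign i a)) =
          Rq n m q a b k l * (of_int (rel_sign (\<eta> i) (\<eta> j) (\<eta> k) (\<eta> l)) * of_int (sig2 n a b * sgnf (\<eta> b + \<eta> l) (\<eta> k)) *
          of_int (sgnf (\<eta> j + \<eta> b) (\<eta> i)))" by simp
      then show ?thesis using ab assms by (simp only: Rh_Rq mult.assoc mult.left_commute mult.commute)
    qed
    finally show "(of_int (sgnf (\<eta> j + \<eta> (snd p)) (\<eta> (fst p) + \<eta> k)) * Rq n m q (fst p) (snd p) k l) \<odot>\<^bsub>B\<^esub>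
        (f (var (j, snd p)) \<otimes>\<^bsub>B\<^esub> f (var (i, fst p))) =
        (of_int (rel_sign (\<eta> i) (\<eta> j) (\<eta> k) (\<eta> l)) * Rh (prod.swap p) (k, l)) \<odot>\<^bsub>B\<^esub> tt B s (j, i) (prod.swap p)"
      using ab assms sc by (simp add: tt_def)
  qed
  also have "\<dots> = lincomb B (prod.swap ` J) (\<lambda>p. of_int (rel_sign (\<eta> i) (\<eta> j) (\<eta> k) (\<eta> l)) * Rh p (k, l)) (tt B s (j, i))"
    by (rule B.lincomb_reindex[symmetric]) (auto intro!: cl ji sm)
  finally show "f (rel_right i j k l) = of_int (rel_sign (\<eta> i) (\<eta> j) (\<eta> k) (\<eta> l)) \<odot>\<^bsub>B\<^esub> lincomb B J (\<lambda>u. Rh u (k, l)) (tt B s (j, i))"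
    unfolding sw using cl ji by (subst B.smult_lincomb) auto
qed

text \<open>An equivalence because it is used both ways: to read the matrix identity off the
  generators of \<open>A(R)\<close>, and to verify the relations when a homomorphism is to be
  constructed.\<close>

lemma hom_rel_iff:
  assumes "i \<in> I" "j \<in> I" "k \<in> I" "l \<in> I"
  shows "f (rel_left i j k l - rel_right i j k l) = \<zero>\<^bsub>B\<^esub> \<longleftrightarrow>
    lincomb B J (Rh (j, i)) (\<lambda>u. tt B s u (k, l)) = lincomb B J (\<lambda>u. Rh u (k, l)) (tt B s (j, i))"
proof -
  interpret B: superalgebra B by (rule B)
  note cl = tt_closed[OF B s]
  have J: "(k, l) \<in> J" "(j, i) \<in> J" using assms by (simp_all add: J_def)
  let ?L = "lincomb B J (Rh (j, i)) (\<lambda>u. tt B s u (k, l))" and ?R = "lincomb B J (\<lambda>u. Rh u (k, l)) (tt B s (j, i))"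
  let ?e = "of_int (rel_sign (\<eta> i) (\<eta> j) (\<eta> k) (\<eta> l)) :: 'k"
  have c: "?L \<in> carrier B" "?R \<in> carrier B" using cl J by (auto intro!: B.lincomb_closed)
  have e0: "?e \<noteq> 0" unfolding rel_sign_def by (cases "\<eta> i"; cases "\<eta> j"; cases "\<eta> k"; cases "\<eta> l") simp_all
  have "f (rel_left i j k l - rel_right i j k l) = ?e \<odot>\<^bsub>B\<^esub> ?L \<ominus>\<^bsub>B\<^esub> ?e \<odot>\<^bsub>B\<^esub> ?R"
    using hom_free_minus[OF B f hom_rel_left(2)[OF assms] hom_rel_right(2)[OF assms]]
    by (simp add: hom_rel_left(1)[OF assms] hom_rel_right(1)[OF assms])
  moreover have "?e \<odot>\<^bsub>B\<^esub> ?L \<ominus>\<^bsub>B\<^esub> ?e \<odot>\<^bsub>B\<^esub> ?R = \<zero>\<^bsub>B\<^esub> \<longleftrightarrow> ?e \<odot>\<^bsub>B\<^esub> ?L = ?e \<odot>\<^bsub>B\<^esub> ?R"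
    by (rule B.sub_eq_zero_iff[OF B.smult_in_carrier[OF c(1)] B.smult_in_carrier[OF c(2)]])
  moreover have "?L = ?R" if "?e \<odot>\<^bsub>B\<^esub> ?L = ?e \<odot>\<^bsub>B\<^esub> ?R"
    by (rule B.smult_cancel[OF e0 c that])
  ultimately show ?thesis by metis
qed

end

lemma rel_homog:
  assumes "i \<in> I" "j \<in> I" "k \<in> I" "l \<in> I"
  shows "rel_left i j k l - rel_right i j k l \<in> homog FT ((\<eta> i + \<eta> j) + (\<eta> k + \<eta> l))"
proof -
  interpret F: superalgebra FT by (rule superalgebra_free)
  have vc: "var (x, y) * var (z, w) \<in> homog FT ((\<eta> x + \<eta> y) + (\<eta> z + \<eta> w))" if "x \<in> I" "y \<in> I" "z \<in> I" "w \<in> I" for x y z w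
    using F.homog_mult[OF var_pair[OF that(1,2)] var_pair[OF that(3,4)]] by simp
  have m: "fst p \<in> I" "snd p \<in> I" if "p \<in> J" for p using that by (auto simp: J_def)
  have c: "var (x, y) * var (z, w) \<in> carrier FT" if "x \<in> I" "y \<in> I" "z \<in> I" "w \<in> I" for x y z w
    by (rule F.homog_carrier[OF vc[OF that]])
  have deg: "x + y + (z + w) = i + j + (k + l)" if "i + j = x + z" "y = k" "w = l" for x y z w i j k l :: bit
    using that by (simp add: ac_simps)
  have "rel_left i j k l = lincomb FT J (\<lambda>p. of_int (sgnf (\<eta> j + \<eta> l) (\<eta> (fst p) + \<eta> k)) * Rq n m q i j (fst p) (snd p))
     (\<lambda>p. var (fst p, k) * var (snd p, l))"
    unfolding rel_left_def using c m assms by (subst free_lincomb) (auto simp: mult.assoc)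
  also have "\<dots> \<in> homog FT ((\<eta> i + \<eta> j) + (\<eta> k + \<eta> l))"
  proof (rule F.homog_lincomb_support[OF finite_J])
    fix p assume p: "p \<in> J"
    note v = vc[OF m(1)[OF p] assms(3) m(2)[OF p] assms(4)]
    show "var (fst p, k) * var (snd p, l) \<in> carrier FT" by (rule F.homog_carrier[OF v])
    assume "of_int (sgnf (\<eta> j + \<eta> l) (\<eta> (fst p) + \<eta> k)) * Rq n m q i j (fst p) (snd p) \<noteq> 0"
    then have "\<eta> i + \<eta> j = \<eta> (fst p) + \<eta> (snd p)" using Rq_parity[OF assms(1,2) m[OF p]] by auto
    from deg[OF this refl refl] show "var (fst p, k) * var (snd p, l) \<in> homog FT ((\<eta> i + \<eta> j) + (\<eta> k + \<eta> l))"
      using v by (simp only:)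
  qed
  finally have l: "rel_left i j k l \<in> homog FT ((\<eta> i + \<eta> j) + (\<eta> k + \<eta> l))" .
  have "rel_right i j k l = lincomb FT J (\<lambda>p. of_int (sgnf (\<eta> j + \<eta> (snd p)) (\<eta> (fst p) + \<eta> k)) * Rq n m q (fst p) (snd p) k l)
     (\<lambda>p. var (j, snd p) * var (i, fst p))"
    unfolding rel_right_def using c m assms by (subst free_lincomb) (auto simp: mult.assoc)
  also have "\<dots> \<in> homog FT ((\<eta> i + \<eta> j) + (\<eta> k + \<eta> l))"
  proof (rule F.homog_lincomb_support[OF finite_J])
    fix p assume p: "p \<in> J"
    note v = vc[OF assms(2) m(2)[OF p] assms(1) m(1)[OF p]]
    show "var (j, snd p) * var (i, fst p) \<in> carrier FT" by (rule F.homog_carrier[OF v])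
    assume "of_int (sgnf (\<eta> j + \<eta> (snd p)) (\<eta> (fst p) + \<eta> k)) * Rq n m q (fst p) (snd p) k l \<noteq> 0"
    then have "\<eta> (fst p) + \<eta> (snd p) = \<eta> k + \<eta> l" using Rq_parity[OF m[OF p] assms(3,4)] by auto
    then have "\<eta> j + \<eta> (snd p) + (\<eta> i + \<eta> (fst p)) = \<eta> i + \<eta> j + (\<eta> k + \<eta> l)"
      by (metis add.assoc add.commute)
    then show "var (j, snd p) * var (i, fst p) \<in> homog FT ((\<eta> i + \<eta> j) + (\<eta> k + \<eta> l))"
      using v by (simp only:)
  qed
  finally have r: "rel_right i j k l \<in> homog FT ((\<eta> i + \<eta> j) + (\<eta> k + \<eta> l))" .
  have "rel_left i j k l - rel_right i j k l = rel_left i j k l \<oplus>\<^bsub>FT\<^esub> ((- 1) \<odot>\<^bsub>FT\<^esub> rel_right i j k l)"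
    by simp
  also have "\<dots> \<in> homog FT ((\<eta> i + \<eta> j) + (\<eta> k + \<eta> l))"
    by (rule F.homog_plus[OF l F.homog_smult[OF r]])
  finally show ?thesis .
qed

sublocale AR: presentation "I \<times> I" "tdeg n" "AR_rels n m q"
  by unfold_locales (unfold AR_rels_eq, use rel_homog in blast)

lemma superalgebra_AR: "superalgebra (AR n m q)"
  unfolding AR_def by (rule AR.superalgebra_presented)

definition sAR :: "int \<Rightarrow> int \<Rightarrow> ((int \<times> int) fmon \<Rightarrow>\<^sub>0 'k) set" where
  "sAR i j = tsign i j \<odot>\<^bsub>AR n m q\<^esub> AR_gen n m q i j"

lemma AR_gen_homog: "i \<in> I \<Longrightarrow> j \<in> I \<Longrightarrow> AR_gen n m q i j \<in> homog (AR n m q) (\<eta> i + \<eta> j)"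
  using AR.gen_homog[of "(i, j)"] by (simp add: AR_gen_def AR_def tdeg_def add.commute)

lemma rtt_AR: "rtt (AR n m q) sAR"
proof -
  interpret A: superalgebra "AR n m q" by (rule superalgebra_AR)
  have h: "\<forall>i\<in>I. \<forall>j\<in>I. sAR i j \<in> homog (AR n m q) (\<eta> i + \<eta> j)"
    using AR_gen_homog by (auto simp: sAR_def)
  have f: "AR.Id.proj \<in> superalgebra_hom FT (AR n m q)" unfolding AR_def by (rule AR.proj_hom)
  have fs: "AR.Id.proj (var (i, j)) = tsign i j \<odot>\<^bsub>AR n m q\<^esub> sAR i j" if "i \<in> I" "j \<in> I" for i j
  proof -
    have "AR.Id.proj (var (i, j)) = AR_gen n m q i j" by (simp add: AR_gen_def presented_gen_def)
    then show ?thesis using AR_gen_homog[OF that] by (auto simp: sAR_def)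
  qed
  have "lincomb (AR n m q) J (Rh p) (\<lambda>u. tt (AR n m q) sAR u r) = lincomb (AR n m q) J (\<lambda>u. Rh u r) (tt (AR n m q) sAR p)"
    if pr: "p \<in> J" "r \<in> J" for p r
  proof -
    obtain i j k l where e: "p = (j, i)" "r = (k, l)" by (cases p; cases r)
    then have m: "i \<in> I" "j \<in> I" "k \<in> I" "l \<in> I" using pr by (auto simp: J_def)
    have "rel_left i j k l - rel_right i j k l \<in> AR_rels n m q" using m unfolding AR_rels_eq by blast
    then have "AR.Id.proj (rel_left i j k l - rel_right i j k l) = \<zero>\<^bsub>AR n m q\<^esub>"
      unfolding AR_def by (rule AR.proj_rels)
    moreover have "(AR.Id.proj (rel_left i j k l - rel_right i j k l) = \<zero>\<^bsub>AR n m q\<^esub>) \<longleftrightarrow>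
      lincomb (AR n m q) J (Rh (j, i)) (\<lambda>u. tt (AR n m q) sAR u (k, l)) =
      lincomb (AR n m q) J (\<lambda>u. Rh u (k, l)) (tt (AR n m q) sAR (j, i))"
      by (rule hom_rel_iff[OF superalgebra_AR h f fs m])
    ultimately show ?thesis unfolding e by blast
  qed
  then show ?thesis using h by (simp add: rtt_def)
qed

lemma AR_lift:
  assumes B: "superalgebra B" and s: "rtt B s"
  shows "\<exists>g\<in>superalgebra_hom (AR n m q) B. \<forall>i\<in>I. \<forall>j\<in>I. g (sAR i j) = s i j"
proof -
  interpret B: superalgebra B by (rule B)
  interpret A: superalgebra "AR n m q" by (rule superalgebra_AR)
  have h: "\<forall>i\<in>I. \<forall>j\<in>I. s i j \<in> homog B (\<eta> i + \<eta> j)" using s by (simp add: rtt_def)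
  let ?b = "\<lambda>x. tsign (fst x) (snd x) \<odot>\<^bsub>B\<^esub> s (fst x) (snd x)"
  have "\<exists>g\<in>superalgebra_hom AR.PX B. \<forall>x\<in>I \<times> I. g (AR.gen x) = ?b x"
  proof (rule AR.presented_lift[OF B])
    fix x assume "x \<in> I \<times> I"
    then show "?b x \<in> homog B (tdeg n x)" using h by (auto simp: tdeg_def add.commute)
  next
    fix f and r assume f: "f \<in> superalgebra_hom AR.FX B" and fb: "\<And>x. x \<in> I \<times> I \<Longrightarrow> f (var x) = ?b x"
      and "r \<in> AR_rels n m q"
    then obtain i j k l where m: "i \<in> I" "j \<in> I" "k \<in> I" "l \<in> I" and r: "r = rel_left i j k l - rel_right i j k l"
      by (auto simp: AR_rels_eq)
    have "f (var (x, y)) = tsign x y \<odot>\<^bsub>B\<^esub> s x y" if "x \<in> I" "y \<in> I" for x y using fb[of "(x, y)"] that by simp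
    from hom_rel_iff[OF B h f this m] show "f r = \<zero>\<^bsub>B\<^esub>" using s m unfolding r by (simp add: rtt_def J_def)
  qed
  then obtain g where g: "g \<in> superalgebra_hom (AR n m q) B" "\<forall>x\<in>I \<times> I. g (AR.gen x) = ?b x"
    unfolding AR_def by blast
  have "g (sAR i j) = s i j" if "i \<in> I" "j \<in> I" for i j
  proof -
    have "g (AR_gen n m q i j) = tsign i j \<odot>\<^bsub>B\<^esub> s i j" using g(2) that by (auto simp: AR_gen_def)
    moreover have "s i j \<in> carrier B" "AR_gen n m q i j \<in> carrier (AR n m q)"
      using that h AR_gen_homog[OF that] B.homog_carrier A.homog_carrier by blast+
    ultimately show ?thesis by (simp add: sAR_def hom_smult[OF g(1)])
  qed
  then show ?thesis using g by blast
qed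

lemma AR_hom_eq:
  assumes B: "superalgebra B" and f: "f \<in> superalgebra_hom (AR n m q) B" and g: "g \<in> superalgebra_hom (AR n m q) B"
    and e: "\<And>i j. i \<in> I \<Longrightarrow> j \<in> I \<Longrightarrow> f (AR_gen n m q i j) = g (AR_gen n m q i j)" and p: "p \<in> carrier (AR n m q)"
  shows "f p = g p"
  using AR.presented_hom_eq[OF B f[unfolded AR_def] g[unfolded AR_def] _ p[unfolded AR_def]] e
  by (auto simp: AR_gen_def)

end

text \<open>For double sums whose coefficients depend on both indices, as when a matrix is moved
  from one tensor factor to the other.\<close>

lemma (in ground_module) lincomb_swap_coeff:
  assumes "finite I" "finite J" "\<And>i j. i \<in> I \<Longrightarrow> j \<in> J \<Longrightarrow> x i j \<in> carrier M"
  shows "lincomb M I (\<lambda>_. 1) (\<lambda>i. lincomb M J (d i) (x i)) =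
    lincomb M J (\<lambda>_. 1) (\<lambda>j. lincomb M I (\<lambda>i. d i j) (\<lambda>i. x i j))"
proof -
  have "lincomb M I (\<lambda>_. 1) (\<lambda>i. lincomb M J (d i) (x i)) =
      lincomb M I (\<lambda>_. 1) (\<lambda>i. lincomb M J (\<lambda>_. 1) (\<lambda>j. d i j \<odot> x i j))"
  proof (rule lincomb_cong[OF refl])
    fix i assume i: "i \<in> I"
    have "lincomb M J (d i) (x i) = lincomb M J (\<lambda>_. 1) (\<lambda>j. d i j \<odot> x i j)"
      by (rule lincomb_cong) (use assms i in auto)
    then show "1 \<odot> lincomb M J (d i) (x i) = 1 \<odot> lincomb M J (\<lambda>_. 1) (\<lambda>j. d i j \<odot> x i j)" by simp
    show "lincomb M J (\<lambda>_. 1) (\<lambda>j. d i j \<odot> x i j) \<in> carrier M" using assms i by auto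
  qed
  also have "\<dots> = lincomb M J (\<lambda>_. 1) (\<lambda>j. lincomb M I (\<lambda>_. 1) (\<lambda>i. d i j \<odot> x i j))"
    by (rule lincomb_swap) (use assms in auto)
  also have "\<dots> = lincomb M J (\<lambda>_. 1) (\<lambda>j. lincomb M I (\<lambda>i. d i j) (\<lambda>i. x i j))"
  proof (rule lincomb_cong[OF refl])
    fix j assume j: "j \<in> J"
    have "lincomb M I (\<lambda>_. 1) (\<lambda>i. d i j \<odot> x i j) = lincomb M I (\<lambda>i. d i j) (\<lambda>i. x i j)"
      by (rule lincomb_cong) (use assms j in auto)
    then show "1 \<odot> lincomb M I (\<lambda>_. 1) (\<lambda>i. d i j \<odot> x i j) = 1 \<odot> lincomb M I (\<lambda>i. d i j) (\<lambda>i. x i j)" by simp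
    show "lincomb M I (\<lambda>i. d i j) (\<lambda>i. x i j) \<in> carrier M" using assms j by auto
  qed
  finally show ?thesis .
qed

lemma (in ground_module) lincomb_cong_all:
  assumes "\<And>i. i \<in> I \<Longrightarrow> x i = y i" "\<And>i. i \<in> I \<Longrightarrow> y i \<in> carrier M"
  shows "lincomb M I c x = lincomb M I c y"
  by (rule lincomb_cong) (use assms in auto)

lemma restrict_hom:
  assumes "superalgebra A" "f \<in> superalgebra_hom A B"
  shows "restrict f (carrier A) \<in> superalgebra_hom A B"
  by (rule hom_cong[OF assms]) simp

section \<open>Counits\<close>

text \<open>Scaling by \<open>\<epsilon> h\<close> is multiplication by a multiple of one, so the
  universal property of the tensor product applies. A sign could only arise for odd
  \<open>h\<close>, where \<epsilon> vanishes.\<close>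

lemma ground_eval_homs:
  assumes A: "superalgebra A" and H: "superalgebra H" and \<epsilon>: "\<epsilon> \<in> superalgebra_hom H ground"
  shows "tensor_lift A H A (\<lambda>x h. \<epsilon> h \<odot>\<^bsub>A\<^esub> x) \<in> superalgebra_hom (A \<otimes>\<^sub>s H) A"
    and "x \<in> carrier A \<Longrightarrow> h \<in> carrier H \<Longrightarrow>
      tensor_lift A H A (\<lambda>x h. \<epsilon> h \<odot>\<^bsub>A\<^esub> x) (pure_tensor A H x h) = \<epsilon> h \<odot>\<^bsub>A\<^esub> x"
    and "tensor_lift H A A (\<lambda>h x. \<epsilon> h \<odot>\<^bsub>A\<^esub> x) \<in> superalgebra_hom (H \<otimes>\<^sub>s A) A"
    and "x \<in> carrier A \<Longrightarrow> h \<in> carrier H \<Longrightarrow>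
      tensor_lift H A A (\<lambda>h x. \<epsilon> h \<odot>\<^bsub>A\<^esub> x) (pure_tensor H A h x) = \<epsilon> h \<odot>\<^bsub>A\<^esub> x"
proof -
  interpret A: superalgebra A by (rule A)
  interpret H: superalgebra H by (rule H)
  interpret AH: tensor_pair A H by (rule tensor_pair.intro[OF A H])
  interpret HA: tensor_pair H A by (rule tensor_pair.intro[OF H A])
  let ?g = "(\<lambda>c. c \<odot>\<^bsub>A\<^esub> \<one>\<^bsub>A\<^esub>) \<circ> \<epsilon>"
  have g: "?g \<in> superalgebra_hom H A" by (rule hom_compose[OF \<epsilon> A.unit_hom])
  have odd: "\<epsilon> h = 0" if "h \<in> homog H 1" for h using hom_homog[OF \<epsilon> that] by simp
  have e1: "\<epsilon> h \<odot>\<^bsub>A\<^esub> x = id x \<otimes>\<^bsub>A\<^esub> ?g h" and e2: "\<epsilon> h \<odot>\<^bsub>A\<^esub> x = ?g h \<otimes>\<^bsub>A\<^esub> id x" if "x \<in> carrier A" for x h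
    using that by (simp_all add: A.smult_mult_left A.smult_mult_right)
  have c: "?g h \<otimes>\<^bsub>A\<^esub> id x = of_int (sgnf \<beta> \<alpha>) \<odot>\<^bsub>A\<^esub> (id x \<otimes>\<^bsub>A\<^esub> ?g h)"
    and c': "id x \<otimes>\<^bsub>A\<^esub> ?g h = of_int (sgnf \<alpha> \<beta>) \<odot>\<^bsub>A\<^esub> (?g h \<otimes>\<^bsub>A\<^esub> id x)"
    if x: "x \<in> homog A \<alpha>" and h: "h \<in> homog H \<beta>" for x h \<alpha> \<beta>
  proof -
    have xc: "x \<in> carrier A" using x by auto
    show "?g h \<otimes>\<^bsub>A\<^esub> id x = of_int (sgnf \<beta> \<alpha>) \<odot>\<^bsub>A\<^esub> (id x \<otimes>\<^bsub>A\<^esub> ?g h)"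
      "id x \<otimes>\<^bsub>A\<^esub> ?g h = of_int (sgnf \<alpha> \<beta>) \<odot>\<^bsub>A\<^esub> (?g h \<otimes>\<^bsub>A\<^esub> id x)"
      unfolding e1[OF xc, symmetric] e2[OF xc, symmetric] using xc odd h bit_cases[of \<beta>] by auto
  qed
  note b1 = AH.hom_product_bilinear[OF A hom_id g] and b2 = HA.hom_product_bilinear[OF A g hom_id]
  have eq1: "tensor_lift A H A (\<lambda>x h. \<epsilon> h \<odot>\<^bsub>A\<^esub> x) X = tensor_lift A H A (\<lambda>x h. id x \<otimes>\<^bsub>A\<^esub> ?g h) X"
    if "X \<in> carrier (A \<otimes>\<^sub>s H)" for X
    by (rule AH.tensor_lift_cong[OF A.ground_module_axioms b1 e1 that])
  have eq2: "tensor_lift H A A (\<lambda>h x. \<epsilon> h \<odot>\<^bsub>A\<^esub> x) X = tensor_lift H A A (\<lambda>h x. ?g h \<otimes>\<^bsub>A\<^esub> id x) X"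
    if "X \<in> carrier (H \<otimes>\<^sub>s A)" for X
    by (rule HA.tensor_lift_cong[OF A.ground_module_axioms b2 e2 that])
  show "tensor_lift A H A (\<lambda>x h. \<epsilon> h \<odot>\<^bsub>A\<^esub> x) \<in> superalgebra_hom (A \<otimes>\<^sub>s H) A"
    by (rule hom_cong[OF AH.superalgebra_T AH.tensor_lift_hom[OF A hom_id g c] eq1])
  show "tensor_lift H A A (\<lambda>h x. \<epsilon> h \<odot>\<^bsub>A\<^esub> x) \<in> superalgebra_hom (H \<otimes>\<^sub>s A) A"
    by (rule hom_cong[OF HA.superalgebra_T HA.tensor_lift_hom[OF A g hom_id c'] eq2])
  assume xh: "x \<in> carrier A" "h \<in> carrier H"
  show "tensor_lift A H A (\<lambda>x h. \<epsilon> h \<odot>\<^bsub>A\<^esub> x) (pure_tensor A H x h) = \<epsilon> h \<odot>\<^bsub>A\<^esub> x"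
    using xh AH.tensor_lift_pure[OF A.ground_module_axioms b1 xh] by (simp only: eq1[OF AH.P_closed[OF xh]] e1)
  show "tensor_lift H A A (\<lambda>h x. \<epsilon> h \<odot>\<^bsub>A\<^esub> x) (pure_tensor H A h x) = \<epsilon> h \<odot>\<^bsub>A\<^esub> x"
    using xh HA.tensor_lift_pure[OF A.ground_module_axioms b2 xh(2,1)] by (simp only: eq2[OF HA.P_closed[OF xh(2,1)]] e2)
qed

section \<open>Generic \<open>q\<close>: the element \<open>Q\<close> and the quotient by
  \<open>Q - 1\<close>\<close>

locale generic_quantum_parameters = quantum_parameters n m q for n m :: nat and q :: "'k::field" +
  assumes not_root: "\<forall>k::nat. k > 0 \<longrightarrow> q ^ k \<noteq> 1"
begin

lemma kappa_nonzero: "\<kappa> \<noteq> 0"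
proof
  assume "\<kappa> = 0"
  then have "q * q = 1" using q0 by (simp add: field_simps)
  then show False using not_root[rule_format, of 2] by (simp add: power2_eq_square)
qed

text \<open>Excludes \<open>q + inverse q = 0\<close>, so that the covariant relation at
  \<open>(k, k)\<close> for odd \<open>k\<close> forces the square of \<open>x k\<close> to
  vanish.\<close>

lemma q_square_ne: "q * q \<noteq> - 1"
proof
  assume "q * q = - 1"
  then have "q ^ 4 = (- 1) * (- 1)" by (metis power2_eq_square power_mult num_double numeral_times_numeral power4_eq_xxxx mult.assoc)
  then show False using not_root[rule_format, of 4] by simp
qed

text \<open>On antipodal pairs, where \<open>C\<close> lives, the signs in \<open>Q\<close> are
  those produced by the sign-free generators together with \<open>tt\<close>. Thus \<open>Q\<close>
  is the entry of \<open>C S\<close> in column \<open>(k, - k)\<close>, divided by the entry of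
  \<open>C\<close> there.\<close>

lemma Qelt_eq:
  assumes k: "k \<in> I"
  shows "Qelt n m q k = inverse (Cv k) \<odot>\<^bsub>AR n m q\<^esub> lincomb (AR n m q) J Crow (\<lambda>u. tt (AR n m q) sAR u (k, - k))"
proof -
  interpret A: superalgebra "AR n m q" by (rule superalgebra_AR)
  have gc: "AR_gen n m q i j \<in> carrier (AR n m q)" if "i \<in> I" "j \<in> I" for i j
    using AR_gen_homog[OF that] by auto
  have "(\<Oplus>\<^bsub>AR n m q\<^esub>a\<in>I. \<Oplus>\<^bsub>AR n m q\<^esub>b\<in>I. (of_int (sig2 n a k * sig2 n b a) * Cq n q a b) \<odot>\<^bsub>AR n m q\<^esub>
         (AR_gen n m q a k \<otimes>\<^bsub>AR n m q\<^esub> AR_gen n m q b (- k))) =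
      lincomb (AR n m q) (I \<times> I) (\<lambda>p. of_int (sig2 n (fst p) k * sig2 n (snd p) (fst p)) * Cq n q (fst p) (snd p))
        (\<lambda>p. AR_gen n m q (fst p) k \<otimes>\<^bsub>AR n m q\<^esub> AR_gen n m q (snd p) (- k))"
    by (rule A.finsum_finsum_smult) (use gc k in auto)
  also have "\<dots> = lincomb (AR n m q) J Crow (\<lambda>u. tt (AR n m q) sAR u (k, - k))"
  proof (rule A.lincomb_cong)
    fix p assume p: "p \<in> J"
    then obtain a b where ab: "p = (a, b)" "a \<in> I" "b \<in> I" by (auto simp: J_def)
    have g: "AR_gen n m q a k \<in> carrier (AR n m q)" "AR_gen n m q b (- k) \<in> carrier (AR n m q)" using gc ab k by auto
    show "tt (AR n m q) sAR p (k, - k) \<in> carrier (AR n m q)" using g ab by (simp add: tt_def sAR_def)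
    have sgn: "sgnf (\<eta> a) (\<eta> k) * sgnf (\<eta> a) (\<eta> a) = sgnf (\<eta> a + \<eta> k) (\<eta> a) * (sgnf (\<eta> k) (\<eta> a + \<eta> k) * sgnf (\<eta> k) (\<eta> a + \<eta> k))"
      by (cases "\<eta> a"; cases "\<eta> k") simp_all
    show "(of_int (sig2 n (fst p) k * sig2 n (snd p) (fst p)) * Cq n q (fst p) (snd p)) \<odot>\<^bsub>AR n m q\<^esub>
        (AR_gen n m q (fst p) k \<otimes>\<^bsub>AR n m q\<^esub> AR_gen n m q (snd p) (- k)) =
        Crow p \<odot>\<^bsub>AR n m q\<^esub> tt (AR n m q) sAR p (k, - k)"
    proof (cases "b = - a")
      case True
      have "of_int (sig2 n a k * sig2 n b a) = of_int (sgnf (\<eta> a + \<eta> k) (\<eta> a)) * (tsign a k * tsign b (- k))"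
        using True sgn by (simp add: sig2_def tsign_def flip: of_int_mult)
      then show ?thesis using g ab True
        by (simp add: tt_def sAR_def Crow_def A.smult_mult_left A.smult_mult_right ac_simps)
    next
      case False
      then show ?thesis using g ab by (simp add: Crow_def Cq_eq_0 tt_def sAR_def)
    qed
  qed (simp add: J_def)
  finally show ?thesis unfolding Qelt_def Cv_def by simp
qed

lemma Qelt_homog: "k \<in> I \<Longrightarrow> Qelt n m q k \<in> homog (AR n m q) 0"
proof -
  assume k: "k \<in> I"
  interpret A: superalgebra "AR n m q" by (rule superalgebra_AR)
  have h: "\<forall>i\<in>I. \<forall>j\<in>I. sAR i j \<in> homog (AR n m q) (\<eta> i + \<eta> j)" using rtt_AR by (simp add: rtt_def)
  show ?thesis unfolding Qelt_eq[OF k]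
  proof (intro A.homog_smult A.homog_lincomb_support[OF finite_J])
    fix p assume p: "p \<in> J"
    have kk: "(k, - k) \<in> J" using k by (simp add: J_def)
    show "tt (AR n m q) sAR p (k, - k) \<in> carrier (AR n m q)" by (rule tt_closed[OF superalgebra_AR h p kk])
    assume "Crow p \<noteq> 0"
    then have e: "snd p = - fst p" using Cq_eq_0 by (auto simp: Crow_def)
    have I: "fst p \<in> I" using p by (auto simp: J_def)
    have "sAR (fst p) k \<in> homog (AR n m q) (\<eta> (fst p) + \<eta> k)" "sAR (snd p) (- k) \<in> homog (AR n m q) (\<eta> (fst p) + \<eta> k)"
      using h[rule_format, of "fst p" k] h[rule_format, of "snd p" "- k"] I k e by auto
    from A.homog_mult[OF this] show "tt (AR n m q) sAR p (k, - k) \<in> homog (AR n m q) 0"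
      by (simp add: tt_def)
  qed
qed

lemma one_I: "1 \<in> I" using n1 by (auto simp: idx_def)

text \<open>\<open>Q - 1\<close> is homogeneous of degree zero.\<close>

lemma graded_ideal_JQ: "graded_ideal (AR n m q) (JQ n m q)"
proof -
  interpret A: superalgebra "AR n m q" by (rule superalgebra_AR)
  show ?thesis unfolding JQ_def
    using Qelt_homog[OF one_I] A.homog_one by (intro A.graded_ideal_genideal) (auto simp: a_minus_def)
qed

sublocale JQ: graded_ideal "AR n m q" "JQ n m q" by (rule graded_ideal_JQ)

lemma superalgebra_SPO: "superalgebra (SPO n m q)"
  unfolding SPO_def by (rule JQ.superalgebra_quot)

lemma SPO_proj: "JQ.proj \<in> superalgebra_hom (AR n m q) (SPO n m q)"
  unfolding SPO_def by (rule JQ.proj_hom)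

abbreviation "H \<equiv> SPO n m q"

definition sH :: "int \<Rightarrow> int \<Rightarrow> ((int \<times> int) fmon \<Rightarrow>\<^sub>0 'k) set set" where
  "sH i j = JQ.proj (sAR i j)"

lemma sH_homog: "i \<in> I \<Longrightarrow> j \<in> I \<Longrightarrow> sH i j \<in> homog H (\<eta> i + \<eta> j)"
  using hom_homog[OF SPO_proj] rtt_AR by (simp add: sH_def rtt_def)

lemma SPO_gen_eq: "i \<in> I \<Longrightarrow> j \<in> I \<Longrightarrow> SPO_gen n m q i j = tsign i j \<odot>\<^bsub>H\<^esub> sH i j"
  and sH_eq: "i \<in> I \<Longrightarrow> j \<in> I \<Longrightarrow> sH i j = tsign i j \<odot>\<^bsub>H\<^esub> SPO_gen n m q i j"
proof -
  interpret S: superalgebra H by (rule superalgebra_SPO)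
  assume ij: "i \<in> I" "j \<in> I"
  have g: "AR_gen n m q i j \<in> carrier (AR n m q)" using AR_gen_homog[OF ij] by (rule JQ.homog_carrier)
  show e: "sH i j = tsign i j \<odot>\<^bsub>H\<^esub> SPO_gen n m q i j"
    using g by (simp add: sH_def sAR_def hom_smult[OF SPO_proj] SPO_gen_def)
  have "SPO_gen n m q i j \<in> carrier H" unfolding SPO_gen_def by (rule hom_closed[OF SPO_proj g])
  then show "SPO_gen n m q i j = tsign i j \<odot>\<^bsub>H\<^esub> sH i j" unfolding e by simp
qed

text \<open>The quotient imposes the relation \<open>Q = 1\<close> formed at \<open>k = 1\<close>,
  which is one column of \<open>C S = C\<close>; \<open>spoI\<close> extends it to every
  column.\<close>

lemma spo_SPO: "spo H sH"
proof -
  interpret S: superalgebra H by (rule superalgebra_SPO)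
  have h: "\<forall>i\<in>I. \<forall>j\<in>I. sAR i j \<in> homog (AR n m q) (\<eta> i + \<eta> j)" using rtt_AR by (simp add: rtt_def)
  have p: "(1, - 1) \<in> J" using one_I by (simp add: J_def)
  note cl = tt_closed[OF superalgebra_AR h _ p]
  have s: "sH = (\<lambda>i j. JQ.proj (sAR i j))" by (simp add: sH_def fun_eq_iff)
  have r: "rtt H sH" unfolding s by (rule rtt_hom[OF superalgebra_AR superalgebra_SPO SPO_proj rtt_AR])
  let ?Q = "lincomb (AR n m q) J Crow (\<lambda>u. tt (AR n m q) sAR u (1, - 1))"
  have Qc: "?Q \<in> carrier (AR n m q)" by (rule JQ.lincomb_closed[OF cl])
  have Q1: "JQ.proj (Qelt n m q 1) = \<one>\<^bsub>H\<^esub>"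
  proof -
    have c: "Qelt n m q 1 \<in> carrier (AR n m q)" using Qelt_homog[OF one_I] by (rule JQ.homog_carrier)
    then have "Qelt n m q 1 \<ominus>\<^bsub>AR n m q\<^esub> \<one>\<^bsub>AR n m q\<^esub> \<in> JQ n m q"
      unfolding JQ_def by (intro JQ.genideal_self') auto
    then show ?thesis using JQ.proj_eq_iff[OF c JQ.one_closed] unfolding SPO_def JQ.quot_one by blast
  qed
  have "Cv 1 \<odot>\<^bsub>AR n m q\<^esub> Qelt n m q 1 = ?Q"
    unfolding Qelt_eq[OF one_I] using Qc Cv_nonzero[of 1] by simp
  then have "JQ.proj ?Q = Cv 1 \<odot>\<^bsub>H\<^esub> \<one>\<^bsub>H\<^esub>"
    using Q1 hom_smult[OF SPO_proj JQ.homog_carrier[OF Qelt_homog[OF one_I]], of "Cv 1"] by simp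
  moreover have "JQ.proj ?Q = lincomb H J Crow (\<lambda>u. JQ.proj (tt (AR n m q) sAR u (1, - 1)))"
    by (rule hom_lincomb[OF superalgebra_AR superalgebra_SPO SPO_proj finite_J cl])
  moreover have "\<dots> = lincomb H J Crow (\<lambda>u. tt H sH u (1, - 1))"
    by (rule S.lincomb_cong_all)
      (use tt_hom[OF superalgebra_AR SPO_proj h _ p] tt_closed[OF superalgebra_SPO _ _ p, of sH] sH_homog in \<open>simp_all add: s\<close>)
  ultimately have "lincomb H J Crow (\<lambda>u. tt H sH u (1, - 1)) = Crow (1, - 1) \<odot>\<^bsub>H\<^esub> \<one>\<^bsub>H\<^esub>"
    by (simp add: Crow_def Cv_def)
  then show ?thesis by (rule spoI[OF superalgebra_SPO r kappa_nonzero])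
qed

text \<open>The column \<open>(1, - 1)\<close> of the second condition in \<open>spo\<close> says
  exactly that the lift from \<open>A(R)\<close> kills \<open>Q - 1\<close>.\<close>

lemma SPO_lift:
  assumes B: "superalgebra B" and s: "spo B s"
  shows "\<exists>g\<in>superalgebra_hom H B. \<forall>i\<in>I. \<forall>j\<in>I. g (sH i j) = s i j"
proof -
  interpret B: superalgebra B by (rule B)
  obtain f where f: "f \<in> superalgebra_hom (AR n m q) B" "\<forall>i\<in>I. \<forall>j\<in>I. f (sAR i j) = s i j"
    using AR_lift[OF B] s unfolding spo_def by blast
  have h: "\<forall>i\<in>I. \<forall>j\<in>I. sAR i j \<in> homog (AR n m q) (\<eta> i + \<eta> j)" using rtt_AR by (simp add: rtt_def)
  have hs: "\<forall>i\<in>I. \<forall>j\<in>I. s i j \<in> homog B (\<eta> i + \<eta> j)" using s by (simp add: spo_def rtt_def)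
  have p: "(1, - 1) \<in> J" using one_I by (simp add: J_def)
  note cl = tt_closed[OF superalgebra_AR h _ p]
  let ?Q = "lincomb (AR n m q) J Crow (\<lambda>u. tt (AR n m q) sAR u (1, - 1))"
  have Qc: "?Q \<in> carrier (AR n m q)" by (rule JQ.lincomb_closed[OF cl])
  have t: "f (tt (AR n m q) sAR u (1, - 1)) = tt B s u (1, - 1)" if "u \<in> J" for u
  proof -
    have "f (tt (AR n m q) sAR u (1, - 1)) = tt B (\<lambda>i j. f (sAR i j)) u (1, - 1)"
      by (rule tt_hom[OF superalgebra_AR f(1) h that p, symmetric])
    also have "\<dots> = tt B s u (1, - 1)" using f(2) that one_I by (auto simp: tt_def J_def)
    finally show ?thesis .
  qed
  have "f ?Q = lincomb B J Crow (\<lambda>u. f (tt (AR n m q) sAR u (1, - 1)))"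
    by (rule hom_lincomb[OF superalgebra_AR B f(1) finite_J cl])
  also have "\<dots> = lincomb B J Crow (\<lambda>u. tt B s u (1, - 1))"
    by (rule B.lincomb_cong_all[OF t tt_closed[OF B hs _ p]])
  also have "\<dots> = Cv 1 \<odot>\<^bsub>B\<^esub> \<one>\<^bsub>B\<^esub>" using s p by (simp add: spo_def Crow_def Cv_def)
  finally have "f (Qelt n m q 1) = \<one>\<^bsub>B\<^esub>"
    unfolding Qelt_eq[OF one_I] using Qc Cv_nonzero[of 1] by (simp add: hom_smult[OF f(1)])
  then have z: "f (Qelt n m q 1 \<ominus>\<^bsub>AR n m q\<^esub> \<one>\<^bsub>AR n m q\<^esub>) = \<zero>\<^bsub>B\<^esub>"
    using JQ.homog_carrier[OF Qelt_homog[OF one_I]]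
    by (simp add: a_minus_def JQ.minus_eq_smult hom_add[OF f(1)] hom_smult[OF f(1)] hom_one[OF f(1)])
      (metis B.minus_eq_smult B.one_closed B.r_neg)
  have "f x = \<zero>\<^bsub>B\<^esub>" if "x \<in> JQ n m q" for x
    by (rule JQ.hom_vanishes_genideal[OF B f(1) _ _ that[unfolded JQ_def]])
      (use z JQ.homog_carrier[OF Qelt_homog[OF one_I]] in \<open>auto simp: a_minus_def\<close>)
  from JQ.quot_lift[OF B f(1) this] obtain g where g: "g \<in> superalgebra_hom H B"
    "\<forall>x\<in>carrier (AR n m q). g (JQ.proj x) = f x" unfolding SPO_def by blast
  have "g (sH i j) = s i j" if "i \<in> I" "j \<in> I" for i j
    using g(2) f(2) h that JQ.homog_carrier[of "sAR i j" "\<eta> i + \<eta> j"] by (simp add: sH_def)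
  then show ?thesis using g(1) by blast
qed

lemma SPO_hom_eq:
  assumes B: "superalgebra B" and f: "f \<in> superalgebra_hom H B" and g: "g \<in> superalgebra_hom H B"
    and e: "\<And>i j. i \<in> I \<Longrightarrow> j \<in> I \<Longrightarrow> f (sH i j) = g (sH i j)" and p: "p \<in> carrier H"
  shows "f p = g p"
proof -
  interpret S: superalgebra H by (rule superalgebra_SPO)
  have "(f \<circ> JQ.proj) x = (g \<circ> JQ.proj) x" if "x \<in> carrier (AR n m q)" for x
  proof (rule AR_hom_eq[OF B hom_compose[OF SPO_proj f] hom_compose[OF SPO_proj g] _ that])
    fix i j assume ij: "i \<in> I" "j \<in> I"
    have "f (SPO_gen n m q i j) = g (SPO_gen n m q i j)"
      using e[OF ij] S.homog_carrier[OF sH_homog[OF ij]] by (simp add: SPO_gen_eq[OF ij] hom_smult[OF f] hom_smult[OF g])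
    then show "(f \<circ> JQ.proj) (AR_gen n m q i j) = (g \<circ> JQ.proj) (AR_gen n m q i j)"
      by (simp add: SPO_gen_def)
  qed
  then show ?thesis using JQ.quot_hom_eqI[of f g p] p unfolding SPO_def by simp
qed

end

section \<open>Matrix coactions\<close>

context quantum_parameters
begin

text \<open>With \<open>x\<close> a row \<open>s i\<close> of a matrix this is also the coproduct
  matrix, so coaction and comultiplication are treated together.\<close>

definition coact :: "('k, 'a, 'm) superalgebra_scheme \<Rightarrow> ('k, 'b, 'p) superalgebra_scheme \<Rightarrow>
    (int \<Rightarrow> 'a) \<Rightarrow> (int \<Rightarrow> int \<Rightarrow> 'b) \<Rightarrow> int \<Rightarrow> ('a \<times> 'b \<Rightarrow>\<^sub>0 'k) set" where
  "coact A B x s k = lincomb (A \<otimes>\<^sub>s B) I (\<lambda>_. 1) (\<lambda>a. pure_tensor A B (x a) (s a k))"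

context
  fixes A :: "('k, 'a, 'm) superalgebra_scheme" and B :: "('k, 'b, 'p) superalgebra_scheme"
    and s :: "int \<Rightarrow> int \<Rightarrow> 'b"
  assumes A: "superalgebra A" and B: "superalgebra B"
    and s: "\<forall>i\<in>I. \<forall>j\<in>I. s i j \<in> homog B (\<eta> i + \<eta> j)"
begin

interpretation AB: tensor_pair A B by (rule tensor_pair.intro[OF A B])

lemma s_closed: "i \<in> I \<Longrightarrow> j \<in> I \<Longrightarrow> s i j \<in> carrier B"
  using s AB.B.homog_carrier by blast

text \<open>The offset \<xi> covers both uses: it is zero for the generators \<open>x\<close>, and
  \<open>\<eta> i\<close> for row \<open>i\<close> of a matrix.\<close>

lemma coact_homog:
  assumes "\<And>a. a \<in> I \<Longrightarrow> x a \<in> homog A (\<xi> + \<eta> a)" "k \<in> I"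
  shows "coact A B x s k \<in> homog (A \<otimes>\<^sub>s B) (\<xi> + \<eta> k)"
  unfolding coact_def
proof (rule AB.TS.homog_lincomb[OF finite_I])
  fix a assume a: "a \<in> I"
  have "AB.P (x a) (s a k) \<in> homog AB.T ((\<xi> + \<eta> a) + (\<eta> a + \<eta> k))"
    by (rule AB.P_homog[OF assms(1)[OF a]]) (use s a assms(2) in auto)
  moreover have "(\<xi> + \<eta> a) + (\<eta> a + \<eta> k) = \<xi> + \<eta> k" by (metis bit_add_self2 add.assoc)
  ultimately show "AB.P (x a) (s a k) \<in> homog AB.T (\<xi> + \<eta> k)" by simp
qed

text \<open>The sign from interchanging \<open>s a k\<close> with \<open>x' b\<close> splits by
  biadditivity: the part in \<open>\<eta> b\<close> is the one contained in \<open>tt\<close>, and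
  only the part in the offset remains.\<close>

lemma coact_mult:
  assumes x: "\<And>a. a \<in> I \<Longrightarrow> x a \<in> carrier A" and x': "\<And>a. a \<in> I \<Longrightarrow> x' a \<in> homog A (\<xi>' + \<eta> a)"
    and k: "k \<in> I" and l: "l \<in> I"
  shows "coact A B x s k \<otimes>\<^bsub>A \<otimes>\<^sub>s B\<^esub> coact A B x' s l =
    lincomb (A \<otimes>\<^sub>s B) J (\<lambda>p. of_int (sgnf (\<eta> (fst p) + \<eta> k) \<xi>'))
      (\<lambda>p. pure_tensor A B (x (fst p) \<otimes>\<^bsub>A\<^esub> x' (snd p)) (tt B s p (k, l)))"
proof -
  have xc': "x' a \<in> carrier A" if "a \<in> I" for a using x'[OF that] by auto
  have "coact A B x s k \<otimes>\<^bsub>AB.T\<^esub> coact A B x' s l = lincomb AB.T (I \<times> I) (\<lambda>(i, j). 1 * 1)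
      (\<lambda>(a, b). AB.P (x a) (s a k) \<otimes>\<^bsub>AB.T\<^esub> AB.P (x' b) (s b l))"
    unfolding coact_def by (rule AB.TS.lincomb_mult_lincomb) (use x xc' s_closed k l in auto)
  also have "\<dots> = lincomb AB.T J (\<lambda>p. of_int (sgnf (\<eta> (fst p) + \<eta> k) \<xi>'))
      (\<lambda>p. AB.P (x (fst p) \<otimes>\<^bsub>A\<^esub> x' (snd p)) (tt B s p (k, l)))"
  proof (rule AB.T.lincomb_cong)
    fix p assume "p \<in> J"
    then obtain a b where ab: "p = (a, b)" "a \<in> I" "b \<in> I" by (auto simp: J_def)
    note c = x[OF ab(2)] xc'[OF ab(3)] s_closed[OF ab(2) k] s_closed[OF ab(3) l]
    show "AB.P (x (fst p) \<otimes>\<^bsub>A\<^esub> x' (snd p)) (tt B s p (k, l)) \<in> carrier AB.T"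
      using c ab by (simp add: tt_def)
    have m: "AB.P (x a) (s a k) \<otimes>\<^bsub>AB.T\<^esub> AB.P (x' b) (s b l) =
        of_int (sgnf (\<eta> a + \<eta> k) (\<xi>' + \<eta> b)) \<odot>\<^bsub>AB.T\<^esub> AB.P (x a \<otimes>\<^bsub>A\<^esub> x' b) (s a k \<otimes>\<^bsub>B\<^esub> s b l)"
      by (rule AB.P_mult_P[OF c(1) _ x'[OF ab(3)] c(4)]) (use s ab k in auto)
    show "(case p of (i, j) \<Rightarrow> 1 * 1) \<odot>\<^bsub>AB.T\<^esub> (case p of (a, b) \<Rightarrow> AB.P (x a) (s a k) \<otimes>\<^bsub>AB.T\<^esub> AB.P (x' b) (s b l)) =
        of_int (sgnf (\<eta> (fst p) + \<eta> k) \<xi>') \<odot>\<^bsub>AB.T\<^esub> AB.P (x (fst p) \<otimes>\<^bsub>A\<^esub> x' (snd p)) (tt B s p (k, l))"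
      using c ab by (simp add: m tt_def AB.P_simps sgnf_add_right)
  qed (simp add: J_def)
  finally show ?thesis .
qed

end

context
  fixes A :: "('k, 'a, 'm) superalgebra_scheme" and B :: "('k, 'b, 'p) superalgebra_scheme"
    and s :: "int \<Rightarrow> int \<Rightarrow> 'a" and s' :: "int \<Rightarrow> int \<Rightarrow> 'b"
  assumes A: "superalgebra A" and B: "superalgebra B"
    and s: "\<forall>i\<in>I. \<forall>j\<in>I. s i j \<in> homog A (\<eta> i + \<eta> j)"
    and s': "\<forall>i\<in>I. \<forall>j\<in>I. s' i j \<in> homog B (\<eta> i + \<eta> j)"
begin

interpretation AB: tensor_pair A B by (rule tensor_pair.intro[OF A B])

text \<open>The signs left over by \<open>coact_mult\<close> recombine into those of
  \<open>tt A\<close>. Hence \<open>tt\<close> carries the product of matrices to an ordinary matrix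
  product with entries in the tensor product, and no signs remain.\<close>

lemma tt_product:
  assumes "p \<in> J" "r \<in> J"
  shows "tt (A \<otimes>\<^sub>s B) (\<lambda>i j. coact A B (s i) s' j) p r =
    lincomb (A \<otimes>\<^sub>s B) J (\<lambda>_. 1) (\<lambda>u. pure_tensor A B (tt A s p u) (tt B s' u r))"
proof -
  obtain i j k l where e: "p = (i, j)" "r = (k, l)" by (cases p; cases r)
  have m: "i \<in> I" "j \<in> I" "k \<in> I" "l \<in> I" using assms e by (auto simp: J_def)
  note cA = tt_closed[OF A s] and cB = tt_closed[OF B s']
  have sc: "s x y \<in> carrier A" if "x \<in> I" "y \<in> I" for x y using s that AB.A.homog_carrier by blast
  have "coact A B (s i) s' k \<otimes>\<^bsub>AB.T\<^esub> coact A B (s j) s' l =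
      lincomb AB.T J (\<lambda>p. of_int (sgnf (\<eta> (fst p) + \<eta> k) (\<eta> j))) (\<lambda>p. AB.P (s i (fst p) \<otimes>\<^bsub>A\<^esub> s j (snd p)) (tt B s' p (k, l)))"
    by (rule coact_mult[OF A B s']) (use s sc m in auto)
  then have "tt AB.T (\<lambda>i j. coact A B (s i) s' j) p r = of_int (sgnf (\<eta> i + \<eta> k) (\<eta> j)) \<odot>\<^bsub>AB.T\<^esub>
      lincomb AB.T J (\<lambda>p. of_int (sgnf (\<eta> (fst p) + \<eta> k) (\<eta> j))) (\<lambda>p. AB.P (s i (fst p) \<otimes>\<^bsub>A\<^esub> s j (snd p)) (tt B s' p (k, l)))"
    by (simp add: tt_def e)
  also have "\<dots> = lincomb AB.T J (\<lambda>p. of_int (sgnf (\<eta> i + \<eta> k) (\<eta> j)) * of_int (sgnf (\<eta> (fst p) + \<eta> k) (\<eta> j)))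
      (\<lambda>p. AB.P (s i (fst p) \<otimes>\<^bsub>A\<^esub> s j (snd p)) (tt B s' p (k, l)))"
    by (rule AB.T.smult_lincomb) (use sc cB m in \<open>auto simp: J_def\<close>)
  also have "\<dots> = lincomb AB.T J (\<lambda>_. 1) (\<lambda>u. AB.P (tt A s p u) (tt B s' u r))"
  proof (rule AB.T.lincomb_cong[OF refl])
    fix u assume u: "u \<in> J"
    then obtain a b where ab: "u = (a, b)" "a \<in> I" "b \<in> I" by (auto simp: J_def)
    have c: "s i a \<in> carrier A" "s j b \<in> carrier A" "tt B s' u (k, l) \<in> carrier B"
      using sc m ab cB[OF u] assms e by auto
    show "AB.P (tt A s p u) (tt B s' u r) \<in> carrier AB.T" using cA[OF assms(1) u] cB[OF u assms(2)] by simp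
    have "sgnf (\<eta> i + \<eta> k) (\<eta> j) * sgnf (\<eta> a + \<eta> k) (\<eta> j) = sgnf (\<eta> i + \<eta> a) (\<eta> j)"
      by (cases "\<eta> i"; cases "\<eta> k"; cases "\<eta> j"; cases "\<eta> a") simp_all
    then have "of_int (sgnf (\<eta> i + \<eta> k) (\<eta> j)) * of_int (sgnf (\<eta> a + \<eta> k) (\<eta> j)) = (of_int (sgnf (\<eta> i + \<eta> a) (\<eta> j)) :: 'k)"
      by (metis of_int_mult)
    then show "(of_int (sgnf (\<eta> i + \<eta> k) (\<eta> j)) * of_int (sgnf (\<eta> (fst u) + \<eta> k) (\<eta> j))) \<odot>\<^bsub>AB.T\<^esub>
        AB.P (s i (fst u) \<otimes>\<^bsub>A\<^esub> s j (snd u)) (tt B s' u (k, l)) = 1 \<odot>\<^bsub>AB.T\<^esub> AB.P (tt A s p u) (tt B s' u r)"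
      using c ab e by (simp add: tt_def[of A] AB.P_simps)
  qed
  finally show ?thesis .
qed

lemma product_homog: "\<forall>i\<in>I. \<forall>j\<in>I. coact A B (s i) s' j \<in> homog (A \<otimes>\<^sub>s B) (\<eta> i + \<eta> j)"
  using coact_homog[OF A B s'] s by simp

lemma lincomb_tt_product:
  assumes "r \<in> J"
  shows "lincomb (A \<otimes>\<^sub>s B) J c (\<lambda>p. tt (A \<otimes>\<^sub>s B) (\<lambda>i j. coact A B (s i) s' j) p r) =
    lincomb (A \<otimes>\<^sub>s B) J (\<lambda>_. 1) (\<lambda>u. pure_tensor A B (lincomb A J c (\<lambda>p. tt A s p u)) (tt B s' u r))"
proof -
  note cA = tt_closed[OF A s] and cB = tt_closed[OF B s']
  have "lincomb AB.T J c (\<lambda>p. tt AB.T (\<lambda>i j. coact A B (s i) s' j) p r) =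
      lincomb AB.T J c (\<lambda>p. lincomb AB.T J (\<lambda>_. 1) (\<lambda>u. AB.P (tt A s p u) (tt B s' u r)))"
    by (rule AB.T.lincomb_cong_all) (use tt_product cA cB assms in auto)
  also have "\<dots> = lincomb AB.T J (\<lambda>_. 1) (\<lambda>u. lincomb AB.T J c (\<lambda>p. AB.P (tt A s p u) (tt B s' u r)))"
    by (rule AB.T.lincomb_swap) (use cA cB assms in auto)
  also have "\<dots> = lincomb AB.T J (\<lambda>_. 1) (\<lambda>u. AB.P (lincomb A J c (\<lambda>p. tt A s p u)) (tt B s' u r))"
  proof (rule AB.T.lincomb_cong_all)
    fix u assume u: "u \<in> J"
    show "lincomb AB.T J c (\<lambda>p. AB.P (tt A s p u) (tt B s' u r)) = AB.P (lincomb A J c (\<lambda>p. tt A s p u)) (tt B s' u r)"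
      by (rule AB.P_lincomb_left[symmetric]) (use cA cB assms u in auto)
    show "AB.P (lincomb A J c (\<lambda>p. tt A s p u)) (tt B s' u r) \<in> carrier AB.T"
      using cA cB assms u by auto
  qed
  finally show ?thesis .
qed

text \<open>\<open>Rh\<close> is moved through one tensor factor at a time, by \<open>rA\<close> and
  then by \<open>rB\<close>.\<close>

lemma rtt_product:
  assumes rA: "rtt A s" and rB: "rtt B s'"
  shows "rtt (A \<otimes>\<^sub>s B) (\<lambda>i j. coact A B (s i) s' j)"
proof -
  note cA = tt_closed[OF A s] and cB = tt_closed[OF B s']
  have "lincomb AB.T J (Rh p) (\<lambda>u. tt AB.T (\<lambda>i j. coact A B (s i) s' j) u r) =
      lincomb AB.T J (\<lambda>u. Rh u r) (tt AB.T (\<lambda>i j. coact A B (s i) s' j) p)" if pr: "p \<in> J" "r \<in> J" for p r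
  proof -
    have "lincomb AB.T J (Rh p) (\<lambda>u. tt AB.T (\<lambda>i j. coact A B (s i) s' j) u r) =
        lincomb AB.T J (\<lambda>_. 1) (\<lambda>u. AB.P (lincomb A J (Rh p) (\<lambda>v. tt A s v u)) (tt B s' u r))"
      by (rule lincomb_tt_product[OF pr(2)])
    also have "\<dots> = lincomb AB.T J (\<lambda>_. 1) (\<lambda>u. lincomb AB.T J (\<lambda>v. Rh v u) (\<lambda>v. AB.P (tt A s p v) (tt B s' u r)))"
    proof (rule AB.T.lincomb_cong_all)
      fix u assume u: "u \<in> J"
      have "lincomb A J (Rh p) (\<lambda>v. tt A s v u) = lincomb A J (\<lambda>v. Rh v u) (tt A s p)"
        using rA pr u by (simp add: rtt_def)
      moreover have "AB.P (lincomb A J (\<lambda>v. Rh v u) (tt A s p)) (tt B s' u r) =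
          lincomb AB.T J (\<lambda>v. Rh v u) (\<lambda>v. AB.P (tt A s p v) (tt B s' u r))"
        by (rule AB.P_lincomb_left) (use cA cB pr u in auto)
      ultimately show "AB.P (lincomb A J (Rh p) (\<lambda>v. tt A s v u)) (tt B s' u r) =
          lincomb AB.T J (\<lambda>v. Rh v u) (\<lambda>v. AB.P (tt A s p v) (tt B s' u r))" by simp
      show "lincomb AB.T J (\<lambda>v. Rh v u) (\<lambda>v. AB.P (tt A s p v) (tt B s' u r)) \<in> carrier AB.T"
        using cA cB pr u by auto
    qed
    also have "\<dots> = lincomb AB.T J (\<lambda>_. 1) (\<lambda>v. lincomb AB.T J (Rh v) (\<lambda>u. AB.P (tt A s p v) (tt B s' u r)))"
      by (rule AB.T.lincomb_swap_coeff) (use cA cB pr in auto)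
    also have "\<dots> = lincomb AB.T J (\<lambda>_. 1) (\<lambda>v. lincomb AB.T J (\<lambda>u. Rh u r) (\<lambda>u. AB.P (tt A s p v) (tt B s' v u)))"
    proof (rule AB.T.lincomb_cong_all)
      fix v assume v: "v \<in> J"
      have "lincomb AB.T J (Rh v) (\<lambda>u. AB.P (tt A s p v) (tt B s' u r)) = AB.P (tt A s p v) (lincomb B J (Rh v) (\<lambda>u. tt B s' u r))"
        by (rule AB.P_lincomb_right[symmetric]) (use cA cB pr v in auto)
      also have "lincomb B J (Rh v) (\<lambda>u. tt B s' u r) = lincomb B J (\<lambda>u. Rh u r) (tt B s' v)"
        using rB pr v by (simp add: rtt_def)
      also have "AB.P (tt A s p v) (lincomb B J (\<lambda>u. Rh u r) (tt B s' v)) =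
          lincomb AB.T J (\<lambda>u. Rh u r) (\<lambda>u. AB.P (tt A s p v) (tt B s' v u))"
        by (rule AB.P_lincomb_right) (use cA cB pr v in auto)
      finally show "lincomb AB.T J (Rh v) (\<lambda>u. AB.P (tt A s p v) (tt B s' u r)) =
          lincomb AB.T J (\<lambda>u. Rh u r) (\<lambda>u. AB.P (tt A s p v) (tt B s' v u))" .
      show "lincomb AB.T J (\<lambda>u. Rh u r) (\<lambda>u. AB.P (tt A s p v) (tt B s' v u)) \<in> carrier AB.T"
        using cA cB pr v by auto
    qed
    also have "\<dots> = lincomb AB.T J (\<lambda>u. Rh u r) (\<lambda>u. lincomb AB.T J (\<lambda>_. 1) (\<lambda>v. AB.P (tt A s p v) (tt B s' v u)))"
      by (rule AB.T.lincomb_swap) (use cA cB pr in auto)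
    also have "\<dots> = lincomb AB.T J (\<lambda>u. Rh u r) (tt AB.T (\<lambda>i j. coact A B (s i) s' j) p)"
      by (rule AB.T.lincomb_cong_all)
        (use tt_product pr tt_closed[OF AB.superalgebra_T product_homog] in auto)
    finally show ?thesis .
  qed
  then show ?thesis using product_homog by (simp add: rtt_def)
qed

text \<open>The left factor reproduces \<open>C\<close>, which is then free to act on the right
  factor.\<close>

lemma spo_product:
  assumes sA: "spo A s" and sB: "spo B s'"
  shows "spo (A \<otimes>\<^sub>s B) (\<lambda>i j. coact A B (s i) s' j)"
proof -
  note cA = tt_closed[OF A s] and cB = tt_closed[OF B s']
  have "lincomb AB.T J Crow (\<lambda>u. tt AB.T (\<lambda>i j. coact A B (s i) s' j) u r) = Crow r \<odot>\<^bsub>AB.T\<^esub> \<one>\<^bsub>AB.T\<^esub>" if r: "r \<in> J" for r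
  proof -
    have "lincomb AB.T J Crow (\<lambda>u. tt AB.T (\<lambda>i j. coact A B (s i) s' j) u r) =
        lincomb AB.T J (\<lambda>_. 1) (\<lambda>u. AB.P (lincomb A J Crow (\<lambda>v. tt A s v u)) (tt B s' u r))"
      by (rule lincomb_tt_product[OF r])
    also have "\<dots> = lincomb AB.T J Crow (\<lambda>u. AB.P \<one>\<^bsub>A\<^esub> (tt B s' u r))"
      by (rule AB.T.lincomb_cong) (use sA cB r in \<open>auto simp: spo_def AB.P_simps\<close>)
    also have "\<dots> = AB.P \<one>\<^bsub>A\<^esub> (lincomb B J Crow (\<lambda>u. tt B s' u r))"
      by (rule AB.P_lincomb_right[symmetric]) (use cB r in auto)
    also have "\<dots> = Crow r \<odot>\<^bsub>AB.T\<^esub> \<one>\<^bsub>AB.T\<^esub>" using sB r by (simp add: spo_def AB.P_simps AB.T_one)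
    finally show ?thesis .
  qed
  then show ?thesis using rtt_product sA sB by (simp add: spo_def)
qed

end

end

lemma lincomb_ground: "finite I \<Longrightarrow> lincomb ground I c x = (\<Sum>i\<in>I. c i * x i)"
proof (induction I rule: finite_induct)
  case empty
  interpret G: superalgebra ground by (rule superalgebra_ground)
  show ?case using G.lincomb_empty by simp
next
  case (insert i I)
  interpret G: superalgebra ground by (rule superalgebra_ground)
  show ?case using insert G.lincomb_insert[of I i x c] by simp
qed

section \<open>The counit matrix; coassociativity and counit laws on generators\<close>

context quantum_parameters
begin

text \<open>These are the values of the counit on the sign-free generators. Their \<open>tt\<close>
  is the identity matrix on pairs, which commutes with \<open>Rh\<close> and fixes
  \<open>C\<close>.\<close>

lemma spo_ground: "spo ground (\<lambda>i j. of_bool (i = j))"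
proof -
  have tt: "tt ground (\<lambda>i j. of_bool (i = j)) p r = of_bool (p = r)" for p r
    by (cases p; cases r) (auto simp: tt_def)
  have d1: "(\<Sum>u\<in>J. c u * of_bool (u = r)) = (c r :: 'k)" if "r \<in> J" for c r
    using that by (simp add: of_bool_def if_distrib cong: if_cong)
  have d2: "(\<Sum>u\<in>J. c u * of_bool (r = u)) = (c r :: 'k)" if "r \<in> J" for c r
  proof -
    have "(\<Sum>u\<in>J. c u * of_bool (r = u)) = (\<Sum>u\<in>J. c u * of_bool (u = r))"
      by (rule sum.cong) auto
    then show ?thesis using d1[OF that, of c] by simp
  qed
  show ?thesis
    unfolding spo_def rtt_def tt by (auto simp: lincomb_ground d1 d2)
qed

lemma coact_closed:
  assumes "superalgebra A" "superalgebra B" "\<And>a. a \<in> I \<Longrightarrow> x a \<in> carrier A" "\<And>a. a \<in> I \<Longrightarrow> s a i \<in> carrier B"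
  shows "coact A B x s i \<in> carrier (A \<otimes>\<^sub>s B)"
proof -
  interpret AB: tensor_pair A B by (rule tensor_pair.intro[OF assms(1,2)])
  show ?thesis unfolding coact_def by (rule AB.T.lincomb_closed) (use assms in auto)
qed

text \<open>Both sides unfold to the double sum of the tensors of \<open>x l\<close>,
  \<open>s l k\<close> and \<open>s k i\<close>. With \<open>x\<close> a row of generators this
  gives coassociativity of the comultiplication as well.\<close>

lemma coact_coassoc:
  assumes A: "superalgebra A" and C: "superalgebra C"
    and x: "\<And>i. i \<in> I \<Longrightarrow> x i \<in> carrier A" and s: "\<And>i j. i \<in> I \<Longrightarrow> j \<in> I \<Longrightarrow> s i j \<in> carrier C"
    and \<delta>: "\<delta> \<in> superalgebra_hom A (A \<otimes>\<^sub>s C)" "\<And>i. i \<in> I \<Longrightarrow> \<delta> (x i) = coact A C x s i"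
    and \<Delta>: "\<Delta> \<in> superalgebra_hom C (C \<otimes>\<^sub>s C)" "\<And>i j. i \<in> I \<Longrightarrow> j \<in> I \<Longrightarrow> \<Delta> (s i j) = coact C C (s i) s j"
    and i: "i \<in> I"
  shows "tensor_assoc A C C (tensor_map A C (A \<otimes>\<^sub>s C) C \<delta> id (\<delta> (x i))) = tensor_map A C A (C \<otimes>\<^sub>s C) id \<Delta> (\<delta> (x i))"
proof -
  interpret AC: tensor_pair A C by (rule tensor_pair.intro[OF A C])
  interpret CC: tensor_pair C C by (rule tensor_pair.intro[OF C C])
  interpret L: tensor_pair AC.T C by (rule tensor_pair.intro[OF AC.superalgebra_T C])
  interpret R: tensor_pair A CC.T by (rule tensor_pair.intro[OF A CC.superalgebra_T])
  note m1 = tensor_map_hom[OF A C AC.superalgebra_T C \<delta>(1) hom_id]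
  note m2 = tensor_map_hom[OF A C A CC.superalgebra_T hom_id \<Delta>(1)]
  note as = tensor_assoc_hom[OF A C C]
  let ?m1 = "tensor_map A C AC.T C \<delta> id" and ?m2 = "tensor_map A C A CC.T id \<Delta>" and ?as = "tensor_assoc A C C"
  have cx: "coact A C x s k \<in> carrier AC.T" if "k \<in> I" for k
    by (rule coact_closed[OF A C]) (use x s that in auto)
  have "?m1 (\<delta> (x i)) = lincomb L.T I (\<lambda>_. 1) (\<lambda>k. ?m1 (AC.P (x k) (s k i)))"
    unfolding \<delta>(2)[OF i] coact_def
    by (rule hom_lincomb[OF AC.superalgebra_T L.superalgebra_T m1(1)]) (use x s i in auto)
  also have "\<dots> = lincomb L.T I (\<lambda>_. 1) (\<lambda>k. L.P (coact A C x s k) (s k i))"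
    by (rule L.T.lincomb_cong_all) (use x s i cx in \<open>simp_all add: m1(2) \<delta>(2)\<close>)
  finally have "?as (?m1 (\<delta> (x i))) = ?as (lincomb L.T I (\<lambda>_. 1) (\<lambda>k. L.P (coact A C x s k) (s k i)))" by simp
  also have "\<dots> = lincomb R.T I (\<lambda>_. 1) (\<lambda>k. ?as (L.P (coact A C x s k) (s k i)))"
    by (rule hom_lincomb[OF L.superalgebra_T R.superalgebra_T as(1)]) (use s i cx in auto)
  also have "\<dots> = lincomb R.T I (\<lambda>_. 1) (\<lambda>k. lincomb R.T I (\<lambda>_. 1) (\<lambda>l. R.P (x l) (CC.P (s l k) (s k i))))"
  proof (rule R.T.lincomb_cong_all)
    fix k assume k: "k \<in> I"
    have "L.P (coact A C x s k) (s k i) = lincomb L.T I (\<lambda>_. 1) (\<lambda>l. L.P (AC.P (x l) (s l k)) (s k i))"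
      unfolding coact_def by (rule L.P_lincomb_left) (use x s i k in auto)
    then have "?as (L.P (coact A C x s k) (s k i)) = ?as (lincomb L.T I (\<lambda>_. 1) (\<lambda>l. L.P (AC.P (x l) (s l k)) (s k i)))"
      by simp
    also have "\<dots> = lincomb R.T I (\<lambda>_. 1) (\<lambda>l. ?as (L.P (AC.P (x l) (s l k)) (s k i)))"
      by (rule hom_lincomb[OF L.superalgebra_T R.superalgebra_T as(1)]) (use x s i k in auto)
    also have "\<dots> = lincomb R.T I (\<lambda>_. 1) (\<lambda>l. R.P (x l) (CC.P (s l k) (s k i)))"
      by (rule R.T.lincomb_cong_all) (use x s i k in \<open>simp_all add: as(2)\<close>)
    finally show "?as (L.P (coact A C x s k) (s k i)) = lincomb R.T I (\<lambda>_. 1) (\<lambda>l. R.P (x l) (CC.P (s l k) (s k i)))" .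
  qed (use x s i in auto)
  also have "\<dots> = lincomb R.T I (\<lambda>_. 1) (\<lambda>l. lincomb R.T I (\<lambda>_. 1) (\<lambda>k. R.P (x l) (CC.P (s l k) (s k i))))"
    by (rule R.T.lincomb_swap) (use x s i in auto)
  also have "\<dots> = lincomb R.T I (\<lambda>_. 1) (\<lambda>l. R.P (x l) (\<Delta> (s l i)))"
  proof (rule R.T.lincomb_cong_all)
    fix l assume l: "l \<in> I"
    have "R.P (x l) (lincomb CC.T I (\<lambda>_. 1) (\<lambda>k. CC.P (s l k) (s k i))) =
        lincomb R.T I (\<lambda>_. 1) (\<lambda>k. R.P (x l) (CC.P (s l k) (s k i)))"
      by (rule R.P_lincomb_right) (use x s i l in auto)
    then show "lincomb R.T I (\<lambda>_. 1) (\<lambda>k. R.P (x l) (CC.P (s l k) (s k i))) = R.P (x l) (\<Delta> (s l i))"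
      unfolding \<Delta>(2)[OF l i] coact_def by simp
    show "R.P (x l) (\<Delta> (s l i)) \<in> carrier R.T" using x s i l hom_closed[OF \<Delta>(1)] by simp
  qed
  also have "\<dots> = lincomb R.T I (\<lambda>_. 1) (\<lambda>l. ?m2 (AC.P (x l) (s l i)))"
    by (rule R.T.lincomb_cong_all) (use x s i hom_closed[OF \<Delta>(1)] in \<open>simp_all add: m2(2)\<close>)
  also have "\<dots> = ?m2 (\<delta> (x i))"
    unfolding \<delta>(2)[OF i] coact_def
    by (rule hom_lincomb[OF AC.superalgebra_T R.superalgebra_T m2(1), symmetric]) (use x s i in auto)
  finally show ?thesis .
qed

lemma coact_counit:
  assumes A: "superalgebra A" and C: "superalgebra C"
    and x: "\<And>i. i \<in> I \<Longrightarrow> x i \<in> carrier A" and s: "\<And>i j. i \<in> I \<Longrightarrow> j \<in> I \<Longrightarrow> s i j \<in> carrier C"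
    and \<epsilon>: "\<epsilon> \<in> superalgebra_hom C ground" "\<And>i j. i \<in> I \<Longrightarrow> j \<in> I \<Longrightarrow> \<epsilon> (s i j) = of_bool (i = j)"
    and i: "i \<in> I"
  shows "tensor_lift A C A (\<lambda>x h. \<epsilon> h \<odot>\<^bsub>A\<^esub> x) (coact A C x s i) = x i"
proof -
  interpret AC: tensor_pair A C by (rule tensor_pair.intro[OF A C])
  note ev = ground_eval_homs(1,2)[OF A C \<epsilon>(1)]
  have "tensor_lift A C A (\<lambda>x h. \<epsilon> h \<odot>\<^bsub>A\<^esub> x) (coact A C x s i) =
      lincomb A I (\<lambda>_. 1) (\<lambda>k. tensor_lift A C A (\<lambda>x h. \<epsilon> h \<odot>\<^bsub>A\<^esub> x) (AC.P (x k) (s k i)))"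
    unfolding coact_def by (rule hom_lincomb[OF AC.superalgebra_T A ev(1)]) (use x s i in auto)
  also have "\<dots> = lincomb A I (\<lambda>k. of_bool (k = i)) x"
    by (rule AC.A.lincomb_cong) (use x s i \<epsilon>(2) in \<open>auto simp: ev(2)\<close>)
  also have "\<dots> = of_bool (i = i) \<odot>\<^bsub>A\<^esub> x i"
    by (rule AC.A.lincomb_single) (use x i in auto)
  finally show ?thesis using x[OF i] by simp
qed

lemma coact_counit_left:
  assumes C: "superalgebra C" and s: "\<And>i j. i \<in> I \<Longrightarrow> j \<in> I \<Longrightarrow> s i j \<in> carrier C"
    and \<epsilon>: "\<epsilon> \<in> superalgebra_hom C ground" "\<And>i j. i \<in> I \<Longrightarrow> j \<in> I \<Longrightarrow> \<epsilon> (s i j) = of_bool (i = j)"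
    and i: "i \<in> I" and j: "j \<in> I"
  shows "tensor_lift C C C (\<lambda>h x. \<epsilon> h \<odot>\<^bsub>C\<^esub> x) (coact C C (s i) s j) = s i j"
proof -
  interpret CC: tensor_pair C C by (rule tensor_pair.intro[OF C C])
  note ev = ground_eval_homs(3,4)[OF C C \<epsilon>(1)]
  have "tensor_lift C C C (\<lambda>h x. \<epsilon> h \<odot>\<^bsub>C\<^esub> x) (coact C C (s i) s j) =
      lincomb C I (\<lambda>_. 1) (\<lambda>k. tensor_lift C C C (\<lambda>h x. \<epsilon> h \<odot>\<^bsub>C\<^esub> x) (CC.P (s i k) (s k j)))"
    unfolding coact_def by (rule hom_lincomb[OF CC.superalgebra_T C ev(1)]) (use s i j in auto)
  also have "\<dots> = lincomb C I (\<lambda>k. of_bool (i = k)) (\<lambda>k. s k j)"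
    by (rule CC.A.lincomb_cong) (use s i j \<epsilon>(2) in \<open>auto simp: ev(2)\<close>)
  also have "\<dots> = of_bool (i = i) \<odot>\<^bsub>C\<^esub> s i j"
    by (rule CC.A.lincomb_single) (use s i j in auto)
  finally show ?thesis using s[OF i j] by simp
qed

end

section \<open>The bi-superalgebra structure of the quantum supergroup\<close>

context generic_quantum_parameters
begin

interpretation S: superalgebra H by (rule superalgebra_SPO)
interpretation SS: tensor_pair H H by (rule tensor_pair.intro[OF superalgebra_SPO superalgebra_SPO])

lemma sH_closed: "i \<in> I \<Longrightarrow> j \<in> I \<Longrightarrow> sH i j \<in> carrier H"
  using sH_homog by (rule S.homog_carrier)

lemma sH_homog_all: "\<forall>i\<in>I. \<forall>j\<in>I. sH i j \<in> homog H (\<eta> i + \<eta> j)"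
  using sH_homog by blast

text \<open>The sign prescribed in the coproduct equals
  \<open>tsign i j * tsign i k * tsign k j\<close>, the product of the signs that relate the three
  generators involved to their sign-free forms.\<close>

lemma SPO_gen_coact:
  assumes "i \<in> I" "j \<in> I"
  shows "(\<Oplus>\<^bsub>H \<otimes>\<^sub>s H\<^esub>k\<in>I. of_int (sgnf (eta n k - eta n i) (eta n k - eta n j)) \<odot>\<^bsub>H \<otimes>\<^sub>s H\<^esub>
       pure_tensor H H (SPO_gen n m q i k) (SPO_gen n m q k j)) = tsign i j \<odot>\<^bsub>H \<otimes>\<^sub>s H\<^esub> coact H H (sH i) sH j"
proof -
  have "tsign i j \<odot>\<^bsub>SS.T\<^esub> coact H H (sH i) sH j = lincomb SS.T I (\<lambda>k. tsign i j * 1) (\<lambda>k. SS.P (sH i k) (sH k j))"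
    unfolding coact_def by (rule SS.T.smult_lincomb) (use sH_closed assms in auto)
  also have "\<dots> = lincomb SS.T I (\<lambda>k. of_int (sgnf (eta n k - eta n i) (eta n k - eta n j)))
      (\<lambda>k. SS.P (SPO_gen n m q i k) (SPO_gen n m q k j))"
  proof (rule SS.T.lincomb_cong[OF refl])
    fix k assume k: "k \<in> I"
    note c = sH_closed[OF assms(1) k] sH_closed[OF k assms(2)]
    show "SS.P (SPO_gen n m q i k) (SPO_gen n m q k j) \<in> carrier SS.T"
      using c k assms by (simp add: SPO_gen_eq)
    have "tsign i j = of_int (sgnf (eta n k - eta n i) (eta n k - eta n j)) * (tsign k j * tsign i k)"
      unfolding tsign_def by (cases "\<eta> i"; cases "\<eta> j"; cases "\<eta> k") simp_all
    then show "(tsign i j * 1) \<odot>\<^bsub>SS.T\<^esub> SS.P (sH i k) (sH k j) =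
        of_int (sgnf (eta n k - eta n i) (eta n k - eta n j)) \<odot>\<^bsub>SS.T\<^esub> SS.P (SPO_gen n m q i k) (SPO_gen n m q k j)"
      using c k assms by (simp add: SPO_gen_eq SS.P_simps)
  qed
  finally show ?thesis by (simp add: lincomb_def)
qed

text \<open>The comultiplication is a definite description. Existence comes from lifting the product
  matrix, restricted to the carrier; uniqueness from agreement on generators together with the
  normalisation outside the carrier.\<close>

lemma SPO_comult:
  shows SPO_comult_hom: "SPO_comult n m q \<in> superalgebra_hom H (H \<otimes>\<^sub>s H)"
    and SPO_comult_sH: "i \<in> I \<Longrightarrow> j \<in> I \<Longrightarrow> SPO_comult n m q (sH i j) = coact H H (sH i) sH j"
proof -
  let ?Pr = "\<lambda>\<Delta>. \<Delta> \<in> extensional (carrier H) \<and> \<Delta> \<in> superalgebra_hom H (H \<otimes>\<^sub>s H) \<and>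
     (\<forall>i\<in>idx n m. \<forall>j\<in>idx n m. \<Delta> (SPO_gen n m q i j) =
        (\<Oplus>\<^bsub>H \<otimes>\<^sub>s H\<^esub>k\<in>idx n m. of_int (sgnf (eta n k - eta n i) (eta n k - eta n j)) \<odot>\<^bsub>H \<otimes>\<^sub>s H\<^esub>
             pure_tensor H H (SPO_gen n m q i k) (SPO_gen n m q k j)))"
  have gens: "\<Delta> (sH i j) = coact H H (sH i) sH j" if "?Pr \<Delta>" "i \<in> I" "j \<in> I" for \<Delta> i j
  proof -
    have \<Delta>: "\<Delta> \<in> superalgebra_hom H (H \<otimes>\<^sub>s H)" using that by blast
    have "SPO_gen n m q i j \<in> carrier H" using that sH_closed by (simp add: SPO_gen_eq)
    then have "\<Delta> (sH i j) = tsign i j \<odot>\<^bsub>SS.T\<^esub> (tsign i j \<odot>\<^bsub>SS.T\<^esub> coact H H (sH i) sH j)"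
      using that by (simp add: sH_eq hom_smult[OF \<Delta>] SPO_gen_coact[unfolded bit_diff_add])
    moreover have "coact H H (sH i) sH j \<in> carrier SS.T"
      by (rule coact_closed[OF superalgebra_SPO superalgebra_SPO]) (use that sH_closed in auto)
    ultimately show ?thesis by simp
  qed
  have "\<exists>!\<Delta>. ?Pr \<Delta>"
  proof (rule ex_ex1I)
    obtain g where g: "g \<in> superalgebra_hom H SS.T" "\<forall>i\<in>I. \<forall>j\<in>I. g (sH i j) = coact H H (sH i) sH j"
      using SPO_lift[OF SS.superalgebra_T spo_product[OF superalgebra_SPO superalgebra_SPO sH_homog_all sH_homog_all spo_SPO spo_SPO]]
      by blast
    have "g (SPO_gen n m q i j) = tsign i j \<odot>\<^bsub>SS.T\<^esub> coact H H (sH i) sH j" if "i \<in> I" "j \<in> I" for i j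
      using that g(2) sH_closed by (simp add: SPO_gen_eq hom_smult[OF g(1)])
    moreover have "SPO_gen n m q i j \<in> carrier H" if "i \<in> I" "j \<in> I" for i j
      using that sH_closed by (simp add: SPO_gen_eq)
    ultimately have "?Pr (restrict g (carrier H))"
      using restrict_hom[OF superalgebra_SPO g(1)] by (simp add: SPO_gen_coact[unfolded bit_diff_add])
    then show "\<exists>\<Delta>. ?Pr \<Delta>" by blast
  next
    fix \<Delta> \<Delta>' assume 1: "?Pr \<Delta>" and 2: "?Pr \<Delta>'"
    have d: "\<Delta> \<in> superalgebra_hom H SS.T" "\<Delta>' \<in> superalgebra_hom H SS.T"
      "\<Delta> \<in> extensional (carrier H)" "\<Delta>' \<in> extensional (carrier H)" using 1 2 by blast+
    show "\<Delta> = \<Delta>'"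
    proof (rule extensionalityI[OF d(3,4)])
      fix h assume h: "h \<in> carrier H"
      show "\<Delta> h = \<Delta>' h"
        by (rule SPO_hom_eq[OF SS.superalgebra_T d(1,2) _ h]) (simp only: gens[OF 1] gens[OF 2])
    qed
  qed
  from theI'[OF this] have P: "?Pr (SPO_comult n m q)" unfolding SPO_comult_def .
  then show "SPO_comult n m q \<in> superalgebra_hom H (H \<otimes>\<^sub>s H)" by blast
  show "i \<in> I \<Longrightarrow> j \<in> I \<Longrightarrow> SPO_comult n m q (sH i j) = coact H H (sH i) sH j" by (rule gens[OF P])
qed

lemma SPO_counit:
  shows SPO_counit_hom: "SPO_counit n m q \<in> superalgebra_hom H ground"
    and SPO_counit_sH: "i \<in> I \<Longrightarrow> j \<in> I \<Longrightarrow> SPO_counit n m q (sH i j) = of_bool (i = j)"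
proof -
  let ?Pr = "\<lambda>\<epsilon>. \<epsilon> \<in> extensional (carrier H) \<and> \<epsilon> \<in> superalgebra_hom H ground \<and>
     (\<forall>i\<in>idx n m. \<forall>j\<in>idx n m. \<epsilon> (SPO_gen n m q i j) = of_bool (i = j))"
  have one: "tsign i i = 1" for i by (simp add: tsign_def)
  have gens: "\<epsilon> (sH i j) = of_bool (i = j)" if "?Pr \<epsilon>" "i \<in> I" "j \<in> I" for \<epsilon> i j
  proof -
    have \<epsilon>: "\<epsilon> \<in> superalgebra_hom H ground" using that by blast
    have "SPO_gen n m q i j \<in> carrier H" using that sH_closed by (simp add: SPO_gen_eq)
    then show ?thesis using that one by (auto simp: sH_eq hom_smult[OF \<epsilon>])
  qed
  have "\<exists>!\<epsilon>. ?Pr \<epsilon>"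
  proof (rule ex_ex1I)
    obtain g where g: "g \<in> superalgebra_hom H ground" "\<forall>i\<in>I. \<forall>j\<in>I. g (sH i j) = of_bool (i = j)"
      using SPO_lift[OF superalgebra_ground spo_ground] by blast
    have "g (SPO_gen n m q i j) = of_bool (i = j)" if "i \<in> I" "j \<in> I" for i j
      using that g(2) sH_closed one by (auto simp: SPO_gen_eq hom_smult[OF g(1)])
    moreover have "SPO_gen n m q i j \<in> carrier H" if "i \<in> I" "j \<in> I" for i j
      using that sH_closed by (simp add: SPO_gen_eq)
    ultimately have "?Pr (restrict g (carrier H))"
      using restrict_hom[OF superalgebra_SPO g(1)] by simp
    then show "\<exists>\<epsilon>. ?Pr \<epsilon>" by blast
  next
    fix \<epsilon> \<epsilon>' assume 1: "?Pr \<epsilon>" and 2: "?Pr \<epsilon>'"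
    have d: "\<epsilon> \<in> superalgebra_hom H ground" "\<epsilon>' \<in> superalgebra_hom H ground"
      "\<epsilon> \<in> extensional (carrier H)" "\<epsilon>' \<in> extensional (carrier H)" using 1 2 by blast+
    show "\<epsilon> = \<epsilon>'"
    proof (rule extensionalityI[OF d(3,4)])
      fix h assume h: "h \<in> carrier H"
      show "\<epsilon> h = \<epsilon>' h"
        by (rule SPO_hom_eq[OF superalgebra_ground d(1,2) _ h]) (simp only: gens[OF 1] gens[OF 2])
    qed
  qed
  from theI'[OF this] have P: "?Pr (SPO_counit n m q)" unfolding SPO_counit_def .
  then show "SPO_counit n m q \<in> superalgebra_hom H ground" by blast
  show "i \<in> I \<Longrightarrow> j \<in> I \<Longrightarrow> SPO_counit n m q (sH i j) = of_bool (i = j)" by (rule gens[OF P])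
qed

lemma bisuperalgebra_SPO: "bisuperalgebra H (SPO_comult n m q) (SPO_counit n m q)"
proof (intro bisuperalgebra.intro bisuperalgebra_axioms.intro)
  let ?\<Delta> = "SPO_comult n m q" and ?\<epsilon> = "SPO_counit n m q"
  interpret R: tensor_pair H SS.T by (rule tensor_pair.intro[OF superalgebra_SPO SS.superalgebra_T])
  show "superalgebra H" by (rule superalgebra_SPO)
  show "?\<Delta> \<in> superalgebra_hom H (H \<otimes>\<^sub>s H)" by (rule SPO_comult_hom)
  show "?\<epsilon> \<in> superalgebra_hom H ground" by (rule SPO_counit_hom)
  fix h assume h: "h \<in> carrier H"
  let ?L = "tensor_assoc H H H \<circ> (tensor_map H H SS.T H ?\<Delta> id \<circ> ?\<Delta>)" and ?R = "tensor_map H H H SS.T id ?\<Delta> \<circ> ?\<Delta>"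
  have L: "?L \<in> superalgebra_hom H R.T"
    by (intro hom_compose[OF hom_compose[OF SPO_comult_hom tensor_map_hom(1)] tensor_assoc_hom(1)]
        superalgebra_SPO SS.superalgebra_T SPO_comult_hom hom_id)
  have R: "?R \<in> superalgebra_hom H R.T"
    by (intro hom_compose[OF SPO_comult_hom tensor_map_hom(1)] superalgebra_SPO SS.superalgebra_T SPO_comult_hom hom_id)
  have "?L h = ?R h"
  proof (rule SPO_hom_eq[OF R.superalgebra_T L R _ h])
    fix i j assume ij: "i \<in> I" "j \<in> I"
    show "?L (sH i j) = ?R (sH i j)"
      using coact_coassoc[OF superalgebra_SPO superalgebra_SPO, of "sH i" sH ?\<Delta> ?\<Delta> j]
        ij sH_closed SPO_comult_hom SPO_comult_sH by simp
  qed
  then show "tensor_assoc H H H (tensor_map H H SS.T H ?\<Delta> id (?\<Delta> h)) = tensor_map H H H SS.T id ?\<Delta> (?\<Delta> h)" by simp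
  note cl = ground_eval_homs(3)[OF superalgebra_SPO superalgebra_SPO SPO_counit_hom]
    and cr = ground_eval_homs(1)[OF superalgebra_SPO superalgebra_SPO SPO_counit_hom]
  have "(tensor_lift H H H (\<lambda>x y. ?\<epsilon> x \<odot>\<^bsub>H\<^esub> y) \<circ> ?\<Delta>) h = id h"
  proof (rule SPO_hom_eq[OF superalgebra_SPO hom_compose[OF SPO_comult_hom cl] hom_id _ h])
    fix i j assume ij: "i \<in> I" "j \<in> I"
    show "(tensor_lift H H H (\<lambda>x y. ?\<epsilon> x \<odot>\<^bsub>H\<^esub> y) \<circ> ?\<Delta>) (sH i j) = id (sH i j)"
      using coact_counit_left[OF superalgebra_SPO sH_closed SPO_counit_hom SPO_counit_sH ij] ij
      by (simp add: SPO_comult_sH)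
  qed
  then show "tensor_lift H H H (\<lambda>x y. ?\<epsilon> x \<odot>\<^bsub>H\<^esub> y) (?\<Delta> h) = h" by simp
  have "(tensor_lift H H H (\<lambda>x y. ?\<epsilon> y \<odot>\<^bsub>H\<^esub> x) \<circ> ?\<Delta>) h = id h"
  proof (rule SPO_hom_eq[OF superalgebra_SPO hom_compose[OF SPO_comult_hom cr] hom_id _ h])
    fix i j assume ij: "i \<in> I" "j \<in> I"
    show "(tensor_lift H H H (\<lambda>x y. ?\<epsilon> y \<odot>\<^bsub>H\<^esub> x) \<circ> ?\<Delta>) (sH i j) = id (sH i j)"
      using coact_counit[OF superalgebra_SPO superalgebra_SPO sH_closed[OF ij(1)] sH_closed SPO_counit_hom SPO_counit_sH ij(2)] ij
      by (simp add: SPO_comult_sH)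
  qed
  then show "tensor_lift H H H (\<lambda>x y. ?\<epsilon> y \<odot>\<^bsub>H\<^esub> x) (?\<Delta> h) = h" by simp
qed

end

lemma free_minus_closed:
  assumes "x \<in> carrier (free_superalgebra X d)" "y \<in> carrier (free_superalgebra X d)"
  shows "x - y \<in> carrier (free_superalgebra X d)"
  using assms keys_diff[of x y] unfolding free_carrier by blast

lemma const_closed: "const a \<in> carrier (free_superalgebra X d)"
  by (auto simp: free_carrier const_def)

section \<open>The Weyl relations in covariant form\<close>

context quantum_parameters
begin

abbreviation "rr \<equiv> int (n + m)"
abbreviation "FW \<equiv> free_superalgebra I \<eta> :: ('k, int fmon \<Rightarrow>\<^sub>0 'k) superalgebra"

text \<open>Stated for elements of any superalgebra, since it has to be transported from the
  generators to their images in the tensor product.\<close>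

definition covariant :: "('k, 'b, 'p) superalgebra_scheme \<Rightarrow> 'k \<Rightarrow> (int \<Rightarrow> 'b) \<Rightarrow> bool" where
  "covariant B c x \<longleftrightarrow> (\<forall>i\<in>I. x i \<in> homog B (\<eta> i)) \<and>
     (\<forall>r\<in>J. lincomb B J (\<lambda>p. Rh p r) (\<lambda>p. x (fst p) \<otimes>\<^bsub>B\<^esub> x (snd p)) =
        q \<odot>\<^bsub>B\<^esub> (x (fst r) \<otimes>\<^bsub>B\<^esub> x (snd r)) \<oplus>\<^bsub>B\<^esub> (c * Crow r) \<odot>\<^bsub>B\<^esub> \<one>\<^bsub>B\<^esub>)"

text \<open>
  In degree zero the relations are linear in the \<open>x k x (-k)\<close> and \<open>1\<close>. They are encoded by their
  coefficients, functions on \<open>I \<union> {0}\<close> with the index \<open>0\<close> standing for \<open>1\<close>: \<open>Ev k\<close> is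
  the covariant relation for \<open>(k, -k)\<close>, \<open>R3v j\<close> and \<open>R4v\<close> are the defining relations of the
  Weyl superalgebra, and \<open>Vv\<close> interpolates between \<open>R4v\<close> and a multiple of \<open>Ev rr\<close>.
\<close>

definition Ev :: "'k \<Rightarrow> int \<Rightarrow> int \<Rightarrow> 'k" where
  "Ev c k z = of_bool (z \<noteq> 0) * Mh z k - q * of_bool (z = k) - (c * Cv k) * of_bool (z = 0)"

definition R3v :: "int \<Rightarrow> int \<Rightarrow> 'k" where
  "R3v j z = (q powi (- sig n (j - 1)) * of_bool (z = - j + 1) - of_int (sig n (j - 1)) * q * of_bool (z = j - 1))
     - (of_int (sig n (j - 1) * sig n j) * of_bool (z = - j)
        - of_int (sig n (j - 1)) * q * q powi (- sig n j) * of_bool (z = j))"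

definition R4v :: "'k \<Rightarrow> int \<Rightarrow> 'k" where
  "R4v c z = (1 * of_bool (z = - 1) - q ^ 2 * of_bool (z = 1))
     - (q powi (2 * (int n - int m)) * c * of_bool (z = 0) - \<kappa> * Dv z * of_bool (2 \<le> z))"

definition Vv :: "'k \<Rightarrow> int \<Rightarrow> int \<Rightarrow> 'k" where
  "Vv c j z = Cv j * (av j * of_bool (z = - j) - q * of_bool (z = j)) + \<kappa> * Dv z * of_bool (j < z)
     - (Cv rr)\<^sup>2 * c * of_bool (z = 0)"

text \<open>Among the positive indices the \<open>n\<close> even ones contribute \<open>1\<close>
  each to the exponent and the \<open>m\<close> odd ones \<open>- 1\<close>. This is the origin of
  the exponent in the last Weyl relation.\<close>

lemma Cv_rr: "(Cv rr)\<^sup>2 = q powi (2 * (int n - int m))"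
proof -
  have "(\<Sum>k=1..rr. sig n k) = (\<Sum>k\<in>{1..int n}. sig n k) + (\<Sum>k\<in>{int n + 1..rr}. sig n k)"
    by (subst sum.union_disjoint[symmetric]) (auto intro!: sum.cong)
  also have "(\<Sum>k\<in>{1..int n}. sig n k) = (\<Sum>k\<in>{1..int n}. 1)"
    by (rule sum.cong) (auto simp: sig_def sig2_def eta_def)
  also have "(\<Sum>k\<in>{int n + 1..rr}. sig n k) = (\<Sum>k\<in>{int n + 1..rr}. - 1)"
    by (rule sum.cong) (auto simp: sig_def sig2_def eta_def)
  finally have "(\<Sum>k=1..rr. sig n k) = int n - int m" by simp
  then show ?thesis using n1 by (simp add: Cv_pos power2_eq_square power_int_add[symmetric] q0)
qed

lemma sig_exhaust:
  obtains "sig n j = 1" "sg j = 1" "av j = inverse q" "q powi sig n j = q" "q powi (- sig n j) = inverse q"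
  | "sig n j = - 1" "sg j = - 1" "av j = - q" "q powi sig n j = inverse q" "q powi (- sig n j) = q"
  using sg_cases[of j] by (auto simp: av_def power_int_minus)

lemma Cv_pred: "2 \<le> j \<Longrightarrow> Cv j = q powi sig n j * Cv (j - 1)"
  using Cv_rec[of "j - 1"] by simp

lemma Dv_minus_pos: "Dv (- j) = inverse (Cv j)"
  by (simp add: Dv_eq)

text \<open>The rank one parts and the constants of columns \<open>j - 1\<close> and
  \<open>j\<close> are proportional with the ratio of the entries of \<open>C\<close>. Subtracting
  the scaled column cancels them, apart from one boundary term at \<open>- j\<close>, and what is
  left is the defining relation.\<close>

lemma Ev_R3v:
  assumes j: "2 \<le> j"
  shows "Ev c (j - 1) z = sg (j - 1) * R3v j z + (Cv (j - 1) * inverse (Cv j)) * Ev c j z"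
proof -
  have C0: "Cv (j - 1) \<noteq> 0" by (rule Cv_nonzero)
  note C = Cv_pred[OF j]
  have D: "Dv (- j) = inverse (Cv j)" by (rule Dv_minus_pos)
  have i: "of_int (sig n (j - 1)) = sg (j - 1)" "of_int (sig n j) = sg j" by (simp_all add: sg_def)
  consider "z = 0" | "z = j" | "z = - j" | "z = j - 1" | "z = - j + 1" | "z < - j"
    | "- j < z" "z \<noteq> 0" "z \<noteq> j" "z \<noteq> j - 1" "z \<noteq> - j + 1" by linarith
  then show ?thesis
  proof cases
    case 3
    show ?thesis unfolding Ev_def Mh_def R3v_def of_int_mult i using 3 j C0 q0
      by (cases rule: sig_exhaust[of j]; cases rule: sig_exhaust[of "j - 1"]) (simp_all add: C D field_simps)
  qed (unfold Ev_def Mh_def R3v_def of_int_mult i, insert j C0 q0,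
    (cases rule: sig_exhaust[of j]; cases rule: sig_exhaust[of "j - 1"]; simp add: C field_simps)+)
qed

text \<open>Lowering \<open>j\<close> by one lets the tail of the sum absorb the index
  \<open>j\<close>, while the constant stays the same; the difference is a multiple of the
  \<open>j\<close>-th defining relation.\<close>

lemma Vv_R3v:
  assumes j: "2 \<le> j"
  shows "Vv c (j - 1) z = Vv c j z + (Cv (j - 1) * sg (j - 1)) * R3v j z"
proof -
  have C0: "Cv (j - 1) \<noteq> 0" by (rule Cv_nonzero)
  note C = Cv_pred[OF j]
  have D: "Dv j = - q * av j * Cv j" using j by (intro Dv_av) auto
  have i: "of_int (sig n (j - 1)) = sg (j - 1)" "of_int (sig n j) = sg j" by (simp_all add: sg_def)
  consider "z = 0" | "z = j" | "z = - j" | "z = j - 1" | "z = - j + 1"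
    | "z \<noteq> - j" "z \<noteq> 0" "z \<noteq> j" "z \<noteq> j - 1" "z \<noteq> - j + 1" by linarith
  then show ?thesis
  proof cases
    case 2
    show ?thesis unfolding Vv_def R3v_def of_int_mult i using 2 j C0 q0
      by (cases rule: sig_exhaust[of j]; cases rule: sig_exhaust[of "j - 1"]) (simp_all add: C D field_simps)
  qed (unfold Vv_def R3v_def of_int_mult i, insert j C0 q0,
    (cases rule: sig_exhaust[of j]; cases rule: sig_exhaust[of "j - 1"]; auto simp add: C field_simps)+)
qed

text \<open>At \<open>j = 1\<close> the tail is the whole sum of the last Weyl relation, and the
  constants match by \<open>Cv_rr\<close>.\<close>

lemma Vv_first: "Vv c 1 z = R4v c z"
proof -
  have "av 1 = inverse q" by (simp add: av_def sg_def power_int_minus)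
  then show ?thesis unfolding Vv_def R4v_def Cv_rr using q0
    by (auto simp: Cv_1 power2_eq_square algebra_simps)
qed

text \<open>At the top index the tail is empty; of the two factors \<open>Cv rr\<close> in the
  constant, one is the multiplier and the other belongs to \<open>Ev\<close>.\<close>

lemma Vv_last: "z \<in> I \<or> z = 0 \<Longrightarrow> Vv c rr z = Cv rr * Ev c rr z"
  using n1 unfolding Vv_def Ev_def Mh_def by (auto simp: idx_def power2_eq_square algebra_simps)

text \<open>The starting point for the negative columns: the covariant relations at
  \<open>(- 1, 1)\<close> and \<open>(1, - 1)\<close> are proportional.\<close>

lemma Ev_minus_first: "Dv 1 * Ev c (- 1) z = inverse (Cv 1) * Ev c 1 z"
proof -
  have a: "av 1 = inverse q" by (simp add: av_def sg_def power_int_minus)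
  have D: "Dv 1 = - q" using Dv_av[of 1] q0 by (simp add: Cv_1 a)
  have D': "Dv (- 1) = inverse q" by (simp add: Dv_eq Cv_1)
  have C: "Cv (- 1) = - inverse q" using Cv_uminus[of 1] q0 by (simp add: Cv_1 a)
  consider "z = 0" | "z = 1" | "z = - 1" | "z < - 1" | "1 < z" by linarith
  then show ?thesis
    using q0 unfolding Ev_def Mh_def
    by cases (simp_all add: a D D' C Cv_1 field_simps)
qed

text \<open>\<open>Dv j\<close> is the inverse of \<open>Cv (- j)\<close>, so multiplying column
  \<open>- j\<close> by it normalises both the constant and the rank one part. Between consecutive
  columns these cancel up to boundary terms, which form the defining relation.\<close>

lemma Ev_minus_R3v:
  assumes j: "2 \<le> j"
  shows "Dv j * Ev c (- j) z = Dv (j - 1) * Ev c (- (j - 1)) z - (Cv (j - 1) * sg (j - 1)) * R3v j z"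
proof -
  have C0: "Cv (j - 1) \<noteq> 0" by (rule Cv_nonzero)
  note C = Cv_pred[OF j]
  have D: "Dv j = - q * av j * Cv j" "Dv (j - 1) = - q * av (j - 1) * Cv (j - 1)" using j by (intro Dv_av; simp)+
  have Cm: "Cv (- j) = - inverse (q * av j * Cv j)" "Cv (1 - j) = - inverse (q * av (j - 1) * Cv (j - 1))"
    using Cv_uminus[of j] Cv_uminus[of "j - 1"] j by auto
  have i: "of_int (sig n (j - 1)) = sg (j - 1)" "of_int (sig n j) = sg j" by (simp_all add: sg_def)
  have am: "av (1 - j) = av (j - 1)" using sig_uminus(3)[of "j - 1"] by simp
  have c0: ?thesis if "z = 0"
    unfolding Ev_def Mh_def R3v_def of_int_mult i using that j C0 q0
    by (cases rule: sig_exhaust[of j]; cases rule: sig_exhaust[of "j - 1"]; simp add: C D Cm am field_simps)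
  have c1: ?thesis if "z = j"
    unfolding Ev_def Mh_def R3v_def of_int_mult i using that j C0 q0
    by (cases rule: sig_exhaust[of j]; cases rule: sig_exhaust[of "j - 1"]; simp add: C D Cm am field_simps)
  have c2: ?thesis if "z = - j"
    unfolding Ev_def Mh_def R3v_def of_int_mult i using that j C0 q0
    by (cases rule: sig_exhaust[of j]; cases rule: sig_exhaust[of "j - 1"]; simp add: C D Cm am field_simps)
  have c3: ?thesis if "z = j - 1"
    unfolding that Ev_def Mh_def R3v_def of_int_mult i using j C0 q0
    by (cases rule: sig_exhaust[of j]; cases rule: sig_exhaust[of "j - 1"]; simp add: C D Cm am field_simps)
  have c4: ?thesis if "z = - j + 1"
    unfolding Ev_def Mh_def R3v_def of_int_mult i using that j C0 q0
    by (cases rule: sig_exhaust[of j]; cases rule: sig_exhaust[of "j - 1"]; simp add: C D Cm am field_simps)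
  have c5: ?thesis if "z < j - 1 \<and> z \<noteq> - j \<and> z \<noteq> 0 \<and> z \<noteq> - j + 1"
    unfolding Ev_def Mh_def R3v_def of_int_mult i using that j C0 q0
    by (cases rule: sig_exhaust[of j]; cases rule: sig_exhaust[of "j - 1"]; simp add: C D Cm am field_simps)
  have c6: ?thesis if "z > j"
    unfolding Ev_def Mh_def R3v_def of_int_mult i using that j C0 q0
    by (cases rule: sig_exhaust[of j]; cases rule: sig_exhaust[of "j - 1"]; simp add: C D Cm am field_simps)
  show ?thesis using c0 c1 c2 c3 c4 c5 c6 by linarith
qed

section \<open>Equivalence of the Weyl relations with the covariant ones\<close>

context
  fixes B :: "('k, 'b, 'p) superalgebra_scheme" and x :: "int \<Rightarrow> 'b"
  assumes B: "superalgebra B" and x: "\<forall>i\<in>I. x i \<in> homog B (\<eta> i)"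
begin

interpretation B: superalgebra B by (rule B)

lemma x_closed: "i \<in> I \<Longrightarrow> x i \<in> carrier B"
  using x B.homog_carrier by blast

definition Zv :: "int \<Rightarrow> 'b" where
  "Zv k = (if k = 0 then \<one>\<^bsub>B\<^esub> else x k \<otimes>\<^bsub>B\<^esub> x (- k))"

definition LZ :: "(int \<Rightarrow> 'k) \<Rightarrow> 'b" where
  "LZ u = lincomb B (insert 0 I) u Zv"

lemma Zv_closed: "k \<in> insert 0 I \<Longrightarrow> Zv k \<in> carrier B"
  using x_closed by (auto simp: Zv_def)

lemma LZ_closed: "LZ u \<in> carrier B"
  unfolding LZ_def by (rule B.lincomb_closed) (rule Zv_closed)

lemma LZ_cong: "(\<And>z. z \<in> I \<or> z = 0 \<Longrightarrow> u z = v z) \<Longrightarrow> LZ u = LZ v"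
  unfolding LZ_def by (rule B.lincomb_cong) (use Zv_closed in auto)

lemma LZ_add: "LZ (\<lambda>z. u z + v z) = LZ u \<oplus>\<^bsub>B\<^esub> LZ v"
  unfolding LZ_def by (rule B.lincomb_add_coeff) (rule Zv_closed)

lemma LZ_scale: "LZ (\<lambda>z. a * u z) = a \<odot>\<^bsub>B\<^esub> LZ u"
  unfolding LZ_def by (rule B.smult_lincomb[symmetric]) (use Zv_closed in auto)

lemma LZ_diff: "LZ (\<lambda>z. u z - v z) = LZ u \<ominus>\<^bsub>B\<^esub> LZ v"
proof -
  have "LZ (\<lambda>z. u z - v z) = LZ (\<lambda>z. u z + (- 1) * v z)" by (rule LZ_cong) simp
  then show ?thesis using LZ_closed by (simp only: LZ_add LZ_scale a_minus_def B.minus_eq_smult)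
qed

lemma LZ_single: "k \<in> I \<or> k = 0 \<Longrightarrow> LZ (\<lambda>z. a * of_bool (z = k)) = a \<odot>\<^bsub>B\<^esub> Zv k"
  unfolding LZ_def using B.lincomb_single[of "insert 0 I" k "\<lambda>z. a * of_bool (z = k)" Zv] Zv_closed by auto

abbreviation "null u \<equiv> LZ u = \<zero>\<^bsub>B\<^esub>"

lemma null_comb:
  assumes "null u" "null v" "\<And>z. z \<in> I \<or> z = 0 \<Longrightarrow> w z = a * u z + b * v z"
  shows "null w"
proof -
  have "LZ w = LZ (\<lambda>z. a * u z + b * v z)" by (rule LZ_cong) (use assms in auto)
  also have "\<dots> = a \<odot>\<^bsub>B\<^esub> LZ u \<oplus>\<^bsub>B\<^esub> b \<odot>\<^bsub>B\<^esub> LZ v" by (simp only: LZ_add LZ_scale)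
  finally show ?thesis using assms by simp
qed

lemma null_multiple:
  assumes "null u" "\<And>z. z \<in> I \<or> z = 0 \<Longrightarrow> w z = a * u z"
  shows "null w"
  by (rule null_comb[of u u w a 0]) (use assms in auto)

text \<open>Forwards, consecutive positive columns of \<open>Ev\<close> give the relations
  \<open>R3v\<close>; these carry \<open>Vv\<close> from the top index down to \<open>1\<close>,
  where it is \<open>R4v\<close>. Backwards, \<open>Vv\<close> is carried up to the top index and
  gives the last column of \<open>Ev\<close>; the \<open>R3v\<close> then yield the other positive
  columns in descending order, and from column \<open>- 1\<close> on the negative ones.\<close>

lemma null_Ev_iff:
  "(\<forall>k\<in>I. null (Ev c k)) \<longleftrightarrow> (\<forall>j\<in>{2..rr}. null (R3v j)) \<and> null (R4v c)"
proof
  assume E: "\<forall>k\<in>I. null (Ev c k)"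
  have mem: "j \<in> I" "j - 1 \<in> I" if "j \<in> {2..rr}" for j using that by (auto simp: idx_def)
  have R3: "null (R3v j)" if j: "j \<in> {2..rr}" for j
  proof (rule null_comb[of "Ev c (j - 1)" "Ev c j" _ "sg (j - 1)" "- sg (j - 1) * (Cv (j - 1) * inverse (Cv j))"])
    fix z
    have "Ev c (j - 1) z = sg (j - 1) * R3v j z + (Cv (j - 1) * inverse (Cv j)) * Ev c j z"
      using j by (intro Ev_R3v) auto
    then show "R3v j z = sg (j - 1) * Ev c (j - 1) z + - sg (j - 1) * (Cv (j - 1) * inverse (Cv j)) * Ev c j z"
      by (simp add: algebra_simps)
  qed (use E mem[OF j] in auto)
  have rr: "rr \<in> I" using n1 by (auto simp: idx_def)
  have V: "null (Vv c j)" if "1 \<le> j" "j \<le> rr" for j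
    using that(2,1)
  proof (induction j rule: int_le_induct)
    case base
    show ?case by (rule null_multiple[of "Ev c rr"]) (use E rr Vv_last in auto)
  next
    case (step j)
    show ?case
      by (rule null_comb[of "Vv c j" "R3v j" _ 1 "Cv (j - 1) * sg (j - 1)"]) (use step R3 Vv_R3v in auto)
  qed
  have "null (R4v c)" by (rule null_multiple[of "Vv c 1" _ 1]) (use V[of 1] n1 Vv_first in auto)
  then show "(\<forall>j\<in>{2..rr}. null (R3v j)) \<and> null (R4v c)" using R3 by blast
next
  assume R: "(\<forall>j\<in>{2..rr}. null (R3v j)) \<and> null (R4v c)"
  have V: "null (Vv c j)" if "1 \<le> j" "j \<le> rr" for j
    using that
  proof (induction j rule: int_ge_induct)
    case base
    show ?case by (rule null_multiple[of "R4v c" _ 1]) (use R Vv_first in auto)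
  next
    case (step j)
    show ?case
    proof (rule null_comb[of "Vv c j" "R3v (j + 1)" _ 1 "- (Cv j * sg j)"])
      fix z
      show "Vv c (j + 1) z = 1 * Vv c j z + - (Cv j * sg j) * R3v (j + 1) z"
        using Vv_R3v[of "j + 1" c z] step by simp
    qed (use step R in auto)
  qed
  have E: "null (Ev c j)" if "1 \<le> j" "j \<le> rr" for j
    using that(2,1)
  proof (induction j rule: int_le_induct)
    case base
    show ?case
      by (rule null_multiple[of "Vv c rr" _ "inverse (Cv rr)"]) (use V[of rr] base Vv_last Cv_nonzero[of rr] in auto)
  next
    case (step j)
    show ?case
      by (rule null_comb[of "R3v j" "Ev c j" _ "sg (j - 1)" "Cv (j - 1) * inverse (Cv j)"]) (use step R Ev_R3v in auto)
  qed
  have E': "null (Ev c (- j))" if "1 \<le> j" "j \<le> rr" for j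
    using that
  proof (induction j rule: int_ge_induct)
    case base
    show ?case
    proof (rule null_multiple[of "Ev c 1" _ "inverse (Dv 1) * inverse (Cv 1)"])
      fix z show "Ev c (- 1) z = inverse (Dv 1) * inverse (Cv 1) * Ev c 1 z"
        using Ev_minus_first[of c z] Dv_nonzero[of 1] Cv_nonzero[of 1] by (simp add: field_simps)
    qed (use E[of 1] base in auto)
  next
    case (step j)
    show ?case
    proof (rule null_comb[of "Ev c (- j)" "R3v (j + 1)" _ "inverse (Dv (j + 1)) * Dv j" "- (inverse (Dv (j + 1)) * (Cv j * sg j))"])
      fix z
      have "Dv (j + 1) * Ev c (- (j + 1)) z = Dv j * Ev c (- j) z - (Cv j * sg j) * R3v (j + 1) z"
        using Ev_minus_R3v[of "j + 1" c z] step by simp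
      then show "Ev c (- (j + 1)) z = inverse (Dv (j + 1)) * Dv j * Ev c (- j) z + - (inverse (Dv (j + 1)) * (Cv j * sg j)) * R3v (j + 1) z"
        using Dv_nonzero[of "j + 1"] by (simp add: field_simps)
    qed (use step R in auto)
  qed
  show "\<forall>k\<in>I. null (Ev c k)"
  proof
    fix k assume k: "k \<in> I"
    show "null (Ev c k)"
      using k E[of k] E'[of "- k"] by (cases "0 < k") (auto simp: idx_def)
  qed
qed

lemma covariant_antidiagonal_iff:
  assumes k: "k \<in> I"
  shows "lincomb B J (\<lambda>p. Rh p (k, - k)) (\<lambda>p. x (fst p) \<otimes>\<^bsub>B\<^esub> x (snd p)) =
        q \<odot>\<^bsub>B\<^esub> (x k \<otimes>\<^bsub>B\<^esub> x (- k)) \<oplus>\<^bsub>B\<^esub> (c * Crow (k, - k)) \<odot>\<^bsub>B\<^esub> \<one>\<^bsub>B\<^esub> \<longleftrightarrow> null (Ev c k)"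
proof -
  have sub: "(\<lambda>i. (i, - i)) ` I \<subseteq> J" by (auto simp: J_def)
  have "lincomb B J (\<lambda>p. Rh p (k, - k)) (\<lambda>p. x (fst p) \<otimes>\<^bsub>B\<^esub> x (snd p)) =
      lincomb B ((\<lambda>i. (i, - i)) ` I) (\<lambda>p. Rh p (k, - k)) (\<lambda>p. x (fst p) \<otimes>\<^bsub>B\<^esub> x (snd p))"
    by (rule B.lincomb_mono_neutral[symmetric, OF finite_J sub]) (auto simp: Rh_def J_def x_closed)
  also have "\<dots> = lincomb B I (\<lambda>i. Rh (i, - i) (k, - k)) (\<lambda>i. x (fst (i, - i)) \<otimes>\<^bsub>B\<^esub> x (snd (i, - i)))"
    by (rule B.lincomb_reindex) (auto intro: inj_onI simp: x_closed)
  also have "\<dots> = lincomb B I (\<lambda>z. of_bool (z \<noteq> 0) * Mh z k) Zv"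
    by (rule B.lincomb_cong) (auto simp: Rh_def Zv_def x_closed dest: I_nonzero)
  also have "\<dots> = LZ (\<lambda>z. of_bool (z \<noteq> 0) * Mh z k)"
    unfolding LZ_def by (rule B.lincomb_mono_neutral) (use Zv_closed in auto)
  finally have l: "lincomb B J (\<lambda>p. Rh p (k, - k)) (\<lambda>p. x (fst p) \<otimes>\<^bsub>B\<^esub> x (snd p)) = LZ (\<lambda>z. of_bool (z \<noteq> 0) * Mh z k)" .
  have k0: "k \<noteq> 0" using k I_nonzero by blast
  have r: "q \<odot>\<^bsub>B\<^esub> (x k \<otimes>\<^bsub>B\<^esub> x (- k)) \<oplus>\<^bsub>B\<^esub> (c * Crow (k, - k)) \<odot>\<^bsub>B\<^esub> \<one>\<^bsub>B\<^esub> =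
      LZ (\<lambda>z. q * of_bool (z = k) + (c * Cv k) * of_bool (z = 0))"
    unfolding LZ_add using LZ_single[of k q] LZ_single[of 0 "c * Cv k"] k k0 by (simp add: Zv_def Crow_def Cv_def)
  have "Ev c k = (\<lambda>z. of_bool (z \<noteq> 0) * Mh z k - (q * of_bool (z = k) + (c * Cv k) * of_bool (z = 0)))"
    by (simp add: Ev_def fun_eq_iff algebra_simps)
  then have "LZ (Ev c k) = LZ (\<lambda>z. of_bool (z \<noteq> 0) * Mh z k) \<ominus>\<^bsub>B\<^esub> LZ (\<lambda>z. q * of_bool (z = k) + (c * Cv k) * of_bool (z = 0))"
    by (simp only: LZ_diff)
  then show ?thesis unfolding l r using B.sub_eq_zero_iff[OF LZ_closed LZ_closed] by simp
qed

text \<open>A block of size one compares its eigenvalue with \<open>q\<close>: for even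
  \<open>k\<close> they agree, for odd \<open>k\<close> the difference
  \<open>- (q + inverse q)\<close> is nonzero and the square must vanish. In a block of size two the
  column with \<open>l < k\<close> is the commutation relation, and the other column follows from
  it.\<close>

lemma covariant_offdiagonal_iff:
  assumes q2: "q * q \<noteq> - 1"
  shows "(\<forall>k\<in>I. \<forall>l\<in>I. l \<noteq> - k \<longrightarrow> lincomb B J (\<lambda>p. Rh p (k, l)) (\<lambda>p. x (fst p) \<otimes>\<^bsub>B\<^esub> x (snd p)) =
        q \<odot>\<^bsub>B\<^esub> (x k \<otimes>\<^bsub>B\<^esub> x l) \<oplus>\<^bsub>B\<^esub> (c * Crow (k, l)) \<odot>\<^bsub>B\<^esub> \<one>\<^bsub>B\<^esub>) \<longleftrightarrow>
    (\<forall>i\<in>I. \<eta> i = 1 \<longrightarrow> x i \<otimes>\<^bsub>B\<^esub> x i = \<zero>\<^bsub>B\<^esub>) \<and>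
    (\<forall>i\<in>I. \<forall>j\<in>I. i < j \<and> i \<noteq> - j \<longrightarrow> x i \<otimes>\<^bsub>B\<^esub> x j = (of_int (sig2 n i j) * q) \<odot>\<^bsub>B\<^esub> (x j \<otimes>\<^bsub>B\<^esub> x i))"
    (is "(\<forall>k\<in>I. \<forall>l\<in>I. l \<noteq> - k \<longrightarrow> ?P k l) \<longleftrightarrow> ?R1 \<and> ?R2")
proof -
  have c0: "Crow (k, l) = 0" if "l \<noteq> - k" for k l using that by (simp add: Crow_def Cq_eq_0)
  have xx: "x i \<otimes>\<^bsub>B\<^esub> x j \<in> carrier B" if "i \<in> I" "j \<in> I" for i j using that x_closed by auto
  have diag: "?P k k \<longleftrightarrow> (\<eta> k = 1 \<longrightarrow> x k \<otimes>\<^bsub>B\<^esub> x k = \<zero>\<^bsub>B\<^esub>)" if k: "k \<in> I" for k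
  proof -
    have kk: "k \<noteq> - k" using I_nonzero[OF k] by auto
    have "lincomb B J (\<lambda>p. Rh p (k, k)) (\<lambda>p. x (fst p) \<otimes>\<^bsub>B\<^esub> x (snd p)) =
        Rh (k, k) (k, k) \<odot>\<^bsub>B\<^esub> (x (fst (k, k)) \<otimes>\<^bsub>B\<^esub> x (snd (k, k)))"
      by (rule B.lincomb_single) (use k kk in \<open>auto simp: J_def Rh_def x_closed\<close>)
    then have e: "?P k k \<longleftrightarrow> (sg k * q powi sig n k) \<odot>\<^bsub>B\<^esub> (x k \<otimes>\<^bsub>B\<^esub> x k) = q \<odot>\<^bsub>B\<^esub> (x k \<otimes>\<^bsub>B\<^esub> x k)"
      using kk k xx by (simp add: Rh_def c0)
    show ?thesis
    proof (cases "\<eta> k = 1")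
      case True
      then have s: "sg k * q powi sig n k = - inverse q" by (simp add: sg_def sig_def sig2_def)
      have "q + inverse q \<noteq> 0" using q2 q0 by (simp add: field_simps) (metis add.commute add_eq_0_iff)
      have "x k \<otimes>\<^bsub>B\<^esub> x k = \<zero>\<^bsub>B\<^esub>" if h: "(- inverse q) \<odot>\<^bsub>B\<^esub> (x k \<otimes>\<^bsub>B\<^esub> x k) = q \<odot>\<^bsub>B\<^esub> (x k \<otimes>\<^bsub>B\<^esub> x k)"
      proof (rule B.smult_cancel[OF \<open>q + inverse q \<noteq> 0\<close> xx[OF k k]])
        have "(q + inverse q) \<odot>\<^bsub>B\<^esub> (x k \<otimes>\<^bsub>B\<^esub> x k) = (- inverse q) \<odot>\<^bsub>B\<^esub> (x k \<otimes>\<^bsub>B\<^esub> x k) \<oplus>\<^bsub>B\<^esub> inverse q \<odot>\<^bsub>B\<^esub> (x k \<otimes>\<^bsub>B\<^esub> x k)"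
          unfolding h using xx[OF k k] by (simp add: B.smult_add_left)
        also have "\<dots> = (- inverse q + inverse q) \<odot>\<^bsub>B\<^esub> (x k \<otimes>\<^bsub>B\<^esub> x k)"
          by (rule B.smult_add_left[symmetric, OF xx[OF k k]])
        finally show "(q + inverse q) \<odot>\<^bsub>B\<^esub> (x k \<otimes>\<^bsub>B\<^esub> x k) = (q + inverse q) \<odot>\<^bsub>B\<^esub> \<zero>\<^bsub>B\<^esub>"
          using xx[OF k k] by simp
      qed simp
      then show ?thesis unfolding e s using True by auto
    next
      case False
      then have "\<eta> k = 0" using bit_cases by blast
      then have "sg k * q powi sig n k = q" by (simp add: sg_def sig_def sig2_def)
      then show ?thesis unfolding e using False by simp
    qed
  qed
  have off: "?P k l \<longleftrightarrow> of_int (sig2 n k l) \<odot>\<^bsub>B\<^esub> (x l \<otimes>\<^bsub>B\<^esub> x k) \<oplus>\<^bsub>B\<^esub> (of_bool (k < l) * \<kappa>) \<odot>\<^bsub>B\<^esub> (x k \<otimes>\<^bsub>B\<^esub> x l) = q \<odot>\<^bsub>B\<^esub> (x k \<otimes>\<^bsub>B\<^esub> x l)"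
    if kl: "k \<in> I" "l \<in> I" "l \<noteq> - k" "l \<noteq> k" for k l
  proof -
    have "lincomb B J (\<lambda>p. Rh p (k, l)) (\<lambda>p. x (fst p) \<otimes>\<^bsub>B\<^esub> x (snd p)) =
        lincomb B {(l, k), (k, l)} (\<lambda>p. Rh p (k, l)) (\<lambda>p. x (fst p) \<otimes>\<^bsub>B\<^esub> x (snd p))"
      by (rule B.lincomb_mono_neutral[symmetric]) (use kl in \<open>auto simp: J_def Rh_def x_closed\<close>)
    also have "\<dots> = of_int (sig2 n k l) \<odot>\<^bsub>B\<^esub> (x l \<otimes>\<^bsub>B\<^esub> x k) \<oplus>\<^bsub>B\<^esub> (of_bool (k < l) * \<kappa>) \<odot>\<^bsub>B\<^esub> (x k \<otimes>\<^bsub>B\<^esub> x l)"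
    proof -
      have "lincomb B {(l, k), (k, l)} (\<lambda>p. Rh p (k, l)) (\<lambda>p. x (fst p) \<otimes>\<^bsub>B\<^esub> x (snd p)) =
          Rh (l, k) (k, l) \<odot>\<^bsub>B\<^esub> (x (fst (l, k)) \<otimes>\<^bsub>B\<^esub> x (snd (l, k))) \<oplus>\<^bsub>B\<^esub>
          lincomb B {(k, l)} (\<lambda>p. Rh p (k, l)) (\<lambda>p. x (fst p) \<otimes>\<^bsub>B\<^esub> x (snd p))"
        by (rule B.lincomb_insert) (use kl xx in auto)
      also have "lincomb B {(k, l)} (\<lambda>p. Rh p (k, l)) (\<lambda>p. x (fst p) \<otimes>\<^bsub>B\<^esub> x (snd p)) =
          Rh (k, l) (k, l) \<odot>\<^bsub>B\<^esub> (x (fst (k, l)) \<otimes>\<^bsub>B\<^esub> x (snd (k, l)))"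
        by (rule B.lincomb_singleton) (use kl xx in auto)
      finally show ?thesis using kl by (simp add: Rh_def)
    qed
    finally show ?thesis using kl xx by (simp add: c0)
  qed
  have s2: "of_int (sig2 n k l) * of_int (sig2 n k l) = (1 :: 'k)" "sig2 n l k = sig2 n k l" for k l
    by (simp_all add: sig2_def sgnf_def mult.commute flip: of_int_mult)
  have gt: "?P k l \<longleftrightarrow> x l \<otimes>\<^bsub>B\<^esub> x k = (of_int (sig2 n l k) * q) \<odot>\<^bsub>B\<^esub> (x k \<otimes>\<^bsub>B\<^esub> x l)"
    if kl: "k \<in> I" "l \<in> I" "l \<noteq> - k" "l < k" for k l
  proof -
    have "?P k l \<longleftrightarrow> of_int (sig2 n k l) \<odot>\<^bsub>B\<^esub> (x l \<otimes>\<^bsub>B\<^esub> x k) = q \<odot>\<^bsub>B\<^esub> (x k \<otimes>\<^bsub>B\<^esub> x l)"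
      using off[of k l] kl xx by simp
    also have "\<dots> \<longleftrightarrow> x l \<otimes>\<^bsub>B\<^esub> x k = (of_int (sig2 n k l) * q) \<odot>\<^bsub>B\<^esub> (x k \<otimes>\<^bsub>B\<^esub> x l)"
    proof
      assume "of_int (sig2 n k l) \<odot>\<^bsub>B\<^esub> (x l \<otimes>\<^bsub>B\<^esub> x k) = q \<odot>\<^bsub>B\<^esub> (x k \<otimes>\<^bsub>B\<^esub> x l)"
      then have "of_int (sig2 n k l) \<odot>\<^bsub>B\<^esub> (of_int (sig2 n k l) \<odot>\<^bsub>B\<^esub> (x l \<otimes>\<^bsub>B\<^esub> x k)) =
          of_int (sig2 n k l) \<odot>\<^bsub>B\<^esub> (q \<odot>\<^bsub>B\<^esub> (x k \<otimes>\<^bsub>B\<^esub> x l))" by simp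
      then show "x l \<otimes>\<^bsub>B\<^esub> x k = (of_int (sig2 n k l) * q) \<odot>\<^bsub>B\<^esub> (x k \<otimes>\<^bsub>B\<^esub> x l)"
        using kl xx s2 by simp
    next
      assume "x l \<otimes>\<^bsub>B\<^esub> x k = (of_int (sig2 n k l) * q) \<odot>\<^bsub>B\<^esub> (x k \<otimes>\<^bsub>B\<^esub> x l)"
      then show "of_int (sig2 n k l) \<odot>\<^bsub>B\<^esub> (x l \<otimes>\<^bsub>B\<^esub> x k) = q \<odot>\<^bsub>B\<^esub> (x k \<otimes>\<^bsub>B\<^esub> x l)"
        using kl xx s2(1)[of k l] by (simp add: mult.assoc[symmetric])
    qed
    finally show ?thesis by (simp add: s2)
  qed
  have lt: "?P k l" if kl: "k \<in> I" "l \<in> I" "l \<noteq> - k" "k < l"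
    and h: "x k \<otimes>\<^bsub>B\<^esub> x l = (of_int (sig2 n k l) * q) \<odot>\<^bsub>B\<^esub> (x l \<otimes>\<^bsub>B\<^esub> x k)" for k l
  proof -
    have c: "x l \<otimes>\<^bsub>B\<^esub> x k \<in> carrier B" using xx kl by blast
    \<comment> \<open>The identity \<open>1 + \<kappa> * q = q * q\<close> makes the column with
      \<open>k < l\<close> a consequence of the commutation relation.\<close>
    have "of_int (sig2 n k l) + \<kappa> * (of_int (sig2 n k l) * q) = q * (of_int (sig2 n k l) * q)"
      using q0 by (simp add: algebra_simps)
    then have "of_int (sig2 n k l) \<odot>\<^bsub>B\<^esub> (x l \<otimes>\<^bsub>B\<^esub> x k) \<oplus>\<^bsub>B\<^esub> \<kappa> \<odot>\<^bsub>B\<^esub> (x k \<otimes>\<^bsub>B\<^esub> x l) = q \<odot>\<^bsub>B\<^esub> (x k \<otimes>\<^bsub>B\<^esub> x l)"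
      unfolding h using c by (simp add: B.smult_add_left[symmetric])
    then show ?thesis using off[of k l] kl by simp
  qed
  show ?thesis
  proof
    assume P: "\<forall>k\<in>I. \<forall>l\<in>I. l \<noteq> - k \<longrightarrow> ?P k l"
    have "?R1"
    proof (intro ballI impI)
      fix i assume i: "i \<in> I" "\<eta> i = 1"
      then have "i \<noteq> - i" using I_nonzero[OF i(1)] by auto
      then have "?P i i" using P i by blast
      then show "x i \<otimes>\<^bsub>B\<^esub> x i = \<zero>\<^bsub>B\<^esub>" using diag[OF i(1)] i by blast
    qed
    moreover have "?R2"
    proof (intro ballI impI)
      fix i j assume ij: "i \<in> I" "j \<in> I" "i < j \<and> i \<noteq> - j"
      then have "?P j i" using P by blast
      then show "x i \<otimes>\<^bsub>B\<^esub> x j = (of_int (sig2 n i j) * q) \<odot>\<^bsub>B\<^esub> (x j \<otimes>\<^bsub>B\<^esub> x i)" using gt[of j i] ij by blast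
    qed
    ultimately show "?R1 \<and> ?R2" by blast
  next
    assume R: "?R1 \<and> ?R2"
    show "\<forall>k\<in>I. \<forall>l\<in>I. l \<noteq> - k \<longrightarrow> ?P k l"
    proof (intro ballI impI)
      fix k l assume kl: "k \<in> I" "l \<in> I" "l \<noteq> - k"
      consider "k = l" | "l < k" | "k < l" by linarith
      then show "?P k l"
      proof cases
        case 1
        have "?P k k" using diag[OF kl(1)] R kl(1) by blast
        then show ?thesis using 1 by simp
      next
        case 2
        then show ?thesis using gt[OF kl 2] R kl by blast
      next
        case 3
        have "k \<noteq> - l" using kl by auto
        then show ?thesis using lt[OF kl 3] R kl 3 by blast
      qed
    qed
  qed
qed

text \<open>Applied in one direction to the projection onto the Weyl superalgebra and in the other
  to homomorphisms that are to be lifted from the free superalgebra.\<close>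

lemma hom_weyl_rels_iff:
  assumes q2: "q * q \<noteq> - 1" and f: "f \<in> superalgebra_hom FW B" and fx: "\<And>i. i \<in> I \<Longrightarrow> f (var i) = x i"
  shows "(\<forall>s\<in>weyl_rels n m q c. f s = \<zero>\<^bsub>B\<^esub>) \<longleftrightarrow> covariant B c x"
proof -
  interpret F: superalgebra FW by (rule superalgebra_free)
  have vc: "var i \<in> carrier FW" if "i \<in> I" for i using that by (rule var_carrier)
  have vv: "var i * var j \<in> carrier FW" "f (var i * var j) = x i \<otimes>\<^bsub>B\<^esub> x j" if "i \<in> I" "j \<in> I" for i j
    using F.m_closed[OF vc[OF that(1)] vc[OF that(2)]] hom_mult[OF f vc[OF that(1)] vc[OF that(2)]] that by (simp_all add: fx)
  have cvv: "const a * var i * var j \<in> carrier FW" "f (const a * var i * var j) = a \<odot>\<^bsub>B\<^esub> (x i \<otimes>\<^bsub>B\<^esub> x j)"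
    if "i \<in> I" "j \<in> I" for a i j
  proof -
    have "const a * var i * var j = const a * (var i * var j)" by (rule mult.assoc)
    then have "const a * var i * var j = a \<odot>\<^bsub>FW\<^esub> (var i * var j)" by (simp add: const_mult)
    then show "const a * var i * var j \<in> carrier FW" "f (const a * var i * var j) = a \<odot>\<^bsub>B\<^esub> (x i \<otimes>\<^bsub>B\<^esub> x j)"
      using F.smult_in_carrier[OF vv(1)[OF that]] hom_smult[OF f vv(1)[OF that]] vv(2)[OF that] by simp_all
  qed
  have fc: "f (const a) = a \<odot>\<^bsub>B\<^esub> \<one>\<^bsub>B\<^esub>" for a
  proof -
    have "const a = a \<odot>\<^bsub>FW\<^esub> \<one>\<^bsub>FW\<^esub>" using const_mult[of a 1] by simp
    then show ?thesis using hom_smult[OF f F.one_closed] hom_one[OF f] by simp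
  qed
  note fm = hom_free_minus[OF B f]
  note mc = free_minus_closed[of _ I \<eta>]
  have R2: "f (var i * var j - const (of_int (sig2 n i j) * q) * var j * var i) = \<zero>\<^bsub>B\<^esub> \<longleftrightarrow>
      x i \<otimes>\<^bsub>B\<^esub> x j = (of_int (sig2 n i j) * q) \<odot>\<^bsub>B\<^esub> (x j \<otimes>\<^bsub>B\<^esub> x i)" if "i \<in> I" "j \<in> I" for i j
    using B.sub_eq_zero_iff[of "x i \<otimes>\<^bsub>B\<^esub> x j" "(of_int (sig2 n i j) * q) \<odot>\<^bsub>B\<^esub> (x j \<otimes>\<^bsub>B\<^esub> x i)"] that x_closed
    by (simp add: fm[OF vv(1)[OF that] cvv(1)[OF that(2,1)]] vv cvv)
  have R3: "f ((const (q powi (- sig n (j - 1))) * var (- j + 1) * var (j - 1)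
        - const (of_int (sig n (j - 1)) * q) * var (j - 1) * var (- j + 1))
     - (const (of_int (sig n (j - 1) * sig n j)) * var (- j) * var j
        - const (of_int (sig n (j - 1)) * q * q powi (- sig n j)) * var j * var (- j))) = LZ (R3v j)"
    if j: "2 \<le> j" "j \<le> rr" for j
  proof -
    have m: "j \<in> I" "- j \<in> I" "j - 1 \<in> I" "- j + 1 \<in> I" using j by (auto simp: idx_def)
    have nz: "- j + 1 \<noteq> 0" "j - 1 \<noteq> 0" "- j \<noteq> 0" "j \<noteq> 0" using j by auto
    have Z: "x (- j + 1) \<otimes>\<^bsub>B\<^esub> x (j - 1) = Zv (- j + 1)" "x (j - 1) \<otimes>\<^bsub>B\<^esub> x (- j + 1) = Zv (j - 1)"
      "x (- j) \<otimes>\<^bsub>B\<^esub> x j = Zv (- j)" "x j \<otimes>\<^bsub>B\<^esub> x (- j) = Zv j"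
      using nz by (simp_all add: Zv_def)
    have LR: "LZ (R3v j) = ((q powi (- sig n (j - 1))) \<odot>\<^bsub>B\<^esub> Zv (- j + 1) \<ominus>\<^bsub>B\<^esub> (of_int (sig n (j - 1)) * q) \<odot>\<^bsub>B\<^esub> Zv (j - 1))
       \<ominus>\<^bsub>B\<^esub> ((of_int (sig n (j - 1) * sig n j)) \<odot>\<^bsub>B\<^esub> Zv (- j) \<ominus>\<^bsub>B\<^esub> (of_int (sig n (j - 1)) * q * q powi (- sig n j)) \<odot>\<^bsub>B\<^esub> Zv j)"
      unfolding R3v_def LZ_diff
      using LZ_single[OF disjI1[OF m(4)], of "q powi (- sig n (j - 1))"] LZ_single[OF disjI1[OF m(3)], of "of_int (sig n (j - 1)) * q"]
        LZ_single[OF disjI1[OF m(2)], of "of_int (sig n (j - 1) * sig n j)"]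
        LZ_single[OF disjI1[OF m(1)], of "of_int (sig n (j - 1)) * q * q powi (- sig n j)"]
      by simp
    show ?thesis unfolding LR
      by (simp only: fm[OF mc[OF cvv(1)[OF m(4,3)] cvv(1)[OF m(3,4)]] mc[OF cvv(1)[OF m(2,1)] cvv(1)[OF m(1,2)]]]
          fm[OF cvv(1)[OF m(4,3)] cvv(1)[OF m(3,4)]] fm[OF cvv(1)[OF m(2,1)] cvv(1)[OF m(1,2)]]
          cvv(2)[OF m(4,3)] cvv(2)[OF m(3,4)] cvv(2)[OF m(2,1)] cvv(2)[OF m(1,2)] Z)
  qed
  have R4: "f ((var (- 1) * var 1 - const (q ^ 2) * var 1 * var (- 1))
     - (const (q powi (2 * (int n - int m)) * c) - (\<Sum>i=2..rr. const (\<kappa> * Cq_inv n q i (- i)) * var i * var (- i)))) = LZ (R4v c)"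
  proof -
    have m: "- 1 \<in> I" "1 \<in> I" using n1 by (auto simp: idx_def)
    have sub: "{2..rr} \<subseteq> I" by (auto simp: idx_def)
    then have sm: "i \<in> I \<and> - i \<in> I" if "i \<in> {2..rr}" for i using that by auto
    note S = hom_quadratic[OF B f, of "{2..rr}" "\<lambda>i. i" "\<lambda>i. - i" "\<lambda>i. \<kappa> * Cq_inv n q i (- i)", OF finite_atLeastAtMost_int sm]
    have "f (\<Sum>i=2..rr. const (\<kappa> * Cq_inv n q i (- i)) * var i * var (- i)) =
        lincomb B {2..rr} (\<lambda>i. \<kappa> * Cq_inv n q i (- i)) (\<lambda>i. f (var i) \<otimes>\<^bsub>B\<^esub> f (var (- i)))"
      by (rule S(1)) simp_all
    also have "\<dots> = lincomb B {2..rr} (\<lambda>z. \<kappa> * Dv z * of_bool (2 \<le> z)) Zv"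
      by (rule B.lincomb_cong[OF refl]) (use sm x_closed in \<open>auto simp: fx Zv_def Dv_def\<close>)
    also have "\<dots> = LZ (\<lambda>z. \<kappa> * Dv z * of_bool (2 \<le> z))"
      unfolding LZ_def by (rule B.lincomb_mono_neutral) (use sub Zv_closed in \<open>auto simp: idx_def\<close>)
    finally have fS: "f (\<Sum>i=2..rr. const (\<kappa> * Cq_inv n q i (- i)) * var i * var (- i)) = LZ (\<lambda>z. \<kappa> * Dv z * of_bool (2 \<le> z))" .
    have Sc: "(\<Sum>i=2..rr. const (\<kappa> * Cq_inv n q i (- i)) * var i * var (- i)) \<in> carrier FW"
      by (rule S(2)) simp_all
    have LR: "LZ (R4v c) = (1 \<odot>\<^bsub>B\<^esub> Zv (- 1) \<ominus>\<^bsub>B\<^esub> q ^ 2 \<odot>\<^bsub>B\<^esub> Zv 1)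
       \<ominus>\<^bsub>B\<^esub> ((q powi (2 * (int n - int m)) * c) \<odot>\<^bsub>B\<^esub> Zv 0 \<ominus>\<^bsub>B\<^esub> LZ (\<lambda>z. \<kappa> * Dv z * of_bool (2 \<le> z)))"
      unfolding R4v_def LZ_diff
      using LZ_single[OF disjI1[OF m(1)], of 1] LZ_single[OF disjI1[OF m(2)], of "q ^ 2"] LZ_single[of 0 "q powi (2 * (int n - int m)) * c"]
      by simp
    have Z: "x (- 1) \<otimes>\<^bsub>B\<^esub> x 1 = 1 \<odot>\<^bsub>B\<^esub> Zv (- 1)" "x 1 \<otimes>\<^bsub>B\<^esub> x (- 1) = Zv 1" "\<one>\<^bsub>B\<^esub> = Zv 0"
      using m x_closed by (simp_all add: Zv_def)
    show ?thesis unfolding LR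
      by (simp only: fm[OF mc[OF vv(1)[OF m(1,2)] cvv(1)[OF m(2,1)]] mc[OF const_closed Sc]]
          fm[OF vv(1)[OF m(1,2)] cvv(1)[OF m(2,1)]] fm[OF const_closed Sc] vv(2)[OF m(1,2)] cvv(2)[OF m(2,1)] fc fS Z)
  qed
  have "(\<forall>s\<in>weyl_rels n m q c. f s = \<zero>\<^bsub>B\<^esub>) \<longleftrightarrow>
     (\<forall>i\<in>I. \<eta> i = 1 \<longrightarrow> x i \<otimes>\<^bsub>B\<^esub> x i = \<zero>\<^bsub>B\<^esub>) \<and>
     (\<forall>i\<in>I. \<forall>j\<in>I. i < j \<and> i \<noteq> - j \<longrightarrow> x i \<otimes>\<^bsub>B\<^esub> x j = (of_int (sig2 n i j) * q) \<odot>\<^bsub>B\<^esub> (x j \<otimes>\<^bsub>B\<^esub> x i)) \<and>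
     (\<forall>j\<in>{2..rr}. null (R3v j)) \<and> null (R4v c)"
    (is "?l \<longleftrightarrow> ?r")
  proof
    assume l: ?l
    have "x i \<otimes>\<^bsub>B\<^esub> x i = \<zero>\<^bsub>B\<^esub>" if "i \<in> I" "\<eta> i = 1" for i
    proof -
      have "var i * var i \<in> weyl_rels n m q c" using that unfolding weyl_rels_def by blast
      then have "f (var i * var i) = \<zero>\<^bsub>B\<^esub>" using l by blast
      then show ?thesis using vv(2) that by simp
    qed
    moreover have "x i \<otimes>\<^bsub>B\<^esub> x j = (of_int (sig2 n i j) * q) \<odot>\<^bsub>B\<^esub> (x j \<otimes>\<^bsub>B\<^esub> x i)" if "i \<in> I" "j \<in> I" "i < j" "i \<noteq> - j" for i j
    proof -
      have "var i * var j - const (of_int (sig2 n i j) * q) * var j * var i \<in> weyl_rels n m q c"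
        using that unfolding weyl_rels_def by blast
      then show ?thesis using l R2[OF that(1,2)] by blast
    qed
    moreover have "null (R3v j)" if "j \<in> {2..rr}" for j
    proof -
      have j: "2 \<le> j" "j \<le> rr" using that by auto
      then have "(const (q powi (- sig n (j - 1))) * var (- j + 1) * var (j - 1)
          - const (of_int (sig n (j - 1)) * q) * var (j - 1) * var (- j + 1))
        - (const (of_int (sig n (j - 1) * sig n j)) * var (- j) * var j
          - const (of_int (sig n (j - 1)) * q * q powi (- sig n j)) * var j * var (- j)) \<in> weyl_rels n m q c"
        unfolding weyl_rels_def by blast
      then show ?thesis using l R3[OF j] by force
    qed
    moreover have "null (R4v c)" using l unfolding weyl_rels_def using R4 by (simp add: ball_Un)
    ultimately show ?r by blast
  next
    assume r: ?r
    show ?l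
    proof
      fix s assume "s \<in> weyl_rels n m q c"
      then consider i where "s = var i * var i" "i \<in> I" "\<eta> i = 1"
        | i j where "s = var i * var j - const (of_int (sig2 n i j) * q) * var j * var i" "i \<in> I" "j \<in> I" "i < j" "i \<noteq> - j"
        | j where "s = (const (q powi (- sig n (j - 1))) * var (- j + 1) * var (j - 1)
              - const (of_int (sig n (j - 1)) * q) * var (j - 1) * var (- j + 1))
            - (const (of_int (sig n (j - 1) * sig n j)) * var (- j) * var j
              - const (of_int (sig n (j - 1)) * q * q powi (- sig n j)) * var j * var (- j))" "2 \<le> j" "j \<le> rr"
        | "s = (var (- 1) * var 1 - const (q ^ 2) * var 1 * var (- 1))
            - (const (q powi (2 * (int n - int m)) * c) - (\<Sum>i=2..rr. const (\<kappa> * Cq_inv n q i (- i)) * var i * var (- i)))"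
        unfolding weyl_rels_def by blast
      then show "f s = \<zero>\<^bsub>B\<^esub>"
      proof cases
        case 1
        then show ?thesis using r vv(2)[of i i] by simp
      next
        case (2 i j)
        then show ?thesis using r R2[OF 2(2,3)] by blast
      next
        case (3 j)
        have "null (R3v j)" using r 3(2,3) by simp
        then show ?thesis unfolding 3(1) R3[OF 3(2,3)] .
      next
        case 4
        then show ?thesis using r R4 by simp
      qed
    qed
  qed
  also have "\<dots> \<longleftrightarrow> covariant B c x"
  proof -
    let ?P = "\<lambda>k l. lincomb B J (\<lambda>p. Rh p (k, l)) (\<lambda>p. x (fst p) \<otimes>\<^bsub>B\<^esub> x (snd p)) =
        q \<odot>\<^bsub>B\<^esub> (x k \<otimes>\<^bsub>B\<^esub> x l) \<oplus>\<^bsub>B\<^esub> (c * Crow (k, l)) \<odot>\<^bsub>B\<^esub> \<one>\<^bsub>B\<^esub>"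
    have "covariant B c x \<longleftrightarrow> (\<forall>k\<in>I. \<forall>l\<in>I. ?P k l)" using x by (simp add: covariant_def J_def)
    \<comment> \<open>The squares and the commutation relations correspond to the columns off the
      antidiagonal, the remaining two families of relations to the antidiagonal ones.\<close>
    also have "\<dots> \<longleftrightarrow> (\<forall>k\<in>I. \<forall>l\<in>I. l \<noteq> - k \<longrightarrow> ?P k l) \<and> (\<forall>k\<in>I. ?P k (- k))"
    proof -
      have "(\<forall>k\<in>I. \<forall>l\<in>I. Q k l) \<longleftrightarrow> (\<forall>k\<in>I. \<forall>l\<in>I. l \<noteq> - k \<longrightarrow> Q k l) \<and> (\<forall>k\<in>I. Q k (- k))" for Q
        by (metis I_uminus)
      then show ?thesis .
    qed
    also have "(\<forall>k\<in>I. ?P k (- k)) \<longleftrightarrow> (\<forall>k\<in>I. null (Ev c k))"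
      using covariant_antidiagonal_iff by blast
    finally show ?thesis unfolding null_Ev_iff covariant_offdiagonal_iff[OF q2] by blast
  qed
  finally show ?thesis .
qed

end

end

section \<open>Covariance of the images of the generators\<close>

context quantum_parameters
begin

text \<open>\<open>Rh\<close> is passed from behind the matrix of \<open>s\<close> to in front of
  it, where it acts on \<open>X\<close> and produces \<open>q X + c C\<close>. The first term is
  again the row of products of the images; in the second the matrix of \<open>s\<close> reproduces
  \<open>C\<close>.\<close>

lemma covariant_coact:
  assumes A: "superalgebra A" and C: "superalgebra C" and x: "covariant A c x" and s: "spo C s"
  shows "covariant (A \<otimes>\<^sub>s C) c (coact A C x s)"
proof -
  interpret AC: tensor_pair A C by (rule tensor_pair.intro[OF A C])
  have sh: "\<forall>i\<in>I. \<forall>j\<in>I. s i j \<in> homog C (\<eta> i + \<eta> j)" using s by (simp add: spo_def rtt_def)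
  have xh: "x i \<in> homog A (0 + \<eta> i)" if "i \<in> I" for i using x that by (simp add: covariant_def)
  have xc: "x i \<in> carrier A" if "i \<in> I" for i using xh[OF that] by auto
  note cl = tt_closed[OF C sh]
  define X where "X p = x (fst p) \<otimes>\<^bsub>A\<^esub> x (snd p)" for p
  have Xc: "X p \<in> carrier A" if "p \<in> J" for p using that xc by (auto simp: X_def J_def)
  define Y where "Y = coact A C x s"
  have Yh: "Y i \<in> homog AC.T (\<eta> i)" if "i \<in> I" for i
    unfolding Y_def using coact_homog[OF A C sh, of x 0 i] xh that by simp
  have YY: "Y (fst r) \<otimes>\<^bsub>AC.T\<^esub> Y (snd r) = lincomb AC.T J (\<lambda>_. 1) (\<lambda>p. AC.P (X p) (tt C s p r))" if r: "r \<in> J" for r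
  proof -
    have "Y (fst r) \<otimes>\<^bsub>AC.T\<^esub> Y (snd r) = lincomb AC.T J (\<lambda>p. of_int (sgnf (\<eta> (fst p) + \<eta> (fst r)) 0))
        (\<lambda>p. AC.P (x (fst p) \<otimes>\<^bsub>A\<^esub> x (snd p)) (tt C s p (fst r, snd r)))"
      unfolding Y_def by (rule coact_mult[OF A C sh]) (use xc xh r in \<open>auto simp: J_def\<close>)
    then show ?thesis by (simp add: X_def)
  qed
  have XX: "lincomb A J (\<lambda>p. Rh p r) X = q \<odot>\<^bsub>A\<^esub> X r \<oplus>\<^bsub>A\<^esub> (c * Crow r) \<odot>\<^bsub>A\<^esub> \<one>\<^bsub>A\<^esub>" if "r \<in> J" for r
    using x that unfolding covariant_def X_def[abs_def] by blast
  have "lincomb AC.T J (\<lambda>p. Rh p r) (\<lambda>p. Y (fst p) \<otimes>\<^bsub>AC.T\<^esub> Y (snd p)) =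
      q \<odot>\<^bsub>AC.T\<^esub> (Y (fst r) \<otimes>\<^bsub>AC.T\<^esub> Y (snd r)) \<oplus>\<^bsub>AC.T\<^esub> (c * Crow r) \<odot>\<^bsub>AC.T\<^esub> \<one>\<^bsub>AC.T\<^esub>" if r: "r \<in> J" for r
  proof -
    have "lincomb AC.T J (\<lambda>p. Rh p r) (\<lambda>p. Y (fst p) \<otimes>\<^bsub>AC.T\<^esub> Y (snd p)) =
        lincomb AC.T J (\<lambda>p. Rh p r) (\<lambda>p. lincomb AC.T J (\<lambda>_. 1) (\<lambda>u. AC.P (X u) (tt C s u p)))"
      by (rule AC.T.lincomb_cong_all) (use YY Xc cl in auto)
    also have "\<dots> = lincomb AC.T J (\<lambda>_. 1) (\<lambda>u. lincomb AC.T J (\<lambda>p. Rh p r) (\<lambda>p. AC.P (X u) (tt C s u p)))"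
      by (rule AC.T.lincomb_swap) (use Xc cl in auto)
    also have "\<dots> = lincomb AC.T J (\<lambda>_. 1) (\<lambda>u. lincomb AC.T J (Rh u) (\<lambda>p. AC.P (X u) (tt C s p r)))"
    proof (rule AC.T.lincomb_cong_all)
      fix u assume u: "u \<in> J"
      have "lincomb AC.T J (\<lambda>p. Rh p r) (\<lambda>p. AC.P (X u) (tt C s u p)) = AC.P (X u) (lincomb C J (\<lambda>p. Rh p r) (tt C s u))"
        by (rule AC.P_lincomb_right[symmetric]) (use Xc cl u in auto)
      also have "lincomb C J (\<lambda>p. Rh p r) (tt C s u) = lincomb C J (Rh u) (\<lambda>p. tt C s p r)"
        using s u r by (simp add: spo_def rtt_def)
      also have "AC.P (X u) (lincomb C J (Rh u) (\<lambda>p. tt C s p r)) = lincomb AC.T J (Rh u) (\<lambda>p. AC.P (X u) (tt C s p r))"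
        by (rule AC.P_lincomb_right) (use Xc cl u r in auto)
      finally show "lincomb AC.T J (\<lambda>p. Rh p r) (\<lambda>p. AC.P (X u) (tt C s u p)) = lincomb AC.T J (Rh u) (\<lambda>p. AC.P (X u) (tt C s p r))" .
      show "lincomb AC.T J (Rh u) (\<lambda>p. AC.P (X u) (tt C s p r)) \<in> carrier AC.T" using Xc cl u r by auto
    qed
    also have "\<dots> = lincomb AC.T J (\<lambda>_. 1) (\<lambda>p. lincomb AC.T J (\<lambda>u. Rh u p) (\<lambda>u. AC.P (X u) (tt C s p r)))"
      by (rule AC.T.lincomb_swap_coeff) (use Xc cl r in auto)
    also have "\<dots> = lincomb AC.T J (\<lambda>_. 1) (\<lambda>p. q \<odot>\<^bsub>AC.T\<^esub> AC.P (X p) (tt C s p r) \<oplus>\<^bsub>AC.T\<^esub> (c * Crow p) \<odot>\<^bsub>AC.T\<^esub> AC.P \<one>\<^bsub>A\<^esub> (tt C s p r))"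
    proof (rule AC.T.lincomb_cong_all)
      fix p assume p: "p \<in> J"
      have "lincomb AC.T J (\<lambda>u. Rh u p) (\<lambda>u. AC.P (X u) (tt C s p r)) = AC.P (lincomb A J (\<lambda>u. Rh u p) X) (tt C s p r)"
        by (rule AC.P_lincomb_left[symmetric]) (use Xc cl p r in auto)
      then show "lincomb AC.T J (\<lambda>u. Rh u p) (\<lambda>u. AC.P (X u) (tt C s p r)) =
          q \<odot>\<^bsub>AC.T\<^esub> AC.P (X p) (tt C s p r) \<oplus>\<^bsub>AC.T\<^esub> (c * Crow p) \<odot>\<^bsub>AC.T\<^esub> AC.P \<one>\<^bsub>A\<^esub> (tt C s p r)"
        using Xc cl p r by (simp add: XX AC.P_simps)
      show "q \<odot>\<^bsub>AC.T\<^esub> AC.P (X p) (tt C s p r) \<oplus>\<^bsub>AC.T\<^esub> (c * Crow p) \<odot>\<^bsub>AC.T\<^esub> AC.P \<one>\<^bsub>A\<^esub> (tt C s p r) \<in> carrier AC.T"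
        using Xc cl p r by auto
    qed
    also have "\<dots> = lincomb AC.T J (\<lambda>_. 1) (\<lambda>p. q \<odot>\<^bsub>AC.T\<^esub> AC.P (X p) (tt C s p r)) \<oplus>\<^bsub>AC.T\<^esub>
        lincomb AC.T J (\<lambda>_. 1) (\<lambda>p. (c * Crow p) \<odot>\<^bsub>AC.T\<^esub> AC.P \<one>\<^bsub>A\<^esub> (tt C s p r))"
      by (rule AC.T.lincomb_add) (use Xc cl r in auto)
    also have "lincomb AC.T J (\<lambda>_. 1) (\<lambda>p. q \<odot>\<^bsub>AC.T\<^esub> AC.P (X p) (tt C s p r)) = q \<odot>\<^bsub>AC.T\<^esub> (Y (fst r) \<otimes>\<^bsub>AC.T\<^esub> Y (snd r))"
    proof -
      have "q \<odot>\<^bsub>AC.T\<^esub> lincomb AC.T J (\<lambda>_. 1) (\<lambda>p. AC.P (X p) (tt C s p r)) = lincomb AC.T J (\<lambda>_. q * 1) (\<lambda>p. AC.P (X p) (tt C s p r))"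
        by (rule AC.T.smult_lincomb) (use Xc cl r in auto)
      moreover have "lincomb AC.T J (\<lambda>_. 1) (\<lambda>p. q \<odot>\<^bsub>AC.T\<^esub> AC.P (X p) (tt C s p r)) = lincomb AC.T J (\<lambda>_. q * 1) (\<lambda>p. AC.P (X p) (tt C s p r))"
        by (rule AC.T.lincomb_cong) (use Xc cl r in auto)
      ultimately show ?thesis unfolding YY[OF r] by simp
    qed
    also have "lincomb AC.T J (\<lambda>_. 1) (\<lambda>p. (c * Crow p) \<odot>\<^bsub>AC.T\<^esub> AC.P \<one>\<^bsub>A\<^esub> (tt C s p r)) = (c * Crow r) \<odot>\<^bsub>AC.T\<^esub> \<one>\<^bsub>AC.T\<^esub>"
    proof -
      have cr: "lincomb C J Crow (\<lambda>p. tt C s p r) \<in> carrier C" by (rule AC.B.lincomb_closed) (use cl r in auto)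
      have "lincomb AC.T J (\<lambda>_. 1) (\<lambda>p. (c * Crow p) \<odot>\<^bsub>AC.T\<^esub> AC.P \<one>\<^bsub>A\<^esub> (tt C s p r)) =
          lincomb AC.T J Crow (\<lambda>p. c \<odot>\<^bsub>AC.T\<^esub> AC.P \<one>\<^bsub>A\<^esub> (tt C s p r))"
        by (rule AC.T.lincomb_cong) (use cl r in \<open>auto simp: mult.commute\<close>)
      also have "\<dots> = lincomb AC.T J Crow (\<lambda>p. AC.P (c \<odot>\<^bsub>A\<^esub> \<one>\<^bsub>A\<^esub>) (tt C s p r))"
        by (rule AC.T.lincomb_cong_all) (use cl r in \<open>auto simp: AC.P_simps\<close>)
      also have "\<dots> = AC.P (c \<odot>\<^bsub>A\<^esub> \<one>\<^bsub>A\<^esub>) (lincomb C J Crow (\<lambda>p. tt C s p r))"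
        by (rule AC.P_lincomb_right[symmetric]) (use cl r in auto)
      also have "\<dots> = (c * Crow r) \<odot>\<^bsub>AC.T\<^esub> \<one>\<^bsub>AC.T\<^esub>"
        using s r by (simp add: spo_def AC.P_simps AC.T_one mult.commute)
      finally show ?thesis .
    qed
    finally show ?thesis .
  qed
  then show ?thesis using Yh unfolding covariant_def Y_def[symmetric] by blast
qed

end

section \<open>The coaction\<close>

locale weyl_parameters = generic_quantum_parameters n m q
  for n m :: nat and q :: "'k::field" + fixes c :: 'k
begin

lemma weyl_rels_homog: "weyl_rels n m q c \<subseteq> (\<Union>\<gamma>. homog FW \<gamma>)"
proof
  interpret F: superalgebra FW by (rule superalgebra_free)
  have vv: "var i * var j \<in> homog FW (\<eta> i + \<eta> j)" if "i \<in> I" "j \<in> I" for i j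
    using F.homog_mult[OF var_in_free[OF that(1)] var_in_free[OF that(2)]] by simp
  have cvv: "const a * var i * var j \<in> homog FW (\<eta> i + \<eta> j)" if "i \<in> I" "j \<in> I" for i j a
  proof -
    have "const a * var i * var j = const a * (var i * var j)" by (rule mult.assoc)
    then have "const a * var i * var j = a \<odot>\<^bsub>FW\<^esub> (var i * var j)" by (simp add: const_mult)
    then show ?thesis using F.homog_smult[OF vv[OF that]] by simp
  qed
  have mi: "x - y \<in> homog FW \<gamma>" if "x \<in> homog FW \<gamma>" "y \<in> homog FW \<gamma>" for x y \<gamma>
  proof -
    have "x - y = x \<oplus>\<^bsub>FW\<^esub> ((- 1) \<odot>\<^bsub>FW\<^esub> y)"
      by (intro poly_mapping_eqI) (simp add: lookup_add lookup_minus)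
    then show ?thesis using F.homog_plus[OF that(1) F.homog_smult[OF that(2), of "- 1"]] by simp
  qed
  have co: "const a \<in> homog FW 0" for a by (simp add: homog_free const_def)
  fix s assume "s \<in> weyl_rels n m q c"
  then consider i where "s = var i * var i" "i \<in> I"
    | i j where "s = var i * var j - const (of_int (sig2 n i j) * q) * var j * var i" "i \<in> I" "j \<in> I"
    | j where "s = (const (q powi (- sig n (j - 1))) * var (- j + 1) * var (j - 1)
          - const (of_int (sig n (j - 1)) * q) * var (j - 1) * var (- j + 1))
        - (const (of_int (sig n (j - 1) * sig n j)) * var (- j) * var j
          - const (of_int (sig n (j - 1)) * q * q powi (- sig n j)) * var j * var (- j))" "2 \<le> j" "j \<le> rr"
    | "s = (var (- 1) * var 1 - const (q ^ 2) * var 1 * var (- 1))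
        - (const (q powi (2 * (int n - int m)) * c) - (\<Sum>i=2..rr. const (\<kappa> * Cq_inv n q i (- i)) * var i * var (- i)))"
    unfolding weyl_rels_def by blast
  then have "\<exists>\<gamma>. s \<in> homog FW \<gamma>"
  proof cases
    case 1
    then show ?thesis using vv by blast
  next
    case (2 i j)
    have "const (of_int (sig2 n i j) * q) * var j * var i \<in> homog FW (\<eta> i + \<eta> j)"
      using cvv[OF 2(3,2)] by (simp add: add.commute)
    from mi[OF vv[OF 2(2,3)] this] show ?thesis unfolding 2(1) by blast
  next
    case (3 j)
    have m: "j \<in> I" "- j \<in> I" "j - 1 \<in> I" "- j + 1 \<in> I" using 3 by (auto simp: idx_def)
    have e: "\<eta> (1 - j) = \<eta> (j - 1)" using eta_uminus[of "j - 1"] by simp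
    have "const a * var (- j + 1) * var (j - 1) \<in> homog FW 0" "const a * var (j - 1) * var (- j + 1) \<in> homog FW 0"
      "const a * var (- j) * var j \<in> homog FW 0" "const a * var j * var (- j) \<in> homog FW 0" for a
      using cvv[OF m(4,3), of a] cvv[OF m(3,4), of a] cvv[OF m(2,1), of a] cvv[OF m(1,2), of a] by (simp_all add: e)
    then have "s \<in> homog FW 0" unfolding 3(1) by (intro mi)
    then show ?thesis by blast
  next
    case 4
    have m: "- 1 \<in> I" "1 \<in> I" using one_I by auto
    have v: "var (- 1) * var 1 \<in> homog FW 0" "const a * var 1 * var (- 1) \<in> homog FW 0" for a
      using vv[OF m] cvv[OF m(2,1), of a] by simp_all
    have S: "(\<Sum>i\<in>K. const (\<kappa> * Cq_inv n q i (- i)) * var i * var (- i)) \<in> homog FW 0" if "finite K" "K \<subseteq> I" for K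
      using that
    proof (induction K rule: finite_induct)
      case empty
      then show ?case using F.homog_zero[of 0] by simp
    next
      case (insert i K)
      have "const (\<kappa> * Cq_inv n q i (- i)) * var i * var (- i) \<in> homog FW 0"
        using cvv[of i "- i" "\<kappa> * Cq_inv n q i (- i)"] insert by simp
      from F.homog_plus[OF this insert.IH] show ?case using insert by simp
    qed
    have "{2..rr} \<subseteq> I" by (auto simp: idx_def)
    then have "s \<in> homog FW 0" unfolding 4 using v co S by (intro mi) auto
    then show ?thesis by blast
  qed
  then show "s \<in> (\<Union>\<gamma>. homog FW \<gamma>)" by blast
qed

sublocale W: presentation I \<eta> "weyl_rels n m q c"
  by unfold_locales (rule weyl_rels_homog)

abbreviation "W \<equiv> weyl n m q c"
abbreviation "xW \<equiv> weyl_gen n m q c"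

lemma superalgebra_weyl: "superalgebra W"
  unfolding weyl_def by (rule W.superalgebra_presented)

interpretation WS: superalgebra W by (rule superalgebra_weyl)
interpretation HS: superalgebra H by (rule superalgebra_SPO)
interpretation WH: tensor_pair W H by (rule tensor_pair.intro[OF superalgebra_weyl superalgebra_SPO])

lemma xW_homog: "\<forall>i\<in>I. xW i \<in> homog W (\<eta> i)"
  unfolding weyl_gen_def weyl_def using W.gen_homog by blast

lemma xW_closed: "i \<in> I \<Longrightarrow> xW i \<in> carrier W"
  using xW_homog WS.homog_carrier by blast

text \<open>The projection kills the relations, and the equivalence reads this as covariance of its
  values on the variables.\<close>

lemma covariant_weyl: "covariant W c xW"
proof -
  have f: "W.Id.proj \<in> superalgebra_hom FW W" unfolding weyl_def by (rule W.proj_hom)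
  have fx: "W.Id.proj (var i) = xW i" for i by (simp add: weyl_gen_def presented_gen_def)
  have "(\<forall>s\<in>weyl_rels n m q c. W.Id.proj s = \<zero>\<^bsub>W\<^esub>) \<longleftrightarrow> covariant W c xW"
    by (rule hom_weyl_rels_iff[OF superalgebra_weyl xW_homog q_square_ne f fx])
  moreover have "\<forall>s\<in>weyl_rels n m q c. W.Id.proj s = \<zero>\<^bsub>W\<^esub>" unfolding weyl_def using W.proj_rels by blast
  ultimately show ?thesis by blast
qed

lemma weyl_lift:
  assumes B: "superalgebra B" and y: "covariant B c y"
  shows "\<exists>g\<in>superalgebra_hom W B. \<forall>i\<in>I. g (xW i) = y i"
proof -
  have yh: "\<forall>i\<in>I. y i \<in> homog B (\<eta> i)" using y by (simp add: covariant_def)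
  have "\<exists>g\<in>superalgebra_hom W.PX B. \<forall>i\<in>I. g (W.gen i) = y i"
  proof (rule W.presented_lift[OF B])
    fix f s assume f: "f \<in> superalgebra_hom W.FX B" "\<And>i. i \<in> I \<Longrightarrow> f (var i) = y i" and s: "s \<in> weyl_rels n m q c"
    have "(\<forall>s\<in>weyl_rels n m q c. f s = \<zero>\<^bsub>B\<^esub>) \<longleftrightarrow> covariant B c y"
      by (rule hom_weyl_rels_iff[OF B yh q_square_ne f])
    then show "f s = \<zero>\<^bsub>B\<^esub>" using y s by blast
  qed (use yh in blast)
  then show ?thesis unfolding weyl_def weyl_gen_def by blast
qed

lemma weyl_hom_eq:
  assumes "superalgebra B" "f \<in> superalgebra_hom W B" "g \<in> superalgebra_hom W B"
    "\<And>i. i \<in> I \<Longrightarrow> f (xW i) = g (xW i)" "b \<in> carrier W"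
  shows "f b = g b"
  using W.presented_hom_eq[OF assms(1) assms(2)[unfolded weyl_def] assms(3)[unfolded weyl_def] _ assms(5)[unfolded weyl_def]]
    assms(4) by (simp add: weyl_gen_def)

text \<open>The sign prescribed for the coaction is \<open>tsign j i\<close>, so it cancels against
  the one that relates the generator \<open>SPO_gen n m q j i\<close> to
  \<open>sH j i\<close>.\<close>

lemma weyl_gen_coact:
  assumes "i \<in> I"
  shows "(\<Oplus>\<^bsub>W \<otimes>\<^sub>s H\<^esub>j\<in>I. of_int (sgnf (eta n i) (eta n j - eta n i)) \<odot>\<^bsub>W \<otimes>\<^sub>s H\<^esub>
       pure_tensor W H (xW j) (SPO_gen n m q j i)) = coact W H xW sH i"
proof -
  have "coact W H xW sH i = lincomb WH.T I (\<lambda>j. of_int (sgnf (eta n i) (eta n j - eta n i)))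
      (\<lambda>j. WH.P (xW j) (SPO_gen n m q j i))"
    unfolding coact_def
  proof (rule WH.T.lincomb_cong[OF refl])
    fix j assume j: "j \<in> I"
    note cc = xW_closed[OF j] sH_closed[OF j assms]
    show "WH.P (xW j) (SPO_gen n m q j i) \<in> carrier WH.T" using cc j assms by (simp add: SPO_gen_eq)
    have "of_int (sgnf (eta n i) (eta n j - eta n i)) * tsign j i = 1"
      using tsign_square[of j i] by (simp add: tsign_def)
    then show "1 \<odot>\<^bsub>WH.T\<^esub> WH.P (xW j) (sH j i) =
        of_int (sgnf (eta n i) (eta n j - eta n i)) \<odot>\<^bsub>WH.T\<^esub> WH.P (xW j) (SPO_gen n m q j i)"
      using cc j assms by (simp add: SPO_gen_eq WH.P_simps)
  qed
  then show ?thesis by (simp add: lincomb_def)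
qed

lemma weyl_coaction_iff:
  "weyl_coaction n m q c \<delta> \<longleftrightarrow> \<delta> \<in> extensional (carrier W) \<and> \<delta> \<in> superalgebra_hom W (W \<otimes>\<^sub>s H) \<and>
     (\<forall>i\<in>I. \<delta> (xW i) = coact W H xW sH i)"
  unfolding weyl_coaction_def using weyl_gen_coact by simp

text \<open>Restricting the lifted homomorphism to the carrier meets the normalisation in
  \<open>weyl_coaction\<close>, and that normalisation in turn upgrades agreement on the carrier to
  equality of functions.\<close>

lemma weyl_coaction_ex1: "\<exists>!\<delta>. weyl_coaction n m q c \<delta>"
proof (rule ex_ex1I)
  obtain g where g: "g \<in> superalgebra_hom W WH.T" "\<forall>i\<in>I. g (xW i) = coact W H xW sH i"
    using weyl_lift[OF WH.superalgebra_T covariant_coact[OF superalgebra_weyl superalgebra_SPO covariant_weyl spo_SPO]] by blast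
  have "weyl_coaction n m q c (restrict g (carrier W))"
    unfolding weyl_coaction_iff using restrict_hom[OF superalgebra_weyl g(1)] g(2) xW_closed by simp
  then show "\<exists>\<delta>. weyl_coaction n m q c \<delta>" by blast
next
  fix \<delta> \<delta>' assume d: "weyl_coaction n m q c \<delta>" "weyl_coaction n m q c \<delta>'"
  show "\<delta> = \<delta>'"
  proof (rule extensionalityI[of _ "carrier W"])
    fix b assume b: "b \<in> carrier W"
    show "\<delta> b = \<delta>' b"
      by (rule weyl_hom_eq[OF WH.superalgebra_T _ _ _ b]) (use d in \<open>simp_all add: weyl_coaction_iff\<close>)
  qed (use d in \<open>simp_all add: weyl_coaction_iff\<close>)
qed

lemma comodule_weyl:
  assumes d: "weyl_coaction n m q c \<delta>"
  shows "comodule_superalgebra H (SPO_comult n m q) (SPO_counit n m q) W \<delta>"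
proof (intro comodule_superalgebra.intro comodule_superalgebra_axioms.intro)
  let ?\<Delta> = "SPO_comult n m q" and ?\<epsilon> = "SPO_counit n m q"
  interpret SS: tensor_pair H H by (rule tensor_pair.intro[OF superalgebra_SPO superalgebra_SPO])
  interpret R: tensor_pair W SS.T by (rule tensor_pair.intro[OF superalgebra_weyl SS.superalgebra_T])
  have \<delta>: "\<delta> \<in> superalgebra_hom W WH.T" "\<And>i. i \<in> I \<Longrightarrow> \<delta> (xW i) = coact W H xW sH i"
    using d by (simp_all add: weyl_coaction_iff)
  show "bisuperalgebra H ?\<Delta> ?\<epsilon>" by (rule bisuperalgebra_SPO)
  show "superalgebra W" by (rule superalgebra_weyl)
  show "\<delta> \<in> superalgebra_hom W (W \<otimes>\<^sub>s H)" by (rule \<delta>(1))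
  fix b assume b: "b \<in> carrier W"
  let ?L = "tensor_assoc W H H \<circ> (tensor_map W H WH.T H \<delta> id \<circ> \<delta>)" and ?R = "tensor_map W H W SS.T id ?\<Delta> \<circ> \<delta>"
  have L: "?L \<in> superalgebra_hom W R.T"
    by (intro hom_compose[OF hom_compose[OF \<delta>(1) tensor_map_hom(1)] tensor_assoc_hom(1)]
        superalgebra_weyl superalgebra_SPO WH.superalgebra_T \<delta>(1) hom_id)
  have R: "?R \<in> superalgebra_hom W R.T"
    by (intro hom_compose[OF \<delta>(1) tensor_map_hom(1)] superalgebra_weyl superalgebra_SPO SS.superalgebra_T SPO_comult_hom hom_id)
  have "?L b = ?R b"
  proof (rule weyl_hom_eq[OF R.superalgebra_T L R _ b])
    fix i assume i: "i \<in> I"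
    have "tensor_assoc W H H (tensor_map W H WH.T H \<delta> id (\<delta> (xW i))) = tensor_map W H W SS.T id ?\<Delta> (\<delta> (xW i))"
      by (rule coact_coassoc[OF superalgebra_weyl superalgebra_SPO xW_closed sH_closed \<delta> SPO_comult_hom SPO_comult_sH i])
    then show "?L (xW i) = ?R (xW i)" by simp
  qed
  then show "tensor_assoc W H H (tensor_map W H WH.T H \<delta> id (\<delta> b)) = tensor_map W H W SS.T id ?\<Delta> (\<delta> b)" by simp
  note ev = ground_eval_homs(1)[OF superalgebra_weyl superalgebra_SPO SPO_counit_hom]
  have "(tensor_lift W H W (\<lambda>x h. ?\<epsilon> h \<odot>\<^bsub>W\<^esub> x) \<circ> \<delta>) b = id b"
  proof (rule weyl_hom_eq[OF superalgebra_weyl hom_compose[OF \<delta>(1) ev] hom_id _ b])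
    fix i assume i: "i \<in> I"
    show "(tensor_lift W H W (\<lambda>x h. ?\<epsilon> h \<odot>\<^bsub>W\<^esub> x) \<circ> \<delta>) (xW i) = id (xW i)"
      using coact_counit[OF superalgebra_weyl superalgebra_SPO xW_closed sH_closed SPO_counit_hom SPO_counit_sH i] \<delta>(2)[OF i]
      by simp
  qed
  then show "tensor_lift W H W (\<lambda>x h. ?\<epsilon> h \<odot>\<^bsub>W\<^esub> x) (\<delta> b) = b" by simp
qed

end

theorem mainTheorem5:
  fixes q c :: "'k::field_char_0" and n m :: nat
  assumes "q \<noteq> 0" and "\<forall>k::nat. k > 0 \<longrightarrow> q ^ k \<noteq> 1"
    and "n \<ge> 1" and "m \<ge> 1"
  shows "(\<exists>!\<delta>. weyl_coaction n m q c \<delta>) \<and>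
    (\<forall>\<delta>. weyl_coaction n m q c \<delta> \<longrightarrow>
       comodule_superalgebra (SPO n m q) (SPO_comult n m q) (SPO_counit n m q) (weyl n m q c) \<delta>)"
proof -
  interpret weyl_parameters n m q c
    by unfold_locales (use assms in auto)
  show ?thesis using weyl_coaction_ex1 comodule_weyl by blast
qed

end
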